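(* Let $n=3$ or $n=4$ and $\alpha_0=\frac{2\pi}{n}$. Let $F_{\delta,\nu}$ be a family of real-analytic area-preserving and orientation-preserving maps of a neighbourhood of the origin in $\mathbb R^2$, depending analytically on two real parameters $(\delta,\nu)$ near $(0,0)$, fixing the origin, which in the complex coordinate $z=x+iy$ has the form $$f_{\delta,\nu}(z,\bar z)=e^{i(\alpha_0-\delta)}z+a_{\nu,\delta}\,z^2\bar z+b_{\nu,\delta}\,\bar z^{\,n-1}+O(|z|^4),$$ where $a_{\nu,\delta}$ and $b_{\nu,\delta}$ are analytic functions of the parameters. Suppose $b_{0,0}\neq0$. Then for all sufficiently small values of $\nu$ there is a formal canonical change of variables which conjugates $F_{\delta,\nu}$ with $R_{\alpha_0}\circ\Phi^1_{H_{\delta,\nu}}$, where the formal Hamiltonian $H_{\delta,\nu}$ has the form $$H_{\delta,\nu}(I,\varphi)=\delta I+I^2A(I,\delta,\nu)+I^{n/2}B(I,\delta,\nu)\cos n\varphi,$$ where $$A(I,\delta,\nu)=\sum_{k,m\ge0}a_{km}(\nu)I^k\delta^m,\qquad B(I,\delta,\nu)=\sum_{k,m\ge0}b_{km}(\nu)I^k\delta^m,$$ the coefficients $a_{km},b_{km}$ are real-analytic functions of $\nu$, and - if $n=3$, then $a_{km}=0$ for $k\equiv0\pmod3$ and $b_{km}=0$ for $k\equiv2\pmod3$; - if $n=4$, then $a_{km}=0$ for $k\equiv1\pmod4$ and $b_{km}=0$ for $k\equiv3\pmod4$. Moreover, the coefficients $a_{km}(\nu)$ and $b_{km}(\nu)$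 are defined uniquely, provided the leading order is normalised to ensure $b_{00}(\nu)>0$.
   Context: $R_\alpha$ is the rotation of the plane by the angle $\alpha$, $R_\alpha=\begin{pmatrix}\cos\alpha&-\sin\alpha\\ \sin\alpha&\cos\alpha\end{pmatrix}$. The plane with coordinates $(x,y)$ is identified with the complex plane via $z=x+iy$, $\bar z=x-iy$. Symplectic polar coordinates $(I,\varphi)$ are defined by $x=\sqrt{2I}\cos\varphi$, $y=\sqrt{2I}\sin\varphi$, so $z=\sqrt{2I}e^{i\varphi}$, $z\bar z=2I$, and $I^{n/2}\cos n\varphi=2^{-n/2}\,\mathrm{Re}(z^n)$. Thus, for each $\nu$, a Hamiltonian of the stated form is a real formal power series in $(x,y,\delta)$. For a formal power series $H$, $\Phi^t_H$ is the formal Hamiltonian flow generated by $H$ with respect to the area form in $(x,y)$ (parameters being constant), with the convention $\dot x=\partial H/\partial y$, $\dot y=-\partial H/\partial x$; $\Phi_H^1$ is the time-one map. For fixed $\nu$, a formal canonical change of variables is an invertible change of $(x,y)$, given by real formal power series in $(x,y,\delta)$ that vanish at $x=y=0$ and whose Jacobian determinant with respect to $(x,y)$ is identically $1$. Conjugation is understood at the level of formal Taylor series in $(x,y,\delta)$. *)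

theory Defs
  imports "HOL-Analysis.Analysis" "HOL-Library.Landau_Symbols"
    "HOL-Computational_Algebra.Formal_Power_Series"
begin

subsection \<open>Real-analytic functions of several variables\<close>

text \<open>
  A multi-index is an extensional function on \<^term>\<open>Basis\<close>; \<^const>\<open>has_sum\<close> makes the
  convergence of the power series unconditional, as is usual in several variables.
\<close>

definition real_analytic_at ::
    "('a::euclidean_space \<Rightarrow> 'b::real_normed_vector) \<Rightarrow> 'a \<Rightarrow> bool" where
  "real_analytic_at f a \<longleftrightarrow>
     (\<exists>r>0. \<exists>c :: ('a \<Rightarrow> nat) \<Rightarrow> 'b. \<forall>x\<in>ball a r.
        ((\<lambda>m. (\<Prod>e\<in>Basis. ((x - a) \<bullet> e) ^ m e) *\<^sub>R c m) has_sum f x) (Basis \<rightarrow>\<^sub>E UNIV))"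

definition real_analytic_on ::
    "('a::euclidean_space \<Rightarrow> 'b::real_normed_vector) \<Rightarrow> 'a set \<Rightarrow> bool" where
  "real_analytic_on f S \<longleftrightarrow> (\<forall>a\<in>S. real_analytic_at f a)"


subsection \<open>Maps of the plane\<close>

definition area_preserving_on :: "(real^2 \<Rightarrow> real^2) \<Rightarrow> (real^2) set \<Rightarrow> bool" where
  "area_preserving_on f U \<longleftrightarrow> (\<forall>p\<in>U. \<bar>det (jacobian f (at p))\<bar> = 1)"

definition orientation_preserving_on :: "(real^2 \<Rightarrow> real^2) \<Rightarrow> (real^2) set \<Rightarrow> bool" where
  "orientation_preserving_on f U \<longleftrightarrow> (\<forall>p\<in>U. det (jacobian f (at p)) > 0)"

definition to_complex :: "real^2 \<Rightarrow> complex" where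
  "to_complex p = Complex (p $ 1) (p $ 2)"


subsection \<open>Formal power series in \<open>(x, y, \<delta>)\<close>\<close>

text \<open>
  In the nested type below the outermost variable is \<open>x\<close>, the middle one is \<open>y\<close> and the
  innermost one is the parameter \<open>\<delta>\<close>.
\<close>

type_synonym 'a fps3 = "'a fps fps fps"

definition coeff3 :: "'a::zero fps3 \<Rightarrow> nat \<Rightarrow> nat \<Rightarrow> nat \<Rightarrow> 'a" where
  "coeff3 P i j k = fps_nth (fps_nth (fps_nth P i) j) k"

definition Abs_fps3 :: "(nat \<Rightarrow> nat \<Rightarrow> nat \<Rightarrow> 'a::zero) \<Rightarrow> 'a fps3" where
  "Abs_fps3 c = Abs_fps (\<lambda>i. Abs_fps (\<lambda>j. Abs_fps (\<lambda>k. c i j k)))"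

definition const3 :: "'a::zero \<Rightarrow> 'a fps3" where
  "const3 c = fps_const (fps_const (fps_const c))"

definition var_x :: "'a::comm_ring_1 fps3" where
  "var_x = fps_X"

definition var_y :: "'a::comm_ring_1 fps3" where
  "var_y = fps_const fps_X"

definition var_delta :: "'a::comm_ring_1 fps3" where
  "var_delta = fps_const (fps_const fps_X)"

definition deriv_x :: "real fps3 \<Rightarrow> real fps3" where
  "deriv_x P = fps_deriv P"

definition deriv_y :: "real fps3 \<Rightarrow> real fps3" where
  "deriv_y P = Abs_fps (\<lambda>i. fps_deriv (fps_nth P i))"

text \<open>A formal map sends \<open>(x, y)\<close> to a pair of power series, \<open>\<delta>\<close> being a fixed parameter.\<close>

type_synonym formal_map = "real fps3 \<times> real fps3"

definition vanishes_at_origin :: "formal_map \<Rightarrow> bool" where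
  "vanishes_at_origin G \<longleftrightarrow>
     fps_nth (fps_nth (fst G) 0) 0 = 0 \<and> fps_nth (fps_nth (snd G) 0) 0 = 0"

text \<open>
  Substitution of \<open>G = (G\<^sub>1, G\<^sub>2)\<close> for \<open>(x, y)\<close> in \<open>P\<close>, meaningful when \<open>G\<close> vanishes at
  \<open>x = y = 0\<close>: then \<open>G\<^sub>1\<^sup>p G\<^sub>2\<^sup>q\<close> has order at least \<open>p + q\<close> in \<open>(x, y)\<close>, so
  that the terms omitted from the finite sum do not contribute to the coefficient of
  \<open>x\<^sup>i y\<^sup>j\<close>.
\<close>

definition subst_xy :: "real fps3 \<Rightarrow> formal_map \<Rightarrow> real fps3" where
  "subst_xy P G = Abs_fps (\<lambda>i. Abs_fps (\<lambda>j.
     \<Sum>p\<le>i + j. \<Sum>q\<le>i + j.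
       fps_nth (fps_nth P p) q * fps_nth (fps_nth (fst G ^ p * snd G ^ q) i) j))"

definition formal_comp :: "formal_map \<Rightarrow> formal_map \<Rightarrow> formal_map" (infixl "\<circ>\<^sub>f" 55) where
  "F \<circ>\<^sub>f G = (subst_xy (fst F) G, subst_xy (snd F) G)"

definition formal_id :: formal_map where
  "formal_id = (var_x, var_y)"

definition formal_rotation :: "real \<Rightarrow> formal_map" where
  "formal_rotation \<alpha> =
     (const3 (cos \<alpha>) * var_x - const3 (sin \<alpha>) * var_y,
      const3 (sin \<alpha>) * var_x + const3 (cos \<alpha>) * var_y)"

definition formal_canonical_change :: "formal_map \<Rightarrow> bool" where
  "formal_canonical_change G \<longleftrightarrow>
     vanishes_at_origin G \<and>
     (\<exists>G'. vanishes_at_origin G' \<and> G \<circ>\<^sub>f G' = formal_id \<and> G' \<circ>\<^sub>f G = formal_id) \<and>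
     deriv_x (fst G) * deriv_y (snd G) - deriv_y (fst G) * deriv_x (snd G) = 1"


subsection \<open>Taylor series\<close>

definition has_fps3_expansion :: "(real \<Rightarrow> real \<Rightarrow> real \<Rightarrow> real) \<Rightarrow> real fps3 \<Rightarrow> bool" where
  "has_fps3_expansion g P \<longleftrightarrow>
     (\<exists>r>0. \<forall>x y \<delta>. \<bar>x\<bar> < r \<and> \<bar>y\<bar> < r \<and> \<bar>\<delta>\<bar> < r \<longrightarrow>
        ((\<lambda>(i, j, k). coeff3 P i j k * x ^ i * y ^ j * \<delta> ^ k) has_sum g x y \<delta>) UNIV)"

definition has_taylor_series :: "(real \<Rightarrow> real^2 \<Rightarrow> real^2) \<Rightarrow> formal_map \<Rightarrow> bool" where
  "has_taylor_series f G \<longleftrightarrow>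
     has_fps3_expansion (\<lambda>x y \<delta>. f \<delta> (vector [x, y]) $ 1) (fst G) \<and>
     has_fps3_expansion (\<lambda>x y \<delta>. f \<delta> (vector [x, y]) $ 2) (snd G)"


subsection \<open>Formal Hamiltonian flows\<close>

text \<open>
  \<open>\<Phi>\<close> is the flow \<open>t \<mapsto> \<Phi>\<^sup>t\<close> of \<open>x' = \<partial>H/\<partial>y\<close>, \<open>y' = - \<partial>H/\<partial>x\<close>,
  where the differential equation holds for each coefficient of the series.
\<close>

definition formal_hamiltonian_flow :: "real fps3 \<Rightarrow> (real \<Rightarrow> formal_map) \<Rightarrow> bool" where
  "formal_hamiltonian_flow H \<Phi> \<longleftrightarrow>
     \<Phi> 0 = formal_id \<and> (\<forall>t. vanishes_at_origin (\<Phi> t)) \<and>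
     (\<forall>t i j k.
        ((\<lambda>s. coeff3 (fst (\<Phi> s)) i j k) has_real_derivative
           coeff3 (subst_xy (deriv_y H) (\<Phi> t)) i j k) (at t) \<and>
        ((\<lambda>s. coeff3 (snd (\<Phi> s)) i j k) has_real_derivative
           coeff3 (subst_xy (- deriv_x H) (\<Phi> t)) i j k) (at t))"


subsection \<open>The Hamiltonian of the normal form\<close>

definition action_I :: "real fps3" where
  "action_I = const3 (1/2) * (var_x ^ 2 + var_y ^ 2)"

text \<open>\<open>I\<^bsup>n/2\<^esup> cos n\<phi> = 2\<^bsup>-n/2\<^esup> Re ((x + \<i>y)\<^sup>n)\<close>\<close>

definition action_cos :: "nat \<Rightarrow> real fps3" where
  "action_cos n = const3 (2 powr (- real n / 2)) *
     Abs_fps3 (\<lambda>i j k. Re (coeff3 ((var_x + const3 \<i> * var_y) ^ n) i j k))"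

text \<open>
  The series \<open>\<Sum>\<^sub>k\<^sub>,\<^sub>m c\<^sub>k\<^sub>m I\<^sup>k \<delta>\<^sup>m\<close>; since \<open>I\<^sup>k\<close> is homogeneous of degree
  \<open>2 k\<close> in \<open>(x, y)\<close>, only terms with \<open>k \<le> i + j\<close> contribute to the coefficient of
  \<open>x\<^sup>i y\<^sup>j\<close>.
\<close>

definition action_series :: "(nat \<Rightarrow> nat \<Rightarrow> real) \<Rightarrow> real fps3" where
  "action_series c = Abs_fps (\<lambda>i. Abs_fps (\<lambda>j.
     \<Sum>k\<le>i + j. Abs_fps (\<lambda>m. c k m) * fps_nth (fps_nth (action_I ^ k) i) j))"

definition normal_hamiltonian ::
    "nat \<Rightarrow> (nat \<Rightarrow> nat \<Rightarrow> real) \<Rightarrow> (nat \<Rightarrow> nat \<Rightarrow> real) \<Rightarrow> real fps3" where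
  "normal_hamiltonian n A B =
     var_delta * action_I + action_I ^ 2 * action_series A + action_cos n * action_series B"

definition reduced_coeffs ::
    "nat \<Rightarrow> (nat \<Rightarrow> nat \<Rightarrow> real) \<Rightarrow> (nat \<Rightarrow> nat \<Rightarrow> real) \<Rightarrow> bool" where
  "reduced_coeffs n A B \<longleftrightarrow>
     (n = 3 \<longrightarrow> (\<forall>k m. (k mod 3 = 0 \<longrightarrow> A k m = 0) \<and> (k mod 3 = 2 \<longrightarrow> B k m = 0))) \<and>
     (n = 4 \<longrightarrow> (\<forall>k m. (k mod 4 = 1 \<longrightarrow> A k m = 0) \<and> (k mod 4 = 3 \<longrightarrow> B k m = 0)))"

text \<open>
  A formal canonical change of variables conjugates the family \<open>f \<delta>\<close> with
  \<open>R\<^sub>\<alpha> \<circ> \<Phi>\<^sup>1\<^sub>H\<close>, \<open>\<Phi>\<^sup>1\<^sub>H\<close> being the time-one map of \<open>H\<close>.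
\<close>

definition formally_conjugate_to_flow ::
    "(real \<Rightarrow> real^2 \<Rightarrow> real^2) \<Rightarrow> real \<Rightarrow> real fps3 \<Rightarrow> bool" where
  "formally_conjugate_to_flow f \<alpha> H \<longleftrightarrow>
     (\<exists>G \<Psi> \<Phi>. has_taylor_series f G \<and> formal_canonical_change \<Psi> \<and>
        formal_hamiltonian_flow H \<Phi> \<and>
        \<Psi> \<circ>\<^sub>f G = (formal_rotation \<alpha> \<circ>\<^sub>f \<Phi> 1) \<circ>\<^sub>f \<Psi>)"

end

(*
  A formal map is handled through the algebra endomorphism T f = f o G it induces on power series; the time-t
  map of a Hamiltonian K becomes exp (t {., K}). Formal series are filtered by weights, delta having weight n - 2,
  so that delta I and the leading part al I^2 + Re (g z^n) of the Hamiltonian are both of weight n.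

  First, averaging over the rotation R by 2 pi / n brings the map to the form R o Phi_H with H invariant under R; this
  is possible with all coefficients analytic in nu. The leading resonant coefficient g is nonzero because it is
  a nonzero multiple of b. Then H is simplified by flows of invariant Hamiltonians L: the new terms are those of the
  image of {h, .} on the invariants, h = al I^2 + Re (g z^n). This image is complemented, in each degree, by the
  permitted terms I^k and I^k Re (g z^n): the relation between I^a h^j and the normal terms involves
  Legendre-type polynomials in al and |g|^2, which are positive where they are needed as divisors.
  A constant rotation makes g positive.

  For uniqueness, the n-th power of R o Phi_H is the time-n flow of H, and a formal flow determines its generator. So two
  normal forms are related by a canonical map commuting with R. It is the flow of some invariant K, and the
  terms of K of lowest weight are forced to be powers of H, whose flow does not change H.
*)
theory Submission
  imports Defs "HOL-Complex_Analysis.Complex_Analysis"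
begin

text \<open>The residue classes come from the relations obtained by bracketing h with S I^a h^j, S =
  Im (g z^n). For n = 3 the term I^2 is too heavy to be leading, so al = 0 and a relation ties
  I^(a+2) h^j to I^(a-1) h^(j+2); for a = 0 the second term is absent. So I^r h^j lies in the image
  whenever r = 2 mod 3, in particular I^2 I^k with k = 0 and I^k h with k = 2 mod 3. For n = 4 a
  relation has three terms, and in degree 4 J + 2 a combination of them is Q_J I^(2J-1) C + W_J
  I^(2J+1), C = Re (g z^4). For arbitrary al one has W_J > 0 for odd J and Q_J > 0 for even J: this
  gives the alternation modulo 4. Bracketing with h keeps the power of delta, bracketing with delta
  I raises it by one; so in a fixed weight both existence and uniqueness proceed by ascending powers
  of delta. Two more gradings run alongside: the total degree makes exponentials finite in each
  coefficient, and the order in x, y keeps the quadratic part exactly delta I. Each coefficient is a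
  finite expression in earlier ones, and the divisors that depend on nu do not vanish, so
  analyticity in nu persists.\<close>

lemma coeff3_ext: "(\<And>i j k. coeff3 P i j k = coeff3 Q i j k) \<Longrightarrow> P = Q"
  by (auto simp: coeff3_def fps_eq_iff)

lemma coeff3_simps [simp]:
  fixes P Q :: "'a::comm_ring_1 fps3"
  shows "coeff3 (P + Q) i j k = coeff3 P i j k + coeff3 Q i j k"
    "coeff3 (P - Q) i j k = coeff3 P i j k - coeff3 Q i j k"
    "coeff3 (- P) i j k = - coeff3 P i j k"
    "coeff3 (0 :: 'a fps3) i j k = 0"
    "coeff3 (Abs_fps3 f) i j k = f i j k"
  by (auto simp: coeff3_def Abs_fps3_def)

lemma coeff3_sum [simp]:
  fixes f :: "'b \<Rightarrow> 'a::comm_ring_1 fps3"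
  shows "coeff3 (sum f A) i j k = (\<Sum>x\<in>A. coeff3 (f x) i j k)"
  by (induction A rule: infinite_finite_induct) auto

lemma coeff3_mult:
  fixes P Q :: "'a::comm_ring_1 fps3"
  shows "coeff3 (P * Q) i j k =
    (\<Sum>a\<le>i. \<Sum>b\<le>j. \<Sum>c\<le>k. coeff3 P a b c * coeff3 Q (i - a) (j - b) (k - c))"
  by (simp add: coeff3_def fps_mult_nth fps_sum_nth atLeast0AtMost)

text \<open>Series in the parameter alone. They are the scalars of the whole proof: substitutions,
  derivatives and brackets in x, y are linear over them.\<close>

definition pconst :: "'a::comm_ring_1 fps \<Rightarrow> 'a fps3" where
  "pconst c = fps_const (fps_const c)"

lemma nth_pconst_mult [simp]:
  "fps_nth (fps_nth (pconst c * P) i) j = c * fps_nth (fps_nth P i) j"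
  by (simp add: pconst_def)

lemma pconst_simps [simp]:
  "pconst c + pconst c' = pconst (c + c')" "pconst c * pconst c' = pconst (c * c')"
  "pconst 0 = 0" "pconst 1 = 1"
  by (simp_all add: pconst_def)

lemma const3_pconst: "const3 c = pconst (fps_const c)"
  by (simp add: const3_def pconst_def)

lemma var_delta_pconst: "var_delta = pconst fps_X"
  by (simp add: var_delta_def pconst_def)

lemma coeff3_const3_mult [simp]: "coeff3 (const3 c * P) i j k = c * coeff3 P i j k" for c :: "'a::comm_ring_1"
  by (simp add: const3_def coeff3_def)

lemma coeff3_var_mult:
  "coeff3 (var_x * P) i j k = (if i = 0 then 0 else coeff3 P (i - 1) j k)"
  "coeff3 (var_y * P) i j k = (if j = 0 then 0 else coeff3 P i (j - 1) k)"
  "coeff3 (var_delta * P) i j k = (if k = 0 then 0 else coeff3 P i j (k - 1))"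
  by (simp_all add: coeff3_def var_x_def var_y_def var_delta_def)

lemma const3_simps:
  "const3 (a + b) = const3 a + const3 b" "const3 (a * b) = const3 a * const3 b"
  "const3 (- a :: 'a::comm_ring_1) = - const3 a"
  "const3 (a - b :: 'a::comm_ring_1) = const3 a - const3 b"
  "const3 0 = 0" "const3 1 = 1" for a b :: "'a::comm_ring_1"
  by (simp_all add: const3_def fps_const_add[symmetric] fps_const_neg[symmetric] fps_const_mult[symmetric]
      fps_const_sub[symmetric] del: fps_const_add fps_const_neg fps_const_mult fps_const_sub)

lemma const3_power: "const3 (a ^ p) = const3 (a::'a::comm_ring_1) ^ p"
  by (induction p) (auto simp: const3_simps)

lemma const3_of_nat: "const3 (of_nat p :: 'a::comm_ring_1) = of_nat p"
  by (induction p) (auto simp: const3_simps)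

lemma const3_numeral: "const3 (numeral p :: 'a::comm_ring_1) = numeral p"
  using const3_of_nat[of "numeral p", where 'a='a] by simp

lemma coeff3_monomial:
  fixes c :: "'a::comm_ring_1 fps"
  shows
  "coeff3 (pconst c * var_x ^ p * var_y ^ q) i j k = (if i = p \<and> j = q then fps_nth c k else 0)"
proof -
  have y: "var_y ^ q = (fps_const (fps_X ^ q) :: 'a fps3)" for q
    by (simp add: var_y_def fps_const_power)
  have "fps_nth (var_x ^ p * var_y ^ q :: 'a fps3) i = (if i = p then fps_X ^ q else 0)"
    by (simp add: var_x_def y fps_X_power_nth)
  then have "fps_nth (fps_nth (var_x ^ p * var_y ^ q :: 'a fps3) i) j = (if i = p \<and> j = q then 1 else 0)"
    by (simp add: fps_X_power_nth)
  then show ?thesis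
    by (simp add: coeff3_def mult.assoc)
qed

lemma coeff3_var [simp]:
  "coeff3 (var_x :: 'a::comm_ring_1 fps3) i j k = (if i = 1 \<and> j = 0 \<and> k = 0 then 1 else 0)"
  "coeff3 (var_y :: 'a::comm_ring_1 fps3) i j k = (if i = 0 \<and> j = 1 \<and> k = 0 then 1 else 0)"
  "coeff3 (var_delta :: 'a::comm_ring_1 fps3) i j k = (if i = 0 \<and> j = 0 \<and> k = 1 then 1 else 0)"
  "coeff3 (1 :: 'a::comm_ring_1 fps3) i j k = (if i = 0 \<and> j = 0 \<and> k = 0 then 1 else 0)"
  using coeff3_monomial[where 'a='a, of 1 1 0 i j k] coeff3_monomial[where 'a='a, of 1 0 1 i j k]
    coeff3_monomial[where 'a='a, of fps_X 0 0 i j k] coeff3_monomial[where 'a='a, of 1 0 0 i j k]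
  by (auto simp: var_delta_pconst)

subsection \<open>Weights\<close>

text \<open>The parameter delta is given weight \<open>d\<close>. With \<open>d = 0\<close> this is
  the order in x, y, with \<open>d = 1\<close> the total degree, and \<open>d = n - 2\<close> makes
  delta I exactly as heavy as z^n.\<close>

definition wt :: "nat \<Rightarrow> nat \<Rightarrow> real fps3 \<Rightarrow> bool" where
  "wt d N P \<longleftrightarrow> (\<forall>i j k. i + j + d * k < N \<longrightarrow> coeff3 P i j k = 0)"

lemma wtD: "wt d N P \<Longrightarrow> i + j + d * k < N \<Longrightarrow> coeff3 P i j k = 0"
  by (simp add: wt_def)

lemma wt_mono: "wt d N P \<Longrightarrow> M \<le> N \<Longrightarrow> wt d M P"
  by (auto simp: wt_def)

lemma wt_d_mono: "wt d N P \<Longrightarrow> d \<le> d' \<Longrightarrow> wt d' N P"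
proof -
  assume "wt d N P" "d \<le> d'"
  then show ?thesis
    unfolding wt_def by (metis add_left_mono le_less_trans mult_le_mono1)
qed

lemma wt_0 [simp]: "wt d N 0" "wt d 0 P"
  by (auto simp: wt_def)

lemma wt_add [intro]: "wt d N P \<Longrightarrow> wt d N Q \<Longrightarrow> wt d N (P + Q)"
  and wt_diff [intro]: "wt d N P \<Longrightarrow> wt d N Q \<Longrightarrow> wt d N (P - Q)"
  and wt_minus [intro]: "wt d N P \<Longrightarrow> wt d N (- P)"
  by (auto simp: wt_def)

lemma wt_sum: "(\<And>x. x \<in> A \<Longrightarrow> wt d N (f x)) \<Longrightarrow> wt d N (sum f A)"
  by (auto simp: wt_def intro: sum.neutral)

lemma wt_mult: "wt d M P \<Longrightarrow> wt d N Q \<Longrightarrow> wt d (M + N) (P * Q)"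
  unfolding wt_def
proof (intro allI impI)
  fix i j k
  assume P: "\<forall>i j k. i + j + d * k < M \<longrightarrow> coeff3 P i j k = 0"
    and Q: "\<forall>i j k. i + j + d * k < N \<longrightarrow> coeff3 Q i j k = 0" and lt: "i + j + d * k < M + N"
  have "coeff3 P a b c * coeff3 Q (i - a) (j - b) (k - c) = 0" if "a \<le> i" "b \<le> j" "c \<le> k" for a b c
  proof -
    have "d * k = d * c + d * (k - c)" using that(3) by (metis add_mult_distrib2 le_add_diff_inverse)
    then have "a + b + d * c < M \<or> (i - a) + (j - b) + d * (k - c) < N" using that lt by linarith
    then show ?thesis using P Q by auto
  qed
  then show "coeff3 (P * Q) i j k = 0"
    unfolding coeff3_mult by (intro sum.neutral ballI) auto
qed

lemma wt_mult_left: "wt d N Q \<Longrightarrow> wt d N (P * Q)"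
  using wt_mult[of d 0 P N Q] by simp

lemma wt_mult_right: "wt d N Q \<Longrightarrow> wt d N (Q * P)"
  using wt_mult[of d N Q 0 P] by simp

lemma wt_power: "wt d 1 P \<Longrightarrow> wt d p (P ^ p)"
  by (induction p) (use wt_mult[of d 1 P] in auto)

lemma wt_eq_0: "(\<And>N. wt d N P) \<Longrightarrow> P = 0"
proof (rule coeff3_ext)
  fix i j k assume "\<And>N. wt d N P"
  from wtD[OF this[of "Suc (i + j + d * k)"]] show "coeff3 P i j k = coeff3 0 i j k" by simp
qed

lemma wt_var [simp]: "wt d 1 var_x" "wt d 1 var_y" "wt d d var_delta"
  "wt d (Suc 0) var_x" "wt d (Suc 0) var_y"
  by (auto simp: wt_def)

section \<open>Derivatives in x and y, and a density principle for monomials\<close>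

lemma coeff3_deriv_x: "coeff3 (deriv_x P) i j k = real (i + 1) * coeff3 P (i + 1) j k"
proof -
  have "fps_nth (fps_nth (of_nat n * f) j) k = real n * fps_nth (fps_nth (f :: real fps fps) j) k" for n f j k
    by (simp add: fps_of_nat[symmetric])
  then show ?thesis by (simp add: coeff3_def deriv_x_def del: of_nat_add of_nat_Suc)
qed

lemma coeff3_deriv_y: "coeff3 (deriv_y P) i j k = real (j + 1) * coeff3 P i (j + 1) k"
proof -
  have "fps_nth (of_nat n * f) k = real n * fps_nth (f :: real fps) k" for n f k
    by (simp add: fps_of_nat[symmetric])
  then show ?thesis by (simp add: coeff3_def deriv_y_def del: of_nat_add of_nat_Suc)
qed

lemma deriv_linear [simp]:
  "deriv_x (P + Q) = deriv_x P + deriv_x Q" "deriv_y (P + Q) = deriv_y P + deriv_y Q"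
  "deriv_x (P - Q) = deriv_x P - deriv_x Q" "deriv_y (P - Q) = deriv_y P - deriv_y Q"
  "deriv_x (- P) = - deriv_x P" "deriv_y (- P) = - deriv_y P"
  "deriv_x 0 = 0" "deriv_y 0 = 0" 
  by (auto intro!: coeff3_ext simp: coeff3_deriv_x coeff3_deriv_y algebra_simps)

lemma deriv_x_mult: "deriv_x (P * Q) = deriv_x P * Q + P * deriv_x Q"
  by (simp add: deriv_x_def)

lemma fps_deriv_sum': "fps_deriv (\<Sum>a\<in>A. f a) = (\<Sum>a\<in>A. fps_deriv (f a))"
  by (induction A rule: infinite_finite_induct) auto

lemma deriv_y_mult: "deriv_y (P * Q) = deriv_y P * Q + P * deriv_y Q"
proof (rule fps_ext)
  fix i
  show "fps_nth (deriv_y (P * Q)) i = fps_nth (deriv_y P * Q + P * deriv_y Q) i"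
    by (simp add: deriv_y_def fps_mult_nth fps_deriv_sum' sum.distrib add.commute)
qed

lemma deriv_xy: "deriv_x (deriv_y P) = deriv_y (deriv_x P)"
  by (auto intro!: coeff3_ext simp: coeff3_deriv_x coeff3_deriv_y)

lemma deriv_pconst [simp]: "deriv_x (pconst c) = 0" "deriv_y (pconst c) = 0"
  by (auto intro!: coeff3_ext simp: coeff3_deriv_x coeff3_deriv_y) (auto simp: coeff3_def pconst_def)

lemma deriv_var [simp]: "deriv_x var_x = 1" "deriv_x var_y = 0" "deriv_y var_x = 0" "deriv_y var_y = 1"
  by (auto intro!: coeff3_ext simp: coeff3_deriv_x coeff3_deriv_y)

lemma deriv_const3 [simp]: "deriv_x (const3 c) = 0" "deriv_y (const3 c) = 0"
  "deriv_x 1 = 0" "deriv_y 1 = 0" "deriv_x var_delta = 0" "deriv_y var_delta = 0"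
  using deriv_pconst[of 1] by (simp_all add: const3_pconst var_delta_pconst del: deriv_pconst) simp_all

lemma wt_deriv: "wt d (N + 1) P \<Longrightarrow> wt d N (deriv_x P)" "wt d (N + 1) P \<Longrightarrow> wt d N (deriv_y P)"
  by (auto simp: wt_def coeff3_deriv_x coeff3_deriv_y)

text \<open>Up to a remainder of high order in x, y every series is a finite sum of such monomials,
  their coefficients being series in delta. An additive map that loses at most \<open>s\<close>
  orders is therefore zero as soon as it kills them.\<close>

lemma additive_ext:
  fixes Z :: "real fps3 \<Rightarrow> real fps3"
  assumes add: "\<And>f g. Z (f + g) = Z f + Z g"
    and cont: "\<And>N f. wt 0 (N + s) f \<Longrightarrow> wt 0 N (Z f)"
    and mono: "\<And>c p q. Z (pconst c * var_x ^ p * var_y ^ q) = 0"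
  shows "Z f = 0"
proof (rule wt_eq_0)
  fix N
  define M where "M = N + s"
  define m where "m p q = pconst (fps_nth (fps_nth f p) q) * var_x ^ p * var_y ^ q" for p q
  define g where "g = (\<Sum>p<M. \<Sum>q<M. m p q)"
  have Z0: "Z 0 = 0" using add[of 0 0] by simp
  have Zsum: "Z (sum h A) = (\<Sum>x\<in>A. Z (h x))" for h :: "nat \<Rightarrow> real fps3" and A
    by (induction A rule: infinite_finite_induct) (auto simp: Z0 add)
  have "Z g = 0" by (simp add: g_def Zsum m_def mono)
  moreover have "wt 0 M (f - g)"
  proof -
    have "coeff3 g i j k = coeff3 f i j k" if "i < M" "j < M" for i j k
    proof -
      have "coeff3 g i j k = (\<Sum>p<M. \<Sum>q<M. if q = j then if p = i then coeff3 f i j k else 0 else 0)"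
        unfolding g_def m_def coeff3_sum coeff3_monomial
        by (intro sum.cong) (auto simp: coeff3_def)
      then show ?thesis using that by simp
    qed
    then show ?thesis by (auto simp: wt_def)
  qed
  ultimately show "wt 0 N (Z f)"
    using add[of g "f - g"] cont[of N "f - g"] M_def by simp
qed

subsection \<open>Substitution\<close>

lemma vanishes_wt:
  assumes "vanishes_at_origin G" shows "wt d 1 (fst G)" "wt d 1 (snd G)"
  using assms by (auto simp: wt_def vanishes_at_origin_def coeff3_def)

lemma wt_vanishes: "wt 0 1 g \<Longrightarrow> wt 0 1 h \<Longrightarrow> vanishes_at_origin (g, h)"
  by (auto simp: wt_def vanishes_at_origin_def coeff3_def fps_eq_iff)

lemma subst_nth: "fps_nth (fps_nth (subst_xy P G) i) j = (\<Sum>p\<le>i + j. \<Sum>q\<le>i + j.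
       fps_nth (fps_nth P p) q * fps_nth (fps_nth (fst G ^ p * snd G ^ q) i) j)"
  by (simp add: subst_xy_def)

lemma subst_add: "subst_xy (P + Q) G = subst_xy P G + subst_xy Q G"
  by (auto intro!: fps_ext simp: subst_xy_def algebra_simps sum.distrib)

text \<open>The components of \<open>G\<close> have weight at least one for every \<open>d\<close>,
  so replacing x^p y^q by the corresponding product of powers of \<open>G\<close> loses no
  weight.\<close>

lemma subst_wt:
  assumes G: "vanishes_at_origin G" and P: "wt d N P"
  shows "wt d N (subst_xy P G)"
  unfolding wt_def
proof (intro allI impI)
  fix i j k assume lt: "i + j + d * k < N"
  have "fps_nth (fps_nth (fps_nth P p) q * fps_nth (fps_nth (fst G ^ p * snd G ^ q) i) j) k = 0" for p q
    unfolding fps_mult_nth[of "fps_nth (fps_nth P p) q"]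
  proof (intro sum.neutral ballI)
    fix c assume c: "c \<in> {0..k}"
    have w: "wt d (p + q) (fst G ^ p * snd G ^ q)"
      by (intro wt_mult wt_power vanishes_wt G)
    have "d * k = d * c + d * (k - c)" using c by (metis add_mult_distrib2 le_add_diff_inverse atLeastAtMost_iff)
    then have "p + q + d * c < N \<or> i + j + d * (k - c) < p + q" using lt by linarith
    then show "fps_nth (fps_nth (fps_nth P p) q) c * fps_nth (fps_nth (fps_nth (fst G ^ p * snd G ^ q) i) j) (k - c) = 0"
      using wtD[OF P, of p q c] wtD[OF w, of i j "k - c"] by (auto simp: coeff3_def)
  qed
  then show "coeff3 (subst_xy P G) i j k = 0"
    by (simp add: coeff3_def subst_nth fps_sum_nth)
qed

lemma subst_monomial:
  assumes G: "vanishes_at_origin G"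
  shows "subst_xy (pconst c * var_x ^ p * var_y ^ q) G = pconst c * fst G ^ p * snd G ^ q"
proof -
  have *: "fps_nth (fps_nth (pconst c * var_x ^ p * var_y ^ q) p') q' = (if p' = p \<and> q' = q then c else 0)" 
    for p' q' 
    using coeff3_monomial[of c p q p' q'] by (auto simp: coeff3_def fps_eq_iff)
  have "fps_nth (fps_nth (subst_xy (pconst c * var_x ^ p * var_y ^ q) G) i) j =
     fps_nth (fps_nth (pconst c * fst G ^ p * snd G ^ q) i) j" for i j
  proof -
    have "fps_nth (fps_nth (subst_xy (pconst c * var_x ^ p * var_y ^ q) G) i) j =
      (\<Sum>p'\<le>i + j. if p' = p then \<Sum>q'\<le>i + j. if q' = q then c * fps_nth (fps_nth (fst G ^ p * snd G ^ q) i) j else 0 else 0)"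
      unfolding subst_nth * by (intro sum.cong) (auto intro!: sum.neutral sum.cong simp del: sum.delta sum.delta')
    also have "\<dots> = (if p \<le> i + j \<and> q \<le> i + j then c * fps_nth (fps_nth (fst G ^ p * snd G ^ q) i) j else 0)"
      by simp
    \<comment> \<open>Outside the range of the truncated sum the product has too high an order to
      reach this coefficient.\<close>
    also have "\<dots> = c * fps_nth (fps_nth (fst G ^ p * snd G ^ q) i) j"
    proof -
      have w: "wt 0 (p + q) (fst G ^ p * snd G ^ q)"
        by (intro wt_mult wt_power vanishes_wt G)
      have "fps_nth (fps_nth (fst G ^ p * snd G ^ q) i) j = 0" if "\<not> (p \<le> i + j \<and> q \<le> i + j)"
        using wtD[OF w, of i j] that by (auto simp: coeff3_def fps_eq_iff)
      then show ?thesis by auto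
    qed
    finally show ?thesis by (simp add: mult.assoc)
  qed
  then show ?thesis by (auto intro!: fps_ext)
qed

text \<open>Substitutions as endomorphisms that fix the series in delta. Keeping the order in x, y
  plays the role of continuity; together with multiplicativity it makes every such \<open>T\<close>
  a substitution (\<open>alg_eq_subst\<close>).\<close>

definition alg :: "(real fps3 \<Rightarrow> real fps3) \<Rightarrow> bool" where
  "alg T \<longleftrightarrow> (\<forall>f g. T (f + g) = T f + T g) \<and> (\<forall>f g. T (f * g) = T f * T g) \<and>
     (\<forall>c. T (pconst c) = pconst c) \<and> (\<forall>N f. wt 0 N f \<longrightarrow> wt 0 N (T f))"

lemma algD:
  assumes "alg T"
  shows alg_add: "T (f + g) = T f + T g" and alg_mult: "T (f * g) = T f * T g"
    and alg_pconst: "T (pconst c) = pconst c" and alg_wt0: "wt 0 N f \<Longrightarrow> wt 0 N (T f)"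
  using assms by (auto simp: alg_def)

lemma alg_simps:
  assumes "alg T"
  shows "T 0 = 0" "T 1 = 1" "T (- f) = - T f" "T (f - g) = T f - T g"
    "T (const3 a) = const3 a" "T var_delta = var_delta" "T (f ^ p) = T f ^ p"
    "T (sum h A) = (\<Sum>a\<in>A. T (h a))"
proof -
  show 0: "T 0 = 0" using alg_add[OF assms, of 0 0] by simp
  show 1: "T 1 = 1" using alg_pconst[OF assms, of 1] by simp
  show m: "T (- f) = - T f" for f using alg_add[OF assms, of f "- f"] 0 by (simp add: eq_neg_iff_add_eq_0 add.commute)
  show "T (f - g) = T f - T g" using alg_add[OF assms, of f "- g"] m by simp
  show "T (const3 a) = const3 a" "T var_delta = var_delta"
    using alg_pconst[OF assms] by (simp_all add: const3_pconst var_delta_pconst)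
  show "T (f ^ p) = T f ^ p" by (induction p) (auto simp: 1 alg_mult[OF assms])
  show "T (sum h A) = (\<Sum>a\<in>A. T (h a))"
    by (induction A rule: infinite_finite_induct) (auto simp: 0 alg_add[OF assms])
qed

lemma alg_ext:
  assumes T: "alg T" and S: "alg S" and "T var_x = S var_x" "T var_y = S var_y"
  shows "T = S"
proof
  fix f
  have "T f - S f = 0"
    by (rule additive_ext[where s=0 and Z="\<lambda>f. T f - S f"])
       (auto simp: alg_add[OF T] alg_add[OF S] alg_wt0[OF T] alg_wt0[OF S] alg_mult[OF T] alg_mult[OF S]
         alg_pconst[OF T] alg_pconst[OF S] alg_simps[OF T] alg_simps[OF S] assms)
  then show "T f = S f" by simp
qed

lemma alg_comp: "alg T \<Longrightarrow> alg S \<Longrightarrow> alg (\<lambda>f. T (S f))"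
  by (auto simp: alg_def)

lemma alg_id: "alg (\<lambda>f. f)"
  by (auto simp: alg_def)

lemma subst_var [simp]:
  assumes "vanishes_at_origin G"
  shows "subst_xy var_x G = fst G" "subst_xy var_y G = snd G"
  using subst_monomial[OF assms, of 1 1 0] subst_monomial[OF assms, of 1 0 1] by auto

lemma alg_subst:
  assumes G: "vanishes_at_origin G"
  shows "alg (\<lambda>f. subst_xy f G)"
  unfolding alg_def
proof (intro conjI allI impI)
  note sm = subst_monomial[OF G]
  let ?T = "\<lambda>f. subst_xy f G"
  fix f g
  show "?T (f + g) = ?T f + ?T g" by (rule subst_add)
  show "?T (pconst c) = pconst c" for c using sm[of c 0 0] by simp
  show "wt 0 N f \<Longrightarrow> wt 0 N (?T f)" for N f by (rule subst_wt[OF G])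
  \<comment> \<open>Multiplicativity takes two passes of \<open>additive_ext\<close>: here the first
    factor is still a monomial, below it becomes arbitrary.\<close>
  have 1: "?T (pconst c * var_x ^ p * var_y ^ q * f) - ?T (pconst c * var_x ^ p * var_y ^ q) * ?T f = 0" for c p q f
  proof (rule additive_ext[where s=0 and Z="\<lambda>f. ?T (pconst c * var_x ^ p * var_y ^ q * f) - ?T (pconst c * var_x ^ p * var_y ^ q) * ?T f"])
    fix c' p' q'
    have e: "pconst c * var_x ^ p * var_y ^ q * (pconst c' * var_x ^ p' * var_y ^ q') = pconst (c * c') * var_x ^ (p + p') * var_y ^ (q + q')"
      by (simp add: power_add flip: pconst_simps(2))
    show "?T (pconst c * var_x ^ p * var_y ^ q * (pconst c' * var_x ^ p' * var_y ^ q'))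
       - ?T (pconst c * var_x ^ p * var_y ^ q) * ?T (pconst c' * var_x ^ p' * var_y ^ q') = 0"
      unfolding e unfolding sm by (simp add: power_add flip: pconst_simps(2))
  next
    fix N h assume "wt 0 (N + 0) h"
    then show "wt 0 N (?T (pconst c * var_x ^ p * var_y ^ q * h) - ?T (pconst c * var_x ^ p * var_y ^ q) * ?T h)"
      by (simp only: add_0_right) (intro wt_diff wt_mult_left[where N=N] subst_wt[OF G])
  qed (simp add: algebra_simps subst_add)
  have "?T (f * g) - ?T f * ?T g = 0"
  proof (rule additive_ext[where s=0 and Z="\<lambda>f. ?T (f * g) - ?T f * ?T g"])
    fix N h assume "wt 0 (N + 0) h"
    then show "wt 0 N (?T (h * g) - ?T h * ?T g)"
      by (simp only: add_0_right) (intro wt_diff wt_mult_right[where N=N] subst_wt[OF G])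
  next
    fix c p q
    show "?T (pconst c * var_x ^ p * var_y ^ q * g) - ?T (pconst c * var_x ^ p * var_y ^ q) * ?T g = 0"
      by (rule 1)
  qed (simp add: algebra_simps subst_add)
  then show "?T (f * g) = ?T f * ?T g" by simp
qed

lemma alg_vanishes: "alg T \<Longrightarrow> vanishes_at_origin (T var_x, T var_y)"
  by (rule wt_vanishes; rule alg_wt0[of T]; simp)

lemma alg_eq_subst:
  assumes "alg T" shows "T = (\<lambda>f. subst_xy f (T var_x, T var_y))"
  by (rule alg_ext[OF assms alg_subst[OF alg_vanishes[OF assms]]])
     (simp_all only: subst_var[OF alg_vanishes[OF assms]] fst_conv snd_conv)

lemma alg_wt: "alg T \<Longrightarrow> wt d N f \<Longrightarrow> wt d N (T f)"
  by (metis alg_eq_subst alg_vanishes subst_wt)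

lemma subst_comp:
  assumes F: "vanishes_at_origin F" and G: "vanishes_at_origin G"
  shows "subst_xy f (F \<circ>\<^sub>f G) = subst_xy (subst_xy f F) G"
proof -
  have "alg (\<lambda>f. subst_xy (subst_xy f F) G)" by (rule alg_comp[OF alg_subst alg_subst]) fact+
  from alg_eq_subst[OF this] show ?thesis using F by (metis formal_comp_def subst_var)
qed

subsection \<open>The Poisson bracket\<close>

text \<open>With this sign \<open>pb f H\<close> is the derivative of \<open>f\<close> along x' =
  H_y, y' = - H_x.\<close>

definition pb :: "real fps3 \<Rightarrow> real fps3 \<Rightarrow> real fps3" where
  "pb f g = deriv_x f * deriv_y g - deriv_y f * deriv_x g"

lemma pb_add: "pb (f + g) h = pb f h + pb g h" "pb h (f + g) = pb h f + pb h g"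
  and pb_diff: "pb (f - g) h = pb f h - pb g h" "pb h (f - g) = pb h f - pb h g"
  and pb_minus: "pb (- f) h = - pb f h" "pb h (- f) = - pb h f"
  by (simp_all add: pb_def algebra_simps)

lemma pb_0 [simp]: "pb 0 f = 0" "pb f 0 = 0" "pb 1 f = 0" "pb f 1 = 0"
  by (simp_all add: pb_def)

lemma pb_self [simp]: "pb f f = 0"
  by (simp add: pb_def algebra_simps)

lemma pb_swap: "pb f g = - pb g f"
  by (simp add: pb_def algebra_simps)

lemma pb_mult: "pb (f * g) h = f * pb g h + pb f h * g" "pb h (f * g) = f * pb h g + pb h f * g"
  by (simp_all add: pb_def deriv_x_mult deriv_y_mult algebra_simps)

lemma pb_pconst [simp]: "pb (pconst c) f = 0" "pb f (pconst c) = 0"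
  by (simp_all add: pb_def)

lemma pb_const3 [simp]: "pb (const3 c) f = 0" "pb f (const3 c) = 0"
  "pb var_delta f = 0" "pb f var_delta = 0"
  by (simp_all add: pb_def)

lemma pb_const3_mult: "pb (const3 c * f) g = const3 c * pb f g" "pb f (const3 c * g) = const3 c * pb f g"
  by (simp_all add: pb_mult)

lemma pb_sum: "pb (sum f A) h = (\<Sum>a\<in>A. pb (f a) h)" "pb h (sum f A) = (\<Sum>a\<in>A. pb h (f a))"
  by (induction A rule: infinite_finite_induct) (auto simp: pb_add)

lemma pb_power: "pb (f ^ p) g = of_nat p * f ^ (p - 1) * pb f g"
proof (induction p)
  case (Suc p)
  then show ?case by (cases p) (auto simp: pb_mult algebra_simps)
qed simp

lemma pb_var: "pb var_x f = deriv_y f" "pb var_y f = - deriv_x f"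
  "pb f var_x = - deriv_y f" "pb f var_y = deriv_x f"
  by (simp_all add: pb_def)

lemma pb_jacobi: "pb (pb f g) h = pb (pb f h) g + pb f (pb g h)"
  by (simp add: pb_def deriv_x_mult deriv_y_mult deriv_xy algebra_simps)

lemma wt_pb:
  assumes "wt d a f" "wt d b g" shows "wt d (a + b - 2) (pb f g)"
proof -
  have *: "wt d (N - 1) (deriv_x P)" "wt d (N - 1) (deriv_y P)" if "wt d N P" for N P
    using that by (cases N; use wt_deriv[of d "N - 1" P] in simp)+
  have "wt d (a - 1 + (b - 1)) (pb f g)"
    unfolding pb_def by (intro wt_diff wt_mult * assms)
  then show ?thesis by (rule wt_mono) simp
qed

lemma wt_pb': "wt d a f \<Longrightarrow> wt d b g \<Longrightarrow> N + 2 \<le> a + b \<Longrightarrow> wt d N (pb f g)"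
  by (rule wt_mono[OF wt_pb]) auto

subsection \<open>The chain rule\<close>

text \<open>\<open>Z\<close> is a derivation relative to \<open>A\<close>, so vanishing on the
  generators spreads to all monomials, and from there to all series by
  \<open>additive_ext\<close>.\<close>

lemma derivation_ext:
  fixes Z A :: "real fps3 \<Rightarrow> real fps3"
  assumes add: "\<And>f g. Z (f + g) = Z f + Z g"
    and mult: "\<And>f g. Z (f * g) = A f * Z g + Z f * A g"
    and cont: "\<And>N f. wt 0 (N + s) f \<Longrightarrow> wt 0 N (Z f)"
    and gen: "\<And>c. Z (pconst c) = 0" "Z var_x = 0" "Z var_y = 0"
  shows "Z f = 0"
proof (rule additive_ext[of Z s, OF add cont])
  fix c p q
  have "Z 1 = 0" using gen(1)[of 1] by simp
  then have pw: "Z (u ^ p) = 0" if "Z u = 0" for u p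
    by (induction p) (auto simp: mult that)
  show "Z (pconst c * var_x ^ p * var_y ^ q) = 0"
    by (simp add: mult pw gen)
qed

text \<open>In both equations the difference of the two sides is a derivation relative to
  \<open>T\<close> that vanishes on x, y and the series in delta.\<close>

lemma chain_rule:
  assumes T: "alg T"
  shows "deriv_x (T f) = T (deriv_x f) * deriv_x (T var_x) + T (deriv_y f) * deriv_x (T var_y)"
    and "deriv_y (T f) = T (deriv_x f) * deriv_y (T var_x) + T (deriv_y f) * deriv_y (T var_y)"
proof -
  note a = alg_add[OF T] alg_mult[OF T] alg_pconst[OF T] alg_simps[OF T]
  have w: "wt 0 (N + 1) f \<Longrightarrow> wt 0 N (T (deriv_x f))" "wt 0 (N + 1) f \<Longrightarrow> wt 0 N (T (deriv_y f))" 
    "wt 0 (N + 1) f \<Longrightarrow> wt 0 N (deriv_x (T f))" "wt 0 (N + 1) f \<Longrightarrow> wt 0 N (deriv_y (T f))" for N f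
    by (intro alg_wt0[OF T] wt_deriv | assumption)+
  have "deriv_x (T f) - (T (deriv_x f) * deriv_x (T var_x) + T (deriv_y f) * deriv_x (T var_y)) = 0"
    by (rule derivation_ext[where A=T and s=1 and Z="\<lambda>f. deriv_x (T f) - (T (deriv_x f) * deriv_x (T var_x) + T (deriv_y f) * deriv_x (T var_y))"])
       (simp_all only: a deriv_linear deriv_x_mult deriv_y_mult deriv_pconst deriv_var deriv_const3,
        simp_all add: algebra_simps w wt_add wt_diff wt_mult_left wt_mult_right)
  then show "deriv_x (T f) = T (deriv_x f) * deriv_x (T var_x) + T (deriv_y f) * deriv_x (T var_y)" by simp
  have "deriv_y (T f) - (T (deriv_x f) * deriv_y (T var_x) + T (deriv_y f) * deriv_y (T var_y)) = 0"
    by (rule derivation_ext[where A=T and s=1 and Z="\<lambda>f. deriv_y (T f) - (T (deriv_x f) * deriv_y (T var_x) + T (deriv_y f) * deriv_y (T var_y))"])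
       (simp_all only: a deriv_linear deriv_x_mult deriv_y_mult deriv_pconst deriv_var deriv_const3,
        simp_all add: algebra_simps w wt_add wt_diff wt_mult_left wt_mult_right)
  then show "deriv_y (T f) = T (deriv_x f) * deriv_y (T var_x) + T (deriv_y f) * deriv_y (T var_y)" by simp
qed

definition symp :: "(real fps3 \<Rightarrow> real fps3) \<Rightarrow> bool" where
  "symp T \<longleftrightarrow> alg T \<and> pb (T var_x) (T var_y) = 1"

lemma symp_alg: "symp T \<Longrightarrow> alg T"
  by (simp add: symp_def)

text \<open>By the chain rule \<open>pb (T f) (T g)\<close> is \<open>T (pb f g)\<close> times the
  Jacobian determinant of the substitution.\<close>

lemma symp_pb:
  assumes "symp T" shows "T (pb f g) = pb (T f) (T g)"
proof -
  have T: "alg T" and 1: "pb (T var_x) (T var_y) = 1" using assms by (auto simp: symp_def)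
  have "pb (T f) (T g) = (T (deriv_x f) * T (deriv_y g) - T (deriv_y f) * T (deriv_x g)) * pb (T var_x) (T var_y)"
    unfolding pb_def chain_rule[OF T, of f] chain_rule[OF T, of g] by (simp add: algebra_simps)
  then show ?thesis by (simp add: 1) (simp add: pb_def alg_mult[OF T] alg_simps[OF T])
qed

lemma symp_comp: "symp T \<Longrightarrow> symp S \<Longrightarrow> symp (\<lambda>f. T (S f))"
  using symp_pb[of T "S var_x" "S var_y"] alg_simps(2)[of T] by (simp add: symp_def alg_comp)

lemma symp_id: "symp (\<lambda>f. f)"
  by (simp add: symp_def alg_id pb_var)

lemma symp_inv:
  assumes "symp T" "alg T'" "\<And>f. T (T' f) = f" "\<And>f. T' (T f) = f"
  shows "symp T'"
  unfolding symp_def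
proof
  have "T (pb (T' var_x) (T' var_y)) = T 1"
    by (simp add: symp_pb[OF assms(1)] assms(3) alg_simps[OF symp_alg[OF assms(1)]] pb_var)
  then show "pb (T' var_x) (T' var_y) = 1" by (metis assms(4))
qed fact

subsection \<open>Exponentials of Hamiltonian vector fields\<close>

definition ad :: "real fps3 \<Rightarrow> real fps3 \<Rightarrow> real fps3" where
  "ad K f = pb f K"

text \<open>Admissible generators. Weight three in total degree makes each bracket raise the degree,
  so that the exponential series is finite in every coefficient; order two in x, y makes the flow
  fix the origin for every delta. The quadratic Hamiltonian delta I qualifies thanks to its factor
  delta.\<close>

definition gen :: "real fps3 \<Rightarrow> bool" where
  "gen K \<longleftrightarrow> wt 1 3 K \<and> wt 0 2 K"

lemma gen_wt: "gen K \<Longrightarrow> 1 \<le> d \<Longrightarrow> wt d 3 K"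
  using wt_d_mono[of 1 3 K d] by (simp add: gen_def)

lemma gen_0 [simp]: "gen 0" and gen_add: "gen K \<Longrightarrow> gen L \<Longrightarrow> gen (K + L)"
  and gen_minus: "gen K \<Longrightarrow> gen (- K)" and gen_diff: "gen K \<Longrightarrow> gen L \<Longrightarrow> gen (K - L)"
  by (auto simp: gen_def)

lemma gen_alg: "alg T \<Longrightarrow> gen K \<Longrightarrow> gen (T K)"
  by (auto simp: gen_def alg_wt)

text \<open>The exponential of \<open>t\<close> times the bracket with \<open>K\<close>. For
  \<open>gen K\<close> the l-fold bracket has total degree at least l, so the omitted terms do not
  reach this coefficient.\<close>

definition ex :: "real \<Rightarrow> real fps3 \<Rightarrow> real fps3 \<Rightarrow> real fps3" where
  "ex t K f = Abs_fps3 (\<lambda>i j k. \<Sum>l\<le>i + j + k. t ^ l / fact l * coeff3 ((ad K ^^ l) f) i j k)"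

definition es :: "real \<Rightarrow> real fps3 \<Rightarrow> nat \<Rightarrow> real fps3 \<Rightarrow> real fps3" where
  "es t K M f = (\<Sum>l<M. const3 (t ^ l / fact l) * (ad K ^^ l) f)"

lemma ad_pow_add: "(ad K ^^ l) (f + g) = (ad K ^^ l) f + (ad K ^^ l) g"
  and ad_pow_diff: "(ad K ^^ l) (f - g) = (ad K ^^ l) f - (ad K ^^ l) g"
  and ad_pow_const3: "(ad K ^^ l) (const3 c * f) = const3 c * (ad K ^^ l) f"
  and ad_pow_0: "(ad K ^^ l) 0 = 0"
  by (induction l) (auto simp: ad_def pb_add pb_diff pb_const3_mult)

lemma ad_pow_sum: "(ad K ^^ l) (sum h A) = (\<Sum>a\<in>A. (ad K ^^ l) (h a))"
  by (induction A rule: infinite_finite_induct) (auto simp: ad_pow_add ad_pow_0)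

lemma ad_pow_wt: "wt d a f \<Longrightarrow> wt d w K \<Longrightarrow> 2 \<le> w \<Longrightarrow> wt d (a + l * (w - 2)) ((ad K ^^ l) f)"
proof (induction l)
  case (Suc l)
  have "wt d (a + Suc l * (w - 2)) (pb ((ad K ^^ l) f) K)"
    by (rule wt_pb'[OF Suc.IH[OF Suc.prems] Suc.prems(2)]) (use Suc.prems(3) in simp)
  then show ?case by (simp only: funpow.simps o_apply ad_def[of K "(ad K ^^ l) f"])
qed simp

lemma ad_pow_wt1: "gen K \<Longrightarrow> wt 1 a f \<Longrightarrow> wt 1 (a + l) ((ad K ^^ l) f)"
  using ad_pow_wt[of 1 a f 3 K l] by (simp add: gen_def)

lemma ex_coeff:
  assumes "gen K" "i + j + k < M"
  shows "coeff3 (ex t K f) i j k = (\<Sum>l<M. t ^ l / fact l * coeff3 ((ad K ^^ l) f) i j k)"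
  unfolding ex_def coeff3_simps
proof (rule sum.mono_neutral_left)
  show "\<forall>l\<in>{..<M} - {..i + j + k}. t ^ l / fact l * coeff3 ((ad K ^^ l) f) i j k = 0"
    using wtD[OF ad_pow_wt1[OF assms(1), of 0 f]] by auto
qed (use assms in auto)

lemma ex_es: "gen K \<Longrightarrow> wt 1 M (ex t K f - es t K M f)"
  by (auto simp: wt_def es_def ex_coeff)

lemma es_wt: "gen K \<Longrightarrow> wt 1 N f \<Longrightarrow> wt 1 N (es t K M f)"
  unfolding es_def by (intro wt_sum wt_mult_left wt_mono[OF ad_pow_wt1]) auto

lemma es_diff: "es t K M (f - g) = es t K M f - es t K M g"
  by (simp add: es_def ad_pow_diff algebra_simps sum_subtractf)

text \<open>The square of a Cauchy product minus its triangle consists of terms with a + b >= M. The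
  loss of two in the hypothesis leaves room for brackets in place of products.\<close>

lemma triangle_wt:
  fixes U :: "nat \<Rightarrow> nat \<Rightarrow> real fps3"
  assumes "\<And>a b. wt 1 (a + b - 2) (U a b)"
  shows "wt 1 (M - 2) ((\<Sum>a<M. \<Sum>b<M. U a b) - (\<Sum>l<M. \<Sum>a\<le>l. U a (l - a)))"
proof -
  have sub: "{(a, b). a + b < M} \<subseteq> {..<M} \<times> {..<M}" by auto
  have "(\<Sum>l<M. \<Sum>a\<le>l. U a (l - a)) = (\<Sum>(a, b)\<in>{(a, b). a + b < M}. U a b)"
    by (rule sum.triangle_reindex[symmetric])
  then have "(\<Sum>a<M. \<Sum>b<M. U a b) - (\<Sum>l<M. \<Sum>a\<le>l. U a (l - a)) =
     (\<Sum>(a, b)\<in>({..<M} \<times> {..<M}) - {(a, b). a + b < M}. U a b)"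
    by (simp add: sum.cartesian_product sum_diff[OF _ sub])
  also have "wt 1 (M - 2) \<dots>"
  proof (rule wt_sum)
    fix x assume "x \<in> ({..<M} \<times> {..<M}) - {(a, b). a + b < M}"
    then obtain a b where "x = (a, b)" "M \<le> a + b" by (cases x) auto
    then show "wt 1 (M - 2) (case x of (a, b) \<Rightarrow> U a b)"
      using wt_mono[OF assms[of a b], of "M - 2"] by simp
  qed
  finally show ?thesis .
qed

text \<open>Applied to the product and to the Poisson bracket. Iterating the derivation on
  \<open>B f g\<close> gives a binomial formula, so the exponential of \<open>B f g\<close> is the
  Cauchy product of the two exponentials.\<close>

lemma ex_bilinear:
  fixes B :: "real fps3 \<Rightarrow> real fps3 \<Rightarrow> real fps3"
  assumes K: "gen K"
    and add: "\<And>f g h. B (f + g) h = B f h + B g h" "\<And>f g h. B h (f + g) = B h f + B h g"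
    and const: "\<And>c f g. B (const3 c * f) g = const3 c * B f g" "\<And>c f g. B f (const3 c * g) = const3 c * B f g"
    and leibniz: "\<And>f g. pb (B f g) K = B (pb f K) g + B f (pb g K)"
    and w: "\<And>a b f g. wt 1 a f \<Longrightarrow> wt 1 b g \<Longrightarrow> wt 1 (a + b - 2) (B f g)"
  shows "ex t K (B f g) = B (ex t K f) (ex t K g)"
proof -
  have B0: "B 0 h = 0" "B h 0 = 0" for h using add(1)[of 0 0 h] add(2)[of h 0 0] by auto
  have Bm: "B (- f) h = - B f h" "B h (- f) = - B h f" for f h
    using add(1)[of f "- f" h] add(2)[of h f "- f"] B0 by (simp_all add: eq_neg_iff_add_eq_0 add.commute)
  have Bd: "B (f - g) h = B f h - B g h" "B h (f - g) = B h f - B h g" for f g h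
    using add(1)[of f "- g" h] add(2)[of h f "- g"] Bm by simp_all
  have Bs: "B (sum u A) h = (\<Sum>a\<in>A. B (u a) h)" "B h (sum u A) = (\<Sum>a\<in>A. B h (u a))"
    for u :: "nat \<Rightarrow> real fps3" and A h
    by (induction A rule: infinite_finite_induct) (auto simp: B0 add)
  let ?D = "\<lambda>l. (ad K ^^ l)"
  \<comment> \<open>The general Leibniz rule for the derivation \<open>ad K\<close>.\<close>
  have L: "?D l (B f g) = (\<Sum>a\<le>l. of_nat (l choose a) * B (?D a f) (?D (l - a) g))" for l
  proof (induction l)
    case (Suc l)
    have pn: "pb (of_nat m * h) K = of_nat m * pb h K" for m h
      by (metis const3_of_nat pb_const3_mult(1))
    have "?D (Suc l) (B f g) = (\<Sum>a\<le>l. of_nat (l choose a) * B (?D (Suc a) f) (?D (l - a) g)) +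
       (\<Sum>a\<le>l. of_nat (l choose a) * B (?D a f) (?D (Suc l - a) g))"
      by (simp add: Suc ad_def[of K "sum _ _"] pb_sum pn leibniz sum.distrib distrib_left)
         (simp add: ad_def Suc_diff_le)
    also have "(\<Sum>a\<le>l. of_nat (l choose a) * B (?D (Suc a) f) (?D (l - a) g)) =
      (\<Sum>a=1..Suc l. of_nat (l choose (a - 1)) * B (?D a f) (?D (Suc l - a) g))"
      by (rule sum.reindex_bij_witness[of _ "\<lambda>a. a - 1" Suc]) auto
    also have "\<dots> = (\<Sum>a\<le>Suc l. (if a = 0 then 0 else of_nat (l choose (a - 1))) * B (?D a f) (?D (Suc l - a) g))"
      by (rule sum.mono_neutral_cong_left) auto
    also have "(\<Sum>a\<le>l. of_nat (l choose a) * B (?D a f) (?D (Suc l - a) g)) =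
      (\<Sum>a\<le>Suc l. of_nat (l choose a) * B (?D a f) (?D (Suc l - a) g))"
      by simp
    finally show ?case
      by (simp only: sum.distrib[symmetric]) (intro sum.cong, auto simp: choose_reduce_nat algebra_simps)
  qed simp
  have "wt 1 (M - 2) (ex t K (B f g) - B (ex t K f) (ex t K g))" for M
  proof -
    define U where "U a b = const3 (t ^ a / fact a * (t ^ b / fact b)) * B (?D a f) (?D b g)" for a b
    have U: "wt 1 (a + b - 2) (U a b)" for a b
      unfolding U_def using ad_pow_wt1[OF K, of 0] by (intro wt_mult_left w) auto
    have 1: "es t K M (B f g) = (\<Sum>l<M. \<Sum>a\<le>l. U a (l - a))"
      unfolding es_def
    proof (intro sum.cong refl)
      fix l
      have "t ^ l / fact l * of_nat (l choose a) = t ^ a / fact a * (t ^ (l - a) / fact (l - a))" if "a \<le> l" for a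
        using that by (simp add: binomial_fact field_simps flip: power_add)
      then have "const3 (t ^ l / fact l) * of_nat (l choose a) = const3 (t ^ a / fact a * (t ^ (l - a) / fact (l - a)))" if "a \<le> l" for a
        using that by (metis const3_of_nat const3_simps(2))
      then show "const3 (t ^ l / fact l) * ?D l (B f g) = (\<Sum>a\<le>l. U a (l - a))"
        unfolding L U_def sum_distrib_left by (intro sum.cong refl) (simp add: mult.assoc[symmetric])
    qed
    have 2: "B (es t K M f) (es t K M g) = (\<Sum>a<M. \<Sum>b<M. U a b)"
      unfolding es_def Bs const U_def const3_simps by (subst sum.swap) (simp add: mult_ac sum_distrib_left)
    have "ex t K (B f g) - B (ex t K f) (ex t K g) =
      (ex t K (B f g) - es t K M (B f g)) - ((\<Sum>a<M. \<Sum>b<M. U a b) - (\<Sum>l<M. \<Sum>a\<le>l. U a (l - a)))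
      - B (ex t K f - es t K M f) (ex t K g) - B (es t K M f) (ex t K g - es t K M g)"
      unfolding 1 2[symmetric] Bd by simp
    also have "wt 1 (M - 2) \<dots>"
    proof (rule wt_diff[OF wt_diff[OF wt_diff[OF _ triangle_wt[OF U]]]])
      show "wt 1 (M - 2) (ex t K (B f g) - es t K M (B f g))"
        by (rule wt_mono[OF ex_es[OF K]]) simp
      show "wt 1 (M - 2) (B (ex t K f - es t K M f) (ex t K g))"
        using w[OF ex_es[OF K, of M t f], of 0] by simp
      show "wt 1 (M - 2) (B (es t K M f) (ex t K g - es t K M g))"
        using w[OF _ ex_es[OF K, of M t g], of 0] by simp
    qed
    finally show ?thesis .
  qed
  from this[of "_ + 2"] have "ex t K (B f g) - B (ex t K f) (ex t K g) = 0"
    by (intro wt_eq_0) simp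
  then show ?thesis by simp
qed

lemma ex_mult: "gen K \<Longrightarrow> ex t K (f * g) = ex t K f * ex t K g"
  by (rule ex_bilinear[where B="(*)"])
     (auto simp: algebra_simps pb_mult intro: wt_mono[OF wt_mult])

lemma ex_pb: "gen K \<Longrightarrow> ex t K (pb f g) = pb (ex t K f) (ex t K g)"
  by (rule ex_bilinear[where B=pb]) (rule pb_add pb_const3_mult pb_jacobi wt_pb | assumption)+

lemma ad_pow_pconst: "(ad K ^^ l) (pconst c) = (if l = 0 then pconst c else 0)"
  by (cases l) (auto simp: funpow_Suc_right ad_def ad_pow_0 simp del: funpow.simps)

lemma alg_ex: assumes "gen K" shows "alg (ex t K)"
  unfolding alg_def
proof (intro conjI allI impI)
  fix f g c N
  show "ex t K (f + g) = ex t K f + ex t K g"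
    by (rule coeff3_ext) (simp add: ex_def ad_pow_add algebra_simps sum.distrib add_divide_distrib)
  show "ex t K (f * g) = ex t K f * ex t K g" by (rule ex_mult[OF assms])
  show "ex t K (pconst c) = pconst c"
    by (rule coeff3_ext) (simp add: ex_def ad_pow_pconst if_distrib[of "\<lambda>z. coeff3 z _ _ _"]
       if_distrib[of "\<lambda>z. _ * z"] if_distrib[of "\<lambda>z. z / _"] cong: if_cong)
  show "wt 0 N (ex t K f)" if "wt 0 N f"
    using ad_pow_wt[OF that, of 2 K] assms by (auto simp: wt_def ex_def gen_def)
qed

lemma symp_ex: "gen K \<Longrightarrow> symp (ex t K)"
  using ex_pb[of K t var_x var_y] alg_simps(2)[OF alg_ex] by (simp add: symp_def alg_ex pb_var)

lemma ex_zero [simp]: "ex 0 K f = f" 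
  by (rule coeff3_ext) (simp add: ex_def power_0_left if_distrib[of "\<lambda>z. z * _"] if_distrib[of "\<lambda>z. z / _"] cong: if_cong)

lemma ex_fix: "pb f K = 0 \<Longrightarrow> ex t K f = f"
proof -
  assume "pb f K = 0"
  then have "(ad K ^^ l) f = (if l = 0 then f else 0)" for l
    by (cases l) (auto simp: funpow_Suc_right ad_def ad_pow_0 simp del: funpow.simps)
  then show ?thesis by (intro coeff3_ext) (simp add: ex_def if_distrib[of "\<lambda>z. coeff3 z _ _ _"]
       if_distrib[of "\<lambda>z. _ * z"] if_distrib[of "\<lambda>z. z / _"] cong: if_cong)
qed

lemma ex_0 [simp]: "ex t 0 f = f"
  by (rule ex_fix) simp

text \<open>The Cauchy product again, with the binomial theorem for (s + t)^l in place of the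
  Leibniz rule.\<close>

lemma ex_ex:
  assumes K: "gen K"
  shows "ex s K (ex t K f) = ex (s + t) K f"
proof -
  let ?D = "\<lambda>l. (ad K ^^ l)"
  have "wt 1 (M - 2) (ex s K (ex t K f) - ex (s + t) K f)" for M
  proof -
    define U where "U a b = const3 (s ^ a / fact a * (t ^ b / fact b)) * ?D (a + b) f" for a b
    have U: "wt 1 (a + b - 2) (U a b)" for a b
      unfolding U_def using ad_pow_wt1[OF K, of 0 f "a + b"] by (auto intro: wt_mult_left wt_mono)
    have 1: "es (s + t) K M f = (\<Sum>l<M. \<Sum>a\<le>l. U a (l - a))"
      unfolding es_def
    proof (intro sum.cong refl)
      fix l
      have c3s: "const3 (sum u A) = (\<Sum>a\<in>A. const3 (u a))" for u :: "nat \<Rightarrow> real" and A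
        by (induction A rule: infinite_finite_induct) (auto simp: const3_simps)
      have "(s + t) ^ l / fact l = (\<Sum>a\<le>l. s ^ a / fact a * (t ^ (l - a) / fact (l - a)))"
        unfolding binomial_ring sum_divide_distrib
        by (intro sum.cong refl) (simp add: binomial_fact field_simps)
      then show "const3 ((s + t) ^ l / fact l) * ?D l f = (\<Sum>a\<le>l. U a (l - a))"
        by (simp add: U_def c3s sum_distrib_right)
    qed
    have 2: "es s K M (es t K M f) = (\<Sum>a<M. \<Sum>b<M. U a b)"
      unfolding es_def ad_pow_sum ad_pow_const3 U_def const3_simps by (simp add: mult.assoc sum_distrib_left funpow_add)
    have "ex s K (ex t K f) - ex (s + t) K f =
      (ex s K (ex t K f) - es s K M (ex t K f)) + es s K M (ex t K f - es t K M f)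
       + ((\<Sum>a<M. \<Sum>b<M. U a b) - (\<Sum>l<M. \<Sum>a\<le>l. U a (l - a))) - (ex (s + t) K f - es (s + t) K M f)"
      unfolding 1 2[symmetric] es_diff by simp
    also have "wt 1 (M - 2) \<dots>"
      by (rule wt_diff[OF wt_add[OF wt_add[OF wt_mono[OF ex_es[OF K]] wt_mono[OF es_wt[OF K ex_es[OF K]]]]
           triangle_wt[OF U]] wt_mono[OF ex_es[OF K]]]) simp_all
    finally show ?thesis .
  qed
  from this[of "_ + 2"] have "ex s K (ex t K f) - ex (s + t) K f = 0"
    by (intro wt_eq_0) simp
  then show ?thesis by simp
qed

lemma ex_inverse: "gen K \<Longrightarrow> ex t K (ex (- t) K f) = f" "gen K \<Longrightarrow> ex (- t) K (ex t K f) = f"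
  by (simp_all add: ex_ex)

text \<open>\<open>T\<close> intertwines \<open>ad K\<close> with \<open>ad (T K)\<close>, hence it
  maps partial sums to partial sums and only tails of high weight remain.\<close>

lemma symp_ex_conj:
  assumes T: "symp T" and K: "gen K"
  shows "T (ex t K f) = ex t (T K) (T f)"
proof -
  note a = symp_alg[OF T]
  have D: "T ((ad K ^^ l) f) = (ad (T K) ^^ l) (T f)" for l
    by (induction l) (auto simp: ad_def symp_pb[OF T])
  have "wt 1 M (T (ex t K f) - ex t (T K) (T f))" for M
  proof -
    have "T (es t K M f) = es t (T K) M (T f)"
      by (simp add: es_def alg_simps[OF a] alg_mult[OF a] D)
    then have "T (ex t K f) - ex t (T K) (T f) = T (ex t K f - es t K M f) - (ex t (T K) (T f) - es t (T K) M (T f))"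
      by (simp add: alg_simps[OF a])
    also have "wt 1 M \<dots>" by (intro wt_diff alg_wt[OF a] ex_es K gen_alg[OF a])
    finally show ?thesis .
  qed
  then have "T (ex t K f) - ex t (T K) (T f) = 0" by (rule wt_eq_0)
  then show ?thesis by simp
qed

section \<open>Size of the exponential and its dependence on the generator\<close>

lemma ex_tail:
  assumes K: "gen K" "wt d w K" "2 \<le> w" and f: "wt d a f"
  shows "wt d (a + m * (w - 2)) (ex t K f - es t K m f)"
  unfolding wt_def
proof (intro allI impI)
  fix i j k assume lt: "i + j + d * k < a + m * (w - 2)"
  let ?u = "\<lambda>l. t ^ l / fact l * coeff3 ((ad K ^^ l) f) i j k"
  have "coeff3 (ex t K f - es t K m f) i j k = (\<Sum>l<m + (i + j + k + 1). ?u l) - (\<Sum>l<m. ?u l)"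
    by (simp add: es_def ex_coeff[OF K(1), of i j k "m + (i + j + k + 1)"])
  also have "\<dots> = (\<Sum>l\<in>{m..<m + (i + j + k + 1)}. ?u l)"
    by (simp only: atLeast0LessThan[symmetric] sum_diff_nat_ivl[of 0 m])
  also have "\<dots> = 0"
  proof (intro sum.neutral ballI)
    fix l assume "l \<in> {m..<m + (i + j + k + 1)}"
    then have "m * (w - 2) \<le> l * (w - 2)" by (intro mult_le_mono1) simp
    then have "coeff3 ((ad K ^^ l) f) i j k = 0"
      by (intro wtD[OF ad_pow_wt[OF f K(2,3), of l]]) (use lt in linarith)
    then show "?u l = 0" by simp
  qed
  finally show "coeff3 (ex t K f - es t K m f) i j k = 0" .
qed

lemma ex_tail1:
  assumes "gen K" "wt d w K" "2 \<le> w" "wt d a f"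
  shows "wt d (a + w - 2) (ex t K f - f)"
  using ex_tail[OF assms, of 1 t] assms(3) by (simp add: es_def const3_simps)

lemma ex_tail2:
  assumes "gen K" "wt d w K" "2 \<le> w" "wt d a f"
  shows "wt d (a + 2 * (w - 2)) (ex t K f - f - const3 t * pb f K)"
  using ex_tail[OF assms, of 2 t]
  by (simp add: es_def const3_simps lessThan_Suc numeral_2_eq_2 ad_def algebra_simps)

text \<open>In the difference of l-fold brackets at least one factor is \<open>K' - K\<close>, and
  each further bracket adds at least one to the weight. So everything beyond the term with l = 1 has
  weight a + w - 1.\<close>

lemma ex_diff:
  assumes K: "gen K" "gen K'" "1 \<le> d" and w: "wt d w (K' - K)" "2 \<le> w" and f: "wt d a f"
  shows "wt d (a + w - 1) (ex t K' f - ex t K f - const3 t * pb f (K' - K))"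
  unfolding wt_def
proof (intro allI impI)
  fix i j k assume lt: "i + j + d * k < a + w - 1"
  have D: "wt d (a + w - 2 + l) ((ad K' ^^ Suc l) f - (ad K ^^ Suc l) f)" for l
  proof (induction l)
    case 0
    show ?case using wt_pb[OF f w(1)] w(2) by (simp add: ad_def pb_diff)
  next
    case (Suc l)
    define A A' where "A = (ad K ^^ Suc l) f" and "A' = (ad K' ^^ Suc l) f"
    have A: "wt d (a + Suc l * (3 - 2)) A"
      unfolding A_def by (rule ad_pow_wt[OF f gen_wt[OF K(1,3)]]) simp
    have "wt d (a + w - 2 + Suc l) (pb (A' - A) K' + pb A (K' - K))"
      by (intro wt_add wt_pb'[OF _ gen_wt[OF K(2,3)], of "a + w - 2 + l"] wt_pb'[OF A w(1)])
        (use Suc w(2) in \<open>auto simp: A_def A'_def\<close>)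
    moreover have "(ad K' ^^ Suc (Suc l)) f - (ad K ^^ Suc (Suc l)) f = pb (A' - A) K' + pb A (K' - K)"
      by (simp add: A_def A'_def ad_def pb_diff)
    ultimately show ?case by simp
  qed
  let ?u = "\<lambda>l. t ^ l / fact l * (coeff3 ((ad K' ^^ l) f) i j k - coeff3 ((ad K ^^ l) f) i j k)"
  have "coeff3 (ex t K' f - ex t K f) i j k = (\<Sum>l<Suc (Suc (i + j + k)). ?u l)"
    by (simp only: coeff3_simps ex_coeff[OF K(1), of i j k "Suc (Suc (i + j + k))"]
       ex_coeff[OF K(2), of i j k "Suc (Suc (i + j + k))"] less_SucI lessI right_diff_distrib sum_subtractf)
  also have "\<dots> = t * coeff3 (pb f (K' - K)) i j k + (\<Sum>l<i + j + k. ?u (Suc (Suc l)))"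
    by (simp only: sum.lessThan_Suc_shift) (simp add: ad_def pb_diff)
  also have "(\<Sum>l<i + j + k. ?u (Suc (Suc l))) = 0"
  proof (intro sum.neutral ballI)
    fix l
    show "?u (Suc (Suc l)) = 0"
      using wtD[OF D[of "Suc l"], of i j k] lt w(2) by simp
  qed
  finally show "coeff3 (ex t K' f - ex t K f - const3 t * pb f (K' - K)) i j k = 0" by simp
qed

lemma ex_cont:
  assumes K: "gen K" "gen K'" "1 \<le> d" and w: "wt d w (K' - K)" "2 \<le> w" and f: "wt d a f"
  shows "wt d (a + w - 2) (ex t K' f - ex t K f)"
proof -
  have "wt d (a + w - 2) ((ex t K' f - ex t K f - const3 t * pb f (K' - K)) + const3 t * pb f (K' - K))"
    by (intro wt_add wt_mult_left wt_pb[OF f w(1)] wt_mono[OF ex_diff[OF assms]]) simp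
  then show ?thesis by simp
qed

text \<open>Terms free of x and y are invisible to the derivatives; \<open>wt 0 1 f\<close> rules
  them out.\<close>

lemma wt_from_deriv:
  assumes "wt d N (deriv_x f)" "wt d N (deriv_y f)" "wt 0 1 f"
  shows "wt d (N + 1) f"
  unfolding wt_def
proof (intro allI impI)
  fix i j k assume lt: "i + j + d * k < N + 1"
  show "coeff3 f i j k = 0"
  proof (cases i)
    case (Suc i')
    then show ?thesis using wtD[OF assms(1), of i' j k] lt by (simp add: coeff3_deriv_x)
  next
    case 0
    show ?thesis
    proof (cases j)
      case (Suc j')
      then show ?thesis using wtD[OF assms(2), of i j' k] lt by (simp add: coeff3_deriv_y)
    qed (use 0 wtD[OF assms(3), of 0 0 k] in simp)
  qed
qed

text \<open>On x and y the linear term of \<open>ex_diff\<close> is, up to sign and the factor t,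
  the gradient of \<open>K' - K\<close>, which determines its weight. This drives the injectivity of
  the exponential, one weight at a time.\<close>

lemma ex_lead:
  assumes K: "gen K" "gen K'" "1 \<le> d" and t: "t \<noteq> 0" and w: "wt d w (K' - K)" "2 \<le> w"
    and "wt d w (ex t K' var_x - ex t K var_x)" "wt d w (ex t K' var_y - ex t K var_y)"
  shows "wt d (w + 1) (K' - K)"
proof -
  have "wt d w (pb u (K' - K))" if "wt d 1 u" "wt d w (ex t K' u - ex t K u)" for u
  proof -
    have "wt d w ((ex t K' u - ex t K u) - (ex t K' u - ex t K u - const3 t * pb u (K' - K)))"
      by (intro wt_diff[OF that(2) wt_mono[OF ex_diff[OF K w that(1)]]]) simp
    then have "wt d w (const3 t * pb u (K' - K))" by simp
    then show ?thesis using t by (auto simp: wt_def)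
  qed
  from this[of var_x] this[of var_y] assms have "wt d w (deriv_y (K' - K))" "wt d w (- deriv_x (K' - K))"
    by (simp_all only: pb_var wt_var)
  then show ?thesis
    using wt_minus[of d w "- deriv_x (K' - K)"] K(1,2)
    by (intro wt_from_deriv) (auto simp: gen_def simp del: deriv_linear intro: wt_mono[of 0 2])
qed

lemma ex_lead_wt:
  assumes K: "gen K" "gen K'" "1 \<le> d" and t: "t \<noteq> 0" and m: "m \<le> w"
    and "wt d w (ex t K' var_x - ex t K var_x)" "wt d w (ex t K' var_y - ex t K var_y)"
  shows "wt d (m + 1) (K' - K)"
  using m
proof (induction m)
  case 0
  show ?case using gen_wt[OF gen_diff[OF K(2,1)] K(3)] by (rule wt_mono) simp
next
  case (Suc m)
  show ?case
  proof (cases "m = 0")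
    case True
    then show ?thesis using gen_wt[OF gen_diff[OF K(2,1)] K(3)] by (auto intro: wt_mono)
  next
    case False
    have "wt d (Suc m) (K' - K)" using Suc by simp
    from ex_lead[OF K t this] assms False Suc.prems show ?thesis
      by (auto intro: wt_mono)
  qed
qed

lemma ex_inj:
  assumes K: "gen K" "gen K'" and t: "t \<noteq> 0" and eq: "ex t K' = ex t K"
  shows "K' = K"
proof -
  have "wt 1 N (K' - K)" for N
    using ex_lead_wt[OF K _ t, of 1 N N] eq by (auto intro: wt_mono)
  then have "K' - K = 0" by (rule wt_eq_0)
  then show ?thesis by simp
qed

subsection \<open>Formal flows\<close>

text \<open>Each coefficient of \<open>ex t H f\<close> is a polynomial in t; differentiating it
  termwise yields the coefficient of \<open>ex t H (pb f H)\<close>.\<close>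

lemma flow_ex:
  assumes H: "gen H"
  shows "formal_hamiltonian_flow H (\<lambda>t. (ex t H var_x, ex t H var_y))"
proof -
  have d: "((\<lambda>s. coeff3 (ex s H f) i j k) has_real_derivative coeff3 (ex t H (pb f H)) i j k) (at t)" for f i j k t
  proof -
    define N where "N = i + j + k"
    define c where "c l = coeff3 ((ad H ^^ l) f) i j k" for l
    have "((\<lambda>s. \<Sum>l<Suc (Suc N). s ^ l / fact l * c l) has_real_derivative
       (\<Sum>l<Suc (Suc N). real l * t ^ (l - 1) / fact l * c l)) (at t)"
    proof (rule DERIV_sum)
      fix l
      show "((\<lambda>s. s ^ l / fact l * c l) has_real_derivative real l * t ^ (l - 1) / fact l * c l) (at t)"
        using DERIV_cmult[OF DERIV_pow[of l t UNIV], of "c l / fact l"] by (simp add: mult_ac)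
    qed
    moreover have "(\<Sum>l<Suc (Suc N). real l * t ^ (l - 1) / fact l * c l) = (\<Sum>l<Suc N. t ^ l / fact l * c (Suc l))"
      by (subst sum.lessThan_Suc_shift) (auto intro!: sum.cong simp: divide_simps simp del: sum.lessThan_Suc)
    moreover have "coeff3 (ex s H f) i j k = (\<Sum>l<Suc (Suc N). s ^ l / fact l * c l)" for s
      unfolding c_def by (rule ex_coeff[OF H]) (simp add: N_def)
    moreover have "coeff3 (ex t H (pb f H)) i j k = (\<Sum>l<Suc N. t ^ l / fact l * c (Suc l))"
      unfolding c_def funpow_Suc_right o_def ad_def[of H f, symmetric] by (rule ex_coeff[OF H]) (simp add: N_def)
    ultimately show ?thesis by simp
  qed
  have s: "subst_xy f (ex t H var_x, ex t H var_y) = ex t H f" for t f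
    using alg_eq_subst[OF alg_ex[OF H]] by metis
  show ?thesis
    unfolding formal_hamiltonian_flow_def s
    using d[of var_x] d[of var_y] alg_vanishes[OF alg_ex[OF H]]
    by (simp add: formal_id_def pb_var)
qed

lemma wt_power_diff:
  assumes "wt d 1 F" "wt d 1 G" "wt d N (F - G)"
  shows "wt d (N + p - 1) (F ^ p - G ^ p)"
proof (induction p)
  case (Suc p)
  have e: "F ^ Suc p - G ^ Suc p = F ^ p * (F - G) + (F ^ p - G ^ p) * G" by (simp add: algebra_simps)
  have "wt d (N + Suc p - 1) (F ^ p * (F - G))"
    using wt_mult[OF wt_power[OF assms(1), of p] assms(3)] by (simp add: add.commute)
  moreover have "wt d (N + Suc p - 1) ((F ^ p - G ^ p) * G)"
  proof (cases p)
    case Suc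
    then show ?thesis using wt_mult[OF Suc.IH assms(2)] by simp
  qed simp
  ultimately show ?case unfolding e by (rule wt_add)
qed simp

text \<open>Exchanging \<open>F\<close> for \<open>G\<close> in a monomial of degree p + q replaces
  one factor at a time by a difference of weight \<open>N\<close>, a gain of N - 1 over the
  degree.\<close>

lemma subst_diff_wt:
  assumes F: "vanishes_at_origin F" and G: "vanishes_at_origin G" and P: "wt d w P" and N: "1 \<le> N"
    and FG: "wt d N (fst F - fst G)" "wt d N (snd F - snd G)"
  shows "wt d (N + w - 1) (subst_xy P F - subst_xy P G)"
  unfolding wt_def
proof (intro allI impI)
  fix i j k assume lt: "i + j + d * k < N + w - 1"
  define m where "m p q = fst F ^ p * snd F ^ q - fst G ^ p * snd G ^ q" for p q
  have m: "wt d (N + (p + q) - 1) (m p q)" for p q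
  proof -
    have e: "m p q = fst F ^ p * (snd F ^ q - snd G ^ q) + (fst F ^ p - fst G ^ p) * snd G ^ q"
      by (simp add: m_def algebra_simps)
    have "wt d (p + (N + q - 1)) (fst F ^ p * (snd F ^ q - snd G ^ q))" 
      "wt d ((N + p - 1) + q) ((fst F ^ p - fst G ^ p) * snd G ^ q)"
      by (intro wt_mult wt_power wt_power_diff vanishes_wt F G FG)+
    then show ?thesis using N unfolding e by (auto intro!: wt_add intro: wt_mono)
  qed
  have m0: "m 0 0 = 0" by (simp add: m_def)
  have "fps_nth (fps_nth (fps_nth P p) q * fps_nth (fps_nth (m p q) i) j) k = 0" for p q
    unfolding fps_mult_nth[of "fps_nth (fps_nth P p) q"]
  proof (intro sum.neutral ballI)
    fix c assume c: "c \<in> {0..k}"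
    have "d * k = d * c + d * (k - c)" using c by (metis add_mult_distrib2 le_add_diff_inverse atLeastAtMost_iff)
    then have "p + q + d * c < w \<or> i + j + d * (k - c) < N + (p + q) - 1 \<or> (p = 0 \<and> q = 0)" using lt N by linarith
    then show "fps_nth (fps_nth (fps_nth P p) q) c * fps_nth (fps_nth (fps_nth (m p q) i) j) (k - c) = 0"
      using wtD[OF P, of p q c] wtD[OF m, of i j "k - c" p q] m0 by (auto simp: coeff3_def)
  qed
  then have "coeff3 (subst_xy P F) i j k - coeff3 (subst_xy P G) i j k = 0"
    unfolding coeff3_def subst_nth fps_sum_nth sum_subtractf[symmetric]
    by (intro sum.neutral ballI) (simp add: m_def right_diff_distrib)
  then show "coeff3 (subst_xy P F - subst_xy P G) i j k = 0" by simp
qed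

text \<open>The gradient of \<open>H\<close> has total degree at least two, so two flows that agree
  below some degree have right-hand sides agreeing one degree further. With equal initial values the
  coefficients of that degree then agree as well.\<close>

lemma flow_unique:
  assumes H: "gen H" and \<Phi>: "formal_hamiltonian_flow H \<Phi>"
  shows "\<Phi> t = (ex t H var_x, ex t H var_y)"
proof -
  define E where "E t = (ex t H var_x, ex t H var_y)" for t
  have E: "formal_hamiltonian_flow H E" unfolding E_def by (rule flow_ex[OF H])
  note F = \<Phi>[unfolded formal_hamiltonian_flow_def] and G = E[unfolded formal_hamiltonian_flow_def]
  have v: "vanishes_at_origin (\<Phi> t)" "vanishes_at_origin (E t)" for t using F G by auto
  have w: "wt 1 2 (deriv_y H)" "wt 1 2 (- deriv_x H)"
    using H by (auto simp: gen_def intro!: wt_deriv wt_minus)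
  have "wt 1 (N + 1) (fst (\<Phi> t) - fst (E t)) \<and> wt 1 (N + 1) (snd (\<Phi> t) - snd (E t))" for N t
  proof (induction N arbitrary: t)
    case 0
    show ?case using vanishes_wt[OF v(1)] vanishes_wt[OF v(2)] by (auto intro!: wt_diff simp del: One_nat_def)
  next
    case (Suc N)
    have eq: "coeff3 (subst_xy P (\<Phi> t)) i j k = coeff3 (subst_xy P (E t)) i j k"
      if "i + j + k < Suc N + 1" "wt 1 2 P" for i j k t P
      using wtD[OF subst_diff_wt[OF v that(2), where N="N + 1", of t t], of i j k] Suc[of t] that(1) by simp
    have const: "f t = g t" if "\<And>t. (f has_real_derivative D t) (at t)" "\<And>t. (g has_real_derivative D t) (at t)" "f 0 = g 0"
      for f g D and t :: real
    proof -
      have "((\<lambda>s. f s - g s) has_real_derivative 0) (at t)" for t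
        using DERIV_diff[OF that(1)[of t] that(2)[of t]] by simp
      then have "f t - g t = f 0 - g 0" by (intro DERIV_isconst_all) auto
      then show ?thesis using that(3) by simp
    qed
    have i0: "\<Phi> 0 = E 0" using F G by simp
    have "coeff3 (fst (\<Phi> t)) i j k = coeff3 (fst (E t)) i j k" if less: "i + j + k < Suc N + 1" for i j k
    proof (rule const[where D="\<lambda>t. coeff3 (subst_xy (deriv_y H) (E t)) i j k"
           and f="\<lambda>t. coeff3 (fst (\<Phi> t)) i j k" and g="\<lambda>t. coeff3 (fst (E t)) i j k"])
      fix t
      have "((\<lambda>s. coeff3 (fst (\<Phi> s)) i j k) has_real_derivative coeff3 (subst_xy (deriv_y H) (\<Phi> t)) i j k) (at t)"
        using F by blast
      then show "((\<lambda>s. coeff3 (fst (\<Phi> s)) i j k) has_real_derivative coeff3 (subst_xy (deriv_y H) (E t)) i j k) (at t)"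
        by (simp only: eq[OF less w(1)])
      show "((\<lambda>s. coeff3 (fst (E s)) i j k) has_real_derivative coeff3 (subst_xy (deriv_y H) (E t)) i j k) (at t)"
        using G by blast
    qed (simp add: i0)
    moreover have "coeff3 (snd (\<Phi> t)) i j k = coeff3 (snd (E t)) i j k" if less: "i + j + k < Suc N + 1" for i j k
    proof (rule const[where D="\<lambda>t. coeff3 (subst_xy (- deriv_x H) (E t)) i j k"
           and f="\<lambda>t. coeff3 (snd (\<Phi> t)) i j k" and g="\<lambda>t. coeff3 (snd (E t)) i j k"])
      fix t
      have "((\<lambda>s. coeff3 (snd (\<Phi> s)) i j k) has_real_derivative coeff3 (subst_xy (- deriv_x H) (\<Phi> t)) i j k) (at t)"
        using F by blast
      then show "((\<lambda>s. coeff3 (snd (\<Phi> s)) i j k) has_real_derivative coeff3 (subst_xy (- deriv_x H) (E t)) i j k) (at t)"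
        by (simp only: eq[OF less w(2)])
      show "((\<lambda>s. coeff3 (snd (E s)) i j k) has_real_derivative coeff3 (subst_xy (- deriv_x H) (E t)) i j k) (at t)"
        using G by blast
    qed (simp add: i0)
    ultimately show ?case by (simp add: wt_def)
  qed
  then have "wt 1 N (fst (\<Phi> t) - fst (E t))" "wt 1 N (snd (\<Phi> t) - snd (E t))" for N
    using wt_mono[of 1 "N + 1" _ N] by (simp_all only: le_add1)
  then have "fst (\<Phi> t) - fst (E t) = 0" "snd (\<Phi> t) - snd (E t) = 0"
    using wt_eq_0[of 1 "fst (\<Phi> t) - fst (E t)"] wt_eq_0[of 1 "snd (\<Phi> t) - snd (E t)"] by simp_all
  then show ?thesis by (simp add: prod_eq_iff E_def)
qed

subsection \<open>Symplectic maps that agree to some order\<close>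

text \<open>A series \<open>e\<close> with \<open>\<partial>e/\<partial>y = E\<^sub>1\<close>, and \<open>\<partial>e/\<partial>x = - E\<^sub>2\<close> if \<open>(E\<^sub>1, E\<^sub>2)\<close> is divergence free.\<close>

definition prim :: "real fps3 \<Rightarrow> real fps3 \<Rightarrow> real fps3" where
  "prim E1 E2 = Abs_fps3 (\<lambda>i j k.
     if 0 < j then coeff3 E1 i (j - 1) k / real j
     else if 0 < i then - coeff3 E2 (i - 1) 0 k / real i else 0)"

lemma prim_wt: "wt d N E1 \<Longrightarrow> wt d N E2 \<Longrightarrow> wt d (N + 1) (prim E1 E2) \<or> N = 0"
  by (auto simp: wt_def prim_def)

lemma prim_wt0: "wt 0 s E1 \<Longrightarrow> wt 0 s E2 \<Longrightarrow> wt 0 (s + 1) (prim E1 E2)"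
  by (auto simp: wt_def prim_def)

lemma prim_deriv_y: "deriv_y (prim E1 E2) = E1"
  by (rule coeff3_ext) (simp add: coeff3_deriv_y prim_def)

lemma prim_deriv_x:
  assumes "wt d N (deriv_x E1 + deriv_y E2)"
  shows "wt d (N + 1) (E2 + deriv_x (prim E1 E2))"
  unfolding wt_def
proof (intro allI impI)
  fix i j k assume lt: "i + j + d * k < N + 1"
  show "coeff3 (E2 + deriv_x (prim E1 E2)) i j k = 0"
  proof (cases j)
    case (Suc j')
    then show ?thesis using wtD[OF assms, of i j' k] lt
      by (simp add: coeff3_deriv_x coeff3_deriv_y prim_def field_simps)
  qed (simp add: coeff3_deriv_x prim_def)
qed

text \<open>The difference of \<open>T1\<close> and \<open>T2\<close> on the coordinates, carried
  back to the identity by \<open>T0'\<close>, is a vector field that is divergence free to leading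
  order. This is its Hamiltonian, carried forward again by \<open>T0\<close>.\<close>

definition err_ham where
  "err_ham T0 T0' T1 T2 = T0 (prim (T0' (T1 var_x - T2 var_x)) (T0' (T1 var_y - T2 var_y)))"

lemma symp_error:
  assumes T1: "symp T1" and T2: "symp T2" and T0: "symp T0" and T0': "symp T0'"
    and inv: "\<And>f. T0 (T0' f) = f" "\<And>f. T0' (T0 f) = f"
    and near: "wt d 2 (T2 var_x - T0 var_x)" "wt d 2 (T2 var_y - T0 var_y)"
    and err: "wt d N (T1 var_x - T2 var_x)" "wt d N (T1 var_y - T2 var_y)" and N: "2 \<le> N"
  shows "wt d (N + 1) (err_ham T0 T0' T1 T2)"
    and "wt d (N + 1) (T1 var_x - T2 var_x - pb (T0 var_x) (err_ham T0 T0' T1 T2))"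
    and "wt d (N + 1) (T1 var_y - T2 var_y - pb (T0 var_y) (err_ham T0 T0' T1 T2))"
    and "wt 0 s (T1 var_x - T2 var_x) \<Longrightarrow> wt 0 s (T1 var_y - T2 var_y) \<Longrightarrow> wt 0 (s + 1) (err_ham T0 T0' T1 T2)"
proof -
  note a = symp_alg[OF T0] and a' = symp_alg[OF T0']
  define ex ey where "ex = T1 var_x - T2 var_x" and "ey = T1 var_y - T2 var_y"
  define E1 E2 where "E1 = T0' ex" and "E2 = T0' ey"
  define e where "e = prim E1 E2"
  have h: "err_ham T0 T0' T1 T2 = T0 e" by (simp add: err_ham_def e_def E1_def E2_def ex_def ey_def)
  have w: "wt d N ex" "wt d N ey" using err by (simp_all add: ex_def ey_def)
  have wE: "wt d N E1" "wt d N E2" unfolding E1_def E2_def by (rule alg_wt[OF a' w(1)] alg_wt[OF a' w(2)])+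
  \<comment> \<open>The two determinant conditions are subtracted. Replacing \<open>T2\<close> by
    the nearby \<open>T0\<close> costs brackets of weight at least \<open>N\<close>, after which
    \<open>T0'\<close> turns the remaining sum into a divergence.\<close>
  have div: "wt d N (deriv_x E1 + deriv_y E2)"
  proof -
    have p: "pb (T1 var_x) (T1 var_y) = 1" "pb (T2 var_x) (T2 var_y) = 1" using T1 T2 by (auto simp: symp_def)
    have t: "T1 var_x = T2 var_x + ex" "T1 var_y = T2 var_y + ey" by (simp_all add: ex_def ey_def)
    have z: "pb ex (T2 var_y) + pb (T2 var_x) ey + pb ex ey = 0"
      using p(1) unfolding t pb_add p(2) by (simp add: algebra_simps)
    have "wt d N (- (pb ex ey) - pb ex (T2 var_y - T0 var_y) - pb (T2 var_x - T0 var_x) ey)"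
      by (intro wt_diff wt_minus wt_pb'[OF w(1) w(2)] wt_pb'[OF w(1) near(2)] wt_pb'[OF near(1) w(2)]) (use N in auto)
    also have "- (pb ex ey) - pb ex (T2 var_y - T0 var_y) - pb (T2 var_x - T0 var_x) ey = pb ex (T0 var_y) + pb (T0 var_x) ey"
      using z by (simp add: pb_diff algebra_simps eq_neg_iff_add_eq_0)
    finally have "wt d N (T0' (pb ex (T0 var_y) + pb (T0 var_x) ey))" by (rule alg_wt[OF a'])
    then show ?thesis by (simp add: alg_add[OF a'] symp_pb[OF T0'] inv E1_def E2_def pb_var)
  qed
  show "wt d (N + 1) (err_ham T0 T0' T1 T2)"
    unfolding h using prim_wt[OF wE] N by (intro alg_wt[OF a]) (auto simp: e_def)
  have "pb (T0 var_x) (T0 e) = T0 (pb var_x e)" by (simp add: symp_pb[OF T0])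
  also have "\<dots> = ex" by (simp add: pb_var e_def prim_deriv_y E1_def inv)
  finally show "wt d (N + 1) (T1 var_x - T2 var_x - pb (T0 var_x) (err_ham T0 T0' T1 T2))"
    unfolding h by (simp add: ex_def)
  have "T0 (E2 + deriv_x e) = ey - T0 (pb var_y e)"
    by (simp add: alg_add[OF a] alg_simps[OF a] E2_def inv pb_var)
  moreover have "wt d (N + 1) (T0 (E2 + deriv_x e))"
    unfolding e_def by (intro alg_wt[OF a] prim_deriv_x div)
  ultimately show "wt d (N + 1) (T1 var_y - T2 var_y - pb (T0 var_y) (err_ham T0 T0' T1 T2))"
    unfolding h by (simp add: ey_def symp_pb[OF T0])
  show "wt 0 (s + 1) (err_ham T0 T0' T1 T2)" if "wt 0 s (T1 var_x - T2 var_x)" "wt 0 s (T1 var_y - T2 var_y)"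
    unfolding h e_def E1_def E2_def ex_def ey_def using that by (intro alg_wt[OF a] prim_wt0 alg_wt[OF a'])
qed

text \<open>The limit of a sequence whose n-th step has weight at least n: a coefficient of weight w
  no longer changes from index w + 1 on.\<close>

definition lim3 :: "nat \<Rightarrow> (nat \<Rightarrow> real fps3) \<Rightarrow> real fps3" where
  "lim3 d K = Abs_fps3 (\<lambda>i j k. coeff3 (K (Suc (i + j + d * k))) i j k)"

lemma lim3_wt:
  assumes "\<And>n. wt d n (K (Suc n) - K n)"
  shows "wt d n (lim3 d K - K n)"
proof -
  have s: "wt d m (K (m + l) - K m)" for m l
  proof (induction l)
    case (Suc l)
    have "wt d m ((K (Suc (m + l)) - K (m + l)) + (K (m + l) - K m))"
      by (rule wt_add[OF wt_mono[OF assms] Suc]) simp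
    then show ?case by simp
  qed simp
  have s': "wt d m (K n - K m)" if "m \<le> n" for m n
    using s[of m "n - m"] that by simp
  show ?thesis
    unfolding wt_def
  proof (intro allI impI)
    fix i j k assume "i + j + d * k < n"
    then show "coeff3 (lim3 d K - K n) i j k = 0"
      using wtD[OF s'[of "Suc (i + j + d * k)" n], of i j k] by (simp add: lim3_def)
  qed
qed

lemma lim3_closed: "(\<And>n. wt d w (K n)) \<Longrightarrow> wt d w (lim3 d' K)"
  by (auto simp: wt_def lim3_def)

text \<open>The logarithm of a symplectic map tangent to the identity, built by successive
  approximation: adding the Hamiltonian of the leading error to the generator raises the weight of
  the error by one.\<close>

lemma ex_surj:
  assumes S: "symp S" and near: "wt 1 2 (S var_x - var_x)" "wt 1 2 (S var_y - var_y)"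
  shows "\<exists>K. gen K \<and> S = ex 1 K"
proof -
  define e where "e K = err_ham (\<lambda>f. f) (\<lambda>f. f) S (ex 1 K)" for K
  define K where "K n = ((\<lambda>K. K + e K) ^^ n) 0" for n
  have K_Suc: "K (Suc n) = K n + e (K n)" for n by (simp add: K_def)
  have step: "gen (K n) \<and> wt 1 (n + 2) (S var_x - ex 1 (K n) var_x) \<and> wt 1 (n + 2) (S var_y - ex 1 (K n) var_y) \<and>
     wt 1 (n + 3) (e (K n))" for n
  proof (induction n)
    have main: "wt 1 (N + 1) (e K)" "wt 0 2 (e K)" "gen (K + e K)"
       "wt 1 (N + 1) (S var_x - ex 1 (K + e K) var_x)" "wt 1 (N + 1) (S var_y - ex 1 (K + e K) var_y)"
       if K: "gen K" and err: "wt 1 N (S var_x - ex 1 K var_x)" "wt 1 N (S var_y - ex 1 K var_y)" and N: "2 \<le> N" for K N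
    proof -
      have n: "wt 1 2 (ex 1 K u - u)" if "wt 1 1 u" for u
        using ex_tail1[OF K _ _ that, of 3 1] K by (simp add: gen_def)
      have v0: "wt 0 1 (S u - ex 1 K u)" if "wt 0 1 u" for u
        using that alg_wt0[OF symp_alg[OF S]] alg_wt0[OF alg_ex[OF K]] by (intro wt_diff)
      note E = symp_error[OF S symp_ex[OF K] symp_id symp_id refl refl n n err N, folded e_def, OF wt_var(1,2)]
      show 1: "wt 1 (N + 1) (e K)" by (rule E(1))
      show 2: "wt 0 2 (e K)" using E(4)[of 1] v0 by (simp add: numeral_2_eq_2)
      show 3: "gen (K + e K)" using K 1 2 N by (auto simp: gen_def intro!: wt_add intro: wt_mono)
      have x: "wt 1 (N + 1) (S u - ex 1 (K + e K) u)" if "wt 1 1 u" "wt 1 (N + 1) (S u - ex 1 K u - pb u (e K))" for u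
      proof -
        have d: "wt 1 (N + 1) (ex 1 (K + e K) u - ex 1 K u - const3 1 * pb u (K + e K - K))"
          using ex_diff[OF K 3 _ _ _ that(1), of "N + 1" 1] 1 N by simp
        show ?thesis using wt_diff[OF that(2) d] by (simp add: const3_simps)
      qed
      show "wt 1 (N + 1) (S var_x - ex 1 (K + e K) var_x)" "wt 1 (N + 1) (S var_y - ex 1 (K + e K) var_y)"
        by (rule x[OF wt_var(1) E(2)] x[OF wt_var(2) E(3)])+
    qed
    case 0
    have K0: "K 0 = 0" by (simp add: K_def)
    show ?case using near main(1)[of 0 2] unfolding K0 by (simp add: numeral_3_eq_3 numeral_2_eq_2)
    case (Suc n)
    then have "gen (K n)" "wt 1 (n + 2) (S var_x - ex 1 (K n) var_x)" "wt 1 (n + 2) (S var_y - ex 1 (K n) var_y)" by auto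
    from main(3-5)[OF this] have *: "gen (K (Suc n))" "wt 1 (Suc n + 2) (S var_x - ex 1 (K (Suc n)) var_x)"
       "wt 1 (Suc n + 2) (S var_y - ex 1 (K (Suc n)) var_y)"
      by (simp_all add: K_Suc)
    show ?case using * main(1)[OF *] by (simp add: numeral_3_eq_3)
  qed
  define L where "L = lim3 1 K"
  have lim: "wt 1 n (L - K n)" for n
    unfolding L_def using step wt_mono[of 1 "m + 3" "e (K m)" m for m] by (intro lim3_wt) (simp add: K_Suc)
  have L: "gen L"
    unfolding gen_def L_def using step by (auto simp: gen_def intro!: lim3_closed)
  have eq: "S u = ex 1 L u" if "wt 1 1 u" "\<And>n. wt 1 (n + 2) (S u - ex 1 (K n) u)" for u
  proof -
    have "wt 1 n (S u - ex 1 L u)" for n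
    proof -
      have "wt 1 n (ex 1 L u - ex 1 (K (n + 2)) u)"
        using ex_cont[OF _ L _ lim[of "n + 2"] _ that(1), of 1] step by (auto intro: wt_mono)
      from wt_diff[OF wt_mono[OF that(2)[of "n + 2"], of n] this] show ?thesis by simp
    qed
    then have "S u - ex 1 L u = 0" by (rule wt_eq_0)
    then show ?thesis by simp
  qed
  have "S = ex 1 L"
    using step by (intro alg_ext[OF symp_alg[OF S] alg_ex[OF L]] eq wt_var) auto
  with L show ?thesis by blast
qed

subsection \<open>Analytic dependence on the parameter\<close>

text \<open>Analyticity is expressed by a local holomorphic extension, so that products, inverses
  and square roots come from complex analysis; \<open>ra_real_analytic_at\<close> translates back to
  power series.\<close>

definition ra :: "(real \<Rightarrow> real) \<Rightarrow> real \<Rightarrow> bool" where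
  "ra f x \<longleftrightarrow> (\<exists>g. g analytic_on {complex_of_real x} \<and>
     (\<forall>\<^sub>F y in nhds x. g (of_real y) = of_real (f y)))"

lemma ra_const: "ra (\<lambda>x. c) x"
  unfolding ra_def by (intro exI[of _ "\<lambda>_. of_real c"]) auto

lemma ra_add: "ra f x \<Longrightarrow> ra g x \<Longrightarrow> ra (\<lambda>x. f x + g x) x"
  and ra_mult: "ra f x \<Longrightarrow> ra g x \<Longrightarrow> ra (\<lambda>x. f x * g x) x"
proof -
  assume "ra f x" "ra g x"
  then obtain F G where F: "F analytic_on {complex_of_real x}" "\<forall>\<^sub>F y in nhds x. F (of_real y) = of_real (f y)"
    and G: "G analytic_on {complex_of_real x}" "\<forall>\<^sub>F y in nhds x. G (of_real y) = of_real (g y)"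
    by (auto simp: ra_def)
  show "ra (\<lambda>x. f x + g x) x"
    unfolding ra_def using F(1) G(1) eventually_conj[OF F(2) G(2)]
    by (intro exI[of _ "\<lambda>z. F z + G z"]) (auto intro: analytic_on_add elim: eventually_mono)
  show "ra (\<lambda>x. f x * g x) x"
    unfolding ra_def using F(1) G(1) eventually_conj[OF F(2) G(2)]
    by (intro exI[of _ "\<lambda>z. F z * G z"]) (auto intro: analytic_on_mult elim: eventually_mono)
qed

lemma ra_minus: "ra f x \<Longrightarrow> ra (\<lambda>x. - f x) x"
  using ra_mult[OF ra_const[of "-1"], of f x] by simp

lemma ra_diff: "ra f x \<Longrightarrow> ra g x \<Longrightarrow> ra (\<lambda>x. f x - g x) x"
  using ra_add[OF _ ra_minus, of f x g] by simp

lemma ra_divide_const: "ra f x \<Longrightarrow> ra (\<lambda>x. f x / c) x"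
  using ra_mult[OF _ ra_const[of "1 / c"], of f x] by simp

lemma ra_sum: "(\<And>a. a \<in> A \<Longrightarrow> ra (f a) x) \<Longrightarrow> ra (\<lambda>x. \<Sum>a\<in>A. f a x) x"
  by (induction A rule: infinite_finite_induct) (auto intro: ra_add ra_const)

lemma ra_power: "ra f x \<Longrightarrow> ra (\<lambda>x. f x ^ p) x"
  by (induction p) (auto intro: ra_mult ra_const)

lemma ra_inverse:
  assumes "ra f x" "f x \<noteq> 0" shows "ra (\<lambda>x. inverse (f x)) x"
proof -
  obtain F where F: "F analytic_on {complex_of_real x}" "\<forall>\<^sub>F y in nhds x. F (of_real y) = of_real (f y)"
    using assms by (auto simp: ra_def)
  have "F (of_real x) = of_real (f x)" using F(2) by (rule eventually_nhds_x_imp_x)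
  then show ?thesis
    unfolding ra_def using F assms(2)
    by (intro exI[of _ "\<lambda>z. inverse (F z)"]) (auto intro!: analytic_on_inverse elim: eventually_mono)
qed

lemma ra_divide: "ra f x \<Longrightarrow> ra g x \<Longrightarrow> g x \<noteq> 0 \<Longrightarrow> ra (\<lambda>x. f x / g x) x"
  using ra_mult[OF _ ra_inverse, of f x g] by (simp add: divide_inverse)

lemma ra_isCont:
  assumes "ra f x" shows "isCont f x"
proof -
  obtain F where F: "F analytic_on {complex_of_real x}" "\<forall>\<^sub>F y in nhds x. F (of_real y) = of_real (f y)"
    using assms by (auto simp: ra_def)
  have c: "isCont (\<lambda>y. F (complex_of_real y)) x"
    by (rule isCont_o2[of x complex_of_real F]) (simp_all add: isCont_def[of complex_of_real] tendsto_of_real analytic_at_imp_isCont[OF F(1)])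
  have "isCont (\<lambda>y. Re (F (of_real y))) x"
    unfolding isCont_def by (rule tendsto_Re[OF c[unfolded isCont_def]])
  moreover have "\<forall>\<^sub>F y in nhds x. Re (F (of_real y)) = f y"
    using F(2) by eventually_elim simp
  ultimately show ?thesis using isCont_cong[of "\<lambda>y. Re (F (of_real y))" f x] by simp
qed

text \<open>Applied to g1^2 + g2^2: the normalisation b_00 > 0 brings in the modulus of the leading
  coefficient.\<close>

lemma ra_sqrt:
  assumes "ra f x" "f x > 0" shows "ra (\<lambda>x. sqrt (f x)) x"
proof -
  obtain F where F: "F analytic_on {complex_of_real x}" "\<forall>\<^sub>F y in nhds x. F (of_real y) = of_real (f y)"
    using assms by (auto simp: ra_def)
  have Fx: "F (of_real x) = of_real (f x)" using F(2) by (rule eventually_nhds_x_imp_x)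
  have pos: "\<forall>\<^sub>F y in nhds x. f y > 0"
    using ra_isCont[OF assms(1)] assms(2) by (simp add: isCont_def order_tendstoD tendsto_at_iff_tendsto_nhds)
  have "(\<lambda>z. csqrt (F z)) analytic_on {complex_of_real x}"
    by (rule analytic_on_csqrt'[OF F(1)]) (use Fx assms(2) in \<open>auto simp: complex_nonpos_Reals_iff\<close>)
  moreover have "\<forall>\<^sub>F y in nhds x. csqrt (F (of_real y)) = of_real (sqrt (f y))"
    using eventually_conj[OF F(2) pos] by eventually_elim (simp add: csqrt_of_real_nonneg)
  ultimately show ?thesis unfolding ra_def by blast
qed

lemma ra_powser:
  assumes "\<And>y. \<bar>y\<bar> < r \<Longrightarrow> (\<lambda>n. c n * y ^ n) sums f y" "\<bar>x\<bar> < r"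
  shows "ra f x"
proof -
  define g where "g z = (\<Sum>n. complex_of_real (c n) * z ^ n)" for z
  have s: "summable (\<lambda>n. complex_of_real (c n) * z ^ n)" if "norm z < r" for z
  proof -
    have "summable (\<lambda>n. complex_of_real (c n) * complex_of_real ((norm z + r) / 2) ^ n)"
      using assms(1)[of "(norm z + r) / 2"] that
    proof -
      have "0 \<le> (norm z + r) / 2" "(norm z + r) / 2 < r" using that norm_ge_zero[of z] le_less_trans[OF norm_ge_zero that] by auto
      then have "\<bar>(norm z + r) / 2\<bar> < r" by (simp only: abs_of_nonneg)
      from sums_summable[OF sums_of_real[OF assms(1)[OF this], where 'a=complex]] show ?thesis
        by (simp only: of_real_mult of_real_power)
    qed
    then show ?thesis
      by (rule powser_inside) (use that in \<open>auto simp del: of_real_divide of_real_add\<close>)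
  qed
  have "g holomorphic_on ball 0 r"
    by (rule power_series_holomorphic[where a=c]) (use s in \<open>auto simp: g_def summable_sums\<close>)
  then have "g analytic_on ball 0 r" by (simp add: analytic_on_open)
  then have "g analytic_on {complex_of_real x}"
    by (rule analytic_on_subset) (use assms(2) in auto)
  moreover have "\<forall>\<^sub>F y in nhds x. g (of_real y) = of_real (f y)"
  proof -
    have "\<forall>\<^sub>F y in nhds x. y \<in> ball 0 r"
      by (rule eventually_nhds_in_open) (use assms(2) in auto)
    then show ?thesis
    proof eventually_elim
      case (elim y)
      then have "(\<lambda>n. complex_of_real (c n * y ^ n)) sums of_real (f y)" using assms(1)[of y] by (intro sums_of_real) auto
      then show ?case by (simp add: g_def sums_iff)
    qed
  qed
  ultimately show ?thesis unfolding ra_def by blast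
qed

text \<open>The coefficients are the real parts of the Taylor coefficients of the extension; real
  parts suffice because the values on the real axis are real.\<close>

lemma ra_real_analytic_at:
  assumes "ra f x" shows "real_analytic_at f x"
proof -
  obtain F where F: "F analytic_on {complex_of_real x}" "\<forall>\<^sub>F y in nhds x. F (of_real y) = of_real (f y)"
    using assms by (auto simp: ra_def)
  obtain e where e: "e > 0" "F holomorphic_on ball (of_real x) e" using F(1) by (auto simp: analytic_on_def)
  obtain e' where e': "e' > 0" "\<And>y. dist y x < e' \<Longrightarrow> F (of_real y) = of_real (f y)"
    using F(2) by (auto simp: eventually_nhds_metric)
  define r where "r = min e e'"
  define c where "c n = Re ((deriv ^^ n) F (of_real x) / fact n)" for n
  have s: "(\<lambda>n. c n * (y - x) ^ n) sums f y" if "dist y x < r" for y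
  proof -
    have "(\<lambda>n. (deriv ^^ n) F (of_real x) / fact n * (of_real y - of_real x) ^ n) sums F (of_real y)"
      by (rule holomorphic_power_series[OF e(2)]) (use that in \<open>auto simp: r_def dist_commute dist_of_real\<close>)
    then have "(\<lambda>n. Re ((deriv ^^ n) F (of_real x) / fact n * of_real ((y - x) ^ n))) sums Re (F (of_real y))"
      by (intro sums_Re) simp
    moreover have "Re (w * of_real a) = Re w * a" for w a by simp
    ultimately show ?thesis
      using e'(2)[of y] that by (simp only: c_def r_def) simp
  qed
  have h: "((\<lambda>n. c n * (y - x) ^ n) has_sum f y) UNIV" if y: "dist y x < r" for y
  proof -
    \<comment> \<open>A point strictly between y and the edge of the disc of convergence:
      convergence at z makes the series at y absolutely convergent, hence unconditional.\<close>
    define z where "z = x + (dist y x + r) / 2"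
    have "summable (\<lambda>n. c n * (z - x) ^ n)" using s[of z] y by (auto simp: z_def dist_real_def sums_iff)
    then have "summable (\<lambda>n. norm (c n * (y - x) ^ n))"
      by (rule powser_insidea) (use y in \<open>auto simp: z_def dist_real_def\<close>)
    then show ?thesis using s[OF y] by (rule norm_summable_imp_has_sum)
  qed
  show ?thesis
    unfolding real_analytic_at_def
  proof (intro exI[of _ r] exI[of _ "\<lambda>m. c (m 1)"] conjI ballI)
    show "r > 0" using e e' by (simp add: r_def)
    fix y assume "y \<in> ball x r"
    then have "((\<lambda>n. c n * (y - x) ^ n) has_sum f y) UNIV" by (intro h) (auto simp: dist_commute)
    \<comment> \<open>Over the one-element basis of the reals a multi-index is a single
      exponent.\<close>
    moreover have "bij_betw (\<lambda>m :: real \<Rightarrow> nat. m 1) ({1} \<rightarrow>\<^sub>E UNIV) UNIV"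
      by (rule bij_betwI[where g="\<lambda>n. \<lambda>e\<in>{1}. n"]) (auto simp: PiE_iff extensional_def fun_eq_iff)
    ultimately have "((\<lambda>m. c (m 1) * (y - x) ^ m 1) has_sum f y) ({1::real} \<rightarrow>\<^sub>E UNIV)"
      using has_sum_reindex_bij_betw[of "\<lambda>m :: real \<Rightarrow> nat. m 1" "{1} \<rightarrow>\<^sub>E UNIV" UNIV "\<lambda>n. c n * (y - x) ^ n" "f y"] by simp
    then show "((\<lambda>m. (\<Prod>e\<in>Basis. ((y - x) \<bullet> e) ^ m e) *\<^sub>R c (m 1)) has_sum f y) (Basis \<rightarrow>\<^sub>E UNIV)"
      by (simp add: mult.commute)
  qed
qed

text \<open>The constructions below compute each coefficient from finitely many given ones, so they
  stay in this class. The set \<open>S\<close> is a parameter because the interval of nu is shrunk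
  once, to keep the leading coefficient nonzero.\<close>

definition fam :: "real set \<Rightarrow> (real \<Rightarrow> real fps3) \<Rightarrow> bool" where
  "fam S P \<longleftrightarrow> (\<forall>nu\<in>S. \<forall>i j k. ra (\<lambda>nu. coeff3 (P nu) i j k) nu)"

lemma fam_const [simp]: "fam S (\<lambda>_. P)"
  by (simp add: fam_def ra_const)

lemma fam_add: "fam S P \<Longrightarrow> fam S Q \<Longrightarrow> fam S (\<lambda>nu. P nu + Q nu)"
  and fam_diff: "fam S P \<Longrightarrow> fam S Q \<Longrightarrow> fam S (\<lambda>nu. P nu - Q nu)"
  and fam_minus: "fam S P \<Longrightarrow> fam S (\<lambda>nu. - P nu)"
  by (auto simp: fam_def intro: ra_add ra_diff ra_minus)

lemma fam_mult: "fam S P \<Longrightarrow> fam S Q \<Longrightarrow> fam S (\<lambda>nu. P nu * Q nu)"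
  by (auto simp: fam_def coeff3_mult intro!: ra_sum ra_mult)

lemma fam_sum: "(\<And>a. a \<in> A \<Longrightarrow> fam S (P a)) \<Longrightarrow> fam S (\<lambda>nu. \<Sum>a\<in>A. P a nu)"
  by (auto simp: fam_def intro!: ra_sum)

lemma fam_power: "fam S P \<Longrightarrow> fam S (\<lambda>nu. P nu ^ p)"
  by (induction p) (auto intro: fam_mult)

lemma fam_const3: "(\<And>nu. nu \<in> S \<Longrightarrow> ra a nu) \<Longrightarrow> fam S P \<Longrightarrow> fam S (\<lambda>nu. const3 (a nu) * P nu)"
  by (auto simp: fam_def intro: ra_mult)

lemma fam_pb: "fam S P \<Longrightarrow> fam S Q \<Longrightarrow> fam S (\<lambda>nu. pb (P nu) (Q nu))"
  unfolding pb_def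
  by (intro fam_diff fam_mult) (auto simp: fam_def coeff3_deriv_x coeff3_deriv_y intro!: ra_mult ra_const)

lemma fam_ad_pow: "fam S K \<Longrightarrow> fam S f \<Longrightarrow> fam S (\<lambda>nu. (ad (K nu) ^^ l) (f nu))"
  by (induction l) (auto simp: ad_def[of "K _" "(ad _ ^^ _) _"] intro!: fam_pb)

lemma fam_ex:
  assumes "fam S K" "fam S f" shows "fam S (\<lambda>nu. ex t (K nu) (f nu))"
  using fam_ad_pow[OF assms] unfolding fam_def
  by (auto simp: ex_def intro!: ra_sum ra_mult ra_const ra_divide_const)

lemma fam_subst:
  assumes "fam S P" "fam S (\<lambda>nu. fst (G nu))" "fam S (\<lambda>nu. snd (G nu))"
  shows "fam S (\<lambda>nu. subst_xy (P nu) (G nu))"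
proof -
  have m: "fam S (\<lambda>nu. fst (G nu) ^ p * snd (G nu) ^ q)" for p q
    by (intro fam_mult fam_power assms)
  have "coeff3 (subst_xy P G) i j k = (\<Sum>p\<le>i + j. \<Sum>q\<le>i + j. \<Sum>c\<le>k.
     coeff3 P p q c * coeff3 (fst G ^ p * snd G ^ q) i j (k - c))" for P G i j k
    unfolding coeff3_def subst_nth fps_sum_nth fps_mult_nth[of "fps_nth (fps_nth P _) _"] atLeast0AtMost ..
  then show ?thesis
    using assms(1) m unfolding fam_def by (auto intro!: ra_sum ra_mult)
qed

lemma fam_prim: "fam S P \<Longrightarrow> fam S Q \<Longrightarrow> fam S (\<lambda>nu. prim (P nu) (Q nu))"
  unfolding fam_def prim_def coeff3_simps
proof (intro ballI allI)
  fix nu i j k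
  assume "\<forall>nu\<in>S. \<forall>i j k. ra (\<lambda>nu. coeff3 (P nu) i j k) nu" "\<forall>nu\<in>S. \<forall>i j k. ra (\<lambda>nu. coeff3 (Q nu) i j k) nu" "nu \<in> S"
  then show "ra (\<lambda>nu. if 0 < j then coeff3 (P nu) i (j - 1) k / real j
      else if 0 < i then - coeff3 (Q nu) (i - 1) 0 k / real i else 0) nu"
    by (cases "0 < j"; cases "0 < i") (auto intro!: ra_divide_const ra_minus ra_const)
qed

lemma fam_lim3: "(\<And>n. fam S (\<lambda>nu. K nu n)) \<Longrightarrow> fam S (\<lambda>nu. lim3 d (K nu))"
  by (auto simp: fam_def lim3_def)

subsection \<open>Rotations\<close>

definition rot :: "real \<Rightarrow> real fps3 \<Rightarrow> real fps3" where
  "rot \<alpha> f = subst_xy f (formal_rotation \<alpha>)"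

lemma vanishes_rotation: "vanishes_at_origin (formal_rotation \<alpha>)"
  unfolding formal_rotation_def by (intro wt_vanishes wt_add wt_diff wt_mult_left wt_var)

lemma alg_rot: "alg (rot \<alpha>)"
  using alg_subst[OF vanishes_rotation] by (simp add: rot_def[abs_def])

lemma rot_var: "rot \<alpha> var_x = const3 (cos \<alpha>) * var_x - const3 (sin \<alpha>) * var_y"
  "rot \<alpha> var_y = const3 (sin \<alpha>) * var_x + const3 (cos \<alpha>) * var_y"
  using subst_var[OF vanishes_rotation] by (simp_all add: rot_def formal_rotation_def)

lemmas rot_simps = alg_add[OF alg_rot] alg_mult[OF alg_rot] alg_pconst[OF alg_rot] alg_simps[OF alg_rot]

lemma symp_rot: "symp (rot \<alpha>)"
proof -
  have "pb (rot \<alpha> var_x) (rot \<alpha> var_y) = const3 (cos \<alpha> * cos \<alpha> + sin \<alpha> * sin \<alpha>)"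
    unfolding rot_var pb_def const3_simps by (simp add: deriv_x_mult deriv_y_mult algebra_simps)
  also have "cos \<alpha> * cos \<alpha> + sin \<alpha> * sin \<alpha> = 1"
    using sin_cos_squared_add2[of \<alpha>] by (simp add: power2_eq_square)
  finally show ?thesis by (simp add: symp_def alg_rot const3_simps)
qed

lemma rot_rot: "rot \<alpha> (rot \<beta> f) = rot (\<alpha> + \<beta>) f"
proof -
  have "(\<lambda>f. rot \<alpha> (rot \<beta> f)) = rot (\<alpha> + \<beta>)"
    by (rule alg_ext[OF alg_comp[OF alg_rot alg_rot] alg_rot])
       (simp_all add: rot_var rot_simps cos_add sin_add const3_simps algebra_simps)
  then show ?thesis by metis
qed

lemma rot_trivial: "cos \<alpha> = 1 \<Longrightarrow> rot \<alpha> f = f"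
proof -
  assume c: "cos \<alpha> = 1"
  then have "sin \<alpha> = 0" by (simp add: cos_one_sin_zero)
  with c have "rot \<alpha> = (\<lambda>f. f)" by (intro alg_ext alg_rot alg_id) (simp_all add: rot_var const3_simps)
  then show ?thesis by metis
qed

lemma rot_inv: "rot \<alpha> (rot (- \<alpha>) f) = f" "rot (- \<alpha>) (rot \<alpha> f) = f"
  by (simp_all add: rot_rot rot_trivial)

lemma const3_half: "const3 (1/2 :: real) + const3 (1/2) = 1" "const3 (1/2) * (2 :: real fps3) = 1"
proof -
  have "const3 (1/2 + 1/2 :: real) = 1" by (simp add: const3_simps(6))
  then show 1: "const3 (1/2 :: real) + const3 (1/2) = 1" by (simp only: const3_simps(1))
  show "const3 (1/2) * (2 :: real fps3) = 1" using 1 by (rule trans[OF mult_2_right])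
qed

lemma var_squares: "var_x ^ 2 + var_y ^ 2 = 2 * action_I"
proof -
  have "2 * action_I = (const3 (1/2) * 2) * (var_x ^ 2 + var_y ^ 2)"
    unfolding action_I_def by (simp only: mult_ac)
  then show ?thesis by (simp only: const3_half mult_1)
qed

lemma rot_action [simp]: "rot \<alpha> action_I = action_I"
proof -
  have e: "(c * x - s * y) ^ 2 + (s * x + c * y) ^ 2 = (s * s + c * c) * (x ^ 2 + y ^ 2)" for c s x y :: "real fps3"
    by (simp add: power2_eq_square algebra_simps)
  have "const3 (sin \<alpha>) * const3 (sin \<alpha>) + const3 (cos \<alpha>) * const3 (cos \<alpha>) = (1 :: real fps3)"
    using sin_cos_squared_add[of \<alpha>] by (simp add: power2_eq_square flip: const3_simps)
  then show ?thesis by (simp add: action_I_def rot_simps rot_var e)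
qed

lemma wt_action: "wt d 2 action_I"
  unfolding action_I_def by (intro wt_mult_left wt_add wt_power wt_var)

lemma pb_action: "pb action_I f = var_x * deriv_y f - var_y * deriv_x f"
proof -
  have "deriv_x action_I = const3 (1/2) * 2 * var_x" "deriv_y action_I = const3 (1/2) * 2 * var_y"
    by (simp_all add: action_I_def deriv_x_mult deriv_y_mult power2_eq_square algebra_simps)
  then show ?thesis by (simp add: pb_def const3_half)
qed

subsection \<open>The harmonics \<open>Re z\<^sup>p\<close> and \<open>Im z\<^sup>p\<close>\<close>

primrec ZZ :: "nat \<Rightarrow> real fps3 \<times> real fps3" where
  "ZZ 0 = (1, 0)"
| "ZZ (Suc p) = (var_x * fst (ZZ p) - var_y * snd (ZZ p), var_x * snd (ZZ p) + var_y * fst (ZZ p))"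

definition "Zr p = fst (ZZ p)"
definition "Zi p = snd (ZZ p)"

lemma Z_0 [simp]: "Zr 0 = 1" "Zi 0 = 0"
  and Z_Suc: "Zr (Suc p) = var_x * Zr p - var_y * Zi p" "Zi (Suc p) = var_x * Zi p + var_y * Zr p"
  by (simp_all add: Zr_def Zi_def)

lemma Z_add: "Zr (p + q) = Zr p * Zr q - Zi p * Zi q" "Zi (p + q) = Zr p * Zi q + Zi p * Zr q"
proof (induction p)
  case (Suc p)
  { case 1 show ?case unfolding add_Suc Z_Suc Suc by (simp add: algebra_simps) }
  { case 2 show ?case unfolding add_Suc Z_Suc Suc by (simp add: algebra_simps) }
qed simp_all

lemma Z_norm: "Zr p ^ 2 + Zi p ^ 2 = (2 * action_I) ^ p"
proof (induction p)
  case (Suc p)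
  have "Zr (Suc p) ^ 2 + Zi (Suc p) ^ 2 = (var_x ^ 2 + var_y ^ 2) * (Zr p ^ 2 + Zi p ^ 2)"
    by (simp add: Z_Suc power2_eq_square algebra_simps)
  then show ?case by (simp add: Suc var_squares)
qed simp

lemma Z_deriv:
  "deriv_x (Zr p) = of_nat p * Zr (p - 1)" "deriv_y (Zr p) = - of_nat p * Zi (p - 1)"
  "deriv_x (Zi p) = of_nat p * Zi (p - 1)" "deriv_y (Zi p) = of_nat p * Zr (p - 1)"
proof (induction p)
  case (Suc p)
  have key: "of_nat p * (var_x * Zr (p - 1) - var_y * Zi (p - 1)) = of_nat p * Zr p"
    "of_nat p * (var_x * Zi (p - 1) + var_y * Zr (p - 1)) = of_nat p * Zi p"
    by (cases p; simp add: Z_Suc)+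
  { case 1
    have "deriv_x (Zr (Suc p)) = Zr p + of_nat p * (var_x * Zr (p - 1) - var_y * Zi (p - 1))"
      unfolding Z_Suc deriv_linear deriv_x_mult Suc by (simp add: algebra_simps)
    then show ?case unfolding key by (simp add: algebra_simps) }
  { case 2
    have "deriv_y (Zr (Suc p)) = - Zi p - of_nat p * (var_x * Zi (p - 1) + var_y * Zr (p - 1))"
      unfolding Z_Suc deriv_linear deriv_y_mult Suc by (simp add: algebra_simps)
    then show ?case unfolding key by (simp add: algebra_simps) }
  { case 3
    have "deriv_x (Zi (Suc p)) = Zi p + of_nat p * (var_x * Zi (p - 1) + var_y * Zr (p - 1))"
      unfolding Z_Suc deriv_linear deriv_x_mult Suc by (simp add: algebra_simps)
    then show ?case unfolding key by (simp add: algebra_simps) }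
  { case 4
    have "deriv_y (Zi (Suc p)) = Zr p + of_nat p * (var_x * Zr (p - 1) - var_y * Zi (p - 1))"
      unfolding Z_Suc deriv_linear deriv_y_mult Suc by (simp add: algebra_simps)
    then show ?case unfolding key by (simp add: algebra_simps) }
qed simp_all

lemma pb_action_Z: "pb action_I (Zr p) = - of_nat p * Zi p" "pb action_I (Zi p) = of_nat p * Zr p"
proof -
  have "pb action_I (Zr p) = - of_nat p * Zi p \<and> pb action_I (Zi p) = of_nat p * Zr p"
  proof (cases p)
    case (Suc q)
    have e: "x * (- m * a) - y * (m * b) = - m * (x * a + y * b)" "x * (m * b) - y * (m * a) = m * (x * b - y * a)"
      for x y m a b :: "real fps3" by (simp_all add: algebra_simps)
    show ?thesis unfolding pb_action Z_deriv e unfolding Suc Z_Suc by simp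
  qed (simp add: pb_def)
  then show "pb action_I (Zr p) = - of_nat p * Zi p" "pb action_I (Zi p) = of_nat p * Zr p" by auto
qed

lemma pb_Z: "pb (Zr p) (Zi p) = of_nat p * of_nat p * (2 * action_I) ^ (p - 1)"
  unfolding Z_norm[symmetric] unfolding pb_def Z_deriv power2_eq_square by (simp only: ring_distribs mult_ac diff_minus_eq_add mult_minus_left mult_minus_right)

lemma rot_Z: "rot \<alpha> (Zr p) = const3 (cos (real p * \<alpha>)) * Zr p - const3 (sin (real p * \<alpha>)) * Zi p"
  "rot \<alpha> (Zi p) = const3 (sin (real p * \<alpha>)) * Zr p + const3 (cos (real p * \<alpha>)) * Zi p"
proof (induction p)
  case (Suc p)
  have e: "real (Suc p) * \<alpha> = \<alpha> + real p * \<alpha>" by (simp add: algebra_simps)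
  { case 1 show ?case unfolding e by (simp add: Z_Suc rot_simps rot_var Suc cos_add sin_add const3_simps algebra_simps) }
  { case 2 show ?case unfolding e by (simp add: Z_Suc rot_simps rot_var Suc cos_add sin_add const3_simps algebra_simps) }
qed (simp_all add: rot_simps const3_simps)

subsection \<open>Homogeneous parts\<close>

definition homog :: "nat \<Rightarrow> real fps3 \<Rightarrow> bool" where
  "homog D f \<longleftrightarrow> (\<forall>i j k. coeff3 f i j k \<noteq> 0 \<longrightarrow> i + j = D \<and> k = 0)"

lemma homogD: "homog D f \<Longrightarrow> i + j \<noteq> D \<or> k \<noteq> 0 \<Longrightarrow> coeff3 f i j k = 0"
  by (auto simp: homog_def)

lemma homog_iff: "homog D f \<longleftrightarrow> (\<forall>i j k. i + j \<noteq> D \<or> k \<noteq> 0 \<longrightarrow> coeff3 f i j k = 0)"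
  unfolding homog_def by blast

lemma homog_simps [simp]: "homog D 0" "homog 0 1" "homog 1 var_x" "homog 1 var_y"
  "homog (Suc 0) var_x" "homog (Suc 0) var_y"
  by (auto simp: homog_def)

lemma homog_add: "homog D f \<Longrightarrow> homog D g \<Longrightarrow> homog D (f + g)"
  and homog_diff: "homog D f \<Longrightarrow> homog D g \<Longrightarrow> homog D (f - g)"
  and homog_minus: "homog D f \<Longrightarrow> homog D (- f)"
  and homog_const3: "homog D f \<Longrightarrow> homog D (const3 c * f)"
  by (simp_all add: homog_iff)

lemma homog_mult:
  assumes "homog D f" "homog E g" shows "homog (D + E) (f * g)"
  unfolding homog_def
proof (intro allI impI)
  fix i j k assume "coeff3 (f * g) i j k \<noteq> 0"
  then obtain a b c where abc: "a \<le> i" "b \<le> j" "c \<le> k"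
    "coeff3 f a b c * coeff3 g (i - a) (j - b) (k - c) \<noteq> 0"
    unfolding coeff3_mult by (meson atMost_iff sum.not_neutral_contains_not_neutral)
  then have "coeff3 f a b c \<noteq> 0" "coeff3 g (i - a) (j - b) (k - c) \<noteq> 0" by auto
  with assms have "a + b = D \<and> c = 0" "i - a + (j - b) = E \<and> k - c = 0" unfolding homog_def by blast+
  with abc show "i + j = D + E \<and> k = 0" by auto
qed

lemma homog_power: "homog D f \<Longrightarrow> homog (D * p) (f ^ p)"
  by (induction p) (auto dest: homog_mult)

lemma homog_action: "homog 2 action_I"
  unfolding action_I_def by (intro homog_const3 homog_add) (use homog_power[of 1 _ 2] in auto)

lemma homog_Z: "homog p (Zr p)" "homog p (Zi p)"
  by (induction p) (use homog_mult[of 1 var_x] homog_mult[of 1 var_y] in \<open>auto simp: Z_Suc intro!: homog_add homog_diff\<close>)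

lemma homog_wt: "homog D f \<Longrightarrow> wt d D f"
  by (auto simp: homog_def wt_def)

lemma homog_deriv: "homog D f \<Longrightarrow> homog (D - 1) (deriv_x f)" "homog D f \<Longrightarrow> homog (D - 1) (deriv_y f)"
  unfolding homog_def coeff3_deriv_x coeff3_deriv_y by fastforce+

lemma homog_pb: 
  assumes "homog D f" "homog E g" "1 \<le> D" "1 \<le> E" shows "homog (D + E - 2) (pb f g)"
proof -
  have "D + E - 2 = (D - 1) + (E - 1)" using assms by simp
  then show ?thesis unfolding pb_def by (metis homog_diff homog_mult homog_deriv assms(1,2))
qed

lemma homog_expand:
  assumes "homog D f"
  shows "f = (\<Sum>i\<le>D. const3 (coeff3 f i (D - i) 0) * (var_x ^ i * var_y ^ (D - i)))"
proof (rule coeff3_ext)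
  fix i j k
  have m: "coeff3 (var_x ^ p * var_y ^ q :: real fps3) i j k = (if i = p \<and> j = q \<and> k = 0 then 1 else 0)" for p q
    using coeff3_monomial[where 'a=real, of 1 p q i j k] by auto
  have "coeff3 (\<Sum>a\<le>D. const3 (coeff3 f a (D - a) 0) * (var_x ^ a * var_y ^ (D - a))) i j k =
    (\<Sum>a\<le>D. if a = i then if j = D - i \<and> k = 0 then coeff3 f i (D - i) 0 else 0 else 0)"
    unfolding coeff3_sum coeff3_const3_mult m by (intro sum.cong) auto
  also have "\<dots> = coeff3 f i j k"
    using homogD[OF assms, of i j k] by auto
  finally show "coeff3 f i j k = coeff3 (\<Sum>a\<le>D. const3 (coeff3 f a (D - a) 0) * (var_x ^ a * var_y ^ (D - a))) i j k" ..
qed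

text \<open>The coefficient of delta^m, restricted to degree \<open>D\<close> in x, y. The power of
  delta is stripped off so that the result is \<open>homog\<close> and brackets with a homogeneous
  series act degree by degree.\<close>

definition hp :: "nat \<Rightarrow> nat \<Rightarrow> real fps3 \<Rightarrow> real fps3" where
  "hp D m f = Abs_fps3 (\<lambda>i j k. if i + j = D \<and> k = 0 then coeff3 f i j m else 0)"

lemma coeff3_hp [simp]: "coeff3 (hp D m f) i j k = (if i + j = D \<and> k = 0 then coeff3 f i j m else 0)"
  by (simp add: hp_def)

lemma homog_hp: "homog D (hp D m f)"
  by (auto simp: homog_def)

lemma hp_simps [simp]: "hp D m (f + g) = hp D m f + hp D m g" "hp D m (f - g) = hp D m f - hp D m g"
  "hp D m (- f) = - hp D m f" "hp D m 0 = 0" "hp D m (const3 c * f) = const3 c * hp D m f"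
  by (auto intro!: coeff3_ext)

lemma hp_sum: "hp D m (sum f A) = (\<Sum>a\<in>A. hp D m (f a))"
  by (induction A rule: infinite_finite_induct) auto

lemma hp_homog: "homog D f \<Longrightarrow> hp E m f = (if E = D \<and> m = 0 then f else 0)"
  by (auto intro!: coeff3_ext simp: homogD)

lemma hp_ext: "(\<And>D m. hp D m f = hp D m g) \<Longrightarrow> f = g"
proof (rule coeff3_ext)
  fix i j k assume "\<And>D m. hp D m f = hp D m g"
  from this[of "i + j" k] have "coeff3 (hp (i + j) k f) i j 0 = coeff3 (hp (i + j) k g) i j 0" by simp
  then show "coeff3 f i j k = coeff3 g i j k" by simp
qed

lemma wt_hp: "wt d N f \<longleftrightarrow> (\<forall>D m. D + d * m < N \<longrightarrow> hp D m f = 0)"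
proof
  assume "wt d N f"
  then show "\<forall>D m. D + d * m < N \<longrightarrow> hp D m f = 0" by (auto intro!: coeff3_ext simp: wt_def)
next
  assume *: "\<forall>D m. D + d * m < N \<longrightarrow> hp D m f = 0"
  show "wt d N f"
    unfolding wt_def
  proof (intro allI impI)
    fix i j k assume "i + j + d * k < N"
    with * have "coeff3 (hp (i + j) k f) i j 0 = 0" by simp
    then show "coeff3 f i j k = 0" by simp
  qed
qed

lemma hp_delta_mult: "hp D m (var_delta * f) = (if m = 0 then 0 else hp D (m - 1) f)"
  by (auto intro!: coeff3_ext simp: coeff3_var_mult)

lemma hp_delta_power: "hp D m (var_delta ^ k * f) = (if m < k then 0 else hp D (m - k) f)"
proof (induction k arbitrary: m)
  case (Suc k)
  then show ?case by (cases m) (auto simp: hp_delta_mult mult.assoc)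
qed simp

lemma hp_mult:
  assumes P: "homog p P"
  shows "hp D m (P * f) = (if p \<le> D then P * hp (D - p) m f else 0)"
proof (rule coeff3_ext)
  fix i j k
  have z: "coeff3 P a b c * x = 0" if "a + b \<noteq> p \<or> c \<noteq> 0" for a b c x using homogD[OF P that] by simp
  show "coeff3 (hp D m (P * f)) i j k = coeff3 (if p \<le> D then P * hp (D - p) m f else 0) i j k"
  proof (cases "i + j = D \<and> k = 0")
    case True
    have "coeff3 (hp D m (P * f)) i j k = (\<Sum>a\<le>i. \<Sum>b\<le>j. \<Sum>c\<le>m. coeff3 P a b c * coeff3 f (i - a) (j - b) (m - c))"
      using True by (simp add: coeff3_mult)
    also have "\<dots> = (\<Sum>a\<le>i. \<Sum>b\<le>j. coeff3 P a b 0 * coeff3 f (i - a) (j - b) m)"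
    proof (intro sum.cong refl)
      fix a b
      have "(\<Sum>c\<le>m. coeff3 P a b c * coeff3 f (i - a) (j - b) (m - c)) =
        (\<Sum>c\<in>{0}. coeff3 P a b c * coeff3 f (i - a) (j - b) (m - c))"
        by (rule sum.mono_neutral_right) (use z in auto)
      then show "(\<Sum>c\<le>m. coeff3 P a b c * coeff3 f (i - a) (j - b) (m - c)) = coeff3 P a b 0 * coeff3 f (i - a) (j - b) m" by simp
    qed
    also have "\<dots> = coeff3 (if p \<le> D then P * hp (D - p) m f else 0) i j k"
    proof (cases "p \<le> D")
      case le: True
      have "(\<Sum>a\<le>i. \<Sum>b\<le>j. coeff3 P a b 0 * coeff3 f (i - a) (j - b) m) =
         (\<Sum>a\<le>i. \<Sum>b\<le>j. \<Sum>c\<le>k. coeff3 P a b c * coeff3 (hp (D - p) m f) (i - a) (j - b) (k - c))"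
      proof (intro sum.cong refl)
        fix a b assume ab: "a \<in> {..i}" "b \<in> {..j}"
        show "coeff3 P a b 0 * coeff3 f (i - a) (j - b) m = (\<Sum>c\<le>k. coeff3 P a b c * coeff3 (hp (D - p) m f) (i - a) (j - b) (k - c))"
          using z[of a b 0] True le ab by (cases "a + b = p") auto
      qed
      with le show ?thesis by (simp only: coeff3_mult if_True)
    next
      case False
      then have "(\<Sum>a\<le>i. \<Sum>b\<le>j. coeff3 P a b 0 * coeff3 f (i - a) (j - b) m) = 0"
        using True z by (intro sum.neutral ballI) auto
      with False show ?thesis by simp
    qed
    finally show ?thesis .
  next
    case False
    have "coeff3 (P * hp (D - p) m f) i j k = 0" if "p \<le> D"
      using homogD[OF homog_mult[OF P homog_hp[of "D - p" m f]], of i j k] False that by auto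
    then show ?thesis using False by auto
  qed
qed

lemma hp_deriv: "hp D m (deriv_x f) = deriv_x (hp (D + 1) m f)" "hp D m (deriv_y f) = deriv_y (hp (D + 1) m f)"
  by (auto intro!: coeff3_ext simp: coeff3_deriv_x coeff3_deriv_y)

lemma hp_pb:
  assumes P: "homog p P" "1 \<le> p" and D: "p \<le> D + 1"
  shows "hp D m (pb P f) = pb P (hp (D + 2 - p) m f)"
proof -
  have e: "D - (p - 1) + 1 = D + 2 - p" "p - 1 \<le> D" using assms by auto
  show ?thesis
    unfolding pb_def hp_simps hp_mult[OF homog_deriv(1)[OF P(1)]] hp_mult[OF homog_deriv(2)[OF P(1)]] hp_deriv e(1)
    using e(2) by simp
qed

lemma hp_pb_small:
  assumes P: "homog p P" and D: "D + 1 < p"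
  shows "hp D m (pb P f) = 0"
proof -
  have "\<not> p - 1 \<le> D" using assms by auto
  then show ?thesis by (simp add: pb_def hp_mult[OF homog_deriv(1)[OF P(1)]] hp_mult[OF homog_deriv(2)[OF P(1)]])
qed

lemma coeff3_pconst_homog:
  assumes "homog D Q" shows "coeff3 (pconst c * Q) i j k = fps_nth c k * coeff3 Q i j 0"
proof -
  have "coeff3 (pconst c * Q) i j k = (\<Sum>l=0..k. fps_nth c l * coeff3 Q i j (k - l))"
    unfolding coeff3_def nth_pconst_mult fps_mult_nth[of c] ..
  also have "\<dots> = (\<Sum>l\<in>{k}. fps_nth c l * coeff3 Q i j (k - l))"
    by (rule sum.mono_neutral_right) (use homogD[OF assms] in auto)
  finally show ?thesis by simp
qed

lemma hp_pconst: "homog D Q \<Longrightarrow> hp E m (pconst c * Q) = (if E = D then const3 (fps_nth c m) * Q else 0)"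
  by (auto intro!: coeff3_ext simp: coeff3_pconst_homog homogD)

lemma hp_rot: "hp D m (rot \<alpha> f) = rot \<alpha> (hp D m f)"
proof -
  have "hp D m (rot \<alpha> f) - rot \<alpha> (hp D m f) = 0"
  proof (rule additive_ext[where s=0 and Z="\<lambda>f. hp D m (rot \<alpha> f) - rot \<alpha> (hp D m f)"])
    fix N f assume "wt 0 (N + 0) f"
    then have "wt 0 N (rot \<alpha> f)" "wt 0 N (hp D m f)" using alg_wt0[OF alg_rot] by (auto simp: wt_def)
    then show "wt 0 N (hp D m (rot \<alpha> f) - rot \<alpha> (hp D m f))"
      using alg_wt0[OF alg_rot, of N "hp D m f" \<alpha>] by (intro wt_diff) (auto simp: wt_def)
  next
    fix c :: "real fps" and p q
    have 1: "homog (p + q) (var_x ^ p * var_y ^ q)"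
      using homog_mult[OF homog_power[of 1 var_x p] homog_power[of 1 var_y q]] by simp
    have r: "homog 1 (rot \<alpha> var_x)" "homog 1 (rot \<alpha> var_y)"
      unfolding rot_var by (intro homog_add homog_diff homog_const3 homog_simps)+
    have 2: "homog (p + q) (rot \<alpha> (var_x ^ p * var_y ^ q))"
      unfolding rot_simps using homog_mult[OF homog_power[OF r(1), of p] homog_power[OF r(2), of q]] by simp
    show "hp D m (rot \<alpha> (pconst c * var_x ^ p * var_y ^ q)) - rot \<alpha> (hp D m (pconst c * var_x ^ p * var_y ^ q)) = 0"
      unfolding mult.assoc rot_simps(2)[of \<alpha> "pconst c"] rot_simps(3) hp_pconst[OF 1] hp_pconst[OF 2]
      by (simp add: rot_simps)
  qed (simp add: rot_simps)
  then show ?thesis by simp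
qed

lemma homog_rot: "homog D f \<Longrightarrow> homog D (rot \<alpha> f)"
  by (metis hp_homog hp_rot homog_hp)

lemma fam_hp: "fam S f \<Longrightarrow> fam S (\<lambda>nu. hp D m (f nu))"
proof -
  assume "fam S f"
  then have "ra (\<lambda>nu. if i + j = D \<and> k = 0 then coeff3 (f nu) i j m else 0) nu" if "nu \<in> S" for i j k nu
    using that by (cases "i + j = D \<and> k = 0") (auto simp: fam_def ra_const)
  then show ?thesis unfolding fam_def coeff3_hp by blast
qed

lemma fam_rot: "fam S f \<Longrightarrow> fam S (\<lambda>nu. rot \<alpha> (f nu))"
  unfolding rot_def by (intro fam_subst) simp_all

subsection \<open>Averaging over a cyclic group of rotations\<close>

definition av :: "nat \<Rightarrow> real fps3 \<Rightarrow> real fps3" where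
  "av n f = const3 (1 / real n) * (\<Sum>j<n. rot (real j * (2 * pi / real n)) f)"

lemma rot_full: "0 < n \<Longrightarrow> rot (real n * (2 * pi / real n)) f = f"
  by (rule rot_trivial) simp

lemma rot_av: assumes "0 < n" shows "rot (2 * pi / real n) (av n f) = av n f"
proof -
  define th where "th = 2 * pi / real n"
  obtain m where m: "n = Suc m" using assms by (cases n) auto
  let ?r = "\<lambda>j. rot (real j * th) f"
  have "rot th (av n f) = const3 (1 / real n) * (\<Sum>j<n. ?r (Suc j))"
    by (simp add: av_def rot_simps rot_rot ring_distribs flip: th_def)
  also have "(\<Sum>j<n. ?r (Suc j)) = (\<Sum>j<n. ?r j)"
    using sum.lessThan_Suc_shift[of ?r n] rot_full[OF assms, of f, folded th_def] rot_trivial[of 0 f]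
    by (simp del: of_nat_Suc)
  finally show ?thesis by (simp add: av_def flip: th_def)
qed

lemma av_fix: assumes "0 < n" "rot (2 * pi / real n) f = f" shows "av n f = f"
proof -
  define th where "th = 2 * pi / real n"
  have "rot (real j * th) f = f" for j
  proof (induction j)
    case (Suc j)
    have "rot (real (Suc j) * th) f = rot th (rot (real j * th) f)"
      by (simp add: rot_rot ring_distribs)
    then show ?case using Suc assms(2) by (simp add: th_def)
  qed (simp add: rot_trivial)
  then have "av n f = const3 (1 / real n * real n) * f"
    by (simp only: av_def th_def const3_simps const3_of_nat sum_constant card_lessThan mult.assoc)
  then show ?thesis using assms(1) by (simp add: const3_simps)
qed

lemma av_linear: "av n (f + g) = av n f + av n g" "av n (const3 c * f) = const3 c * av n f" "av n 0 = 0"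
  "av n (action_I ^ a * f) = action_I ^ a * av n f"
  "av n (sum h A) = (\<Sum>a\<in>A. av n (h a))"
  "av n (f - g) = av n f - av n g"
  by (simp_all add: av_def rot_simps sum.distrib sum_subtractf algebra_simps sum_distrib_left sum.swap[of _ A])

text \<open>The solution of the homological equation of the group: \<open>u - u \<circ> R = f - av f\<close>, up to sign.\<close>

definition hom_sol :: "nat \<Rightarrow> real fps3 \<Rightarrow> real fps3" where
  "hom_sol n f = const3 (- 1 / real n) * (\<Sum>j<n. of_nat j * rot (real j * (2 * pi / real n)) f)"

lemma hom_sol: assumes n: "0 < n"
  shows "hom_sol n f - rot (2 * pi / real n) (hom_sol n f) = f - av n f"
proof -
  define th where "th = 2 * pi / real n"
  let ?r = "\<lambda>j. rot (real j * th) f"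
  have of: "rot th (of_nat j) = of_nat j" for j
    by (simp add: rot_simps flip: const3_of_nat)
  have "rot th (of_nat j * ?r j) = of_nat j * ?r (Suc j)" for j
    by (simp add: rot_simps(2) of rot_rot ring_distribs)
  then have "rot th (hom_sol n f) = const3 (- 1 / real n) * (\<Sum>j<n. of_nat j * ?r (Suc j))"
    by (simp add: hom_sol_def rot_simps flip: th_def)
  then have "hom_sol n f - rot th (hom_sol n f) =
     const3 (- 1 / real n) * ((\<Sum>j<n. of_nat j * ?r j) - (\<Sum>j<n. of_nat j * ?r (Suc j)))"
    by (simp only: hom_sol_def th_def right_diff_distrib)
  \<comment> \<open>Summation by parts; after a full turn the boundary terms combine to
    \<open>f\<close>, and the sum of the rotated copies is n times the mean.\<close>
  also have "(\<Sum>j<m. of_nat j * ?r j) - (\<Sum>j<m. of_nat j * ?r (Suc j)) = (\<Sum>j<m. ?r j) - of_nat m * ?r m + ?r m - ?r 0" for m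
    by (induction m) (simp_all add: algebra_simps del: of_nat_Suc, simp_all add: algebra_simps)
  also have "const3 (- 1 / real n) * ((\<Sum>j<n. ?r j) - of_nat n * ?r n + ?r n - ?r 0) =
     const3 (1 / real n * real n) * ?r n - av n f"
  proof -
    have r: "?r n = ?r 0" using rot_full[OF n, of f] rot_trivial[of 0 f] by (simp add: th_def)
    have "const3 (- 1 / real n) = - const3 (1 / real n)" by (simp flip: const3_simps)
    then show ?thesis
      unfolding av_def th_def[symmetric] const3_simps(2) const3_of_nat r by (simp add: algebra_simps)
  qed
  finally show ?thesis using n rot_full[OF n, of f] by (simp add: const3_simps th_def)
qed

lemma av_wt: "wt d N f \<Longrightarrow> wt d N (av n f)" and hom_sol_wt: "wt d N f \<Longrightarrow> wt d N (hom_sol n f)"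
  unfolding av_def hom_sol_def by (intro wt_mult_left wt_sum alg_wt[OF alg_rot]; assumption)+

lemma fam_av: "fam S f \<Longrightarrow> fam S (\<lambda>nu. av n (f nu))" and fam_hom_sol: "fam S f \<Longrightarrow> fam S (\<lambda>nu. hom_sol n (f nu))"
  unfolding av_def hom_sol_def by (intro fam_mult fam_const fam_sum fam_rot; assumption)+

lemma av_Z:
  assumes n: "0 < n" and p: "\<not> n dvd p"
  shows "av n (Zr p) = 0" "av n (Zi p) = 0"
proof -
  define th where "th = 2 * pi / real n"
  define c s where "c = cos (real p * th)" and "s = sin (real p * th)"
  define w w' where "w = av n (Zr p)" and "w' = av n (Zi p)"
  have avrot: "av n (rot th f) = av n f" for f
  proof -
    have "av n (rot th f) = rot th (av n f)"
      unfolding av_def th_def[symmetric] by (simp add: rot_simps rot_rot add.commute)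
    then show ?thesis by (simp add: rot_av[OF n] th_def)
  qed
  have 1: "w = const3 c * w - const3 s * w'"
    using avrot[of "Zr p"] by (simp add: rot_Z av_linear w_def w'_def c_def s_def)
  have 2: "w' = const3 s * w + const3 c * w'"
    using avrot[of "Zi p"] by (simp add: rot_Z av_linear w_def w'_def c_def s_def)
  \<comment> \<open>The pair (w, w') is fixed by a plane rotation. \<open>A\<close> is the
    determinant of this rotation minus the identity, nonzero since the angle is not a multiple of 2
    pi.\<close>
  define A where "A = (1 - c) * (1 - c) + s * s"
  have A: "const3 A = (1 - const3 c) * (1 - const3 c) + const3 s * const3 s" by (simp add: A_def const3_simps)
  have 3: "w - const3 c * w = - (const3 s * w')" "const3 c * w - w = const3 s * w'"
    using arg_cong[OF 1, of "\<lambda>u. u - const3 c * w"] arg_cong[OF 1, of "\<lambda>u. const3 c * w - u"] by simp_all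
  have 4: "w' - const3 c * w' = const3 s * w"
    by (rule diff_eq_eq[THEN iffD2]) (rule 2)
  have "const3 A * w = (1 - const3 c) * (w - const3 c * w) + const3 s * (const3 s * w)"
    unfolding A by (simp only: ring_distribs mult_1_left mult.assoc left_diff_distrib right_diff_distrib)
  also have "\<dots> = (1 - const3 c) * - (const3 s * w') + const3 s * (w' - const3 c * w')"
    unfolding 3 4 ..
  finally have Aw: "const3 A * w = 0" by (simp add: algebra_simps)
  have "const3 A * w' = (1 - const3 c) * (w' - const3 c * w') + const3 s * (const3 s * w')"
    unfolding A by (simp only: ring_distribs mult_1_left mult.assoc left_diff_distrib right_diff_distrib)
  also have "\<dots> = (1 - const3 c) * (const3 s * w) + const3 s * (const3 c * w - w)"
    unfolding 3 4 ..
  finally have Aw': "const3 A * w' = 0" by (simp add: algebra_simps)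
  have "c \<noteq> 1"
  proof
    assume "c = 1"
    then obtain k :: int where "real p * (2 * pi / real n) = of_int k * 2 * pi"
      unfolding c_def th_def by (auto simp: cos_one_2pi_int)
    then have "real p = real_of_int k * real n" using n by (simp add: field_simps)
    then have "int p = k * int n" by (metis of_int_eq_iff of_int_mult of_int_of_nat_eq)
    then have "int n dvd int p" by simp
    then show False using p by simp
  qed
  then have "A \<noteq> 0" unfolding A_def by (simp add: sum_squares_eq_zero_iff)
  have "u = 0" if "const3 A * u = 0" for u :: "real fps3"
  proof (rule coeff3_ext)
    fix i j k show "coeff3 u i j k = coeff3 0 i j k"
      using \<open>A \<noteq> 0\<close> arg_cong[OF that, of "\<lambda>u. coeff3 u i j k"] by simp
  qed
  then show "av n (Zr p) = 0" "av n (Zi p) = 0" using Aw Aw' by (simp_all only: w_def[symmetric] w'_def[symmetric])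
qed

subsection \<open>The resonant normal form\<close>

text \<open>Used with \<open>d = 0\<close>, where generators such as delta I have weight two only:
  brackets with them preserve the order instead of raising it, and the gain comes from the single
  factor \<open>K' - K\<close>.\<close>

lemma ex_cont0:
  assumes K: "gen K" "gen K'" "wt d 2 K" "wt d 2 K'" and w: "wt d 3 (K' - K)" and f: "wt d a f"
  shows "wt d (a + 1) (ex t K' f - ex t K f)"
  unfolding wt_def
proof (intro allI impI)
  fix i j k assume lt: "i + j + d * k < a + 1"
  have D: "wt d (a + 1) ((ad K' ^^ l) f - (ad K ^^ l) f)" for l
  proof (induction l)
    case (Suc l)
    define A A' where "A = (ad K ^^ l) f" and "A' = (ad K' ^^ l) f"
    have A: "wt d (a + l * (2 - 2)) A"
      unfolding A_def by (rule ad_pow_wt[OF f K(3)]) simp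
    have "wt d (a + 1) (pb (A' - A) K' + pb A (K' - K))"
      by (intro wt_add wt_pb'[OF _ K(4), of "a + 1"] wt_pb'[OF A w]) (use Suc in \<open>auto simp: A_def A'_def\<close>)
    moreover have "(ad K' ^^ Suc l) f - (ad K ^^ Suc l) f = pb (A' - A) K' + pb A (K' - K)"
      by (simp add: A_def A'_def ad_def pb_diff)
    ultimately show ?case by simp
  qed simp
  have "coeff3 (ex t K' f - ex t K f) i j k =
    (\<Sum>l\<le>i + j + k. t ^ l / fact l * coeff3 ((ad K' ^^ l) f - (ad K ^^ l) f) i j k)"
    by (simp add: ex_def sum_subtractf right_diff_distrib diff_divide_distrib)
  also have "\<dots> = 0"
    using wtD[OF D lt] by (intro sum.neutral ballI) simp
  finally show "coeff3 (ex t K' f - ex t K f) i j k = 0" .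
qed

lemma alg_diff_wt:
  assumes "alg T" "alg T0" "wt d 2 (T var_x - T0 var_x)" "wt d 2 (T var_y - T0 var_y)" "wt d a f"
  shows "wt d (a + 1) (T f - T0 f)"
  using subst_diff_wt[OF alg_vanishes[OF assms(1)] alg_vanishes[OF assms(2)] assms(5), of 2] assms(3,4)
    alg_eq_subst[OF assms(1)] alg_eq_subst[OF assms(2)]
  by (metis (no_types, lifting) Suc_1 Suc_eq_plus1 add.commute add_diff_cancel_left' fst_conv le_add2 plus_1_eq_Suc snd_conv add_Suc_right)

lemma gen_delta_action: "gen (var_delta * action_I)" "wt d (d + 2) (var_delta * action_I)"
proof -
  show w: "wt d (d + 2) (var_delta * action_I)" for d by (intro wt_mult wt_var wt_action)
  show "gen (var_delta * action_I)" unfolding gen_def using w[of 0] w[of 1] by (simp add: numeral_3_eq_3 numeral_2_eq_2)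
qed

text \<open>To first order, changing \<open>K\<close> by \<open>k\<close> and \<open>H\<close> by
  \<open>h\<close> changes the defect by the bracket of \<open>rot th u\<close> with
  \<open>rot th k - h - k\<close>. The equation \<open>hom\<close> is exactly what makes this cancel
  the leading error \<open>e\<close>.\<close>

lemma step_error:
  assumes T: "symp T" and K: "gen K" "gen K'" and H: "gen H" "gen H'" and d: "1 \<le> d" and M: "2 \<le> M"
    and near: "wt d 2 (T var_x - rot th var_x)" "wt d 2 (T var_y - rot th var_y)"
    and k: "K' = K + k" "wt d M k" and h: "H' = H + h" "wt d M h" and u: "wt d 1 u"
    and e: "wt d M (T (ex 1 K u) - ex 1 K (ex 1 H (rot th u)) - pb (rot th u) e)"
    and hom: "e + rot th k = h + k"
  shows "wt d M (T (ex 1 K' u) - ex 1 K' (ex 1 H' (rot th u)))"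
proof -
  define ru where "ru = rot th u"
  note aT = symp_alg[OF T] and aK = alg_ex[OF K(1)]
  have ru: "wt d 1 ru" "wt d 1 (ex 1 H' ru)"
    unfolding ru_def by (intro alg_wt[OF alg_ex[OF H(2)]] alg_wt[OF alg_rot] u)+
  \<comment> \<open>What is left once each exponential is expanded to first order in
    \<open>k\<close> and \<open>h\<close> and each map is replaced by its leading part; every one of
    these remainders has weight \<open>M\<close>.\<close>
  define a1 a2 b1 b2 b3 b4 where "a1 = ex 1 K' u - ex 1 K u - pb u k"
    and "a2 = T (pb u k) - rot th (pb u k)"
    and "b1 = ex 1 H' ru - ex 1 H ru - pb ru h"
    and "b2 = ex 1 K' (ex 1 H' ru) - ex 1 K (ex 1 H' ru) - pb (ex 1 H' ru) k"
    and "b3 = ex 1 K (pb ru h) - pb ru h"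
    and "b4 = pb (ex 1 H' ru - ru) k"
  have puk: "wt d (M - 1) (pb u k)" "wt d (M - 1) (pb ru h)"
    using M by (intro wt_pb'[OF u k(2)] wt_pb'[OF ru(1) h(2)]; simp)+
  have dk: "K' - K = k" "H' - H = h" using k h by auto
  have a1: "wt d M a1" using ex_diff[OF K d _ M u, of 1] k(2) M by (simp add: a1_def dk const3_simps)
  have b1: "wt d M b1" using ex_diff[OF H d _ M ru(1), of 1] h(2) M by (simp add: b1_def dk const3_simps)
  have b2: "wt d M b2" using ex_diff[OF K d _ M ru(2), of 1] k(2) M by (simp add: b2_def dk const3_simps)
  have a2: "wt d M a2" using alg_diff_wt[OF aT alg_rot near puk(1)] M by (simp add: a2_def)
  have b3: "wt d M b3" using ex_tail1[OF K(1) gen_wt[OF K(1) d] _ puk(2), of 1] M by (simp add: b3_def)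
  have b4: "wt d M b4"
    using wt_pb'[OF ex_tail1[OF H(2) gen_wt[OF H(2) d] _ ru(1), of 1] k(2), of M] by (simp add: b4_def)
  have 1: "T (ex 1 K' u) = T (ex 1 K u) + rot th (pb u k) + a2 + T a1"
  proof -
    have "ex 1 K' u = ex 1 K u + pb u k + a1" by (simp add: a1_def)
    then show ?thesis by (simp add: alg_add[OF aT] a2_def)
  qed
  have 2: "ex 1 K' (ex 1 H' ru) = ex 1 K (ex 1 H ru) + pb ru h + b3 + ex 1 K b1 + pb ru k + b4 + b2"
  proof -
    have "ex 1 K' (ex 1 H' ru) = ex 1 K (ex 1 H' ru) + pb (ex 1 H' ru) k + b2" by (simp add: b2_def)
    moreover have "ex 1 H' ru = ex 1 H ru + pb ru h + b1" by (simp add: b1_def)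
    then have "ex 1 K (ex 1 H' ru) = ex 1 K (ex 1 H ru) + ex 1 K (pb ru h) + ex 1 K b1"
      by (simp add: alg_add[OF aK])
    ultimately show ?thesis by (simp add: b3_def b4_def pb_diff)
  qed
  have r: "rot th (pb u k) = pb ru (rot th k)" by (simp add: symp_pb[OF symp_rot] ru_def)
  have "pb ru e + pb ru (rot th k) = pb ru h + pb ru k" using hom by (metis pb_add(2))
  then have "T (ex 1 K' u) - ex 1 K' (ex 1 H' ru) =
    (T (ex 1 K u) - ex 1 K (ex 1 H ru) - pb ru e) + a2 + T a1 - b3 - ex 1 K b1 - b4 - b2"
    unfolding 1 2 r by (simp add: algebra_simps)
  moreover have "wt d M \<dots>"
    by (rule wt_diff[OF wt_diff[OF wt_diff[OF wt_diff[OF wt_add[OF wt_add[OF e[folded ru_def] a2]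
          alg_wt[OF aT a1]] b3] alg_wt[OF aK b1]] b4] b2])
  ultimately show ?thesis by (simp add: ru_def)
qed

text \<open>The Hamiltonian of the leading error is split: its mean goes into \<open>H\<close>, the
  rest is absorbed in \<open>K\<close> by the homological equation of the rotation. Both pieces are
  finite sums of rotated copies, so analyticity in nu is kept, and a formal limit of the iteration
  remains.\<close>

lemma resonant_normal_form:
  fixes G :: "real \<Rightarrow> formal_map" and S :: "real set"
  defines "T \<equiv> \<lambda>nu f. subst_xy f (G nu)"
  assumes n: "3 \<le> n" and d: "d = n - 2" and th: "th = 2 * pi / real n"
    and van: "\<And>nu. nu \<in> S \<Longrightarrow> vanishes_at_origin (G nu)"
    and det: "\<And>nu. nu \<in> S \<Longrightarrow> pb (fst (G nu)) (snd (G nu)) = 1"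
    and fam: "fam S (\<lambda>nu. fst (G nu))" "fam S (\<lambda>nu. snd (G nu))"
    and lin: "\<And>nu u. nu \<in> S \<Longrightarrow> u = var_x \<or> u = var_y \<Longrightarrow> wt 0 2 (T nu u - ex 1 (var_delta * action_I) (rot th u))"
    and low: "\<And>nu u. nu \<in> S \<Longrightarrow> u = var_x \<or> u = var_y \<Longrightarrow> wt d (n - 1) (T nu u - ex 1 (var_delta * action_I) (rot th u))"
  shows "\<exists>K H. fam S K \<and> fam S H \<and> (\<forall>nu\<in>S. wt 0 3 (K nu) \<and> wt d n (K nu) \<and>
     wt 0 3 (H nu - var_delta * action_I) \<and> wt d n (H nu) \<and> rot th (H nu) = H nu \<and>
     (\<forall>f. T nu (ex 1 (K nu) f) = ex 1 (K nu) (ex 1 (H nu) (rot th f))))"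
proof -
  define \<delta>I where "\<delta>I = var_delta * action_I"
  have d1: "1 \<le> d" and n0: "0 < n" and dn: "d + 2 = n" using n d by auto
  have T: "symp (T nu)" if "nu \<in> S" for nu
    using alg_subst[OF van[OF that]] det[OF that] subst_var[OF van[OF that]] by (simp add: symp_def T_def)
  have g\<delta>: "gen \<delta>I" "wt d n \<delta>I" using gen_delta_action(1) gen_delta_action(2)[of d] dn by (simp_all add: \<delta>I_def)
  define e where "e nu K H = err_ham (rot th) (rot (- th)) (\<lambda>f. T nu (ex 1 K f)) (\<lambda>f. ex 1 K (ex 1 H (rot th f)))" for nu K H
  define KH where "KH nu m = ((\<lambda>(K, H). (K + hom_sol n (e nu K H), H + av n (e nu K H))) ^^ m) (0, \<delta>I)" for nu m
  define K H where "K nu m = fst (KH nu m)" and "H nu m = snd (KH nu m)" for nu m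
  have K_0: "K nu 0 = 0" "H nu 0 = \<delta>I" for nu by (simp_all add: K_def H_def KH_def)
  have K_Suc: "K nu (Suc m) = K nu m + hom_sol n (e nu (K nu m) (H nu m))"
    "H nu (Suc m) = H nu m + av n (e nu (K nu m) (H nu m))" for nu m
    by (simp_all add: K_def H_def KH_def split_def)
  have famKH: "fam S (\<lambda>nu. K nu m) \<and> fam S (\<lambda>nu. H nu m)" for m
  proof (induction m)
    case (Suc m)
    then have "fam S (\<lambda>nu. e nu (K nu m) (H nu m))"
      unfolding e_def err_ham_def T_def
      by (intro fam_rot fam_prim fam_diff fam_subst fam_ex fam fam_const) auto
    then show ?case using Suc unfolding K_Suc by (intro conjI fam_add fam_av fam_hom_sol) auto
  qed (simp add: K_0)
  have gK: "gen K" "wt d 3 K" if "wt 0 3 K" for K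
    using wt_d_mono[OF that] wt_mono[OF that, of 2] by (auto simp: gen_def)
  have gH: "gen H" if "wt 0 3 (H - \<delta>I)" for H
    using gen_add[OF gK(1)[OF that] g\<delta>(1)] by simp
  \<comment> \<open>Order three in x, y: the corrections never touch the linear part of the map,
    which is the rotation composed with the flow of delta I for every delta.\<close>
  define good where "good nu K H \<longleftrightarrow> wt 0 3 K \<and> wt d n K \<and> wt 0 3 (H - \<delta>I) \<and> wt d n H \<and> rot th H = H" for nu :: real and K H
  have err0: "wt 0 2 (T nu (ex 1 K u) - ex 1 K (ex 1 H (rot th u)))" 
    if nu: "nu \<in> S" and g: "good nu K H" and u: "u = var_x \<or> u = var_y" for nu K H u
  proof -
    have w: "wt 0 3 K" "wt 0 3 (H - \<delta>I)" using g by (auto simp: good_def)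
    note aT = symp_alg[OF T[OF nu]]
    have u1: "wt 0 1 u" using u by auto
    have ru: "wt 0 1 (rot th u)" "wt 0 1 (ex 1 H (rot th u))"
      by (intro alg_wt0[OF alg_ex[OF gH[OF w(2)]]] alg_wt0[OF alg_rot] u1)+
    have 1: "wt 0 2 (T nu (ex 1 K u - u))"
      using ex_tail1[OF gK(1)[OF w(1)] w(1) _ u1, of 1] by (intro alg_wt0[OF aT]) simp
    have 2: "wt 0 2 (ex 1 K (ex 1 H (rot th u)) - ex 1 H (rot th u))"
      using ex_tail1[OF gK(1)[OF w(1)] w(1) _ ru(2), of 1] by simp
    have 3: "wt 0 2 (ex 1 H (rot th u) - ex 1 \<delta>I (rot th u))"
      using ex_cont0[OF g\<delta>(1) gH[OF w(2)] _ _ w(2) ru(1), of 1] g\<delta>(1) gH[OF w(2)]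
      by (simp add: gen_def numeral_2_eq_2)
    have "wt 0 2 (T nu (ex 1 K u - u) + (T nu u - ex 1 \<delta>I (rot th u)) - (ex 1 H (rot th u) - ex 1 \<delta>I (rot th u))
      - (ex 1 K (ex 1 H (rot th u)) - ex 1 H (rot th u)))"
      by (rule wt_diff[OF wt_diff[OF wt_add[OF 1 lin[OF nu u, folded \<delta>I_def]] 3] 2])
    then show ?thesis by (simp add: alg_simps[OF aT])
  qed
  have near: "wt d 2 (T nu u - rot th u)" if nu: "nu \<in> S" and u: "u = var_x \<or> u = var_y" for nu u
  proof -
    have u1: "wt d 1 (rot th u)" using u by (intro alg_wt[OF alg_rot]) auto
    have 1: "wt d 2 (ex 1 \<delta>I (rot th u) - rot th u)"
      using ex_tail1[OF g\<delta>(1) gen_wt[OF g\<delta>(1) d1] _ u1, of 1] by simp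
    have 2: "wt d 2 (T nu u - ex 1 \<delta>I (rot th u))"
      by (rule wt_mono[OF low[OF nu u, folded \<delta>I_def]]) (use n in simp)
    from wt_add[OF 1 2] show ?thesis by simp
  qed
  have main: "good nu (K + hom_sol n (e nu K H)) (H + av n (e nu K H)) \<and> wt d (N + 1) (e nu K H) \<and>
      (\<forall>u. u = var_x \<or> u = var_y \<longrightarrow> wt d (N + 1) (T nu (ex 1 (K + hom_sol n (e nu K H)) u) -
         ex 1 (K + hom_sol n (e nu K H)) (ex 1 (H + av n (e nu K H)) (rot th u))))"
    if nu: "nu \<in> S" and g: "good nu K H" and N: "n - 1 \<le> N" and
     err: "\<And>u. u = var_x \<or> u = var_y \<Longrightarrow> wt d N (T nu (ex 1 K u) - ex 1 K (ex 1 H (rot th u)))" for nu K H N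
  proof -
    have w: "wt 0 3 K" "wt 0 3 (H - \<delta>I)" using g by (auto simp: good_def)
    note gKH = gK(1)[OF w(1)] gH[OF w(2)]
    have nearT2: "wt d 2 (ex 1 K (ex 1 H (rot th u)) - rot th u)" if u: "wt d 1 u" for u
    proof -
      have u1: "wt d 1 (rot th u)" "wt d 1 (ex 1 H (rot th u))"
        by (intro alg_wt[OF alg_ex[OF gKH(2)]] alg_wt[OF alg_rot] u)+
      have 1: "wt d 2 (ex 1 H (rot th u) - rot th u)"
        using ex_tail1[OF gKH(2) gen_wt[OF gKH(2) d1] _ u1(1), of 1] by simp
      have 2: "wt d 2 (ex 1 K (ex 1 H (rot th u)) - ex 1 H (rot th u))"
        using ex_tail1[OF gKH(1) gen_wt[OF gKH(1) d1] _ u1(2), of 1] by simp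
      from wt_add[OF 1 2] show ?thesis by simp
    qed
    have N2: "2 \<le> N" using N n by simp
    note E = symp_error[OF symp_comp[OF T[OF nu] symp_ex[OF gKH(1)]] symp_comp[OF symp_ex[OF gKH(1)] symp_comp[OF symp_ex[OF gKH(2)] symp_rot]]
       symp_rot symp_rot rot_inv nearT2 nearT2 err err N2, folded e_def, OF wt_var(1,2), simplified]
    define E0 where "E0 = e nu K H"
    have e: "wt d (N + 1) E0" "wt 0 3 E0"
      using E(1) E(4)[of 2] err0[OF nu g] by (simp_all add: E0_def numeral_3_eq_3 numeral_2_eq_2)
    have en: "wt d n E0" using e(1) by (rule wt_mono) (use N in simp)
    have ra: "rot th (av n E0) = av n E0" unfolding th by (rule rot_av[OF n0])
    have good': "good nu (K + hom_sol n E0) (H + av n E0)"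
      using g wt_add[of 0 3 "H - \<delta>I" "av n E0"] e en
      by (auto simp: good_def rot_simps ra algebra_simps intro!: wt_add av_wt hom_sol_wt)
    then have gK': "gen (K + hom_sol n E0)" "gen (H + av n E0)" by (auto simp: good_def intro: gK gH)
    have hom: "E0 + rot th (hom_sol n E0) = av n E0 + hom_sol n E0"
      using hom_sol[OF n0, of E0] unfolding th by (simp add: algebra_simps)
    have "wt d (N + 1) (T nu (ex 1 (K + hom_sol n E0) u) - ex 1 (K + hom_sol n E0) (ex 1 (H + av n E0) (rot th u)))"
      if u: "u = var_x \<or> u = var_y" for u
    proof (rule step_error[OF T[OF nu] gKH(1) gK'(1) gKH(2) gK'(2) d1 _ near[OF nu] near[OF nu] refl _ refl _ _ _ hom])
      show "wt d (N + 1) (T nu (ex 1 K u) - ex 1 K (ex 1 H (rot th u)) - pb (rot th u) E0)"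
        using u E(2,3) by (auto simp: E0_def)
      show "wt d (N + 1) (hom_sol n E0)" "wt d (N + 1) (av n E0)" by (intro hom_sol_wt av_wt e)+
    qed (use u N2 in auto)
    with good' e show ?thesis by (simp add: E0_def)
  qed
  have inv: "good nu (K nu m) (H nu m) \<and> wt d (n + m) (e nu (K nu m) (H nu m)) \<and>
     (\<forall>u. u = var_x \<or> u = var_y \<longrightarrow> wt d (n - 1 + m) (T nu (ex 1 (K nu m) u) - ex 1 (K nu m) (ex 1 (H nu m) (rot th u))))"
    if nu: "nu \<in> S" for nu m
  proof (induction m)
    case 0
    have g: "good nu 0 \<delta>I" using g\<delta> by (simp add: good_def) (simp add: \<delta>I_def rot_simps)
    have "wt d (n - 1) (T nu (ex 1 0 u) - ex 1 0 (ex 1 \<delta>I (rot th u)))" if "u = var_x \<or> u = var_y" for u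
      using low[OF nu that] by (simp add: \<delta>I_def)
    from main[OF nu g order_refl this] this g show ?case using n0 by (auto simp: K_0)
  next
    case (Suc m)
    then have 1: "good nu (K nu (Suc m)) (H nu (Suc m))"
       "\<And>u. u = var_x \<or> u = var_y \<Longrightarrow> wt d (n - 1 + Suc m) (T nu (ex 1 (K nu (Suc m)) u) - ex 1 (K nu (Suc m)) (ex 1 (H nu (Suc m)) (rot th u)))"
      using main[OF nu, of "K nu m" "H nu m" "n - 1 + m"] by (auto simp: K_Suc)
    with main[OF nu 1(1) _ 1(2)] n0 show ?case by simp
  qed
  define K' H' where "K' nu = lim3 d (K nu)" and "H' nu = lim3 d (H nu)" for nu
  have lim: "wt d m (K' nu - K nu m)" "wt d m (H' nu - H nu m)" if nu: "nu \<in> S" for nu m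
  proof -
    have "wt d m (e nu (K nu m) (H nu m))" for m using inv[OF nu, of m] wt_mono[of d "n + m" _ m] by auto
    then show "wt d m (K' nu - K nu m)" "wt d m (H' nu - H nu m)"
      unfolding K'_def H'_def by (intro lim3_wt; simp add: K_Suc av_wt hom_sol_wt)+
  qed
  have H'\<delta>: "H' nu - \<delta>I = lim3 d (\<lambda>m. H nu m - \<delta>I)" for nu
    by (rule coeff3_ext) (simp add: H'_def lim3_def)
  show ?thesis
  proof (rule exI[of _ K'], rule exI[of _ H'], intro conjI ballI allI)
    show "fam S K'" "fam S H'" using famKH unfolding K'_def H'_def by (auto intro!: fam_lim3)
    fix nu assume nu: "nu \<in> S"
    show w: "wt 0 3 (K' nu)" "wt d n (K' nu)" "wt d n (H' nu)"
      using inv[OF nu] unfolding K'_def H'_def good_def by (auto intro!: lim3_closed)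
    show wH: "wt 0 3 (H' nu - var_delta * action_I)"
      unfolding \<delta>I_def[symmetric] H'\<delta> using inv[OF nu] unfolding good_def by (auto intro!: lim3_closed)
    have "wt d m (rot th (H' nu) - H' nu)" for m
    proof -
      have "rot th (H' nu) - H' nu = rot th (H' nu - H nu m) - (H' nu - H nu m)"
        using inv[OF nu, of m] by (simp add: good_def rot_simps)
      then show ?thesis using wt_diff[OF alg_wt[OF alg_rot lim(2)[OF nu, of m]] lim(2)[OF nu, of m], of th] by (simp only:)
    qed
    then have "rot th (H' nu) - H' nu = 0" by (rule wt_eq_0)
    then show "rot th (H' nu) = H' nu" by simp
    note gK' = gK(1)[OF w(1)] and gH' = gH[OF wH[folded \<delta>I_def]]
    note aT = symp_alg[OF T[OF nu]]
    have eq: "T nu (ex 1 (K' nu) u) = ex 1 (K' nu) (ex 1 (H' nu) (rot th u))" if u: "u = var_x \<or> u = var_y" for u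
    proof -
      have u1: "wt d 1 u" "wt d 1 (rot th u)" using u by (auto intro!: alg_wt[OF alg_rot])
      have "wt d m (T nu (ex 1 (K' nu) u) - ex 1 (K' nu) (ex 1 (H' nu) (rot th u)))" for m
      proof -
        define M where "M = m + 2"
        have g: "gen (K nu M)" "gen (H nu M)" using inv[OF nu, of M] by (auto simp: good_def intro: gK gH)
        have M: "2 \<le> M" "1 + M - 2 \<ge> m" by (simp_all add: M_def)
        have 1: "wt d m (T nu (ex 1 (K' nu) u - ex 1 (K nu M) u))"
          by (rule alg_wt[OF aT wt_mono[OF ex_cont[OF g(1) gK' d1 lim(1)[OF nu] M(1) u1(1)] M(2)]])
        have 2: "wt d m (ex 1 (K' nu) (ex 1 (H' nu) (rot th u) - ex 1 (H nu M) (rot th u)))"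
          by (rule alg_wt[OF alg_ex[OF gK'] wt_mono[OF ex_cont[OF g(2) gH' d1 lim(2)[OF nu] M(1) u1(2)] M(2)]])
        have 3: "wt d m (ex 1 (K' nu) (ex 1 (H nu M) (rot th u)) - ex 1 (K nu M) (ex 1 (H nu M) (rot th u)))"
          by (rule wt_mono[OF ex_cont[OF g(1) gK' d1 lim(1)[OF nu] M(1) alg_wt[OF alg_ex[OF g(2)] u1(2)]] M(2)])
        have 4: "wt d m (T nu (ex 1 (K nu M) u) - ex 1 (K nu M) (ex 1 (H nu M) (rot th u)))"
          using inv[OF nu, of M] u by (auto intro: wt_mono simp: M_def)
        from wt_diff[OF wt_diff[OF wt_add[OF 1 4] 2] 3] show ?thesis
          by (simp add: alg_simps[OF aT] alg_simps[OF alg_ex[OF gK']])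
      qed
      then have "T nu (ex 1 (K' nu) u) - ex 1 (K' nu) (ex 1 (H' nu) (rot th u)) = 0" by (rule wt_eq_0)
      then show ?thesis by simp
    qed
    have "(\<lambda>f. T nu (ex 1 (K' nu) f)) = (\<lambda>f. ex 1 (K' nu) (ex 1 (H' nu) (rot th f)))"
      by (rule alg_ext[OF alg_comp[OF aT alg_ex[OF gK']] alg_comp[OF alg_ex[OF gK'] alg_comp[OF alg_ex[OF gH'] alg_rot]]])
         (simp_all add: eq)
    then show "T nu (ex 1 (K' nu) f) = ex 1 (K' nu) (ex 1 (H' nu) (rot th f))" for f by metis
  qed
qed

subsection \<open>The leading Hamiltonian and its invariants\<close>

abbreviation "AI \<equiv> action_I"
abbreviation "DI \<equiv> var_delta * action_I"

text \<open>\<open>CC\<close> and \<open>SS\<close> are the real and the imaginary part of (g1 + i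
  g2) z^n.\<close>

definition CC :: "nat \<Rightarrow> real \<Rightarrow> real \<Rightarrow> real fps3" where
  "CC n g1 g2 = const3 g1 * Zr n - const3 g2 * Zi n"

definition SS :: "nat \<Rightarrow> real \<Rightarrow> real \<Rightarrow> real fps3" where
  "SS n g1 g2 = const3 g1 * Zi n + const3 g2 * Zr n"

definition hh :: "nat \<Rightarrow> real \<Rightarrow> real \<Rightarrow> real \<Rightarrow> real fps3" where
  "hh n al g1 g2 = const3 al * AI ^ 2 + CC n g1 g2"

text \<open>The constant q in C^2 + S^2 = q I^n, which comes from |z|^2 = 2 I.\<close>

definition qq :: "nat \<Rightarrow> real \<Rightarrow> real \<Rightarrow> real" where
  "qq n g1 g2 = (g1 ^ 2 + g2 ^ 2) * 2 ^ n"

lemma pb_I_CS: "pb AI (CC n g1 g2) = - of_nat n * SS n g1 g2" "pb AI (SS n g1 g2) = of_nat n * CC n g1 g2"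
  by (simp_all add: CC_def SS_def pb_add pb_diff pb_const3_mult pb_action_Z algebra_simps)

lemma pb_h_I: "pb (hh n al g1 g2) AI = of_nat n * SS n g1 g2"
  by (simp add: hh_def pb_add pb_const3_mult pb_power pb_swap[of "CC n g1 g2"] pb_I_CS)

lemma SS_square: "SS n g1 g2 ^ 2 = const3 (qq n g1 g2) * AI ^ n - CC n g1 g2 ^ 2"
proof -
  have "SS n g1 g2 ^ 2 + CC n g1 g2 ^ 2 = (const3 g1 ^ 2 + const3 g2 ^ 2) * (Zr n ^ 2 + Zi n ^ 2)"
    by (simp add: SS_def CC_def power2_eq_square algebra_simps)
  also have "\<dots> = const3 (qq n g1 g2) * AI ^ n"
    by (simp add: Z_norm qq_def const3_simps const3_power const3_numeral power_mult_distrib)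
  finally show ?thesis by (simp add: algebra_simps)
qed

lemma pb_C_S: "2 * pb (CC n g1 g2) (SS n g1 g2) = of_nat n * of_nat n * const3 (qq n g1 g2) * AI ^ (n - 1)" if "0 < n"
proof -
  have "pb (CC n g1 g2) (SS n g1 g2) = (const3 g1 ^ 2 + const3 g2 ^ 2) * pb (Zr n) (Zi n)"
    by (simp add: CC_def SS_def pb_add pb_diff pb_const3_mult pb_swap[of "Zi n" "Zr n"] power2_eq_square algebra_simps)
  then show ?thesis using that
    by (cases n) (simp_all add: pb_Z qq_def const3_simps const3_power const3_numeral power_mult_distrib mult_ac)
qed

lemma hom_CS: "homog n (CC n g1 g2)" "homog n (SS n g1 g2)"
  unfolding CC_def SS_def by (intro homog_diff homog_add homog_const3 homog_Z)+

lemma rot_CS: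
  assumes "0 < n" shows "rot (2 * pi / real n) (CC n g1 g2) = CC n g1 g2" "rot (2 * pi / real n) (SS n g1 g2) = SS n g1 g2"
  using assms by (simp_all add: CC_def SS_def rot_simps rot_Z const3_simps)

text \<open>The data of the leading Hamiltonian over an interval or other set \<open>V\<close> of
  parameters. For n = 3 the term I^2 is heavier than z^3 and does not belong to the leading part,
  hence \<open>al3\<close>. The last assumption lets z^n be recovered from h, I and S.\<close>

locale res =
  fixes n :: nat and V :: "real set" and al g1 g2 :: "real \<Rightarrow> real"
  assumes n: "n = 3 \<or> n = 4"
    and al3: "\<And>nu. nu \<in> V \<Longrightarrow> n = 3 \<Longrightarrow> al nu = 0"
    and ra_al: "\<And>nu. nu \<in> V \<Longrightarrow> ra al nu"
    and ra_g: "\<And>nu. nu \<in> V \<Longrightarrow> ra g1 nu" "\<And>nu. nu \<in> V \<Longrightarrow> ra g2 nu"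
    and g: "\<And>nu. nu \<in> V \<Longrightarrow> (g1 nu, g2 nu) \<noteq> (0, 0)"
begin

definition "C nu = CC n (g1 nu) (g2 nu)"
definition "S nu = SS n (g1 nu) (g2 nu)"
definition "h nu = hh n (al nu) (g1 nu) (g2 nu)"
definition "q nu = qq n (g1 nu) (g2 nu)"

lemma n0: "0 < n" "2 \<le> n" using n by auto

lemma C_eq: "C nu = h nu - const3 (al nu) * AI ^ 2"
  by (simp add: C_def h_def hh_def)

lemma S_square: "S nu ^ 2 = const3 (q nu) * AI ^ n - C nu ^ 2"
  by (simp add: S_def C_def q_def SS_square)

lemma pb_hI: "pb (h nu) AI = of_nat n * S nu"
  by (simp add: h_def S_def pb_h_I)

lemma pb_hS: "2 * pb (h nu) (S nu) = 4 * const3 (al nu) * of_nat n * AI * C nu + of_nat n * of_nat n * const3 (q nu) * AI ^ (n - 1)"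
  using pb_C_S[OF n0(1), of "g1 nu" "g2 nu"]
  by (simp add: h_def hh_def S_def C_def q_def pb_add pb_const3_mult pb_power pb_I_CS algebra_simps)

lemma q_pos: "nu \<in> V \<Longrightarrow> 0 < q nu"
  using g[of nu] by (auto simp: q_def qq_def sum_power2_gt_zero_iff)

lemma ra_q: "nu \<in> V \<Longrightarrow> ra q nu"
  unfolding q_def[abs_def] qq_def by (intro ra_mult ra_add ra_power ra_g ra_const) 

lemma fam_CS: "fam V C" "fam V S" "fam V h"
  unfolding C_def[abs_def] S_def[abs_def] CC_def SS_def h_def[abs_def] hh_def
  by (intro fam_add fam_diff fam_const3 fam_const ra_g ra_al; assumption)+

lemma homog_h: "nu \<in> V \<Longrightarrow> homog n (h nu)"
proof -
  assume "nu \<in> V"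
  then have "homog n (const3 (al nu) * AI ^ 2)"
    using al3[of nu] homog_const3[OF homog_power[OF homog_action, of 2], of "al nu"] n
    by (cases "n = 3") (simp_all add: const3_simps)
  then show ?thesis unfolding h_def hh_def by (intro homog_add hom_CS)
qed

lemma homog_S: "homog n (S nu)" and homog_C: "homog n (C nu)"
  by (simp_all add: S_def C_def hom_CS)

lemma rot_hS: "rot (2 * pi / real n) (h nu) = h nu" "rot (2 * pi / real n) (S nu) = S nu" "rot (2 * pi / real n) (C nu) = C nu"
  by (simp_all add: h_def hh_def S_def C_def rot_simps rot_CS[OF n0(1)])

text \<open>Families of polynomials in the invariants, in the basis \<open>I\<^sup>a h\<^sup>j\<close>, \<open>S I\<^sup>a h\<^sup>j\<close>.\<close>

inductive ip :: "nat \<Rightarrow> (real \<Rightarrow> real fps3) \<Rightarrow> bool" where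
  zero: "ip D (\<lambda>_. 0)"
| add: "ip D f \<Longrightarrow> ip D f' \<Longrightarrow> ip D (\<lambda>nu. f nu + f' nu)"
| smul: "(\<And>nu. nu \<in> V \<Longrightarrow> ra a nu) \<Longrightarrow> ip D f \<Longrightarrow> ip D (\<lambda>nu. const3 (a nu) * f nu)"
| mon0: "2 * a + n * j = D \<Longrightarrow> ip D (\<lambda>nu. AI ^ a * h nu ^ j)"
| mon1: "2 * a + n * j + n = D \<Longrightarrow> ip D (\<lambda>nu. S nu * (AI ^ a * h nu ^ j))"
| cng: "ip D f \<Longrightarrow> (\<And>nu. nu \<in> V \<Longrightarrow> f nu = f' nu) \<Longrightarrow> ip D f'"

lemma ip_minus: "ip D f \<Longrightarrow> ip D (\<lambda>nu. - f nu)"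
  using smul[of "\<lambda>_. -1" D f] by (simp add: ra_const const3_simps)

lemma ip_diff: "ip D f \<Longrightarrow> ip D f' \<Longrightarrow> ip D (\<lambda>nu. f nu - f' nu)"
  using add[OF _ ip_minus, of D f f'] by simp

lemma ip_scal: "ip D f \<Longrightarrow> ip D (\<lambda>nu. const3 a * f nu)"
  by (rule smul) (rule ra_const)

lemma ip_sum: "(\<And>x. x \<in> A \<Longrightarrow> ip D (f x)) \<Longrightarrow> ip D (\<lambda>nu. \<Sum>x\<in>A. f x nu)"
  by (induction A rule: infinite_finite_induct) (auto intro: zero add)

lemma ip_mon: "ip (2 * a + n * j) (\<lambda>nu. AI ^ a * h nu ^ j)"
  by (rule mon0) simp

text \<open>Through S^2 = q I^n - (h - al I^2)^2 a square of \<open>S\<close> is eliminated, so that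
  one factor \<open>S\<close> suffices in the basis.\<close>

lemma ip_SS: assumes "2 * a + n * j + 2 * n = D" shows "ip D (\<lambda>nu. S nu ^ 2 * (AI ^ a * h nu ^ j))"
proof (cases "n = 3")
  case True
  have "ip D (\<lambda>nu. const3 (q nu) * (AI ^ (a + n) * h nu ^ j) - AI ^ a * h nu ^ (j + 2))"
    using assms by (intro ip_diff smul mon0 ra_q) (auto simp: algebra_simps)
  then show ?thesis
    by (rule cng) (unfold S_square C_eq, simp add: al3[OF _ True] const3_simps algebra_simps power_add power2_eq_square)
next
  case False
  then have n4: "n = 4" using n by auto
  have "ip D (\<lambda>nu. const3 (q nu) * (AI ^ (a + n) * h nu ^ j) - AI ^ a * h nu ^ (j + 2) +
     const3 (2 * al nu) * (AI ^ (a + 2) * h nu ^ (j + 1)) - const3 (al nu * al nu) * (AI ^ (a + 4) * h nu ^ j))"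
    using assms by (intro ip_diff add smul mon0 ra_q ra_mult ra_const ra_al) (auto simp: algebra_simps n4)
  then show ?thesis
    by (rule cng) (unfold S_square C_eq, simp add: const3_simps const3_numeral algebra_simps power2_eq_square power4_eq_xxxx power_add)
qed

lemma ip_mult_mon0: "ip E f \<Longrightarrow> ip (2 * a + n * j + E) (\<lambda>nu. (AI ^ a * h nu ^ j) * f nu)"
proof (induction rule: ip.induct)
  case (zero D) show ?case by (rule ip.cng[OF ip.zero]) simp
next
  case (add D f f') show ?case by (rule ip.cng[OF ip.add[OF add.IH]]) (simp add: algebra_simps)
next
  case (smul c D f) show ?case by (rule ip.cng[OF ip.smul[OF smul.hyps(1) smul.IH]]) (simp_all add: algebra_simps)
next
  case (mon0 a' j' D)
  have "ip (2 * a + n * j + D) (\<lambda>nu. AI ^ (a + a') * h nu ^ (j + j'))" 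
    by (rule ip.mon0) (use mon0 in \<open>simp add: algebra_simps\<close>)
  then show ?case by (rule ip.cng) (simp add: power_add algebra_simps)
next
  case (mon1 a' j' D)
  have "ip (2 * a + n * j + D) (\<lambda>nu. S nu * (AI ^ (a + a') * h nu ^ (j + j')))" 
    by (rule ip.mon1) (use mon1 in \<open>simp add: algebra_simps\<close>)
  then show ?case by (rule ip.cng) (simp add: power_add algebra_simps)
next
  case (cng D f f') show ?case by (rule ip.cng[OF cng.IH]) (simp add: cng.hyps)
qed

lemma ip_mult_S: "ip E f \<Longrightarrow> ip (n + E) (\<lambda>nu. S nu * f nu)"
proof (induction rule: ip.induct)
  case (zero D) show ?case by (rule ip.cng[OF ip.zero]) simp
next
  case (add D f f') show ?case by (rule ip.cng[OF ip.add[OF add.IH]]) (simp add: algebra_simps)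
next
  case (smul c D f) show ?case by (rule ip.cng[OF ip.smul[OF smul.hyps(1) smul.IH]]) (simp_all add: algebra_simps)
next
  case (mon0 a' j' D)
  show ?case by (rule ip.mon1) (use mon0 in \<open>simp add: algebra_simps\<close>)
next
  case (mon1 a' j' D)
  show ?case by (rule ip.cng[OF ip_SS[of a' j']]) (use mon1 in \<open>simp_all add: algebra_simps power2_eq_square\<close>)
next
  case (cng D f f') show ?case by (rule ip.cng[OF cng.IH]) (simp add: cng.hyps)
qed

lemma ip_mult: "ip D f \<Longrightarrow> ip E f' \<Longrightarrow> ip (D + E) (\<lambda>nu. f nu * f' nu)"
proof (induction rule: ip.induct)
  case (zero D) show ?case by (rule ip.cng[OF ip.zero]) simp
next
  case (add D f g) show ?case by (rule ip.cng[OF ip.add[OF add.IH(1)[OF add.prems] add.IH(2)[OF add.prems]]]) (simp add: algebra_simps)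
next
  case (smul c D f) show ?case by (rule ip.cng[OF ip.smul[OF smul.hyps(1) smul.IH[OF smul.prems]]]) (simp_all add: algebra_simps)
next
  case (mon0 a j D) then show ?case using ip_mult_mon0[of E f' a j] by simp
next
  case (mon1 a j D)
  have "2 * a + n * j + (n + E) = D + E" using mon1 by simp
  with ip_mult_mon0[OF ip_mult_S[OF mon1(2)], of a j]
  have "ip (D + E) (\<lambda>nu. AI ^ a * h nu ^ j * (S nu * f' nu))" by simp
  then show ?case by (rule ip.cng) (simp add: algebra_simps)
next
  case (cng D f g) show ?case by (rule ip.cng[OF cng.IH[OF cng.prems]]) (simp add: cng.hyps)
qed

lemma ip_Z_n: "ip n (\<lambda>_. Zr n)" "ip n (\<lambda>_. Zi n)"
proof -
  have C: "ip n C"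
  proof (cases "n = 3")
    case True
    show ?thesis by (rule cng[OF mon0[of 0 1]]) (simp_all add: C_eq al3[OF _ True] const3_simps)
  next
    case False
    then have "ip n (\<lambda>nu. AI ^ 0 * h nu ^ 1 - const3 (al nu) * (AI ^ 2 * h nu ^ 0))"
      using n by (intro ip_diff smul mon0 ra_al) auto
    then show ?thesis by (rule cng) (simp add: C_eq)
  qed
  have S: "ip n S" by (rule cng[OF mon1[of 0 0]]) simp_all
  define gg where "gg nu = g1 nu ^ 2 + g2 nu ^ 2" for nu
  have gg: "gg nu \<noteq> 0" "ra gg nu" if "nu \<in> V" for nu
    using g[OF that] unfolding gg_def[abs_def]
    by (auto intro!: ra_add ra_power ra_g that simp: sum_power2_eq_zero_iff)
  \<comment> \<open>Solving C + i S = g z^n for z^n; here the division by |g|^2 takes place.\<close>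
  have e: "const3 (g1 nu / gg nu) * C nu + const3 (g2 nu / gg nu) * S nu = const3 ((g1 nu * g1 nu + g2 nu * g2 nu) / gg nu) * Zr n" 
    "const3 (g1 nu / gg nu) * S nu - const3 (g2 nu / gg nu) * C nu = const3 ((g1 nu * g1 nu + g2 nu * g2 nu) / gg nu) * Zi n" for nu
    by (simp_all add: C_def S_def CC_def SS_def divide_inverse const3_simps algebra_simps)
  have e': "(g1 nu * g1 nu + g2 nu * g2 nu) / gg nu = 1" if "nu \<in> V" for nu
    using gg[OF that] by (simp add: gg_def power2_eq_square)
  have "ip n (\<lambda>nu. const3 (g1 nu / gg nu) * C nu + const3 (g2 nu / gg nu) * S nu)"
    by (intro add smul C S ra_divide ra_g gg; assumption)
  then show "ip n (\<lambda>_. Zr n)" by (rule cng) (simp add: e e' const3_simps)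
  have "ip n (\<lambda>nu. const3 (g1 nu / gg nu) * S nu - const3 (g2 nu / gg nu) * C nu)"
    by (intro ip_diff smul C S ra_divide ra_g gg; assumption)
  then show "ip n (\<lambda>_. Zi n)" by (rule cng) (simp add: e e' const3_simps)
qed

lemma ip_Z: "ip (n * m) (\<lambda>_. Zr (n * m))" "ip (n * m) (\<lambda>_. Zi (n * m))"
proof (induction m)
  case 0
  { case 1 show ?case by (rule cng[OF mon0[of 0 0]]) simp_all }
  { case 2 show ?case by (rule cng[OF zero]) simp }
next
  case (Suc m)
  { case 1 show ?case unfolding mult_Suc_right Z_add by (intro ip_diff ip_mult Suc ip_Z_n) }
  { case 2 show ?case unfolding mult_Suc_right Z_add by (intro add ip_mult Suc ip_Z_n) }
qed

lemma ip_av_Z: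
  assumes "2 * a + p = D"
  shows "ip D (\<lambda>_. av n (AI ^ a * Zr p))" "ip D (\<lambda>_. av n (AI ^ a * Zi p))"
proof -
  have "ip D (\<lambda>_. av n (AI ^ a * Zr p)) \<and> ip D (\<lambda>_. av n (AI ^ a * Zi p))"
  proof (cases "n dvd p")
    case False
    then show ?thesis by (simp add: av_linear av_Z[OF n0(1)] zero)
  next
    case True
    then obtain m where m: "p = n * m" by auto
    have "real p * (2 * pi / real n) = 2 * real m * pi" using n0 m by (simp add: field_simps)
    then have "cos (real p * (2 * pi / real n)) = 1" "sin (real p * (2 * pi / real n)) = 0"
      by (simp_all only: cos_2npi sin_2npi)
    then have "av n (Zr p) = Zr p" "av n (Zi p) = Zi p"
      by (auto intro!: av_fix[OF n0(1)] simp: rot_Z const3_simps)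
    moreover have "ip D (\<lambda>_. AI ^ a * Zr p)" "ip D (\<lambda>_. AI ^ a * Zi p)"
      using ip_mult[OF mon0[of a 0] ip_Z(1)[of m]] ip_mult[OF mon0[of a 0] ip_Z(2)[of m]] assms m by auto
    ultimately show ?thesis by (simp add: av_linear)
  qed
  then show "ip D (\<lambda>_. av n (AI ^ a * Zr p))" "ip D (\<lambda>_. av n (AI ^ a * Zi p))" by auto
qed

end

text \<open>Real polynomials in the basis of the real and imaginary parts of (z bar z)^a z^p, on
  which averaging is diagonal. It exhausts all homogeneous polynomials
  (\<open>homog_zspan\<close>).\<close>

inductive zspan :: "nat \<Rightarrow> real fps3 \<Rightarrow> bool" where
  add: "zspan D f \<Longrightarrow> zspan D f' \<Longrightarrow> zspan D (f + f')"
| smul: "zspan D f \<Longrightarrow> zspan D (const3 a * f)"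
| mon0: "2 * a + p = D \<Longrightarrow> zspan D (AI ^ a * Zr p)"
| mon1: "2 * a + p = D \<Longrightarrow> zspan D (AI ^ a * Zi p)"

text \<open>From x = (z + bar z) / 2, y = (z - bar z) / (2 i) and bar z z^p = 2 I z^(p-1). The case
  p = 0 is split off because p - 1 truncates.\<close>

lemma var_mult_Z:
  "var_x * Zr p = const3 (1/2) * (Zr (Suc p) + 2 * (AI * Zr (p - 1))) \<or> p = 0"
  "var_x * Zi p = const3 (1/2) * (Zi (Suc p) + 2 * (AI * Zi (p - 1))) \<or> p = 0"
  "var_y * Zr p = const3 (1/2) * (Zi (Suc p) - 2 * (AI * Zi (p - 1))) \<or> p = 0"
  "var_y * Zi p = const3 (1/2) * (2 * (AI * Zr (p - 1)) - Zr (Suc p)) \<or> p = 0"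
proof -
  have half: "u = const3 (1/2) * v" if "v = 2 * u" for u v :: "real fps3"
  proof -
    have "const3 (1/2) * v = (const3 (1/2) * 2) * u" by (simp only: that mult_ac)
    then show ?thesis by (simp only: const3_half mult_1)
  qed
  have e: "2 * (AI * u) = (var_x ^ 2 + var_y ^ 2) * u" for u by (simp only: var_squares mult_ac)
  have k: "Zr (Suc (Suc r)) + (var_x ^ 2 + var_y ^ 2) * Zr r = 2 * (var_x * Zr (Suc r))"
    "Zi (Suc (Suc r)) + (var_x ^ 2 + var_y ^ 2) * Zi r = 2 * (var_x * Zi (Suc r))"
    "Zi (Suc (Suc r)) - (var_x ^ 2 + var_y ^ 2) * Zi r = 2 * (var_y * Zr (Suc r))"
    "(var_x ^ 2 + var_y ^ 2) * Zr r - Zr (Suc (Suc r)) = 2 * (var_y * Zi (Suc r))" for r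
    unfolding Z_Suc power2_eq_square mult_2 by (simp_all add: algebra_simps)
  have "p = 0 \<or> p = Suc (p - 1)" by auto
  then show "var_x * Zr p = const3 (1/2) * (Zr (Suc p) + 2 * (AI * Zr (p - 1))) \<or> p = 0"
    "var_x * Zi p = const3 (1/2) * (Zi (Suc p) + 2 * (AI * Zi (p - 1))) \<or> p = 0"
    "var_y * Zr p = const3 (1/2) * (Zi (Suc p) - 2 * (AI * Zi (p - 1))) \<or> p = 0"
    "var_y * Zi p = const3 (1/2) * (2 * (AI * Zr (p - 1)) - Zr (Suc p)) \<or> p = 0"
    unfolding e by (metis half k)+
qed

lemma zspan_diff: "zspan D f \<Longrightarrow> zspan D f' \<Longrightarrow> zspan D (f - f')"
  using zspan.add[of D f "const3 (-1) * f'"] zspan.smul[of D f' "-1"] by (simp add: const3_simps)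

lemma zspan_two: "zspan D f \<Longrightarrow> zspan D (2 * f)"
  using zspan.add[of D f f] by (simp only: mult_2)

lemma zspan_var: "zspan D f \<Longrightarrow> zspan (Suc D) (var_x * f) \<and> zspan (Suc D) (var_y * f)"
proof (induction rule: zspan.induct)
  case (add D f f') then show ?case by (auto simp: distrib_left intro: zspan.add)
next
  case (smul D f a) then show ?case using zspan.smul by (metis mult.left_commute)
next
  case (mon0 a p D)
  show ?case
  proof (cases "p = 0")
    case True
    then show ?thesis using zspan.mon0[of a 1 "Suc D"] zspan.mon1[of a 1 "Suc D"] mon0
      by (simp add: Z_Suc mult.commute)
  next
    case False
    have 1: "zspan (Suc D) (AI ^ a * Zr (Suc p))" "zspan (Suc D) (AI ^ a * Zi (Suc p))" 
      "zspan (Suc D) (2 * (AI ^ Suc a * Zr (p - 1)))" "zspan (Suc D) (2 * (AI ^ Suc a * Zi (p - 1)))"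
      using mon0 False by (intro zspan_two zspan.intros; simp)+
    have l: "var_x * (AI ^ a * Zr p) = AI ^ a * (var_x * Zr p)" "var_y * (AI ^ a * Zr p) = AI ^ a * (var_y * Zr p)" by (simp_all only: mult_ac)
    have vm: "var_x * Zr p = const3 (1/2) * (Zr (Suc p) + 2 * (AI * Zr (p - 1)))"
      "var_x * Zi p = const3 (1/2) * (Zi (Suc p) + 2 * (AI * Zi (p - 1)))"
      "var_y * Zr p = const3 (1/2) * (Zi (Suc p) - 2 * (AI * Zi (p - 1)))"
      "var_y * Zi p = const3 (1/2) * (2 * (AI * Zr (p - 1)) - Zr (Suc p))"
      using var_mult_Z[of p] False by blast+
    have "var_x * (AI ^ a * Zr p) = const3 (1/2) * (AI ^ a * Zr (Suc p) + 2 * (AI ^ Suc a * Zr (p - 1)))"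
      "var_y * (AI ^ a * Zr p) = const3 (1/2) * (AI ^ a * Zi (Suc p) - 2 * (AI ^ Suc a * Zi (p - 1)))"
      unfolding l vm by (simp_all only: ring_distribs mult_ac power_Suc)
    then show ?thesis using 1 by (auto intro: zspan.smul zspan.add zspan_diff)
  qed
next
  case (mon1 a p D)
  show ?case
  proof (cases "p = 0")
    case True
    then show ?thesis using zspan.smul[OF zspan.mon0[of a 1 "Suc D"], of 0] mon1
      by (simp add: const3_simps)
  next
    case False
    have 1: "zspan (Suc D) (AI ^ a * Zr (Suc p))" "zspan (Suc D) (AI ^ a * Zi (Suc p))" 
      "zspan (Suc D) (2 * (AI ^ Suc a * Zr (p - 1)))" "zspan (Suc D) (2 * (AI ^ Suc a * Zi (p - 1)))"
      using mon1 False by (intro zspan_two zspan.intros; simp)+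
    have l: "var_x * (AI ^ a * Zi p) = AI ^ a * (var_x * Zi p)" "var_y * (AI ^ a * Zi p) = AI ^ a * (var_y * Zi p)" by (simp_all only: mult_ac)
    have vm: "var_x * Zr p = const3 (1/2) * (Zr (Suc p) + 2 * (AI * Zr (p - 1)))"
      "var_x * Zi p = const3 (1/2) * (Zi (Suc p) + 2 * (AI * Zi (p - 1)))"
      "var_y * Zr p = const3 (1/2) * (Zi (Suc p) - 2 * (AI * Zi (p - 1)))"
      "var_y * Zi p = const3 (1/2) * (2 * (AI * Zr (p - 1)) - Zr (Suc p))"
      using var_mult_Z[of p] False by blast+
    have "var_x * (AI ^ a * Zi p) = const3 (1/2) * (AI ^ a * Zi (Suc p) + 2 * (AI ^ Suc a * Zi (p - 1)))"
      "var_y * (AI ^ a * Zi p) = const3 (1/2) * (2 * (AI ^ Suc a * Zr (p - 1)) - AI ^ a * Zr (Suc p))"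
      unfolding l vm by (simp_all only: ring_distribs mult_ac power_Suc)
    then show ?thesis using 1 by (auto intro: zspan.smul zspan.add zspan_diff)
  qed
qed

lemma zspan_monomial: "zspan (i + j) (var_x ^ i * var_y ^ j)"
proof -
  have "zspan j (var_y ^ j)"
    by (induction j) (use zspan.mon0[of 0 0 0] zspan_var in auto)
  then show ?thesis
    by (induction i) (use zspan_var in \<open>auto simp: mult.assoc\<close>)
qed

text \<open>An invariant equals its average. Expanding it into monomials leaves their coefficients
  as analytic factors in front of the fixed averages, which lie in the basis by
  \<open>ip_av_Z\<close>.\<close>

lemma (in res) ip_invariant:
  assumes f: "fam V f" "\<And>nu. nu \<in> V \<Longrightarrow> homog D (f nu)" "\<And>nu. nu \<in> V \<Longrightarrow> rot (2 * pi / real n) (f nu) = f nu"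
  shows "ip D f"
proof -
  have z: "ip D (\<lambda>_. av n u)" if "zspan D u" for u
    using that
  proof (induction rule: zspan.induct)
    case (add D f f') show ?case unfolding av_linear by (rule ip.add[OF add.IH])
  next
    case (smul D f a) show ?case unfolding av_linear by (rule ip_scal[OF smul.IH])
  qed (rule ip_av_Z; assumption)+
  have "ip D (\<lambda>nu. \<Sum>i\<le>D. const3 (coeff3 (f nu) i (D - i) 0) * av n (var_x ^ i * var_y ^ (D - i)))"
  proof (intro ip_sum smul z)
    fix i assume "i \<in> {..D}" then show "zspan D (var_x ^ i * var_y ^ (D - i))"
      using zspan_monomial[of i "D - i"] by simp
  qed (use f(1) in \<open>auto simp: fam_def\<close>)
  then show ?thesis
  proof (rule cng)
    fix nu assume nu: "nu \<in> V"
    have "f nu = av n (f nu)" using av_fix[OF n0(1) f(3)[OF nu]] by simp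
    also have "\<dots> = av n (\<Sum>i\<le>D. const3 (coeff3 (f nu) i (D - i) 0) * (var_x ^ i * var_y ^ (D - i)))"
      using homog_expand[OF f(2)[OF nu]] by simp
    finally show "(\<Sum>i\<le>D. const3 (coeff3 (f nu) i (D - i) 0) * av n (var_x ^ i * var_y ^ (D - i))) = f nu"
      by (simp add: av_linear)
  qed
qed

subsection \<open>The homological equation\<close>

lemma pb_power2: "pb g (f ^ p) = of_nat p * f ^ (p - 1) * pb g f"
  by (subst pb_swap) (simp add: pb_power pb_swap[of f g])

lemma halve: "u = const3 (1/2) * v" if "2 * u = v" for u v :: "real fps3"
proof -
  have "const3 (1/2) * v = (const3 (1/2) * 2) * u" by (simp only: that[symmetric] mult_ac)
  then show ?thesis by (simp only: const3_half mult_1)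
qed

text \<open>Indices k at which a_km, respectively b_km, is not forced to vanish. \<open>okA\<close>
  and \<open>okB\<close> say the same in terms of the degree in x, y of the term, which is 2 k + 4,
  respectively 2 k + n.\<close>

definition keepA :: "nat \<Rightarrow> nat \<Rightarrow> bool" where
  "keepA n k \<longleftrightarrow> \<not> (n = 3 \<and> k mod 3 = 0) \<and> \<not> (n = 4 \<and> k mod 4 = 1)"

definition keepB :: "nat \<Rightarrow> nat \<Rightarrow> bool" where
  "keepB n k \<longleftrightarrow> \<not> (n = 3 \<and> k mod 3 = 2) \<and> \<not> (n = 4 \<and> k mod 4 = 3)"

definition okA :: "nat \<Rightarrow> nat \<Rightarrow> bool" where
  "okA n D \<longleftrightarrow> even D \<and> 4 \<le> D \<and> keepA n ((D - 4) div 2)"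

definition okB :: "nat \<Rightarrow> nat \<Rightarrow> bool" where
  "okB n D \<longleftrightarrow> n \<le> D \<and> even (D - n) \<and> keepB n ((D - n) div 2)"

text \<open>
  Rescaled Legendre polynomials: \<open>QL al q t\<close> is the mean of \<open>(al + \<surd>q cos \<psi>)\<^sup>t\<close> over the circle.
\<close>

fun QL :: "real \<Rightarrow> real \<Rightarrow> nat \<Rightarrow> real" where
  "QL al q 0 = 1"
| "QL al q (Suc 0) = al"
| "QL al q (Suc (Suc t)) = (real (2 * t + 3) * al * QL al q (Suc t) + real (t + 1) * (q - al ^ 2) * QL al q t) / real (t + 2)"

text \<open>The coefficient of I^(2J+1) in the relation of degree 4 J + 2 (\<open>Red_rel\<close>);
  that of I^(2J-1) C is \<open>QL al q J\<close>.\<close>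

definition WL :: "real \<Rightarrow> real \<Rightarrow> nat \<Rightarrow> real" where
  "WL al q J = al * QL al q J + (q - al ^ 2) * QL al q (J - 1)"

lemma QL_rec: "real (t + 1) * QL al q (t + 1) = real (2 * t + 1) * al * QL al q t + real t * (q - al ^ 2) * QL al q (t - 1)"
  by (cases t) (simp_all add: field_simps)

text \<open>\<open>N J\<close> is the mean of (al + sqrt q cos psi)^J sqrt q cos psi. It forms with
  \<open>QL\<close> a first order recursion with nonnegative weights up to the sign of al, which is
  why positivity can be propagated in steps of two. At odd indices \<open>QL\<close> vanishes for al
  = 0, so \<open>WL\<close> replaces it there.\<close>

lemma QL_pos:
  fixes al q :: real
  assumes q: "0 < q"
  defines "N \<equiv> \<lambda>J. QL al q (J + 1) - al * QL al q J"
  shows "0 < QL al q (2 * i)" "0 \<le> al * N (2 * i)" "0 < WL al q (2 * i + 1)"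
proof -
  have N: "N (J + 1) = real (J + 1) / real (J + 2) * (al * N J + q * QL al q J)" for J
    by (simp add: N_def field_simps power2_eq_square)
  have "0 < QL al q (2 * i) \<and> 0 \<le> al * N (2 * i)"
  proof (induction i)
    case 0 show ?case by (simp add: N_def)
  next
    case (Suc i)
    let ?J = "2 * i"
    have 1: "0 < N (?J + 1)" unfolding N using Suc q by (intro mult_pos_pos add_nonneg_pos) auto
    have "QL al q (?J + 1) = al * QL al q ?J + N ?J" by (simp add: N_def)
    then have "al * QL al q (?J + 1) = al * al * QL al q ?J + al * N ?J" by (simp add: algebra_simps)
    then have 2: "0 \<le> al * QL al q (?J + 1)" using Suc by (simp add: add_nonneg_nonneg)
    have "QL al q (?J + 2) = al * QL al q (?J + 1) + N (?J + 1)" by (simp add: N_def)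
    then have 3: "0 < QL al q (?J + 2)" using 1 2 by linarith
    have "al * N (?J + 2) = real (?J + 2) / real (?J + 3) * (al * al * N (?J + 1) + q * (al * QL al q (?J + 1)))"
    proof -
      have e: "N (?J + 2) = real (?J + 2) / real (?J + 3) * (al * N (?J + 1) + q * QL al q (?J + 1))"
        using N[of "?J + 1"] by (simp only: add.assoc one_add_one) (simp add: add.commute)
      show ?thesis unfolding e by (simp only: ring_distribs mult_ac)
    qed
    moreover have "0 \<le> real (?J + 2) / real (?J + 3) * (al * al * N (?J + 1) + q * (al * QL al q (?J + 1)))"
      by (rule mult_nonneg_nonneg[OF _ add_nonneg_nonneg[OF mult_nonneg_nonneg[OF zero_le_square less_imp_le[OF 1]]
            mult_nonneg_nonneg[OF less_imp_le[OF q] 2]]]) simp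
    ultimately show ?case using 3 by simp
  qed
  then show 1: "0 < QL al q (2 * i)" and 2: "0 \<le> al * N (2 * i)" by auto
  have "WL al q (2 * i + 1) = al * N (2 * i) + q * QL al q (2 * i)"
    by (simp add: WL_def N_def algebra_simps power2_eq_square)
  then show "0 < WL al q (2 * i + 1)" using 1 2 q by (simp add: add_nonneg_pos)
qed

text \<open>\<open>Q\<close> is the summation factor for the three-term relations of
  \<open>rel4\<close>: after multiplying the t-th one by \<open>Q t\<close> all inner terms cancel,
  and only the two ends remain.\<close>

lemma QL_telescope:
  fixes Q e :: "nat \<Rightarrow> 'a::comm_ring_1" and A B :: 'a
  assumes Q: "\<And>t. of_nat (t + 1) * Q (t + 1) = of_nat (2 * t + 1) * A * Q t + of_nat t * B * Q (t - 1)"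
  shows "(\<Sum>t<m. Q t * (of_nat (t + 1) * B * e (t + 1) + of_nat (2 * t + 1) * A * e t - of_nat t * e (t - 1))) =
    of_nat m * (Q m * e (m - 1) + B * Q (m - 1) * e m)"
proof (induction m)
  case (Suc m)
  have "of_nat (Suc m) * (Q (Suc m) * e m + B * Q m * e (Suc m)) =
    (of_nat (2 * m + 1) * A * Q m + of_nat m * B * Q (m - 1)) * e m + of_nat (m + 1) * B * Q m * e (m + 1)"
    using Q[of m] by (simp add: algebra_simps del: of_nat_Suc)
  then show ?case using Suc by (simp only: sum.lessThan_Suc diff_Suc_1) (simp add: algebra_simps)
qed simp

context res
begin

lemma pb_hS': "pb (h nu) (S nu) = const3 (2 * al nu * real n) * (AI * C nu) + const3 (real n * real n / 2 * q nu) * AI ^ (n - 1)"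
proof -
  have h2: "const3 (1/2) * (4 * u) = 2 * u" for u :: "real fps3"
    using halve[of "2 * u" "4 * u"] by simp
  have "pb (h nu) (S nu) = const3 (1/2) * (4 * (const3 (al nu) * of_nat n * AI * C nu) + of_nat n * of_nat n * const3 (q nu) * AI ^ (n - 1))"
    using pb_hS[of nu] by (intro halve) (simp add: algebra_simps)
  then show ?thesis
    by (simp only: h2 distrib_left)
       (simp only: const3_simps const3_of_nat const3_numeral mult_ac divide_inverse one_add_one[symmetric] mult_1)
qed

lemma pb_h_mon: "pb (h nu) (AI ^ a * h nu ^ j) = of_nat a * of_nat n * (S nu * (AI ^ (a - 1) * h nu ^ j))"
  by (simp add: pb_mult pb_power2 pb_hI mult_ac)

lemma pb_h_S_mon: "pb (h nu) (S nu * (AI ^ a * h nu ^ j)) =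
   pb (h nu) (S nu) * (AI ^ a * h nu ^ j) + of_nat a * of_nat n * (S nu ^ 2 * (AI ^ (a - 1) * h nu ^ j))"
  unfolding pb_mult(2)[of _ "S nu"] pb_h_mon by (simp add: power2_eq_square mult_ac)

text \<open>After \<open>C\<close> and \<open>S^2\<close> are eliminated in favour of h and I, three
  neighbouring monomials of one degree remain. The halves are kept since in the main application
  \<open>a\<close> is even and they become integers.\<close>

lemma rel4:
  assumes "n = 4"
  shows "pb (h nu) (S nu * (AI ^ a * h nu ^ j)) =
    const3 8 * (const3 (q nu - al nu ^ 2) * const3 (real a / 2 + 1) * (AI ^ (a + 3) * h nu ^ j)
     + const3 (al nu) * const3 (real a + 1) * (AI ^ (a + 1) * h nu ^ (j + 1))
     - const3 (real a / 2) * (AI ^ (a - 1) * h nu ^ (j + 2)))"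
proof -
  define x where "x = const3 (real a / 2)"
  have ax: "of_nat a = 2 * x" by (simp add: x_def const3_of_nat[symmetric] const3_numeral[symmetric] const3_simps(2)[symmetric])
  have cx: "const3 (real a / 2 + 1) = x + 1" "const3 (real a + 1) = 2 * x + 1"
    by (simp_all add: const3_simps x_def[symmetric] const3_of_nat ax)
  have c: "const3 (2 * al nu * real n) = 8 * const3 (al nu)" "const3 (real n * real n / 2 * q nu) = 8 * const3 (q nu)"
    "const3 (q nu - al nu ^ 2) = const3 (q nu) - const3 (al nu) ^ 2" "const3 8 = (8 :: real fps3)"
    by (simp_all add: assms const3_simps const3_numeral const3_power)
  have n1: "AI ^ (n - 1) = AI ^ 3" "AI ^ n = AI ^ 4" "of_nat n = (4 :: real fps3)" using assms by simp_all
  show ?thesis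
  proof (cases a)
    case 0
    then have "x = 0" by (simp add: x_def const3_simps)
    then show ?thesis unfolding pb_h_S_mon pb_hS' c n1 ax cx unfolding C_eq using 0
      by (simp add: algebra_simps power2_eq_square power3_eq_cube const3_simps(5))
  next
    case (Suc b)
    show ?thesis unfolding pb_h_S_mon pb_hS' S_square c n1 ax cx x_def[symmetric] unfolding C_eq Suc
      by (simp add: algebra_simps power2_eq_square power3_eq_cube power4_eq_xxxx power_add)
  qed
qed

text \<open>With al = 0 one has C = h, and the middle monomial of the relation disappears.\<close>

lemma rel3:
  assumes "n = 3" "nu \<in> V"
  shows "pb (h nu) (S nu * (AI ^ a * h nu ^ j)) =
    const3 3 * (const3 (q nu * (real a + 3/2)) * (AI ^ (a + 2) * h nu ^ j)
     - const3 (real a) * (AI ^ (a - 1) * h nu ^ (j + 2)))"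
proof -
  have c: "const3 (2 * al nu * real n) = 0" "const3 (real n * real n / 2 * q nu) = 3 * const3 (3/2) * const3 (q nu)"
    "const3 (q nu * (real a + 3/2)) = const3 (q nu) * (of_nat a + const3 (3/2))" "const3 3 = (3 :: real fps3)"
    "const3 (real a) = (of_nat a :: real fps3)"
  proof -
    show "const3 (2 * al nu * real n) = 0" by (simp add: al3[OF assms(2,1)] const3_simps(5))
    have "real n * real n / 2 * q nu = 3 * (3/2) * q nu" by (simp add: assms)
    then show "const3 (real n * real n / 2 * q nu) = 3 * const3 (3/2) * const3 (q nu)"
      by (simp only: const3_simps const3_numeral)
  qed (simp_all only: const3_simps const3_of_nat const3_numeral)
  have n1: "AI ^ (n - 1) = AI ^ 2" "AI ^ n = AI ^ 3" "of_nat n = (3 :: real fps3)" using assms by simp_all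
  have C: "C nu = h nu" using al3[OF assms(2,1)] by (simp add: C_eq const3_simps)
  show ?thesis
    by (cases a; unfold pb_h_S_mon pb_hS' S_square c n1 C)
       (simp_all add: algebra_simps power2_eq_square power3_eq_cube)
qed

section \<open>Normal terms and reduction modulo the image of the bracket with h\<close>

definition nfw :: "nat \<Rightarrow> (real \<Rightarrow> real) \<Rightarrow> (real \<Rightarrow> real) \<Rightarrow> (real \<Rightarrow> real fps3) \<Rightarrow> bool" where
  "nfw D x y f \<longleftrightarrow> (\<forall>nu\<in>V. ra x nu \<and> ra y nu \<and>
      f nu = const3 (x nu) * AI ^ (D div 2) + const3 (y nu) * (AI ^ ((D - n) div 2) * C nu)) \<and>
      (\<not> okA n D \<longrightarrow> (\<forall>nu. x nu = 0)) \<and> (\<not> okB n D \<longrightarrow> (\<forall>nu. y nu = 0))"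

definition nf :: "nat \<Rightarrow> (real \<Rightarrow> real fps3) \<Rightarrow> bool" where
  "nf D f \<longleftrightarrow> (\<exists>x y. nfw D x y f)"

lemma nf_add: assumes "nf D f" "nf D f'" shows "nf D (\<lambda>nu. f nu + f' nu)"
proof -
  obtain x y x' y' where "nfw D x y f" "nfw D x' y' f'"
    using assms unfolding nf_def by blast
  then have "nfw D (\<lambda>nu. x nu + x' nu) (\<lambda>nu. y nu + y' nu) (\<lambda>nu. f nu + f' nu)"
    by (auto simp: nfw_def const3_simps algebra_simps intro: ra_add)
  then show ?thesis unfolding nf_def by blast
qed

lemma nf_smul: assumes a: "\<And>nu. nu \<in> V \<Longrightarrow> ra a nu" and f: "nf D f" shows "nf D (\<lambda>nu. const3 (a nu) * f nu)"
proof -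
  obtain x y where "nfw D x y f"
    using f unfolding nf_def by blast
  then have "nfw D (\<lambda>nu. a nu * x nu) (\<lambda>nu. a nu * y nu) (\<lambda>nu. const3 (a nu) * f nu)"
    by (auto simp: nfw_def const3_simps algebra_simps intro: ra_mult a)
  then show ?thesis unfolding nf_def by blast
qed

lemma nf_cng: "nf D f \<Longrightarrow> (\<And>nu. nu \<in> V \<Longrightarrow> f nu = f' nu) \<Longrightarrow> nf D f'"
  unfolding nf_def nfw_def by auto

lemma nf_zero: "nf D (\<lambda>_. 0)"
  unfolding nf_def nfw_def by (rule exI[of _ "\<lambda>_. 0"], rule exI[of _ "\<lambda>_. 0"]) (auto simp: const3_simps ra_const)

text \<open>Reducibility to normal terms modulo the image of the bracket with h, by a preimage with
  analytic coefficients. The degree of the preimage is D + 2 - n because the bracket with h adds n -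
  2.\<close>

definition Red :: "nat \<Rightarrow> (real \<Rightarrow> real fps3) \<Rightarrow> bool" where
  "Red D e \<longleftrightarrow> (\<exists>kp. ip (D + 2 - n) kp \<and> nf D (\<lambda>nu. e nu + pb (h nu) (kp nu)))"

lemma Red_add: assumes "Red D e" "Red D e'" shows "Red D (\<lambda>nu. e nu + e' nu)"
proof -
  obtain k k' where k: "ip (D + 2 - n) k" "nf D (\<lambda>nu. e nu + pb (h nu) (k nu))"
    "ip (D + 2 - n) k'" "nf D (\<lambda>nu. e' nu + pb (h nu) (k' nu))" using assms by (auto simp: Red_def)
  have "nf D (\<lambda>nu. (e nu + e' nu) + pb (h nu) (k nu + k' nu))"
    by (rule nf_cng[OF nf_add[OF k(2,4)]]) (simp add: pb_add)
  then show ?thesis unfolding Red_def using ip.add[OF k(1,3)] by blast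
qed

lemma Red_smul: assumes "\<And>nu. nu \<in> V \<Longrightarrow> ra a nu" "Red D e" shows "Red D (\<lambda>nu. const3 (a nu) * e nu)"
proof -
  obtain k where k: "ip (D + 2 - n) k" "nf D (\<lambda>nu. e nu + pb (h nu) (k nu))" using assms by (auto simp: Red_def)
  have "nf D (\<lambda>nu. const3 (a nu) * e nu + pb (h nu) (const3 (a nu) * k nu))"
    by (rule nf_cng[OF nf_smul[OF assms(1) k(2)]]) (auto simp: pb_const3_mult distrib_left)
  then show ?thesis unfolding Red_def using ip.smul[OF assms(1) k(1)] by blast
qed

lemma Red_scal: "Red D e \<Longrightarrow> Red D (\<lambda>nu. const3 a * e nu)"
  by (rule Red_smul) (rule ra_const)

lemma Red_cng: "Red D e \<Longrightarrow> (\<And>nu. nu \<in> V \<Longrightarrow> e nu = e' nu) \<Longrightarrow> Red D e'"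
proof -
  assume "Red D e" and e: "\<And>nu. nu \<in> V \<Longrightarrow> e nu = e' nu"
  then obtain k where k: "ip (D + 2 - n) k" "nf D (\<lambda>nu. e nu + pb (h nu) (k nu))" by (auto simp: Red_def)
  have "nf D (\<lambda>nu. e' nu + pb (h nu) (k nu))" by (rule nf_cng[OF k(2)]) (simp add: e)
  then show ?thesis unfolding Red_def using k by blast
qed

lemma Red_diff: "Red D e \<Longrightarrow> Red D e' \<Longrightarrow> Red D (\<lambda>nu. e nu - e' nu)"
  using Red_add[of D e "\<lambda>nu. const3 (-1) * e' nu"] Red_scal[of D e' "-1"] by (simp add: const3_simps)

lemma Red_image: assumes "ip E k" "E = D + 2 - n" shows "Red D (\<lambda>nu. pb (h nu) (k nu))"
  unfolding Red_def using ip_minus[OF assms(1)] assms(2) nf_zero[of D]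
  by (intro exI[of _ "\<lambda>nu. - k nu"]) (simp add: pb_minus)

lemma Red_nf: "nf D e \<Longrightarrow> Red D e"
  unfolding Red_def using ip.zero by (intro exI[of _ "\<lambda>_. 0"]) simp

lemma Red_A: assumes "okA n (2 * a)" shows "Red (2 * a) (\<lambda>_. AI ^ a)"
  by (rule Red_nf, unfold nf_def nfw_def, rule exI[of _ "\<lambda>_. 1"], rule exI[of _ "\<lambda>_. 0"])
     (use assms in \<open>auto simp: const3_simps ra_const\<close>)

lemma Red_B: assumes "okB n (2 * a + n)" shows "Red (2 * a + n) (\<lambda>nu. AI ^ a * C nu)"
  by (rule Red_nf, unfold nf_def nfw_def, rule exI[of _ "\<lambda>_. 0"], rule exI[of _ "\<lambda>_. 1"])
     (use assms in \<open>auto simp: const3_simps ra_const\<close>)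

text \<open>Since the bracket of h with I is n S, terms with a factor \<open>S\<close> are in the
  image outright.\<close>

lemma Red_S: assumes "2 * a + n * j + n = D" shows "Red D (\<lambda>nu. S nu * (AI ^ a * h nu ^ j))"
proof -
  have "Red D (\<lambda>nu. const3 (1 / (real (a + 1) * real n)) * pb (h nu) (AI ^ (a + 1) * h nu ^ j))"
    by (intro Red_scal Red_image[OF ip_mon]) (use assms n0 in auto)
  then show ?thesis
  proof (rule Red_cng)
    fix nu
    have "const3 (1 / (real (a + 1) * real n)) * (of_nat (a + 1) * of_nat n) = (1 :: real fps3)"
      using n0 by (simp only: const3_of_nat[symmetric] const3_simps(2)[symmetric]) (simp add: const3_simps)
    then show "const3 (1 / (real (a + 1) * real n)) * pb (h nu) (AI ^ (a + 1) * h nu ^ j) = S nu * (AI ^ a * h nu ^ j)"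
      unfolding pb_h_mon by (simp only: mult.assoc[symmetric] add_diff_cancel_right' mult_1)
  qed
qed

lemma ra_QL: "nu \<in> V \<Longrightarrow> ra (\<lambda>nu. QL (al nu) (q nu) t) nu"
  by (induction t rule: induct_nat_012)
     (auto intro!: ra_divide_const ra_add ra_mult ra_diff ra_power ra_al ra_q ra_const)

lemma ra_WL: "nu \<in> V \<Longrightarrow> ra (\<lambda>nu. WL (al nu) (q nu) J) nu"
  unfolding WL_def by (intro ra_add ra_mult ra_diff ra_power ra_al ra_q ra_QL ra_const)

text \<open>The bracket of h with the sum of QL_t S I^(2t) h^(J-1-t) over t < J telescopes to the
  last two monomials, I^(2J-1) h and I^(2J+1).\<close>

lemma Red_rel:
  assumes n4: "n = 4" and J: "1 \<le> J"
  shows "Red (4 * J + 2) (\<lambda>nu. const3 (QL (al nu) (q nu) J) * (AI ^ (2 * J - 1) * C nu) + const3 (WL (al nu) (q nu) J) * AI ^ (2 * J + 1))"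
proof -
  let ?k = "\<lambda>nu. \<Sum>t<J. const3 (QL (al nu) (q nu) t) * (S nu * (AI ^ (2 * t) * h nu ^ (J - 1 - t)))"
  have "ip (4 * J + 2 + 2 - n) ?k"
    by (intro ip_sum ip.smul ip.mon1 ra_QL) (auto simp: n4)
  then have "Red (4 * J + 2) (\<lambda>nu. const3 (1 / (8 * real J)) * pb (h nu) (?k nu))"
    by (intro Red_scal Red_image) auto
  then show ?thesis
  proof (rule Red_cng)
    fix nu
    define e where "e t = AI ^ (2 * t + 1) * h nu ^ (J - t)" for t
    define Q where "Q t = const3 (QL (al nu) (q nu) t)" for t
    let ?A = "const3 (al nu)" and ?B = "const3 (q nu - al nu ^ 2)"
    have "of_nat (t + 1) * Q (t + 1) = of_nat (2 * t + 1) * ?A * Q t + of_nat t * ?B * Q (t - 1)" for t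
      using arg_cong[OF QL_rec[of t "al nu" "q nu"], of const3] unfolding Q_def const3_simps(1,2) const3_of_nat .
    note tel = QL_telescope[of Q ?A ?B, OF this]
    have r: "pb (h nu) (S nu * (AI ^ (2 * t) * h nu ^ (J - 1 - t))) =
       const3 8 * (of_nat (t + 1) * ?B * e (t + 1) + of_nat (2 * t + 1) * ?A * e t - of_nat t * e (t - 1))" if "t < J" for t
    proof -
      have c: "const3 (real (2 * t) / 2 + 1) = (of_nat (t + 1) :: real fps3)" "const3 (real (2 * t) + 1) = (of_nat (2 * t + 1) :: real fps3)"
        "const3 (real (2 * t) / 2) = (of_nat t :: real fps3)"
        by (simp_all add: const3_of_nat[symmetric] const3_simps algebra_simps)
      have e: "AI ^ (2 * t + 3) * h nu ^ (J - 1 - t) = e (t + 1)" "AI ^ (2 * t + 1) * h nu ^ (J - 1 - t + 1) = e t"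
        "of_nat t * (AI ^ (2 * t - 1) * h nu ^ (J - 1 - t + 2)) = of_nat t * e (t - 1)"
      proof -
        have "J - 1 - t = J - (t + 1)" "J - 1 - t + 1 = J - t" "2 * t + 3 = 2 * (t + 1) + 1" using that by auto
        then show "AI ^ (2 * t + 3) * h nu ^ (J - 1 - t) = e (t + 1)" "AI ^ (2 * t + 1) * h nu ^ (J - 1 - t + 1) = e t"
          by (simp_all only: e_def)
        show "of_nat t * (AI ^ (2 * t - 1) * h nu ^ (J - 1 - t + 2)) = of_nat t * e (t - 1)"
        proof (cases "t = 0")
          case False
          then have "J - 1 - t + 2 = J - (t - 1)" "2 * t - 1 = 2 * (t - 1) + 1" using that by auto
          then show ?thesis by (simp only: e_def)
        qed simp
      qed
      show ?thesis unfolding rel4[OF n4] c e by (simp only: mult_ac)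
    qed
    have "pb (h nu) (?k nu) = (\<Sum>t<J. Q t * (const3 8 * (of_nat (t + 1) * ?B * e (t + 1) + of_nat (2 * t + 1) * ?A * e t - of_nat t * e (t - 1))))"
      unfolding pb_sum pb_const3_mult Q_def by (intro sum.cong refl) (simp only: r lessThan_iff)
    also have "\<dots> = const3 8 * (of_nat J * (Q J * e (J - 1) + ?B * Q (J - 1) * e J))"
      unfolding tel[symmetric] sum_distrib_left by (simp only: mult.left_commute)
    finally have p: "pb (h nu) (?k nu) = const3 (8 * real J) * (Q J * e (J - 1) + ?B * Q (J - 1) * e J)"
      by (simp only: const3_simps const3_of_nat mult.assoc)
    have "const3 (1 / (8 * real J)) * const3 (8 * real J) = (1 :: real fps3)"
      using J by (simp flip: const3_simps(2)) (simp add: const3_simps)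
    then have "const3 (1 / (8 * real J)) * pb (h nu) (?k nu) = Q J * e (J - 1) + ?B * Q (J - 1) * e J"
      unfolding p by (simp only: mult.assoc[symmetric] mult_1)
    \<comment> \<open>The term I^(2J-1) h is rewritten with h = C + al I^2; this is what adds al
      QL_J to the coefficient of I^(2J+1).\<close>
    also have "e (J - 1) = AI ^ (2 * J - 1) * C nu + ?A * AI ^ (2 * J + 1)"
    proof -
      obtain m where m: "J = Suc m" using J by (cases J) auto
      show ?thesis by (simp add: e_def m C_eq algebra_simps power2_eq_square)
    qed
    also have "e J = AI ^ (2 * J + 1)" by (simp add: e_def)
    finally show "const3 (1 / (8 * real J)) * pb (h nu) (?k nu) =
       const3 (QL (al nu) (q nu) J) * (AI ^ (2 * J - 1) * C nu) + const3 (WL (al nu) (q nu) J) * AI ^ (2 * J + 1)"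
      unfolding WL_def Q_def by (simp only: const3_simps ring_distribs mult_ac add_ac)
  qed
qed

lemma Red_div: assumes "\<And>nu. nu \<in> V \<Longrightarrow> ra a nu" "\<And>nu. nu \<in> V \<Longrightarrow> a nu \<noteq> 0" "Red D (\<lambda>nu. const3 (a nu) * e nu)"
  shows "Red D e"
proof (rule Red_cng)
  show "Red D (\<lambda>nu. const3 (inverse (a nu)) * (const3 (a nu) * e nu))"
    by (intro Red_smul ra_inverse assms)
  fix nu assume "nu \<in> V"
  then have "const3 (inverse (a nu)) * const3 (a nu) = (1 :: real fps3)"
    using assms(2) by (simp flip: const3_simps(2)) (simp add: const3_simps)
  then show "const3 (inverse (a nu)) * (const3 (a nu) * e nu) = e nu" by (simp flip: mult.assoc)
qed

text \<open>Degree 4 J + 2 contains both I^(2J+1) and I^(2J-1) C, and only one of them is permitted.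
  The relation of that degree is solved for the other: for odd J by dividing by \<open>WL\<close>,
  for even J by dividing by \<open>QL\<close>.\<close>

lemma Red_4_base:
  assumes n4: "n = 4"
  shows "2 \<le> a \<Longrightarrow> Red (2 * a) (\<lambda>_. AI ^ a)" "Red (2 * a + 4) (\<lambda>nu. AI ^ a * C nu)"
proof -
  show "Red (2 * a) (\<lambda>_. AI ^ a)" if a: "2 \<le> a"
  proof (cases "(a - 2) mod 4 = 1")
    case False
    moreover have "(2 * a - 4) div 2 = a - 2" using a by presburger
    ultimately show ?thesis using a by (intro Red_A) (simp add: okA_def keepA_def n4)
  next
    case True
    define i where "i = (a - 2) div 4"
    have ai: "a = 2 * (2 * i + 1) + 1" proof -
      have "a - 2 = 4 * i + 1" using True unfolding i_def by (metis div_mult_mod_eq mult.commute)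
      then show ?thesis using a by presburger
    qed
    let ?J = "2 * i + 1"
    have B: "Red (4 * ?J + 2) (\<lambda>nu. AI ^ (2 * ?J - 1) * C nu)"
    proof -
      have m: "(4 * i + 1) mod 4 = 1" by presburger
      have d: "2 * (4 * i + 1) + n = 4 * ?J + 2" "2 * ?J - 1 = 4 * i + 1" by (simp_all add: n4)
      show ?thesis using Red_B[of "4 * i + 1"] m by (simp only: d) (simp add: okB_def keepB_def n4)
    qed
    have "Red (4 * ?J + 2) (\<lambda>nu. (const3 (QL (al nu) (q nu) ?J) * (AI ^ (2 * ?J - 1) * C nu) + const3 (WL (al nu) (q nu) ?J) * AI ^ (2 * ?J + 1)) 
       - const3 (QL (al nu) (q nu) ?J) * (AI ^ (2 * ?J - 1) * C nu))"
      by (intro Red_diff Red_rel n4 Red_smul B ra_QL) simp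
    then have "Red (4 * ?J + 2) (\<lambda>nu. const3 (WL (al nu) (q nu) ?J) * AI ^ (2 * ?J + 1))" by (simp only: add_diff_cancel_left')
    from Red_div[OF ra_WL _ this] have "Red (4 * ?J + 2) (\<lambda>nu. AI ^ (2 * ?J + 1))"
      using QL_pos(3)[OF q_pos] by (metis less_irrefl)
    moreover have "4 * ?J + 2 = 2 * a" "2 * ?J + 1 = a" using ai by auto
    ultimately show ?thesis by (simp only:)
  qed
  show "Red (2 * a + 4) (\<lambda>nu. AI ^ a * C nu)"
  proof (cases "a mod 4 = 3")
    case False
    then show ?thesis using Red_B[of a] by (auto simp: okB_def keepB_def n4)
  next
    case True
    define i where "i = a div 4 + 1"
    have ai: "a = 2 * (2 * i) - 1" "1 \<le> i" proof -
      have "a = 4 * (a div 4) + 3" using True by (metis div_mult_mod_eq mult.commute)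
      moreover obtain c where "a div 4 = c" by simp
      ultimately show "a = 2 * (2 * i) - 1" "1 \<le> i" unfolding i_def by simp_all
    qed
    let ?J = "2 * i"
    have A: "Red (4 * ?J + 2) (\<lambda>nu. AI ^ (2 * ?J + 1))"
    proof -
      have "4 * i - 1 = 4 * (i - 1) + 3" using ai(2) by simp
      then have m: "(4 * i - 1) mod 4 = 3" by (simp only: mod_mult_self4) simp
      have d: "2 * (2 * ?J + 1) = 4 * ?J + 2" by simp
      have d2: "(4 * ?J + 2 - 4) div 2 = 4 * i - 1" using ai(2) by presburger
      have "okA n (4 * ?J + 2)" unfolding okA_def keepA_def d2 m using ai(2) by (simp add: n4)
      from Red_A[of "2 * ?J + 1", unfolded d, OF this] show ?thesis .
    qed
    have "Red (4 * ?J + 2) (\<lambda>nu. (const3 (QL (al nu) (q nu) ?J) * (AI ^ (2 * ?J - 1) * C nu) + const3 (WL (al nu) (q nu) ?J) * AI ^ (2 * ?J + 1)) 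
       - const3 (WL (al nu) (q nu) ?J) * AI ^ (2 * ?J + 1))"
      by (intro Red_diff Red_rel n4 Red_smul A ra_WL) (use ai in simp)
    then have "Red (4 * ?J + 2) (\<lambda>nu. const3 (QL (al nu) (q nu) ?J) * (AI ^ (2 * ?J - 1) * C nu))" by (simp only: add_diff_cancel_right')
    from Red_div[OF ra_QL _ this] have "Red (4 * ?J + 2) (\<lambda>nu. AI ^ (2 * ?J - 1) * C nu)"
      using QL_pos(1)[OF q_pos] by (metis less_irrefl)
    moreover have "4 * ?J + 2 = 2 * a + 4" "2 * ?J - 1 = a" using ai by auto
    ultimately show ?thesis by (simp only:)
  qed
qed

text \<open>Solving \<open>rel4\<close> for its highest power of h lowers that power by one or two,
  until at most one factor h is left.\<close>

lemma Red_4: assumes n4: "n = 4" shows "4 \<le> 2 * a + 4 * j \<Longrightarrow> Red (2 * a + 4 * j) (\<lambda>nu. AI ^ a * h nu ^ j)"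
proof (induction j arbitrary: a rule: less_induct)
  case (less j)
  consider "j = 0" | "j = 1" | i where "j = i + 2"
    by (metis One_nat_def add_2_eq_Suc' not0_implies_Suc)
  then show ?case
  proof cases
    case 1
    then show ?thesis using Red_4_base(1)[OF n4, of a] less.prems by simp
  next
    case 2
    have D: "2 * (a + 2) = 2 * a + 4 * j" "2 * a + 4 = 2 * a + 4 * j" using 2 by simp_all
    have "Red (2 * a + 4 * j) (\<lambda>nu. AI ^ (a + 2))" using Red_4_base(1)[OF n4, of "a + 2"] unfolding D(1) by simp
    from Red_add[OF Red_4_base(2)[OF n4, of a, unfolded D(2)] Red_smul[OF ra_al this]]
    show ?thesis by (rule Red_cng) (simp_all add: 2 C_eq algebra_simps power2_eq_square)
  next
    case 3
    define D where "D = 2 * a + 4 * j"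
    have D: "2 * (a + 4) + 4 * i = D" "2 * (a + 2) + 4 * (i + 1) = D" by (simp_all add: D_def 3)
    have 1: "Red D (\<lambda>nu. AI ^ (a + 4) * h nu ^ i)" using less.IH[of i "a + 4"] 3 unfolding D by (simp add: D_def)
    have 2: "Red D (\<lambda>nu. AI ^ (a + 2) * h nu ^ (i + 1))" using less.IH[of "i + 1" "a + 2"] 3 unfolding D by (simp add: D_def)
    have im: "Red D (\<lambda>nu. pb (h nu) (S nu * (AI ^ (a + 1) * h nu ^ i)))"
      by (rule Red_image[OF ip.mon1[OF refl]]) (simp add: D_def 3 n4)
    let ?b = "real (a + 1)"
    \<comment> \<open>The factor 2 / b inverts the coefficient b / 2 that I^a h^(i+2) has in
      \<open>rel4\<close> for the exponent b = a + 1, and 1/8 its overall constant.\<close>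
    have "Red D (\<lambda>nu. const3 (2 / ?b) * (const3 (q nu - al nu ^ 2) * (const3 (?b / 2 + 1) * (AI ^ (a + 4) * h nu ^ i))
       + const3 (al nu) * (const3 (?b + 1) * (AI ^ (a + 2) * h nu ^ (i + 1)))
       - const3 (1/8) * pb (h nu) (S nu * (AI ^ (a + 1) * h nu ^ i))))"
      by (intro Red_scal Red_diff Red_add Red_smul ra_al ra_diff ra_q ra_power 1 2 im)
    then have "Red D (\<lambda>nu. AI ^ a * h nu ^ j)"
    proof (rule Red_cng)
      fix nu
      have bb: "2 / ?b * (?b / 2) = 1" by (simp del: of_nat_add of_nat_Suc)
      have e1: "const3 (1/8) * (const3 8 * u) = u" for u :: "real fps3"
        by (simp add: const3_simps(6) flip: mult.assoc const3_simps(2))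
      have e2: "const3 (2 / ?b) * (const3 (?b / 2) * u) = u" for u :: "real fps3"
        unfolding mult.assoc[symmetric] const3_simps(2)[symmetric] bb const3_simps(6) by (rule mult_1)
      note e = e1 e2
      have s: "a + 1 + 3 = a + 4" "a + 1 + 1 = a + 2" "a + 1 - 1 = a" "i + 2 = j" using 3 by auto
      show "const3 (2 / ?b) * (const3 (q nu - al nu ^ 2) * (const3 (?b / 2 + 1) * (AI ^ (a + 4) * h nu ^ i))
       + const3 (al nu) * (const3 (?b + 1) * (AI ^ (a + 2) * h nu ^ (i + 1)))
       - const3 (1/8) * pb (h nu) (S nu * (AI ^ (a + 1) * h nu ^ i))) = AI ^ a * h nu ^ j"
        unfolding rel4[OF n4] e s by (simp only: mult.assoc diff_diff_eq2 add_diff_cancel_left' e)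
    qed
    then show ?thesis by (simp add: D_def)
  qed
qed

lemma Red_3: assumes n3: "n = 3" shows "3 \<le> 2 * a + 3 * j \<Longrightarrow> Red (2 * a + 3 * j) (\<lambda>nu. AI ^ a * h nu ^ j)"
proof -
  have e: "const3 (1/3) * (const3 3 * u) = u" "0 < b \<Longrightarrow> const3 (1 / b) * (const3 b * u) = u" for u :: "real fps3" and b
    by (simp_all add: const3_simps(6) flip: mult.assoc const3_simps(2))
  have im: "Red D (\<lambda>nu. const3 (1/3) * pb (h nu) (S nu * (AI ^ b * h nu ^ j)))" if "2 * (b + 2) + 3 * j = D" for b j D
    by (rule Red_scal[OF Red_image[OF ip.mon1[OF refl]]]) (use that in \<open>simp add: n3\<close>)
  have im': "Red D (\<lambda>nu. const3 (q nu * (real b + 3/2)) * (AI ^ (b + 2) * h nu ^ j) - const3 (real b) * (AI ^ (b - 1) * h nu ^ (j + 2)))"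
    if "2 * (b + 2) + 3 * j = D" for b j D
    by (rule Red_cng[OF im[OF that]]) (simp add: rel3[OF n3] e)
  \<comment> \<open>At b = 0 the relation has a single term, so I^2 h^j is in the image; climbing by
    three in the exponent of I reaches all exponents that are 2 modulo 3.\<close>
  have two: "Red (2 * (3 * r + 2) + 3 * j) (\<lambda>nu. AI ^ (3 * r + 2) * h nu ^ j)" for r j
  proof (induction r arbitrary: j)
    case 0
    show ?case
      by (rule Red_div[OF _ _ Red_cng[OF im'[of 0 j]], of "\<lambda>nu. q nu * (real 0 + 3/2)"])
         (auto simp: const3_simps intro!: ra_divide_const ra_mult ra_q ra_const dest: q_pos)
  next
    case (Suc r)
    let ?D = "2 * (3 * Suc r + 2) + 3 * j"
    have D: "2 * (3 * r + 2) + 3 * (j + 2) = ?D" by simp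
    have 1: "Red ?D (\<lambda>nu. AI ^ (3 * r + 2) * h nu ^ (j + 2))" using Suc[of "j + 2"] unfolding D .
    have "Red ?D (\<lambda>nu. (const3 (q nu * (real (3 * Suc r) + 3/2)) * (AI ^ (3 * Suc r + 2) * h nu ^ j)
       - const3 (real (3 * Suc r)) * (AI ^ (3 * Suc r - 1) * h nu ^ (j + 2))) + const3 (real (3 * Suc r)) * (AI ^ (3 * r + 2) * h nu ^ (j + 2)))"
      by (intro Red_add im' Red_scal 1 refl)
    then have 2: "Red ?D (\<lambda>nu. const3 (q nu * (real (3 * Suc r) + 3/2)) * (AI ^ (3 * Suc r + 2) * h nu ^ j))"
      by (rule Red_cng) simp
    have nz: "real (3 * Suc r) + 3/2 \<noteq> 0" by (simp add: add_pos_nonneg)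
    show ?case
    proof (rule Red_div[OF _ _ 2])
      fix nu assume nu: "nu \<in> V"
      show "ra (\<lambda>nu. q nu * (real (3 * Suc r) + 3/2)) nu" by (rule ra_mult[OF ra_q[OF nu] ra_const])
      show "q nu * (real (3 * Suc r) + 3/2) \<noteq> 0" using q_pos[OF nu] nz by simp
    qed
  qed
  \<comment> \<open>For the other exponents the relation is used in the opposite direction, lowering
    the power of h by two. The exponent of I keeps its class modulo 3, so the descent ends in a
    permitted term.\<close>
  have other: "a mod 3 \<noteq> 2 \<Longrightarrow> 3 \<le> 2 * a + 3 * j \<Longrightarrow> Red (2 * a + 3 * j) (\<lambda>nu. AI ^ a * h nu ^ j)" for a j
  proof (induction j arbitrary: a rule: less_induct)
    case (less j)
    consider "j = 0" | "j = 1" | i where "j = i + 2"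
      by (metis One_nat_def add_2_eq_Suc' not0_implies_Suc)
    then show ?case
    proof cases
      case 1
      then have "2 \<le> a" using less.prems by simp
      moreover from this have "(a - 2) mod 3 \<noteq> 0" using less.prems(1) by presburger
      moreover from calculation(1) have "(2 * a - 4) div 2 = a - 2" by presburger
      ultimately have "okA n (2 * a)" by (simp add: okA_def keepA_def n3)
      from Red_A[OF this] 1 show ?thesis by simp
    next
      case 2
      have "okB n (2 * a + n)" using less.prems by (auto simp: okB_def keepB_def n3)
      from Red_B[OF this] have "Red (2 * a + 3 * j) (\<lambda>nu. AI ^ a * C nu)" by (simp add: 2 n3)
      then show ?thesis by (rule Red_cng) (simp add: C_eq al3[OF _ n3] const3_simps 2)
    next
      case 3
      let ?D = "2 * a + 3 * j"
      have "(a + 3) mod 3 \<noteq> 2" using less.prems by presburger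
      moreover have D: "2 * (a + 3) + 3 * i = ?D" using 3 by simp
      ultimately have 1: "Red ?D (\<lambda>nu. AI ^ (a + 3) * h nu ^ i)" using less.IH[of i "a + 3"] 3 less.prems(2) unfolding D by simp
      have s: "a + 1 + 2 = a + 3" "a + 1 - 1 = a" "i + 2 = j" using 3 by auto
      have "Red ?D (\<lambda>nu. const3 (q nu * (real (a + 1) + 3/2)) * (AI ^ (a + 3) * h nu ^ i) - 
         (const3 (q nu * (real (a + 1) + 3/2)) * (AI ^ (a + 1 + 2) * h nu ^ i) - const3 (real (a + 1)) * (AI ^ (a + 1 - 1) * h nu ^ (i + 2))))"
        by (intro Red_diff Red_smul im' 1 ra_mult ra_q ra_const) (use 3 in simp_all)
      then have "Red ?D (\<lambda>nu. const3 (real (a + 1)) * (AI ^ a * h nu ^ j))"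
        unfolding s by (rule Red_cng) simp
      from Red_div[OF ra_const _ this] show ?thesis by simp
    qed
  qed
  show "Red (2 * a + 3 * j) (\<lambda>nu. AI ^ a * h nu ^ j)" if "3 \<le> 2 * a + 3 * j"
  proof (cases "a mod 3 = 2")
    case True
    then have "a = 3 * (a div 3) + 2" by (metis div_mult_mod_eq mult.commute)
    then show ?thesis using two[of "a div 3" j] by simp
  qed (use other that in auto)
qed

lemma Red_ip: "ip D e \<Longrightarrow> 3 \<le> D \<Longrightarrow> Red D e"
proof (induction rule: ip.induct)
  case (zero D) show ?case by (rule Red_nf[OF nf_zero])
next
  case (mon0 a j D)
  \<comment> \<open>For n = 4 the degree is even, so at least 3 means at least 4, where the
    reduction starts.\<close>
  then have "2 * a + 4 * j \<noteq> 3" by presburger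
  then show ?case using n mon0 Red_3[of a j] Red_4[of a j] by auto
next
  case (mon1 a j D) then show ?case by (intro Red_S)
next
  case (cng D f f') then show ?case using Red_cng by blast
qed (auto intro: Red_add Red_smul)

end

subsection \<open>Evaluation on rays\<close>

text \<open>Restriction to the line of direction \<open>ph\<close>, scaled by sqrt 2 so that I
  becomes the square of the coordinate. A homogeneous polynomial turns into a trigonometric
  polynomial in \<open>ph\<close> times a power of that coordinate.\<close>

definition ray :: "real \<Rightarrow> real fps3 \<Rightarrow> real fps3" where
  "ray ph f = subst_xy f (const3 (sqrt 2 * cos ph) * var_x, const3 (sqrt 2 * sin ph) * var_x)"

lemma vanishes_ray: "vanishes_at_origin (const3 a * var_x, const3 b * var_x)"
  by (intro wt_vanishes wt_mult_left wt_var)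

lemma alg_ray: "alg (ray ph)"
  using alg_subst[OF vanishes_ray] by (simp add: ray_def[abs_def])

lemmas ray_simps = alg_add[OF alg_ray] alg_mult[OF alg_ray] alg_simps[OF alg_ray]

lemma ray_var: "ray ph var_x = const3 (sqrt 2 * cos ph) * var_x" "ray ph var_y = const3 (sqrt 2 * sin ph) * var_x"
  by (simp_all add: ray_def subst_var[OF vanishes_ray])

lemma ray_action: "ray ph AI = var_x ^ 2"
proof -
  have e: "1 / 2 * ((sqrt 2 * cos ph) ^ 2 + (sqrt 2 * sin ph) ^ 2) = 1"
    using sin_cos_squared_add[of ph] by (simp add: power_mult_distrib add.commute flip: distrib_left)
  have "ray ph AI = const3 (1 / 2 * ((sqrt 2 * cos ph) ^ 2 + (sqrt 2 * sin ph) ^ 2)) * var_x ^ 2"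
    by (simp only: action_I_def ray_simps ray_var const3_simps const3_power power_mult_distrib ring_distribs mult.assoc)
  then show ?thesis unfolding e by (simp add: const3_simps)
qed

lemma ray_Z: "ray ph (Zr p) = const3 (sqrt 2 ^ p * cos (real p * ph)) * var_x ^ p"
  "ray ph (Zi p) = const3 (sqrt 2 ^ p * sin (real p * ph)) * var_x ^ p"
proof (induction p)
  case (Suc p)
  have e: "real (Suc p) * ph = ph + real p * ph" by (simp add: algebra_simps)
  { case 1 show ?case unfolding e
      by (simp add: Z_Suc ray_simps ray_var Suc cos_add const3_simps algebra_simps) }
  { case 2 show ?case unfolding e
      by (simp add: Z_Suc ray_simps ray_var Suc sin_add const3_simps algebra_simps) }
qed (simp_all add: ray_simps const3_simps)

lemma const3_var_power_eq: "const3 a * var_x ^ D = const3 b * (var_x ^ D :: real fps3) \<Longrightarrow> a = b"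
proof -
  assume *: "const3 a * var_x ^ D = const3 b * (var_x ^ D :: real fps3)"
  have "coeff3 (var_x ^ D * var_y ^ 0 :: real fps3) D 0 0 = 1"
    using coeff3_monomial[of "1 :: real fps" D 0 D 0 0] by simp
  then show ?thesis using arg_cong[OF *, of "\<lambda>f. coeff3 f D 0 0"] by simp
qed

text \<open>By the intermediate value theorem \<open>f\<close> takes infinitely many values inside
  the interval, and all of them are roots.\<close>

lemma poly_zero_infinite: 
  fixes p :: "real poly" and f :: "real \<Rightarrow> real"
  assumes "a < b" "continuous_on {a..b} f" "f a \<noteq> f b" "\<And>t. a < t \<Longrightarrow> t < b \<Longrightarrow> poly p (f t) = 0"
  shows "p = 0"
proof (rule ccontr)
  assume "p \<noteq> 0"
  then have fin: "finite {x. poly p x = 0}" by (rule poly_roots_finite)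
  have "{min (f a) (f b)<..<max (f a) (f b)} \<subseteq> {x. poly p x = 0}"
  proof
    fix y assume y: "y \<in> {min (f a) (f b)<..<max (f a) (f b)}"
    have "\<exists>t. a \<le> t \<and> t \<le> b \<and> f t = y"
      using IVT'[of f a y b] IVT2'[of f b y a] y assms(1,2) by (auto simp: min_def max_def split: if_splits)
    then obtain t where t: "a \<le> t" "t \<le> b" "f t = y" by auto
    with y have "t \<noteq> a" "t \<noteq> b" by auto
    with t assms(4)[of t] show "y \<in> {x. poly p x = 0}" by auto
  qed
  then have "finite {min (f a) (f b)<..<max (f a) (f b)}" using fin by (rule finite_subset)
  moreover have "min (f a) (f b) < max (f a) (f b)" using assms(3) by auto
  ultimately show False by (simp add: infinite_Ioo)
qed

subsection \<open>Uniqueness for the homological equation\<close>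

context res
begin

definition lin0 :: "nat \<Rightarrow> (nat \<Rightarrow> real) \<Rightarrow> real \<Rightarrow> real fps3" where
  "lin0 D u nu = (\<Sum>j\<le>D. const3 (u j) * (AI ^ ((D - n * j) div 2) * h nu ^ j))"

definition lin1 :: "nat \<Rightarrow> (nat \<Rightarrow> real) \<Rightarrow> real \<Rightarrow> real fps3" where
  "lin1 D v nu = (\<Sum>j\<le>D. const3 (v j) * (S nu * (AI ^ ((D - n * j - n) div 2) * h nu ^ j)))"

text \<open>Indices whose monomial really has degree \<open>D\<close>. Elsewhere truncated
  subtraction and halving would give wrong exponents, so the coefficients there are kept at
  zero.\<close>

definition val0 :: "nat \<Rightarrow> nat \<Rightarrow> bool" where "val0 D j \<longleftrightarrow> n * j \<le> D \<and> even (D - n * j)"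
definition val1 :: "nat \<Rightarrow> nat \<Rightarrow> bool" where "val1 D j \<longleftrightarrow> n * j + n \<le> D \<and> even (D - n * j - n)"

lemma ip_canon:
  assumes "ip D f" "nu \<in> V"
  shows "\<exists>u v. (\<forall>j. \<not> val0 D j \<longrightarrow> u j = 0) \<and> (\<forall>j. \<not> val1 D j \<longrightarrow> v j = 0) \<and> f nu = lin0 D u nu + lin1 D v nu"
  using assms
proof (induction rule: ip.induct)
  case (zero D)
  show ?case by (rule exI[of _ "\<lambda>_. 0"], rule exI[of _ "\<lambda>_. 0"]) (simp add: lin0_def lin1_def const3_simps)
next
  case (add D f f')
  then obtain u v u' v' where *: "\<forall>j. \<not> val0 D j \<longrightarrow> u j = 0" "\<forall>j. \<not> val1 D j \<longrightarrow> v j = 0" "f nu = lin0 D u nu + lin1 D v nu"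
    "\<forall>j. \<not> val0 D j \<longrightarrow> u' j = 0" "\<forall>j. \<not> val1 D j \<longrightarrow> v' j = 0" "f' nu = lin0 D u' nu + lin1 D v' nu" by blast
  show ?case
    by (rule exI[of _ "\<lambda>j. u j + u' j"], rule exI[of _ "\<lambda>j. v j + v' j"])
       (use * in \<open>simp add: lin0_def lin1_def const3_simps distrib_right sum.distrib\<close>)
next
  case (smul a D f)
  then obtain u v where *: "\<forall>j. \<not> val0 D j \<longrightarrow> u j = 0" "\<forall>j. \<not> val1 D j \<longrightarrow> v j = 0" "f nu = lin0 D u nu + lin1 D v nu" by blast
  show ?case
    by (rule exI[of _ "\<lambda>j. a nu * u j"], rule exI[of _ "\<lambda>j. a nu * v j"])
       (use * in \<open>simp add: lin0_def lin1_def const3_simps distrib_left sum_distrib_left mult.assoc\<close>)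
next
  case (mon0 a j D)
  have "j \<le> D" using mon0 n0 by (metis le_add2 le_trans mult_le_mono1 nat_mult_1 Suc_leI One_nat_def)
  then have "(\<Sum>i\<le>D. const3 (if i = j then 1 else 0) * (AI ^ ((D - n * i) div 2) * h nu ^ i)) = AI ^ a * h nu ^ j"
    using mon0 by (subst sum.remove[of _ j]) (auto simp: const3_simps)
  then show ?case
    by (intro exI[of _ "\<lambda>i. if i = j then 1 else 0"] exI[of _ "\<lambda>_. 0"])
       (use mon0 in \<open>auto simp: lin0_def lin1_def const3_simps val0_def\<close>)
next
  case (mon1 a j D)
  have "j \<le> n * j" using n0 by simp
  then have "j \<le> D" using mon1 by linarith
  then have *: "(\<Sum>i\<le>D. const3 (if i = j then 1 else 0) * (S nu * (AI ^ ((D - n * i - n) div 2) * h nu ^ i))) = S nu * (AI ^ a * h nu ^ j)"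
    using mon1 by (subst sum.remove[of _ j]) (auto simp: const3_simps)
  show ?case
    by (rule exI[of _ "\<lambda>_. 0"], rule exI[of _ "\<lambda>i. if i = j then 1 else 0"])
       (use mon1 * in \<open>auto simp: lin0_def lin1_def const3_simps val1_def\<close>)
next
  case (cng D f f')
  then show ?case by metis
qed

end

text \<open>The coefficients of the preimage satisfy a three-term recursion; in each case it forces them to vanish.\<close>

lemma rec4:
  fixes v :: "nat \<Rightarrow> real" and al q x y :: real
  assumes q: "0 < q" and val: "\<And>j. \<not> 4 * j + 4 \<le> D' \<or> odd D' \<Longrightarrow> v j = 0"
    and b: "\<And>j. b j = (real D' - 4 * real j - 4) / 2"
    and E2: "\<And>l. (q - al ^ 2) * (b (l + 2) / 2 + 1) * v (l + 2) + al * (b (l + 1) + 1) * v (l + 1) = b l / 2 * v l"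
    and E1: "8 * ((q - al ^ 2) * (b 1 / 2 + 1) * v 1 + al * (b 0 + 1) * v 0) = y"
    and E0: "8 * ((q - al ^ 2) * (b 0 / 2 + 1) * v 0) = x - y * al"
    and A: "\<not> okA 4 (D' + 2) \<Longrightarrow> x = 0" and B: "\<not> okB 4 (D' + 2) \<Longrightarrow> y = 0"
  shows "v j = 0"
\<comment> \<open>\<open>b j\<close> can only vanish for D' = 4 j + 4. If no such j exists, the
  recursion started above the degree yields zero all the way down.\<close>
proof (cases "\<exists>m. D' = 4 * m + 4")
  case False
  have "v j = 0" if "D' < j + k" for j k
    using that
  proof (induction k arbitrary: j)
    case 0 then show ?case by (intro val) auto
  next
    case (Suc k)
    have "v (j + 1) = 0" "v (j + 2) = 0" using Suc.IH[of "j + 1"] Suc.IH[of "j + 2"] Suc.prems by auto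
    then have z: "b j / 2 * v j = 0" using E2[of j] by simp
    show ?case
    proof (cases "4 * j + 4 \<le> D' \<and> even D'")
      case True
      have "D' \<noteq> 4 * j + 4" using False by blast
      then have "real D' \<noteq> real (4 * j + 4)" by (metis of_nat_eq_iff)
      then have "b j \<noteq> 0" by (simp add: b)
      then show ?thesis using z by simp
    next
      case False
      then show ?thesis using val by blast
    qed
  qed
  from this[of j "D' + 1"] show ?thesis by simp
next
  case True
  then obtain m where m: "D' = 4 * m + 4" by auto
  have bm: "b (m - t) = 2 * real t" if "t \<le> m" for t using that by (simp add: b m of_nat_diff)
  have above: "v i = 0" if "m < i" for i using that by (intro val) (simp add: m)
  \<comment> \<open>With b (m - t) = 2 t, descending from \<open>v m\<close> is the recursion of the
    rescaled Legendre polynomials.\<close>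
  have Q: "v (m - t) = v m * QL al q t" if "t \<le> m" for t
    using that
  proof (induction t rule: induct_nat_012)
    case 1
    have "m - 1 + 1 = m" "m - 1 + 2 = m + 1" using 1 by auto
    then have "al * (b m + 1) * v m = b (m - 1) / 2 * v (m - 1)"
      using E2[of "m - 1"] above[of "m + 1"] by simp
    then show ?case using bm[of 0] bm[of 1] 1 by (simp add: mult.commute)
  next
    case (ge2 t)
    have e: "m - Suc (Suc t) + 1 = m - Suc t" "m - Suc (Suc t) + 2 = m - t" using ge2.prems by auto
    have "(q - al\<^sup>2) * (real t + 1) * (v m * QL al q t) + al * (2 * real t + 3) * (v m * QL al q (Suc t)) = (real t + 2) * v (m - Suc (Suc t))"
      using E2[of "m - Suc (Suc t)"] bm[of t] bm[of "Suc t"] bm[of "Suc (Suc t)"] ge2 unfolding e by (simp add: algebra_simps)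
    then have "v (m - Suc (Suc t)) = ((q - al\<^sup>2) * (real t + 1) * (v m * QL al q t) + al * (2 * real t + 3) * (v m * QL al q (Suc t))) / (real t + 2)"
      by (simp add: field_simps)
    then show ?case by (simp add: algebra_simps)
  qed simp
  have v0: "v 0 = v m * QL al q m" using Q[of m] by simp
  have b0: "b 0 = 2 * real m" using bm[of m] by simp
  have t1: "(q - al ^ 2) * (b 1 / 2 + 1) * v 1 = v m * (real m * (q - al ^ 2) * QL al q (m - 1))"
  proof (cases "m = 0")
    case True then show ?thesis using above[of 1] by simp
  next
    case False
    then have "b 1 / 2 + 1 = real m" "v 1 = v m * QL al q (m - 1)" using bm[of "m - 1"] Q[of "m - 1"] by (auto simp: of_nat_diff diff_divide_distrib)
    then show ?thesis by (simp only: mult_ac)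
  qed
  have y: "y = 8 * v m * (real (m + 1) * QL al q (m + 1))"
  proof -
    have "y = 8 * (v m * (real m * (q - al ^ 2) * QL al q (m - 1)) + al * (2 * real m + 1) * (v m * QL al q m))"
      using E1 unfolding t1 b0 v0 by simp
    then show ?thesis unfolding QL_rec by (simp add: algebra_simps)
  qed
  have x: "x = 8 * v m * real (m + 1) * WL al q (m + 1)"
    using E0 unfolding y by (simp add: WL_def b0 v0 algebra_simps del: QL.simps)
  \<comment> \<open>\<open>x\<close> and \<open>y\<close> are positive multiples of
    \<open>v m\<close> times \<open>WL\<close> and \<open>QL\<close> at index m + 1. The degree 4 m
    + 6 forbids one of the two normal terms, and it is the one whose factor is positive.\<close>
  have vm: "v m = 0"
  proof (cases "even m")
    case True
    then obtain i where i: "m = 2 * i" by auto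
    have "(4 * m + 2) div 2 = 4 * i + 1" using i by simp
    moreover have "(4 * i + 1) mod 4 = 1" by presburger
    ultimately have "\<not> okA 4 (D' + 2)" by (simp add: okA_def keepA_def m)
    then have "x = 0" by (rule A)
    then show ?thesis using x QL_pos(3)[OF q, of al i] by (simp add: i)
  next
    case False
    then obtain i where i: "m = 2 * i + 1" by (auto elim: oddE)
    have "(4 * m + 2) div 2 = 4 * i + 3" using i by simp
    moreover have "(4 * i + 3) mod 4 = 3" by presburger
    ultimately have "\<not> okB 4 (D' + 2)" by (simp add: okB_def keepB_def m)
    then have "y = 0" by (rule B)
    then show ?thesis using y QL_pos(1)[OF q, of al "i + 1"] by (simp add: i del: QL.simps)
  qed
  show ?thesis
  proof (cases "j \<le> m")
    case True
    then show ?thesis using Q[of "m - j"] vm by simp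
  qed (use above in auto)
qed

lemma rec3:
  fixes v :: "nat \<Rightarrow> real" and q x y :: real
  assumes q: "0 < q" and val: "\<And>j. \<not> (3 * j + 3 \<le> D' \<and> even (D' - 3 * j - 3)) \<Longrightarrow> v j = 0"
    and b: "\<And>j. 3 * j + 3 \<le> D' \<Longrightarrow> b j = (real D' - 3 * real j - 3) / 2"
    and E2: "\<And>l. q * (b (l + 2) + 3/2) * v (l + 2) = b l * v l"
    and E1: "3 * (q * (b 1 + 3/2) * v 1) = y"
    and E0: "3 * (q * (b 0 + 3/2) * v 0) = x"
    and A: "\<not> okA 3 (D' + 1) \<Longrightarrow> x = 0" and B: "\<not> okB 3 (D' + 1) \<Longrightarrow> y = 0"
  shows "v j = 0"
proof (cases "\<exists>m. D' = 3 * m + 3")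
  case False
  have "v j = 0" if "D' < j + k" for j k
    using that
  proof (induction k arbitrary: j)
    case 0 then show ?case by (intro val) auto
  next
    case (Suc k)
    have "v (j + 2) = 0" using Suc.IH[of "j + 2"] Suc.prems by auto
    then have z: "b j * v j = 0" using E2[of j] by simp
    show ?case
    proof (cases "3 * j + 3 \<le> D'")
      case True
      have "D' \<noteq> 3 * j + 3" using False by blast
      then have "real D' \<noteq> real (3 * j + 3)" by (metis of_nat_eq_iff)
      then have "b j \<noteq> 0" by (simp add: b[OF True])
      then show ?thesis using z by simp
    next
      case False
      then show ?thesis using val by blast
    qed
  qed
  from this[of j "D' + 1"] show ?thesis by simp
next
  case True
  then obtain m where m: "D' = 3 * m + 3" by auto
  have pos: "v j = 0" if "q * (b j + 3/2) * v j = 0" for j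
  proof (cases "3 * j + 3 \<le> D'")
    case True
    then have "0 \<le> b j" unfolding b[OF True] by simp
    then have "q * (b j + 3/2) \<noteq> 0" using q by simp
    then show ?thesis using that by simp
  qed (use val in blast)
  \<comment> \<open>In degree 3 m + 4 neither normal term is permitted: for one parity of m its
    index has the forbidden residue, for the other parity the degree does not fit.\<close>
  have xy: "x = 0 \<and> y = 0"
  proof (cases "even m")
    case True
    then obtain i where i: "m = 2 * i" by auto
    have "\<not> okA 3 (D' + 1)" "\<not> okB 3 (D' + 1)" by (simp_all add: okA_def keepA_def okB_def m i)
    then show ?thesis using A B by blast
  next
    case False
    then obtain i where i: "m = 2 * i + 1" by (auto elim: oddE)
    have "(6 * i + 4) div 2 = 3 * i + 2" by simp
    moreover have "(3 * i + 2) mod 3 = 2" by presburger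
    ultimately have "\<not> okB 3 (D' + 1)" by (simp add: okB_def keepB_def m i)
    moreover have "\<not> okA 3 (D' + 1)" by (simp add: okA_def m i)
    ultimately show ?thesis using A B by blast
  qed
  have v01: "v 0 = 0" "v 1 = 0" using E0 E1 xy by (intro pos; simp)+
  show ?thesis
  proof (induction j rule: induct_nat_012)
    case (ge2 j)
    then have "q * (b (j + 2) + 3/2) * v (j + 2) = 0" using E2[of j] by simp
    from pos[OF this] show ?case by simp
  qed (use v01 in auto)
qed

text \<open>Restricted to rays, the equation becomes an identity in the angle. Its odd part
  determines the coefficients of I^a h^j and leaves only those with a = 0; its even part is a
  polynomial identity whose coefficients are the recursion that kills the terms with
  \<open>S\<close>.\<close>

lemma homological_unique:
  fixes n :: nat and al g :: real and kp :: "real fps3"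
  assumes n: "n = 3 \<or> n = 4" and al: "n = 3 \<Longrightarrow> al = 0" and gpos: "0 < g"
    and kp: "homog D' kp" "rot (2 * pi / real n) kp = kp" and D: "D = D' + n - 2"
    and eq: "pb (hh n al g 0) kp = const3 x * AI ^ (D div 2) + const3 y * (AI ^ ((D - n) div 2) * CC n g 0)"
    and A: "\<not> okA n D \<Longrightarrow> x = 0" and B: "\<not> okB n D \<Longrightarrow> y = 0"
  shows "kp = 0 \<or> (\<exists>c j. kp = const3 c * hh n al g 0 ^ j \<and> n * j = D')"
proof -
  interpret res n UNIV "\<lambda>_. al" "\<lambda>_. g" "\<lambda>_. 0"
    by unfold_locales (use n al gpos in \<open>auto simp: ra_const\<close>)
  define h' S' C' where "h' = h 0" and "S' = S 0" and "C' = C 0"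
  have h': "hh n al g 0 = h'" "CC n g 0 = C'" by (simp_all add: h'_def h_def C'_def C_def)
  have "ip D' (\<lambda>_. kp)" by (rule ip_invariant) (use kp in auto)
  from ip_canon[OF this, of 0] obtain u v where uv: "\<And>j. \<not> val0 D' j \<Longrightarrow> u j = 0" "\<And>j. \<not> val1 D' j \<Longrightarrow> v j = 0"
    and k: "kp = lin0 D' u 0 + lin1 D' v 0" by auto
  define qv where "qv = q 0"
  have qv: "0 < qv" using q_pos[of 0] by (simp add: qv_def)
  define a b where "a j = real ((D' - n * j) div 2)" and "b j = (real D' - real n * real j - real n) / 2" for j
  define G where "G = g * sqrt 2 ^ n"
  have G: "0 < G" using gpos by (simp add: G_def)
  define c s where "c ph = G * cos (real n * ph)" and "s ph = G * sin (real n * ph)" for ph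
  have rh: "ray ph h' = const3 (al + c ph) * var_x ^ n" for ph
  proof -
    have "const3 al * (var_x ^ 2) ^ 2 = const3 al * (var_x ^ n :: real fps3)"
      using n al by (auto simp: const3_simps)
    then show ?thesis by (simp add: h'_def h_def hh_def CC_def ray_simps ray_action ray_Z c_def G_def const3_simps algebra_simps)
  qed
  have rC: "ray ph C' = const3 (c ph) * var_x ^ n" for ph
    by (simp add: C'_def C_def CC_def ray_simps ray_Z c_def G_def const3_simps algebra_simps)
  have rS: "ray ph S' = const3 (s ph) * var_x ^ n" for ph
    by (simp add: S'_def S_def SS_def ray_simps ray_Z s_def G_def const3_simps algebra_simps)
  have rm: "ray ph (AI ^ i * h' ^ j) = const3 ((al + c ph) ^ j) * var_x ^ (2 * i + n * j)" for ph i j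
    by (simp add: ray_simps ray_action rh power_mult_distrib const3_power power_add mult_ac flip: power_mult)
  \<comment> \<open>The value on a ray of the bracket computed in \<open>rel4\<close> or
    \<open>rel3\<close>, as a polynomial in t = al + c, the value of h there.\<close>
  define R where "R j t = (if n = 4 then 8 * ((qv - al ^ 2) * (b j / 2 + 1) * t ^ j + al * (b j + 1) * t ^ (j + 1) - b j / 2 * t ^ (j + 2))
     else 3 * (qv * (b j + 3/2) * t ^ j - b j * t ^ (j + 2)))" for j t
  have D2: "D' + n - 2 = D" using D by simp
  have r0: "ray ph (const3 (u j) * pb h' (AI ^ ((D' - n * j) div 2) * h' ^ j)) = const3 (s ph * (real n * (u j * a j) * (al + c ph) ^ j)) * var_x ^ D" for ph j
  proof (cases "val0 D' j \<and> (D' - n * j) div 2 \<noteq> 0")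
    case True
    define M where "M = (D' - n * j) div 2"
    have M: "D' - n * j = 2 * M" "n * j \<le> D'" "M \<noteq> 0" using True[unfolded val0_def] dvd_mult_div_cancel[of 2 "D' - n * j"] unfolding M_def by (blast | metis)+
    then have M2: "(D' - n * j) div 2 = M" by simp
    have "2 \<le> n" using n by auto
    then have e: "n + (2 * ((D' - n * j) div 2 - 1) + n * j) = D" unfolding M2 D using M by linarith
    have "ray ph (const3 (u j) * pb h' (AI ^ ((D' - n * j) div 2) * h' ^ j)) =
      const3 (u j) * (const3 (a j) * const3 (real n) * (const3 (s ph) * var_x ^ n * (const3 ((al + c ph) ^ j) * var_x ^ (2 * ((D' - n * j) div 2 - 1) + n * j))))"
      unfolding h'_def pb_h_mon unfolding h'_def[symmetric] S'_def[symmetric]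
      by (simp only: ray_simps(2,7) rS rm[unfolded ray_simps] a_def const3_of_nat[symmetric] ray_simps(7)) (simp add: ray_simps rS ray_action rm[unfolded ray_simps ray_action])
    also have "\<dots> = const3 (s ph * (real n * (u j * a j) * (al + c ph) ^ j)) * var_x ^ (n + (2 * ((D' - n * j) div 2 - 1) + n * j))"
      by (simp add: const3_simps power_add mult_ac)
    finally show ?thesis unfolding e .
  next
    case False
    then have z: "u j * a j = 0" "const3 (u j) * pb h' (AI ^ ((D' - n * j) div 2) * h' ^ j) = 0"
      using uv(1)[of j] by (auto simp: a_def const3_simps h'_def pb_h_mon)
    show ?thesis unfolding z by (simp add: ray_simps const3_simps(5))
  qed
  have r1: "ray ph (const3 (v j) * pb h' (S' * (AI ^ ((D' - n * j - n) div 2) * h' ^ j))) = const3 (v j * R j (al + c ph)) * var_x ^ D" for ph j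
  proof (cases "val1 D' j")
    case True
    define bb where "bb = (D' - n * j - n) div 2"
    have "2 * bb = D' - n * j - n" unfolding bb_def using True[unfolded val1_def] by (intro dvd_mult_div_cancel) blast
    then have e0: "2 * bb + n * j + n = D'" using True[unfolded val1_def] by linarith
    have bj: "real bb = b j" using arg_cong[OF e0, of real] by (simp add: b_def)
    have "ray ph (pb h' (S' * (AI ^ bb * h' ^ j))) = const3 (R j (al + c ph)) * var_x ^ D"
    proof (cases "n = 4")
      case n4: True
      have e: "2 * (bb + 3) + n * j = D" "2 * (bb + 1) + n * (j + 1) = D" using e0 D n4 by simp_all
      have z: "const3 (b j / 2) * var_x ^ (2 * (bb - 1) + n * (j + 2)) = const3 (b j / 2) * (var_x ^ D :: real fps3)"
      proof (cases "bb = 0")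
        case False then have "2 * (bb - 1) + n * (j + 2) = D" using e0 D n4 by auto
        then show ?thesis by simp
      qed (simp add: bj[symmetric] const3_simps)
      have "ray ph (pb h' (S' * (AI ^ bb * h' ^ j))) = const3 8 * (const3 (qv - al ^ 2) * const3 (b j / 2 + 1) * (const3 ((al + c ph) ^ j) * var_x ^ D)
         + const3 al * const3 (b j + 1) * (const3 ((al + c ph) ^ (j + 1)) * var_x ^ D)
         - const3 ((al + c ph) ^ (j + 2)) * (const3 (b j / 2) * var_x ^ D))"
      proof -
        define m1 m2 m3 where "m1 = AI ^ (bb + 3) * h' ^ j" and "m2 = AI ^ (bb + 1) * h' ^ (j + 1)" and "m3 = AI ^ (bb - 1) * h' ^ (j + 2)"
        have m: "ray ph m1 = const3 ((al + c ph) ^ j) * var_x ^ D" "ray ph m2 = const3 ((al + c ph) ^ (j + 1)) * var_x ^ D"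
          unfolding m1_def m2_def rm e by simp_all
        have m3: "const3 (b j / 2) * ray ph m3 = const3 ((al + c ph) ^ (j + 2)) * (const3 (b j / 2) * var_x ^ D)"
          unfolding m3_def rm z[symmetric] by (simp only: mult.left_commute)
        have "pb h' (S' * (AI ^ bb * h' ^ j)) = const3 8 * (const3 (qv - al ^ 2) * const3 (b j / 2 + 1) * m1 + const3 al * const3 (b j + 1) * m2 - const3 (b j / 2) * m3)"
          unfolding h'_def S'_def rel4[OF n4] m1_def m2_def m3_def bj qv_def ..
        then show ?thesis by (simp only: ray_simps(1,2,6,7) m m3)
      qed
      also have "\<dots> = const3 (R j (al + c ph)) * var_x ^ D"
        by (simp only: R_def n4 if_True refl const3_simps ring_distribs mult_ac)
      finally show ?thesis .
    next
      case False
      then have n3: "n = 3" using n by auto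
      have e: "2 * (bb + 2) + n * j = D" using e0 D n3 by auto
      have z: "const3 (b j) * var_x ^ (2 * (bb - 1) + n * (j + 2)) = const3 (b j) * (var_x ^ D :: real fps3)"
      proof (cases "bb = 0")
        case False then have "2 * (bb - 1) + n * (j + 2) = D" using e0 D n3 by auto
        then show ?thesis by simp
      qed (simp add: bj[symmetric] const3_simps)
      have "ray ph (pb h' (S' * (AI ^ bb * h' ^ j))) = const3 3 * (const3 (qv * (b j + 3/2)) * (const3 ((al + c ph) ^ j) * var_x ^ D)
         - const3 ((al + c ph) ^ (j + 2)) * (const3 (b j) * var_x ^ D))"
      proof -
        define m1 m3 where "m1 = AI ^ (bb + 2) * h' ^ j" and "m3 = AI ^ (bb - 1) * h' ^ (j + 2)"
        have m: "ray ph m1 = const3 ((al + c ph) ^ j) * var_x ^ D"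
          unfolding m1_def rm e by simp
        have m3: "const3 (b j) * ray ph m3 = const3 ((al + c ph) ^ (j + 2)) * (const3 (b j) * var_x ^ D)"
          unfolding m3_def rm z[symmetric] by (simp only: mult.left_commute)
        have "pb h' (S' * (AI ^ bb * h' ^ j)) = const3 3 * (const3 (qv * (b j + 3/2)) * m1 - const3 (b j) * m3)"
          unfolding h'_def S'_def rel3[OF n3 UNIV_I] m1_def m3_def bj qv_def ..
        then show ?thesis by (simp only: ray_simps(1,2,6,7) m m3)
      qed
      also have "\<dots> = const3 (R j (al + c ph)) * var_x ^ D"
        using False by (simp only: R_def if_False const3_simps ring_distribs mult_ac)
      finally show ?thesis .
    qed
    then show ?thesis unfolding bb_def[symmetric] by (simp only: ray_simps(2,7) const3_simps(2) mult.assoc)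
  next
    case False
    then show ?thesis using uv(2)[of j] by (simp add: ray_simps const3_simps)
  qed
  have rr: "ray ph (const3 x * AI ^ (D div 2) + const3 y * (AI ^ ((D - n) div 2) * C')) = const3 (x + y * c ph) * var_x ^ D" for ph
  proof -
    have 1: "const3 x * var_x ^ (2 * (D div 2)) = const3 x * (var_x ^ D :: real fps3)"
      using A by (cases "okA n D") (auto simp: okA_def const3_simps)
    have 2: "const3 y * var_x ^ (2 * ((D - n) div 2) + n) = const3 y * (var_x ^ D :: real fps3)"
      using B by (cases "okB n D") (auto simp: okB_def const3_simps)
    have "ray ph (const3 x * AI ^ (D div 2) + const3 y * (AI ^ ((D - n) div 2) * C')) =
      const3 x * var_x ^ (2 * (D div 2)) + const3 (c ph) * (const3 y * var_x ^ (2 * ((D - n) div 2) + n))"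
      by (simp add: ray_simps ray_action rC power_add mult_ac flip: power_mult)
    then show ?thesis unfolding 1 2 by (simp add: const3_simps algebra_simps)
  qed
  define P where "P = (\<Sum>j\<le>D'. monom (real n * (u j * a j)) j)"
  have main: "s ph * poly P (al + c ph) + (\<Sum>j\<le>D'. v j * R j (al + c ph)) = x + y * c ph" for ph
  proof -
    have c3s: "const3 (sum f A) = (\<Sum>a\<in>A. const3 (f a))" for f :: "nat \<Rightarrow> real" and A
      by (induction A rule: infinite_finite_induct) (auto simp: const3_simps)
    have "pb h' kp = (\<Sum>j\<le>D'. const3 (u j) * pb h' (AI ^ ((D' - n * j) div 2) * h' ^ j)) + (\<Sum>j\<le>D'. const3 (v j) * pb h' (S' * (AI ^ ((D' - n * j - n) div 2) * h' ^ j)))"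
      by (simp add: k lin0_def lin1_def pb_add pb_sum pb_const3_mult h'_def S'_def)
    then have "ray ph (pb h' kp) = const3 (s ph * poly P (al + c ph) + (\<Sum>j\<le>D'. v j * R j (al + c ph))) * var_x ^ D"
      by (simp only: ray_simps(1,10) r0 r1 sum_distrib_right[symmetric] c3s[symmetric] const3_simps(1) distrib_right)
         (simp add: P_def poly_sum poly_monom sum_distrib_left c3s const3_simps sum_distrib_right)
    then have "const3 (s ph * poly P (al + c ph) + (\<Sum>j\<le>D'. v j * R j (al + c ph))) * var_x ^ D = const3 (x + y * c ph) * var_x ^ D"
      using eq[unfolded h'] rr by metis
    then show ?thesis by (rule const3_var_power_eq)
  qed
  have even: "c (- ph) = c ph" "s (- ph) = - s ph" for ph by (simp_all add: c_def s_def)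
  \<comment> \<open>Reversing the angle changes the sign of s only, so the terms with and without
    this factor separate.\<close>
  have m1: "s ph * poly P (al + c ph) = 0" "(\<Sum>j\<le>D'. v j * R j (al + c ph)) = x + y * c ph" for ph
    using main[of ph] main[of "- ph"] unfolding even mult_minus_left by linarith+
  have npos: "0 < real n" using n by auto
  have cont: "continuous_on {0..pi / real n} (\<lambda>ph. al + c ph)" unfolding c_def by (intro continuous_intros)
  have ends: "al + c 0 \<noteq> al + c (pi / real n)" using G npos by (simp add: c_def)
  \<comment> \<open>Between the angles 0 and pi / n the factor s does not vanish while al + c sweeps
    out an interval.\<close>
  have "P = 0"
  proof (rule poly_zero_infinite[OF _ cont ends])
    fix t assume t: "0 < t" "t < pi / real n"
    then have "0 < real n * t" "real n * t < pi" using npos by (simp_all add: field_simps)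
    then have "s t \<noteq> 0" using G sin_gt_zero[of "real n * t"] by (simp add: s_def)
    then show "poly P (al + c t) = 0" using m1(1)[of t] by simp
  qed (use npos in auto)
  then have ua: "u j * a j = 0" if "j \<le> D'" for j
  proof -
    have "coeff P j = real n * (u j * a j)" using that by (simp add: P_def coeff_sum)
    then show ?thesis using \<open>P = 0\<close> npos by simp
  qed
  have v0: "v j = 0" if "D' < j" for j using uv(2)[of j] that n by (auto simp: val1_def)
  have "v j = 0" for j
  proof (cases "n = 4")
    case n4: True
    define w where "w = (\<Sum>j\<le>D'. monom (8 * ((qv - al ^ 2) * (b j / 2 + 1)) * v j) j + monom (8 * (al * (b j + 1)) * v j) (j + 1)
       - monom (4 * b j * v j) (j + 2)) - [: x - y * al, y :]"
    have "w = 0"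
    proof (rule poly_zero_infinite[OF _ cont ends])
      fix t
      show "poly w (al + c t) = 0"
        using m1(2)[of t] by (simp add: w_def poly_sum poly_monom R_def n4 algebra_simps)
    qed (use npos in auto)
    have cf: "coeff w l = 8 * ((qv - al ^ 2) * (b l / 2 + 1) * v l + (if 1 \<le> l then al * (b (l - 1) + 1) * v (l - 1) else 0)
       - (if 2 \<le> l then b (l - 2) / 2 * v (l - 2) else 0)) - coeff [: x - y * al, y :] l" for l
    proof -
      have s0: "(\<Sum>j\<le>D'. if j = l then f j * v j else 0) = f l * v l" for f
        using v0[of l] by auto
      have s1: "(\<Sum>j\<le>D'. if j + i = l then f j * v j else 0) = (if i \<le> l then f (l - i) * v (l - i) else 0)" for f i
      proof (cases "i \<le> l")
        case True
        then have "(\<Sum>j\<le>D'. if j + i = l then f j * v j else 0) = (\<Sum>j\<le>D'. if j = l - i then f j * v j else 0)" by (intro sum.cong) auto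
        then show ?thesis using True v0[of "l - i"] by auto
      qed auto
      show ?thesis
        using s1[of 0 "\<lambda>j. 8 * ((qv - al ^ 2) * (b j / 2 + 1))"] s1[of 1 "\<lambda>j. 8 * (al * (b j + 1))"] s1[of 2 "\<lambda>j. 4 * b j"]
        by (simp add: w_def coeff_sum sum.distrib sum_subtractf)
    qed
    show ?thesis
    proof (rule rec4[OF qv, where D' = D' and b = b and al = al and x = x and y = y])
      show "v j = 0" if "\<not> 4 * j + 4 \<le> D' \<or> odd D'" for j using uv(2)[of j, unfolded val1_def] that unfolding n4 by auto
      show "b j = (real D' - 4 * real j - 4) / 2" for j by (simp add: b_def n4)
      show "(qv - al\<^sup>2) * (b (l + 2) / 2 + 1) * v (l + 2) + al * (b (l + 1) + 1) * v (l + 1) = b l / 2 * v l" for l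
        using cf[of "l + 2"] \<open>w = 0\<close> by simp
      show "8 * ((qv - al\<^sup>2) * (b 1 / 2 + 1) * v 1 + al * (b 0 + 1) * v 0) = y" using cf[of 1] \<open>w = 0\<close> by simp
      show "8 * ((qv - al\<^sup>2) * (b 0 / 2 + 1) * v 0) = x - y * al" using cf[of 0] \<open>w = 0\<close> by simp
      have "D = D' + 2" using D n4 by simp
      then show "\<not> okA 4 (D' + 2) \<Longrightarrow> x = 0" "\<not> okB 4 (D' + 2) \<Longrightarrow> y = 0" using A B n4 by auto
    qed
  next
    case False
    then have n3: "n = 3" using n by auto
    have al0: "al = 0" by (rule al[OF n3])
    define w where "w = (\<Sum>j\<le>D'. monom (3 * (qv * (b j + 3/2)) * v j) j - monom (3 * b j * v j) (j + 2)) - [: x, y :]"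
    have "w = 0"
    proof (rule poly_zero_infinite[OF _ cont ends])
      fix t
      show "poly w (al + c t) = 0"
        using m1(2)[of t] by (simp add: w_def poly_sum poly_monom R_def n3 al0 algebra_simps)
    qed (use npos in auto)
    have cf: "coeff w l = 3 * (qv * (b l + 3/2) * v l - (if 2 \<le> l then b (l - 2) * v (l - 2) else 0)) - coeff [: x, y :] l" for l
    proof -
      have s1: "(\<Sum>j\<le>D'. if j + i = l then f j * v j else 0) = (if i \<le> l then f (l - i) * v (l - i) else 0)" for f i
      proof (cases "i \<le> l")
        case True
        then have "(\<Sum>j\<le>D'. if j + i = l then f j * v j else 0) = (\<Sum>j\<le>D'. if j = l - i then f j * v j else 0)" by (intro sum.cong) auto
        then show ?thesis using True v0[of "l - i"] by auto
      qed auto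
      show ?thesis
        using s1[of 0 "\<lambda>j. 3 * (qv * (b j + 3/2))"] s1[of 2 "\<lambda>j. 3 * b j"]
        by (simp add: w_def coeff_sum sum.distrib sum_subtractf)
    qed
    show ?thesis
    proof (rule rec3[OF qv, where D' = D' and b = b and x = x and y = y])
      show "v j = 0" if "\<not> (3 * j + 3 \<le> D' \<and> even (D' - 3 * j - 3))" for j using uv(2)[of j, unfolded val1_def] that unfolding n3 by auto
      show "b j = (real D' - 3 * real j - 3) / 2" for j by (simp add: b_def n3)
      show "qv * (b (l + 2) + 3/2) * v (l + 2) = b l * v l" for l using cf[of "l + 2"] \<open>w = 0\<close> by simp
      show "3 * (qv * (b 1 + 3/2) * v 1) = y" using cf[of 1] \<open>w = 0\<close> by simp
      show "3 * (qv * (b 0 + 3/2) * v 0) = x" using cf[of 0] \<open>w = 0\<close> by simp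
      have "D = D' + 1" using D n3 by simp
      then show "\<not> okA 3 (D' + 1) \<Longrightarrow> x = 0" "\<not> okB 3 (D' + 1) \<Longrightarrow> y = 0" using A B n3 by auto
    qed
  qed
  then have k1: "kp = lin0 D' u 0" unfolding k lin1_def by (simp add: const3_simps)
  \<comment> \<open>A monomial with a positive exponent of I would contradict \<open>ua\<close>;
    only pure powers of h survive.\<close>
  have z: "u j = 0" if "n * j \<noteq> D'" for j
  proof (cases "val0 D' j")
    case True
    then have "j \<le> D'" using n by (auto simp: val0_def)
    moreover have "(D' - n * j) div 2 \<noteq> 0"
      using dvd_mult_div_cancel[of 2 "D' - n * j"] True[unfolded val0_def] that by (metis mult_0_right diff_is_0_eq le_antisym)
    then have "a j \<noteq> 0" by (simp add: a_def)
    ultimately show ?thesis using ua[of j] by simp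
  qed (use uv in blast)
  show ?thesis
  proof (cases "\<exists>j. n * j = D'")
    case True
    then obtain j where j: "n * j = D'" by auto
    have jD: "j \<le> D'" using j n by auto
    have other: "u i = 0" if "i \<noteq> j" for i using z[of i] that j n by auto
    have "kp = const3 (u j) * (AI ^ ((D' - n * j) div 2) * h' ^ j)"
      unfolding k1 lin0_def using jD by (subst sum.remove[of _ j]) (auto simp: other const3_simps h'_def)
    then show ?thesis using j h' by auto
  next
    case False
    then have "u j = 0" for j using z by blast
    then show ?thesis by (simp add: k1 lin0_def const3_simps)
  qed
qed

subsection \<open>Reduction of the resonant normal form\<close>

text \<open>Brackets with an admissible generator preserve the order in x, y, so the order of the
  first one is inherited by all later terms.\<close>

lemma ex_tail_pb:
  assumes L: "gen L" and f: "wt 0 a (pb f L)" shows "wt 0 a (ex t L f - f)"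
proof -
  have p: "wt 0 a ((ad L ^^ Suc l) f)" for l
    unfolding funpow_Suc_right o_def ad_def[of L f]
    using ad_pow_wt[OF f, of 2 L l] L by (simp add: gen_def)
  show ?thesis
    unfolding wt_def
  proof (intro allI impI)
    fix i j k assume lt: "i + j + 0 * k < a"
    have "coeff3 (ex t L f - f) i j k = (\<Sum>l<Suc (i + j + k). t ^ l / fact l * coeff3 ((ad L ^^ l) f) i j k) - coeff3 f i j k"
      by (simp only: ex_def coeff3_simps lessThan_Suc_atMost)
    also have "\<dots> = 0"
      unfolding sum.lessThan_Suc_shift using wtD[OF p lt] by simp
    finally show "coeff3 (ex t L f - f) i j k = 0" .
  qed
qed

lemma hp_action_series:
  "hp D m (action_series c) = (if even D then const3 (c (D div 2) m) * AI ^ (D div 2) else 0)"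
proof (rule coeff3_ext)
  fix i j k
  have h: "homog (2 * p) (AI ^ p)" for p using homog_power[OF homog_action, of p] by simp
  have "coeff3 (action_series c) i j m = (\<Sum>p\<le>i + j. if 2 * p = i + j then c p m * coeff3 (AI ^ p) i j 0 else 0)"
  proof -
    have "coeff3 (action_series c) i j m = (\<Sum>p\<le>i + j. \<Sum>l=0..m. c p l * coeff3 (AI ^ p) i j (m - l))"
      by (simp add: action_series_def coeff3_def fps_sum_nth fps_mult_nth)
    also have "\<dots> = (\<Sum>p\<le>i + j. if 2 * p = i + j then c p m * coeff3 (AI ^ p) i j 0 else 0)"
    proof (rule sum.cong[OF refl])
      fix p
      have "(\<Sum>l=0..m. c p l * coeff3 (AI ^ p) i j (m - l)) = (\<Sum>l\<in>{m}. c p l * coeff3 (AI ^ p) i j (m - l))"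
        by (rule sum.mono_neutral_right) (use homogD[OF h] in auto)
      then show "(\<Sum>l=0..m. c p l * coeff3 (AI ^ p) i j (m - l)) = (if 2 * p = i + j then c p m * coeff3 (AI ^ p) i j 0 else 0)"
        using homogD[OF h, of i j p 0] by auto
    qed
    finally show ?thesis .
  qed
  also have "\<dots> = (if even (i + j) then c ((i + j) div 2) m * coeff3 (AI ^ ((i + j) div 2)) i j 0 else 0)"
  proof (cases "even (i + j)")
    case True
    then have "(2 * p = i + j) = (p = (i + j) div 2)" for p by auto
    then show ?thesis using True by simp
  next
    case False
    then have "2 * p \<noteq> i + j" for p by (metis dvd_triv_left)
    then show ?thesis using False by simp
  qed
  finally show "coeff3 (hp D m (action_series c)) i j k = coeff3 (if even D then const3 (c (D div 2) m) * AI ^ (D div 2) else 0) i j k"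
    using homogD[OF h, of i j "D div 2" k] by auto
qed

lemma hp_delta_action: "hp D m DI = (if D = 2 \<and> m = 1 then AI else 0)"
  by (auto simp: hp_delta_mult hp_homog[OF homog_action])

context res
begin

abbreviation "th \<equiv> 2 * pi / real n"
definition "dd = n - 2"

lemma dd: "1 \<le> dd" "dd + 2 = n" using n by (auto simp: dd_def)

lemma ip_homog: "ip D f \<Longrightarrow> nu \<in> V \<Longrightarrow> homog D (f nu)"
proof (induction rule: ip.induct)
  case (mon0 a j D)
  then show ?case using homog_mult[OF homog_power[OF homog_action, of a] homog_power[OF homog_h, of nu j]] by simp
next
  case (mon1 a j D)
  have "n + (2 * a + n * j) = D" using mon1 by simp
  then show ?case using homog_mult[OF homog_S[of nu] homog_mult[OF homog_power[OF homog_action, of a] homog_power[OF homog_h[OF mon1(2)], of j]]] by simp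
qed (auto intro: homog_add homog_const3)

lemma ip_rot: "ip D f \<Longrightarrow> nu \<in> V \<Longrightarrow> rot th (f nu) = f nu"
  by (induction rule: ip.induct) (auto simp: rot_simps rot_hS)

lemma fam_cng: "fam V f \<Longrightarrow> (\<And>nu. nu \<in> V \<Longrightarrow> f nu = g nu) \<Longrightarrow> open V \<Longrightarrow> fam V g"
proof -
  assume f: "fam V f" and e: "\<And>nu. nu \<in> V \<Longrightarrow> f nu = g nu" and V: "open V"
  have "ra (\<lambda>nu. coeff3 (g nu) i j k) nu" if nu: "nu \<in> V" for nu i j k
  proof -
    have "ra (\<lambda>nu. coeff3 (f nu) i j k) nu" using f nu by (auto simp: fam_def)
    then obtain F where F: "F analytic_on {complex_of_real nu}" "\<forall>\<^sub>F y in nhds nu. F (of_real y) = of_real (coeff3 (f y) i j k)"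
      by (auto simp: ra_def)
    have "\<forall>\<^sub>F y in nhds nu. y \<in> V" using V nu by (rule eventually_nhds_in_open)
    with F(2) have "\<forall>\<^sub>F y in nhds nu. F (of_real y) = of_real (coeff3 (g y) i j k)"
      by eventually_elim (simp add: e)
    with F(1) show ?thesis unfolding ra_def by blast
  qed
  then show "fam V g" by (simp add: fam_def)
qed

lemma ip_fam: "ip D f \<Longrightarrow> open V \<Longrightarrow> fam V f"
proof (induction rule: ip.induct)
  case (cng D f f') then show ?case using fam_cng by blast
next
  case (smul a D f) then show ?case by (intro fam_const3) auto
qed (auto intro!: fam_add fam_mult fam_power fam_CS)

text \<open>In degrees one and two only powers of I are available among the basis monomials, since n
  > 2.\<close>

lemma ip_low: assumes "ip D f" "nu \<in> V"
  shows "D = 1 \<Longrightarrow> f nu = 0" "D = 2 \<Longrightarrow> pb AI (f nu) = 0"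
proof -
  obtain u v where *: "\<And>j. \<not> val0 D j \<Longrightarrow> u j = 0" "\<And>j. \<not> val1 D j \<Longrightarrow> v j = 0" "f nu = lin0 D u nu + lin1 D v nu"
    using ip_canon[OF assms] by blast
  have n3: "3 \<le> n" using n by auto
  have v: "v j = 0" if "D \<le> 2" for j using n3 that by (intro *(2)) (auto simp: val1_def)
  have u: "u j = 0" if "D \<le> 2" "0 < j" for j
  proof (intro *(1))
    have "3 * 1 \<le> n * j" using n3 that by (intro mult_le_mono) auto
    then show "\<not> val0 D j" using that by (auto simp: val0_def)
  qed
  { assume D: "D = 1"
    have "u j = 0" for j using u[of j] D *(1)[of 0] by (cases "j = 0") (auto simp: val0_def)
    then show "f nu = 0" using v D by (simp add: *(3) lin0_def lin1_def const3_simps) }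
  { assume D: "D = 2"
    have "lin0 D u nu = const3 (u 0) * AI"
      unfolding lin0_def by (subst sum.remove[of _ 0]) (auto simp: u D const3_simps)
    then show "pb AI (f nu) = 0" using v D by (simp add: *(3) lin1_def const3_simps pb_const3_mult) }
qed

text \<open>The quadratic part of an invariant \<open>L\<close> is a multiple of I over the series
  in delta and commutes with I. Hence the flow of \<open>L\<close> leaves the quadratic part delta I
  alone (\<open>ex_inv_wt0\<close>).\<close>

lemma pb_AI_inv:
  assumes L: "gen L" "rot th L = L" shows "wt 0 3 (pb AI L)"
  unfolding wt_hp
proof (intro allI impI)
  fix D m :: nat assume D: "D + 0 * m < 3"
  \<comment> \<open>An auxiliary choice of leading data: invariants of degree two commute with I,
    and this does not involve the given h.\<close>
  interpret r: res n UNIV "\<lambda>_. 0" "\<lambda>_. 1" "\<lambda>_. 0" by unfold_locales (use n in \<open>auto simp: ra_const\<close>)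
  have e: "hp D m (pb AI L) = pb AI (hp D m L)"
    using hp_pb[OF homog_action, of D m L] D by (cases "D = 0") (auto simp: hp_pb_small[OF homog_action] wt_hp gen_def intro!: pb_0(2)[symmetric] L(1)[unfolded gen_def wt_hp, THEN conjunct2, rule_format, THEN arg_cong[of _ 0 "pb AI"], simplified])
  show "hp D m (pb AI L) = 0"
  proof (cases "D = 2")
    case True
    have "r.ip D (\<lambda>_. hp D m L)"
      using L(2) by (intro r.ip_invariant) (auto simp: homog_hp hp_rot[symmetric])
    then show ?thesis unfolding e using r.ip_low(2)[of D _ 0] True by simp
  next
    case False
    then have "hp D m L = 0" using L(1) D by (auto simp: gen_def wt_hp)
    then show ?thesis unfolding e by simp
  qed
qed

lemma ex_inv_wt0:
  assumes L: "gen L" "rot th L = L" and H: "wt 0 3 (H - DI)"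
  shows "wt 0 3 (ex 1 L H - DI)"
proof -
  have "wt 0 3 (pb DI L)" unfolding pb_mult using pb_AI_inv[OF L] by (auto intro: wt_mult_left)
  then have 1: "wt 0 3 (ex 1 L DI - DI)" by (rule ex_tail_pb[OF L(1)])
  have eq: "ex 1 L H - DI = ex 1 L (H - DI) + (ex 1 L DI - DI)"
    by (simp add: alg_simps[OF alg_ex[OF L(1)]])
  show ?thesis unfolding eq by (rule wt_add[OF alg_wt0[OF alg_ex[OF L(1)] H] 1])
qed

text \<open>The homological equation for the whole leading part delta I + h in one weight. The
  unknown at delta^m enters there through h and reappears at delta^(m+1) through delta I; so the
  equations are solved for m = 0, 1, 2, ..., with the bracket of I and the previous unknown as a
  given term.\<close>

lemma correction:
  assumes V: "open V" and e: "fam V e" "\<And>nu. nu \<in> V \<Longrightarrow> rot th (e nu) = e nu" "\<And>nu. nu \<in> V \<Longrightarrow> wt 0 3 (e nu)"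
    and W: "n + 1 \<le> W"
  shows "\<exists>kp. fam V kp \<and> (\<forall>nu\<in>V. rot th (kp nu) = kp nu \<and> wt dd (W - dd) (kp nu) \<and> wt 0 2 (kp nu)) \<and>
    (\<forall>D m. D + dd * m = W \<longrightarrow> 3 \<le> D \<longrightarrow> nf D (\<lambda>nu. hp D m (e nu + pb (DI + h nu) (kp nu))))"
proof -
  define cond where "cond m k k' \<longleftrightarrow> (if dd * m + 3 \<le> W then ip (W - dd * m - dd) k' \<and>
     nf (W - dd * m) (\<lambda>nu. hp (W - dd * m) m (e nu) + (if m = 0 then 0 else pb AI (k nu)) + pb (h nu) (k' nu)) else k' = (\<lambda>_. 0))"
    for m and k k' :: "real \<Rightarrow> real fps3"
  have ex: "\<exists>k'. cond m k k'" if k: "m = 0 \<or> (dd * (m - 1) + 3 \<le> W \<longrightarrow> ip (W - dd * (m - 1) - dd) k)" for m k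
  proof (cases "dd * m + 3 \<le> W")
    case True
    let ?D = "W - dd * m"
    have D3: "3 \<le> ?D" using True by linarith
    have 1: "ip ?D (\<lambda>nu. hp ?D m (e nu))"
      using e(2) by (intro ip_invariant fam_hp e(1)) (auto simp: homog_hp hp_rot[symmetric])
    have 2: "ip ?D (\<lambda>nu. if m = 0 then 0 else pb AI (k nu))"
    proof (cases m)
      case 0 then show ?thesis by (simp add: ip.zero)
    next
      case (Suc m')
      then have "W - dd * (m - 1) - dd = ?D" "dd * (m - 1) + 3 \<le> W" using True by auto
      then have k': "ip ?D k" using k Suc by simp
      have "ip ?D (\<lambda>nu. pb AI (k nu))"
      proof (intro ip_invariant fam_pb fam_const ip_fam[OF k' V])
        fix nu assume nu: "nu \<in> V"
        show "homog ?D (pb AI (k nu))" using homog_pb[OF homog_action ip_homog[OF k' nu]] D3 by simp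
        show "rot th (pb AI (k nu)) = pb AI (k nu)" by (simp add: symp_pb[OF symp_rot] ip_rot[OF k' nu])
      qed
      then show ?thesis using Suc by simp
    qed
    from Red_ip[OF ip.add[OF 1 2] D3] obtain k' where "ip (?D + 2 - n) k'"
      "nf ?D (\<lambda>nu. hp ?D m (e nu) + (if m = 0 then 0 else pb AI (k nu)) + pb (h nu) (k' nu))" unfolding Red_def by blast
    moreover have "?D + 2 - n = ?D - dd" using dd by linarith
    ultimately show ?thesis using True by (auto simp: cond_def)
  qed (auto simp: cond_def)
  have "\<exists>k. \<forall>m<M. cond m (k (m - 1)) (k m)" for M
  proof (induction M)
    case (Suc M)
    then obtain k where k: "\<And>m. m < M \<Longrightarrow> cond m (k (m - 1)) (k m)" by blast
    have "M = 0 \<or> (dd * (M - 1) + 3 \<le> W \<longrightarrow> ip (W - dd * (M - 1) - dd) (k (M - 1)))"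
      using k[of "M - 1"] by (cases M) (auto simp: cond_def)
    from ex[OF this] obtain k' where k': "cond M (k (M - 1)) k'" by blast
    have "cond m ((k(M := k')) (m - 1)) ((k(M := k')) m)" if "m < Suc M" for m
    proof (cases "m = M")
      case True
      then show ?thesis using k' by (cases "M = 0") (auto simp: cond_def)
    next
      case False
      then show ?thesis using k[of m] that by auto
    qed
    then show ?case by blast
  qed auto
  then obtain k where k: "\<And>m. m < Suc W \<Longrightarrow> cond m (k (m - 1)) (k m)" by blast
  have kip: "ip (W - dd * m - dd) (k m)" if "m \<le> W" "dd * m + 3 \<le> W" for m using k[of m] that by (simp add: cond_def)
  have k0: "k m = (\<lambda>_. 0)" if "m \<le> W" "\<not> dd * m + 3 \<le> W" for m using k[of m] that by (simp add: cond_def)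
  have khom: "homog (W - dd * m - dd) (k m nu)" if "m \<le> W" "nu \<in> V" for m nu
    using ip_homog[OF kip[OF that(1)] that(2)] k0[OF that(1)] by (cases "dd * m + 3 \<le> W") auto
  define kp where "kp nu = (\<Sum>m\<le>W. var_delta ^ m * k m nu)" for nu
  have hpk: "hp E m (kp nu) = (if m \<le> W \<and> E = W - dd * m - dd then k m nu else 0)" if nu: "nu \<in> V" for E m nu
  proof -
    have "hp E m (kp nu) = (\<Sum>m'\<le>W. if m' = m then if E = W - dd * m - dd then k m nu else 0 else 0)"
      unfolding kp_def hp_sum hp_delta_power
      by (intro sum.cong refl) (auto simp: hp_homog[OF khom[OF _ nu]])
    then show ?thesis by auto
  qed
  show ?thesis
  proof (intro exI[of _ kp] conjI ballI allI impI)
    have "fam V (k m)" if "m \<le> W" for m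
      using ip_fam[OF kip[OF that] V] k0[OF that] by (cases "dd * m + 3 \<le> W") auto
    then show "fam V kp" unfolding kp_def by (intro fam_sum fam_mult fam_const) auto
    fix nu assume nu: "nu \<in> V"
    have "rot th (k m nu) = k m nu" if "m \<le> W" for m
      using ip_rot[OF kip[OF that] nu] k0[OF that] by (cases "dd * m + 3 \<le> W") (auto simp: rot_simps)
    then show "rot th (kp nu) = kp nu" by (simp add: kp_def rot_simps)
    show "wt dd (W - dd) (kp nu)"
      unfolding wt_hp
    proof (intro allI impI)
      fix E m assume lt: "E + dd * m < W - dd"
      show "hp E m (kp nu) = 0" using lt unfolding hpk[OF nu] by auto
    qed
    show "wt 0 2 (kp nu)"
      unfolding wt_hp
    proof (intro allI impI)
      fix E m :: nat assume lt: "E + 0 * m < 2"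
      show "hp E m (kp nu) = 0"
      proof (cases "m \<le> W \<and> E = W - dd * m - dd \<and> dd * m + 3 \<le> W")
        case True
        \<comment> \<open>In a solved equation the unknown has degree at least 3 -
          \<open>dd\<close>, so below two only degree one occurs, and there are no linear
          invariants.\<close>
        have "dd \<le> 2" using n by (auto simp: dd_def)
        with True lt have "E = 1" by linarith
        then have "k m nu = 0" using ip_low(1)[OF kip nu, of m] True by simp
        then show ?thesis unfolding hpk[OF nu] by simp
      next
        case False
        then show ?thesis unfolding hpk[OF nu] using k0[of m] by auto
      qed
    qed
  next
    fix D m assume D: "D + dd * m = W" "3 \<le> D"
    then have DW: "D = W - dd * m" "dd * m + 3 \<le> W" by auto
    have mW: "m \<le> W" using D dd(1) by (metis le_add2 le_trans mult_le_mono1 nat_mult_1)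
    have c: "nf D (\<lambda>nu. hp D m (e nu) + (if m = 0 then 0 else pb AI (k (m - 1) nu)) + pb (h nu) (k m nu))"
      using k[of m] mW DW(2) unfolding cond_def DW(1) by (simp del: One_nat_def)
    show "nf D (\<lambda>nu. hp D m (e nu + pb (DI + h nu) (kp nu)))"
    proof (rule nf_cng[OF c])
      fix nu assume nu: "nu \<in> V"
      have 1: "hp D m (pb DI (kp nu)) = (if m = 0 then 0 else pb AI (k (m - 1) nu))"
      proof (cases m)
        case (Suc m')
        have "hp D m' (pb AI (kp nu)) = pb AI (hp D m' (kp nu))" using hp_pb[OF homog_action, of D m' "kp nu"] D by simp
        moreover have "hp D m' (kp nu) = k m' nu" using hpk[OF nu, of D m'] DW mW Suc by simp
        ultimately show ?thesis using Suc by (simp add: pb_mult hp_delta_mult)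
      qed (simp add: pb_mult hp_delta_mult)
      have nD: "n \<le> D + 1" "1 \<le> n" using n D by auto
      have "D + 2 - n = W - dd * m - dd" using DW dd by linarith
      then have 2: "hp D m (pb (h nu) (kp nu)) = pb (h nu) (k m nu)"
        using hp_pb[OF homog_h[OF nu] nD(2,1), of m "kp nu"] hpk[OF nu, of "W - dd * m - dd" m] mW by simp
      show "hp D m (e nu) + (if m = 0 then 0 else pb AI (k (m - 1) nu)) + pb (h nu) (k m nu) = hp D m (e nu + pb (DI + h nu) (kp nu))"
        by (simp add: pb_add 1 2)
    qed
  qed
qed

text \<open>The generator is corrected weight by weight. A correction solving the equation in weight
  \<open>W\<close> has weight W - \<open>dd\<close>, so it does not disturb the lighter terms, and
  the corrections converge formally.\<close>

lemma reduced_normal_form: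
  assumes V: "open V" and H: "fam V H" "\<And>nu. nu \<in> V \<Longrightarrow> rot th (H nu) = H nu"
    "\<And>nu. nu \<in> V \<Longrightarrow> wt 0 3 (H nu - DI)" "\<And>nu. nu \<in> V \<Longrightarrow> wt dd (n + 1) (H nu - DI - h nu)"
  shows "\<exists>L. (\<forall>nu\<in>V. gen (L nu) \<and> rot th (L nu) = L nu \<and> wt dd (n + 1) (ex 1 (L nu) (H nu) - DI - h nu)) \<and>
     (\<forall>D m. nf D (\<lambda>nu. hp D m (ex 1 (L nu) (H nu) - DI)))"
proof -
  define \<delta>I where "\<delta>I = DI"
  have wH: "wt dd n (H nu)" if nu: "nu \<in> V" for nu
  proof -
    have "wt dd n ((H nu - \<delta>I - h nu) + \<delta>I + h nu)"
      using H(4)[OF nu] gen_delta_action(2)[of dd] dd homog_wt[OF homog_h[OF nu]]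
      by (intro wt_add) (auto simp: \<delta>I_def intro: wt_mono)
    then show ?thesis by simp
  qed
  define P where "P i L \<longleftrightarrow> fam V L \<and> (\<forall>nu\<in>V. gen (L nu) \<and> rot th (L nu) = L nu \<and> wt dd (n + 1) (ex 1 (L nu) (H nu) - \<delta>I - h nu)) \<and>
     (\<forall>D m. D + dd * m < n + 1 + i \<longrightarrow> nf D (\<lambda>nu. hp D m (ex 1 (L nu) (H nu) - \<delta>I)))" for i :: nat and L
  define R where "R i L L' \<longleftrightarrow> (\<forall>nu\<in>V. wt dd i (L' nu - L nu))" for i :: nat and L L' :: "real \<Rightarrow> real fps3"
  have nfh: "nf D (\<lambda>nu. hp D m (h nu))" for D m
  proof (cases "D = n \<and> m = 0")
    case True
    have "nf n h"
    proof (cases "n = 3")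
      case n3: True
      have "okB n (2 * 0 + n)" using n3 by (simp add: okB_def keepB_def)
      then show ?thesis unfolding nf_def nfw_def
        by (intro exI[of _ "\<lambda>_. 0"] exI[of _ "\<lambda>_. 1"]) (auto simp: C_eq al3[OF _ n3] const3_simps ra_const)
    next
      case False
      then have n4: "n = 4" using n by auto
      have e: "n div 2 = 2" "okA n n" "okB n n" using n4 by (simp_all add: okA_def okB_def keepA_def keepB_def)
      show ?thesis unfolding nf_def nfw_def
        by (rule exI[of _ al], rule exI[of _ "\<lambda>_. 1"]) (simp add: e C_eq const3_simps ra_const ra_al)
    qed
    then have "nf n (\<lambda>nu. hp n 0 (h nu))" by (rule nf_cng) (simp add: hp_homog[OF homog_h])
    then show ?thesis using True by simp
  next
    case False
    show ?thesis by (rule nf_cng[OF nf_zero]) (use False in \<open>auto simp: hp_homog[OF homog_h]\<close>)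
  qed
  have init: "P 0 (\<lambda>_. 0)"
    unfolding P_def
  proof (intro conjI ballI allI impI)
    fix D m assume D: "D + dd * m < n + 1 + 0"
    show "nf D (\<lambda>nu. hp D m (ex 1 0 (H nu) - \<delta>I))"
    proof (rule nf_cng[OF nfh])
      fix nu assume nu: "nu \<in> V"
      have "hp D m (H nu - \<delta>I - h nu) = 0" using H(4)[OF nu] D unfolding wt_hp \<delta>I_def by simp
      then show "hp D m (h nu) = hp D m (ex 1 0 (H nu) - \<delta>I)" by simp
    qed
  qed (use H(4) in \<open>simp_all add: \<delta>I_def rot_simps\<close>)
  have step: "\<exists>L'. P (Suc i) L' \<and> R i L L'" if PL: "P i L" for i L
  proof -
    define W where "W = n + 1 + i"
    have L: "fam V L" "\<And>nu. nu \<in> V \<Longrightarrow> gen (L nu)" "\<And>nu. nu \<in> V \<Longrightarrow> rot th (L nu) = L nu"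
      "\<And>nu. nu \<in> V \<Longrightarrow> wt dd (n + 1) (ex 1 (L nu) (H nu) - \<delta>I - h nu)"
      "\<And>D m. D + dd * m < W \<Longrightarrow> nf D (\<lambda>nu. hp D m (ex 1 (L nu) (H nu) - \<delta>I))"
      using PL by (auto simp: P_def W_def)
    define e where "e nu = ex 1 (L nu) (H nu) - \<delta>I" for nu
    have "rot th (e nu) = e nu" if "nu \<in> V" for nu
      by (simp add: e_def \<delta>I_def rot_simps symp_ex_conj[OF symp_rot L(2)[OF that]] L(3)[OF that] H(2)[OF that])
    moreover have "wt 0 3 (e nu)" if "nu \<in> V" for nu
      unfolding e_def \<delta>I_def by (rule ex_inv_wt0[OF L(2)[OF that] L(3)[OF that] H(3)[OF that]])
    moreover have "fam V e" unfolding e_def by (intro fam_diff fam_ex fam_const L H)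
    ultimately obtain kp where kp: "fam V kp" "\<And>nu. nu \<in> V \<Longrightarrow> rot th (kp nu) = kp nu" "\<And>nu. nu \<in> V \<Longrightarrow> wt dd (W - dd) (kp nu)" "\<And>nu. nu \<in> V \<Longrightarrow> wt 0 2 (kp nu)"
      "\<And>D m. D + dd * m = W \<Longrightarrow> 3 \<le> D \<Longrightarrow> nf D (\<lambda>nu. hp D m (e nu + pb (\<delta>I + h nu) (kp nu)))"
      using correction[OF V, of e W] unfolding \<delta>I_def W_def by auto
    define L' where "L' nu = L nu + kp nu" for nu
    have Wd: "W - dd = i + 3" using dd by (simp add: W_def)
    have gkp: "gen (kp nu)" if nu: "nu \<in> V" for nu
    proof -
      have "coeff3 (kp nu) a b c = 0" if "a + b + 1 * c < 3" for a b c
      proof (cases "a + b < 2")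
        case True then show ?thesis using wtD[OF kp(4)[OF nu], of a b c] by simp
      next
        case False
        then have "c = 0" "a + b = 2" using that by auto
        then show ?thesis using wtD[OF kp(3)[OF nu], of a b c] Wd by simp
      qed
      then show ?thesis using kp(4)[OF nu] by (simp add: gen_def wt_def)
    qed
    have gL': "gen (L' nu)" "rot th (L' nu) = L' nu" if "nu \<in> V" for nu
      using L(2,3)[OF that] kp(2)[OF that] gkp[OF that] by (simp_all add: L'_def gen_add rot_simps)
    \<comment> \<open>Up to weight \<open>W\<close> only the first order change counts, and in it
      \<open>H\<close> may be replaced by its leading part.\<close>
    have d1: "wt dd (W + 1) (ex 1 (L' nu) (H nu) - \<delta>I - (e nu + pb (\<delta>I + h nu) (kp nu)))" if nu: "nu \<in> V" for nu
    proof -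
      have dL: "L' nu - L nu = kp nu" by (simp add: L'_def)
      have 1: "wt dd (W + 1) (ex 1 (L' nu) (H nu) - ex 1 (L nu) (H nu) - pb (H nu) (kp nu))"
        using ex_diff[OF L(2)[OF nu] gL'(1)[OF nu] dd(1) _ _ wH[OF nu], of "W - dd" 1] kp(3)[OF nu] dd Wd
        unfolding dL by (auto simp: const3_simps W_def intro: wt_mono)
      have 2: "wt dd (W + 1) (pb (H nu - \<delta>I - h nu) (kp nu))"
        by (rule wt_pb'[OF H(4)[OF nu, folded \<delta>I_def] kp(3)[OF nu]]) (use dd Wd in \<open>simp add: W_def\<close>)
      from wt_add[OF 1 2] show ?thesis by (simp add: e_def pb_add pb_diff algebra_simps)
    qed
    have d2: "wt dd W (pb (\<delta>I + h nu) (kp nu))" if nu: "nu \<in> V" for nu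
    proof -
      have "wt dd n (\<delta>I + h nu)"
        using gen_delta_action(2)[of dd] dd homog_wt[OF homog_h[OF nu]] by (intro wt_add) (auto simp: \<delta>I_def)
      then show ?thesis by (rule wt_pb'[OF _ kp(3)[OF nu]]) (use dd Wd in \<open>simp add: W_def\<close>)
    qed
    have d3: "wt dd W (ex 1 (L' nu) (H nu) - \<delta>I - e nu)" if nu: "nu \<in> V" for nu
    proof -
      have eq: "ex 1 (L' nu) (H nu) - \<delta>I - e nu =
        (ex 1 (L' nu) (H nu) - \<delta>I - (e nu + pb (\<delta>I + h nu) (kp nu))) + pb (\<delta>I + h nu) (kp nu)"
        by (simp add: algebra_simps)
      show ?thesis unfolding eq by (rule wt_add[OF wt_mono[OF d1[OF nu]] d2[OF nu]]) simp
    qed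
    have "P (Suc i) L'"
      unfolding P_def
    proof (intro conjI ballI allI impI)
      show "fam V L'" unfolding L'_def by (intro fam_add L kp)
      fix nu assume nu: "nu \<in> V"
      show "gen (L' nu)" "rot th (L' nu) = L' nu" using gL'[OF nu] by auto
      have "wt dd (n + 1) (e nu - h nu)" using L(4)[OF nu] by (simp add: e_def)
      moreover have "wt dd (n + 1) (ex 1 (L' nu) (H nu) - \<delta>I - e nu)"
        by (rule wt_mono[OF d3[OF nu]]) (simp add: W_def)
      ultimately have "wt dd (n + 1) ((ex 1 (L' nu) (H nu) - \<delta>I - e nu) + (e nu - h nu))" by (intro wt_add)
      moreover have "(ex 1 (L' nu) (H nu) - \<delta>I - e nu) + (e nu - h nu) = ex 1 (L' nu) (H nu) - \<delta>I - h nu"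
        by (simp add: algebra_simps)
      ultimately show "wt dd (n + 1) (ex 1 (L' nu) (H nu) - \<delta>I - h nu)" by (simp only:)
    next
      fix D m assume D: "D + dd * m < n + 1 + Suc i"
      show "nf D (\<lambda>nu. hp D m (ex 1 (L' nu) (H nu) - \<delta>I))"
      proof (cases "D + dd * m < W")
        case True
        show ?thesis
        proof (rule nf_cng[OF L(5)[OF True]])
          fix nu assume "nu \<in> V"
          then have "hp D m (ex 1 (L' nu) (H nu) - \<delta>I - e nu) = 0" using d3 True unfolding wt_hp by blast
          then show "hp D m (ex 1 (L nu) (H nu) - \<delta>I) = hp D m (ex 1 (L' nu) (H nu) - \<delta>I)" by (simp add: e_def)
        qed
      next
        case False
        then have DW: "D + dd * m = W" "D + dd * m < W + 1" using D by (auto simp: W_def)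
        show ?thesis
        proof (cases "3 \<le> D")
          case True
          show ?thesis
          proof (rule nf_cng[OF kp(5)[OF DW(1) True]])
            fix nu assume "nu \<in> V"
            then have "hp D m (ex 1 (L' nu) (H nu) - \<delta>I - (e nu + pb (\<delta>I + h nu) (kp nu))) = 0" using d1 DW(2) unfolding wt_hp by blast
            then show "hp D m (e nu + pb (\<delta>I + h nu) (kp nu)) = hp D m (ex 1 (L' nu) (H nu) - \<delta>I)" by simp
          qed
        next
          case False
          \<comment> \<open>Below degree three there is nothing to solve: the transformed
            Hamiltonian still coincides with delta I there.\<close>
          show ?thesis
          proof (rule nf_cng[OF nf_zero])
            fix nu assume nu: "nu \<in> V"
            have "wt 0 3 (ex 1 (L' nu) (H nu) - \<delta>I)"
              unfolding \<delta>I_def by (rule ex_inv_wt0[OF gL'[OF nu] H(3)[OF nu]])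
            moreover have "D + 0 * m < 3" using False by simp
            ultimately have "hp D m (ex 1 (L' nu) (H nu) - \<delta>I) = 0" unfolding wt_hp by blast
            then show "0 = hp D m (ex 1 (L' nu) (H nu) - \<delta>I)" by simp
          qed
        qed
      qed
    qed
    moreover have "R i L L'" using wt_mono[OF kp(3), of _ i] Wd by (simp add: R_def L'_def)
    ultimately show ?thesis by blast
  qed
  obtain Ls where Ls: "\<And>i. P i (Ls i)" "\<And>i. R i (Ls i) (Ls (Suc i))"
    using dependent_nat_choice[of P R] init step by blast
  define L where "L nu = lim3 dd (\<lambda>i. Ls i nu)" for nu
  have lim: "wt dd i (L nu - Ls i nu)" if "nu \<in> V" for i nu
    unfolding L_def using Ls(2) that by (intro lim3_wt) (auto simp: R_def)
  have gL: "gen (L nu)" if "nu \<in> V" for nu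
    using Ls(1) that unfolding gen_def L_def P_def by (auto intro!: lim3_closed)
  have rL: "rot th (L nu) = L nu" if nu: "nu \<in> V" for nu
  proof -
    have "wt dd m (rot th (L nu) - L nu)" for m
    proof -
      have "rot th (L nu) - L nu = rot th (L nu - Ls m nu) - (L nu - Ls m nu)"
        using Ls(1)[of m] nu by (simp add: P_def rot_simps)
      then show ?thesis using wt_diff[OF alg_wt[OF alg_rot lim[OF nu, of m]] lim[OF nu, of m], of th] by (simp only:)
    qed
    then have "rot th (L nu) - L nu = 0" by (rule wt_eq_0)
    then show ?thesis by simp
  qed
  have lim2: "wt dd i (ex 1 (L nu) (H nu) - ex 1 (Ls (i + 2) nu) (H nu))" if nu: "nu \<in> V" for i nu
    using ex_cont[OF _ gL[OF nu] dd(1) lim[OF nu, of "i + 2"] _ wH[OF nu], of 1] Ls(1)[of "i + 2"] nu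
    by (auto simp: P_def intro: wt_mono)
  show ?thesis
  proof (intro exI[of _ L] conjI ballI allI gL rL)
    fix nu assume nu: "nu \<in> V"
    have "wt dd (n + 1) (ex 1 (Ls (n + 1 + 2) nu) (H nu) - \<delta>I - h nu)" using Ls(1) nu by (auto simp: P_def)
    from wt_add[OF lim2[OF nu, of "n + 1"] this]
    have "wt dd (n + 1) ((ex 1 (L nu) (H nu) - ex 1 (Ls (n + 1 + 2) nu) (H nu)) + (ex 1 (Ls (n + 1 + 2) nu) (H nu) - \<delta>I - h nu))" .
    moreover have "(ex 1 (L nu) (H nu) - ex 1 (Ls (n + 1 + 2) nu) (H nu)) + (ex 1 (Ls (n + 1 + 2) nu) (H nu) - \<delta>I - h nu)
      = ex 1 (L nu) (H nu) - DI - h nu" by (simp add: \<delta>I_def algebra_simps)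
    ultimately show "wt dd (n + 1) (ex 1 (L nu) (H nu) - DI - h nu)" by (simp only:)
  next
    fix D m
    define i where "i = D + dd * m + 1"
    have "D + dd * m < n + 1 + (i + 2)" by (simp add: i_def)
    then have "nf D (\<lambda>nu. hp D m (ex 1 (Ls (i + 2) nu) (H nu) - \<delta>I))" using Ls(1)[of "i + 2"] unfolding P_def by blast
    then show "nf D (\<lambda>nu. hp D m (ex 1 (L nu) (H nu) - DI))"
    proof (rule nf_cng)
      fix nu assume nu: "nu \<in> V"
      have "D + dd * m < i" by (simp add: i_def)
      then have "hp D m (ex 1 (L nu) (H nu) - ex 1 (Ls (i + 2) nu) (H nu)) = 0" using lim2[OF nu, of i] unfolding wt_hp by blast
      then show "hp D m (ex 1 (Ls (i + 2) nu) (H nu) - \<delta>I) = hp D m (ex 1 (L nu) (H nu) - DI)" by (simp add: \<delta>I_def)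
    qed
  qed
qed

end

subsection \<open>Normal forms and their uniqueness\<close>

lemma coeff3_complex_power:
  "coeff3 ((var_x + const3 \<i> * var_y) ^ n :: complex fps3) i j k = Complex (coeff3 (Zr n) i j k) (coeff3 (Zi n) i j k)"
proof (induction n arbitrary: i j k)
  case 0
  show ?case by (auto simp: complex_eq_iff)
next
  case (Suc n)
  have "coeff3 ((var_x + const3 \<i> * var_y) ^ Suc n :: complex fps3) i j k =
    coeff3 (var_x * (var_x + const3 \<i> * var_y) ^ n :: complex fps3) i j k + \<i> * coeff3 (var_y * (var_x + const3 \<i> * var_y) ^ n :: complex fps3) i j k"
    by (simp add: distrib_right mult.assoc)
  then show ?case by (simp add: coeff3_var_mult Suc Z_Suc complex_eq_iff)
qed

definition sn :: "nat \<Rightarrow> real" where "sn n = 2 powr (- real n / 2)"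

lemma sn_pos: "0 < sn n" by (simp add: sn_def)

lemma action_cos_Z: "action_cos n = const3 (sn n) * Zr n"
proof -
  have "Abs_fps3 (\<lambda>i j k. Re (coeff3 ((var_x + const3 \<i> * var_y) ^ n :: complex fps3) i j k)) = Zr n"
    by (rule coeff3_ext) (simp add: coeff3_complex_power)
  then show ?thesis by (simp add: action_cos_def sn_def)
qed

text \<open>The coefficients listed by the degree in x, y of their term, with the default zero in
  degrees without a term, so that \<open>hp_normal\<close> holds in every degree. The factor
  \<open>sn n\<close> in \<open>cB\<close> converts I^(n/2) cos (n phi) into Re z^n.\<close>

definition cA :: "(nat \<Rightarrow> nat \<Rightarrow> real) \<Rightarrow> nat \<Rightarrow> nat \<Rightarrow> real" where
  "cA A D m = (if 4 \<le> D \<and> even D then A ((D - 4) div 2) m else 0)"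

definition cB :: "nat \<Rightarrow> (nat \<Rightarrow> nat \<Rightarrow> real) \<Rightarrow> nat \<Rightarrow> nat \<Rightarrow> real" where
  "cB n B D m = (if n \<le> D \<and> even (D - n) then sn n * B ((D - n) div 2) m else 0)"

lemma hp_normal:
  "hp D m (normal_hamiltonian n A B - DI) =
    const3 (cA A D m) * AI ^ (D div 2) + const3 (cB n B D m) * (AI ^ ((D - n) div 2) * Zr n)"
proof -
  have 1: "hp D m (AI ^ 2 * action_series A) = const3 (cA A D m) * AI ^ (D div 2)"
  proof (cases "4 \<le> D \<and> even D")
    case True
    then have "D div 2 = 2 + (D - 4) div 2" by auto
    then have e: "AI ^ (D div 2) = AI ^ 2 * AI ^ ((D - 4) div 2)" by (simp only: power_add)
    have "even (D - 4)" using True by auto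
    then show ?thesis using True hp_mult[OF homog_power[OF homog_action, of 2], of D m "action_series A"]
      unfolding e by (simp add: hp_action_series cA_def mult_ac)
  next
    case False
    then have "\<not> (4 \<le> D \<and> even (D - 4))" by auto
    then show ?thesis using hp_mult[OF homog_power[OF homog_action, of 2], of D m "action_series A"] False
      by (auto simp: hp_action_series cA_def const3_simps)
  qed
  have 2: "hp D m (action_cos n * action_series B) = const3 (cB n B D m) * (AI ^ ((D - n) div 2) * Zr n)"
    using hp_mult[OF homog_const3[OF homog_Z(1)[of n], where c = "sn n"], of D m "action_series B"]
    by (auto simp: action_cos_Z hp_action_series cB_def const3_simps mult_ac)
  show ?thesis by (simp add: normal_hamiltonian_def 1 2)
qed

definition lead_al :: "nat \<Rightarrow> (nat \<Rightarrow> nat \<Rightarrow> real) \<Rightarrow> real" where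
  "lead_al n A = (if n = 4 then A 0 0 else 0)"

lemma normal_props:
  fixes A B n
  assumes n: "n = 3 \<or> n = 4"
  defines "H \<equiv> normal_hamiltonian n A B"
  shows "wt 0 3 (H - DI)" "gen H" "rot (2 * pi / real n) H = H" "wt (n - 2) n H"
    "wt (n - 2) (n + 1) (H - DI - hh n (lead_al n A) (sn n * B 0 0) 0)"
    "cos (real n * t) = 1 \<Longrightarrow> rot t H = H"
proof -
  show 1: "wt 0 3 (H - DI)"
    unfolding wt_hp H_def hp_normal using n by (auto simp: cA_def cB_def const3_simps)
  have "wt 0 2 ((H - DI) + DI)" "wt 1 3 ((H - DI) + DI)"
    using gen_delta_action(1) by (intro wt_add wt_mono[OF 1] wt_d_mono[OF 1]; simp add: gen_def)+
  then show "gen H" by (simp add: gen_def)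
  have rot: "rot t H = H" if t: "cos (real n * t) = 1" for t
  proof -
    have s: "sin (real n * t) = 0" using t by (simp add: cos_one_sin_zero)
    have "rot t (H - DI) = H - DI"
      unfolding H_def
      by (rule hp_ext, unfold hp_rot hp_normal) (simp add: rot_simps rot_Z t s const3_simps)
    then show ?thesis by (simp add: rot_simps)
  qed
  then show "cos (real n * t) = 1 \<Longrightarrow> rot t H = H" .
  show "rot (2 * pi / real n) H = H" by (rule rot) (use n in auto)
  show 5: "wt (n - 2) (n + 1) (H - DI - hh n (lead_al n A) (sn n * B 0 0) 0)"
    unfolding wt_hp
  proof (intro allI impI)
    fix D m assume lt: "D + (n - 2) * m < n + 1"
    have hom: "hp D m (hh n (lead_al n A) (sn n * B 0 0) 0) = (if D = n \<and> m = 0 then hh n (lead_al n A) (sn n * B 0 0) 0 else 0)"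
    proof (rule hp_homog)
      have "homog n (const3 (lead_al n A) * AI ^ 2)"
        using n homog_power[OF homog_action, of 2] by (auto simp: lead_al_def const3_simps intro: homog_const3)
      then show "homog n (hh n (lead_al n A) (sn n * B 0 0) 0)" unfolding hh_def by (intro homog_add hom_CS)
    qed
    have hn: "hp D m (H - DI) = const3 (cA A D m) * AI ^ (D div 2) + const3 (cB n B D m) * (AI ^ ((D - n) div 2) * Zr n)"
      unfolding H_def by (rule hp_normal)
    consider "D = n" "m = 0" | "D < n" "0 < m \<or> n \<noteq> 3 \<or> True" "D \<noteq> n"
      using lt n by (cases m) auto
    then show "hp D m (H - DI - hh n (lead_al n A) (sn n * B 0 0) 0) = 0"
    proof cases
      case 1
      then show ?thesis unfolding hp_simps(2)[of D m "H - DI" "hh n (lead_al n A) (sn n * B 0 0) 0"] hom hn using n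
        by (auto simp: cA_def cB_def lead_al_def hh_def CC_def const3_simps)
    next
      case 2
      have "\<not> (4 \<le> D \<and> even D)" using 2 n by auto
      then show ?thesis unfolding hp_simps(2)[of D m "H - DI" "hh n (lead_al n A) (sn n * B 0 0) 0"] hom hn using 2
        by (auto simp: cA_def cB_def const3_simps)
    qed
  qed
  have "homog n (const3 (lead_al n A) * AI ^ 2)"
    using n homog_power[OF homog_action, of 2] by (auto simp: lead_al_def const3_simps intro: homog_const3)
  then have hom: "homog n (hh n (lead_al n A) (sn n * B 0 0) 0)" unfolding hh_def by (intro homog_add hom_CS)
  have "wt (n - 2) n ((H - DI - hh n (lead_al n A) (sn n * B 0 0) 0) + DI + hh n (lead_al n A) (sn n * B 0 0) 0)"
  proof -
    have e: "n - 2 + 2 = n" using n by auto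
    show ?thesis
      by (rule wt_add[OF wt_add[OF wt_mono[OF 5] gen_delta_action(2)[of "n - 2", unfolded e]] homog_wt[OF hom]]) simp
  qed
  then show "wt (n - 2) n H" by simp
qed

lemma reduced_ok:
  assumes "n = 3 \<or> n = 4" "reduced_coeffs n A B"
  shows "\<not> okA n D \<Longrightarrow> cA A D m = 0" "\<not> okB n D \<Longrightarrow> cB n B D m = 0"
  using assms by (auto simp: reduced_coeffs_def okA_def okB_def cA_def cB_def keepA_def keepB_def)

lemma ray_indep:
  assumes eq: "const3 a * AI ^ i + const3 b * (AI ^ j * Zr n) = const3 a' * AI ^ i' + const3 b' * (AI ^ j' * (const3 c * Zr n - const3 s * Zi n))"
    and deg: "a \<noteq> 0 \<Longrightarrow> 2 * i = D" "b \<noteq> 0 \<Longrightarrow> 2 * j + n = D" "a' \<noteq> 0 \<Longrightarrow> 2 * i' = D" "b' \<noteq> 0 \<Longrightarrow> 2 * j' + n = D" and n: "0 < n"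
  shows "a = a'" "b = b' * c" "b' * s = 0"
proof -
  define r where "r = sqrt 2 ^ n"
  have r: "0 < r" by (simp add: r_def)
  have p: "const3 u * var_x ^ k = const3 u * (var_x ^ D :: real fps3)" if "u \<noteq> 0 \<Longrightarrow> k = D" for u k
    using that by (cases "u = 0") (auto simp: const3_simps)
  have pa: "const3 a * var_x ^ (2 * i) = const3 a * (var_x ^ D :: real fps3)" by (rule p) (rule deg(1))
  have pb': "const3 b * var_x ^ (2 * j + n) = const3 b * (var_x ^ D :: real fps3)" by (rule p) (rule deg(2))
  have pa': "const3 a' * var_x ^ (2 * i') = const3 a' * (var_x ^ D :: real fps3)" by (rule p) (rule deg(3))
  have pb'': "const3 b' * var_x ^ (2 * j' + n) = const3 b' * (var_x ^ D :: real fps3)" by (rule p) (rule deg(4))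
  have main: "a + b * (r * cos (real n * ph)) = a' + b' * (c * (r * cos (real n * ph)) - s * (r * sin (real n * ph)))" for ph
  proof -
    have "ray ph (const3 a * AI ^ i + const3 b * (AI ^ j * Zr n)) =
      const3 a * var_x ^ (2 * i) + const3 (r * cos (real n * ph)) * (const3 b * var_x ^ (2 * j + n))"
      by (simp add: ray_simps ray_action ray_Z r_def power_add mult_ac flip: power_mult)
    also have "\<dots> = const3 (a + b * (r * cos (real n * ph))) * var_x ^ D"
      unfolding pa pb' by (simp add: const3_simps algebra_simps)
    finally have 1: "ray ph (const3 a * AI ^ i + const3 b * (AI ^ j * Zr n)) = const3 (a + b * (r * cos (real n * ph))) * var_x ^ D" .
    have "ray ph (const3 a' * AI ^ i' + const3 b' * (AI ^ j' * (const3 c * Zr n - const3 s * Zi n))) =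
      const3 a' * var_x ^ (2 * i') + const3 (c * (r * cos (real n * ph)) - s * (r * sin (real n * ph))) * (const3 b' * var_x ^ (2 * j' + n))"
      by (simp add: ray_simps ray_action ray_Z r_def power_add const3_simps algebra_simps flip: power_mult)
    also have "\<dots> = const3 (a' + b' * (c * (r * cos (real n * ph)) - s * (r * sin (real n * ph)))) * var_x ^ D"
      unfolding pa' pb'' by (simp add: const3_simps algebra_simps)
    finally show ?thesis using 1 eq const3_var_power_eq by metis
  qed
  \<comment> \<open>The angles 0, pi / n and pi / (2 n) make the cosine 1, -1 and 0, which separates
    the coefficients.\<close>
  have "a + b * r = a' + b' * (c * r)" using main[of 0] by simp
  moreover have "a - b * r = a' - b' * (c * r)" using main[of "pi / real n"] n by simp
  ultimately have a: "a = a'" and br: "b * r = b' * (c * r)" by linarith+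
  show "a = a'" by (rule a)
  show "b = b' * c" using br r by (metis less_irrefl mult.assoc mult_right_cancel)
  have e2: "real n * (pi / (2 * real n)) = pi / 2" using n by simp
  have "a = a' - b' * s * r" using main[of "pi / (2 * real n)"] unfolding e2 by simp
  then show "b' * s = 0" using a r by simp
qed

lemma normal_inj:
  assumes n: "n = 3 \<or> n = 4" and eq: "normal_hamiltonian n A B = normal_hamiltonian n A' B'"
  shows "A = A'" "B = B'"
proof -
  have "cA A D m = cA A' D m \<and> cB n B D m = cB n B' D m" for D m
  proof -
    have "const3 (cA A D m) * AI ^ (D div 2) + const3 (cB n B D m) * (AI ^ ((D - n) div 2) * Zr n) =
      const3 (cA A' D m) * AI ^ (D div 2) + const3 (cB n B' D m) * (AI ^ ((D - n) div 2) * (const3 1 * Zr n - const3 0 * Zi n))"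
      using arg_cong[OF eq, of "\<lambda>H. hp D m (H - DI)"] unfolding hp_normal by (simp add: const3_simps)
    from ray_indep[OF this, of D] show ?thesis using n by (auto simp: cA_def cB_def split: if_splits)
  qed
  then have "cA A (2 * k + 4) m = cA A' (2 * k + 4) m" "cB n B (2 * k + n) m = cB n B' (2 * k + n) m" for k m by blast+
  then show "A = A'" "B = B'" using sn_pos[of n] by (auto simp: cA_def cB_def fun_eq_iff)
qed

text \<open>The lowest part of \<open>K\<close> lies in the kernel of the homological equation, so
  it is matched by a combination \<open>Q\<close> of terms delta^m H^j. The flow of \<open>Q\<close>
  fixes \<open>H\<close>, and removing it from \<open>K\<close> gains one weight.\<close>

lemma uniqueness_step:
  assumes n: "n = 3 \<or> n = 4" and red: "reduced_coeffs n A B" "reduced_coeffs n A' B'" and B0: "0 < B 0 0"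
    and w: "3 \<le> w" and K: "gen K" "rot (2 * pi / real n) K = K" "wt (n - 2) w K"
    and eq: "ex 1 K (normal_hamiltonian n A B) = normal_hamiltonian n A' B'"
  shows "\<exists>K'. gen K' \<and> rot (2 * pi / real n) K' = K' \<and> wt (n - 2) (w + 1) K' \<and>
     ex 1 K' (normal_hamiltonian n A B) = normal_hamiltonian n A' B'"
proof -
  define H H' where "H = normal_hamiltonian n A B" and "H' = normal_hamiltonian n A' B'"
  define d th \<delta>I where "d = n - 2" and "th = 2 * pi / real n" and "\<delta>I = DI"
  define g where "g = sn n * B 0 0"
  define h where "h = hh n (lead_al n A) g 0"
  have gpos: "0 < g" using B0 sn_pos by (simp add: g_def)
  have d: "1 \<le> d" "d + 2 = n" using n by (auto simp: d_def)
  note nH = normal_props[OF n, where A = A and B = B, folded H_def th_def \<delta>I_def d_def, folded g_def, folded h_def]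
  have hom_h: "homog n h"
  proof -
    have "homog n (const3 (lead_al n A) * AI ^ 2)"
      using n homog_power[OF homog_action, of 2] by (auto simp: lead_al_def const3_simps intro: homog_const3)
    then show ?thesis unfolding h_def hh_def by (intro homog_add hom_CS)
  qed
  have K': "gen K" "rot th K = K" "wt d w K" using K by (simp_all add: th_def d_def)
  have d1: "wt d (w + n - 1) (H' - H - pb (\<delta>I + h) K)"
  proof -
    have 1: "wt d (w + n - 1) (ex 1 K H - H - const3 1 * pb H K)"
      by (rule wt_mono[OF ex_tail2[OF K'(1,3) _ nH(4)]]) (use w n in auto)
    have 2: "wt d (w + n - 1) (pb (H - \<delta>I - h) K)"
      by (rule wt_pb'[OF nH(5) K'(3)]) (use w in simp)
    from wt_add[OF 1 2] show ?thesis using eq by (simp add: H_def[symmetric] H'_def[symmetric] const3_simps pb_add pb_diff algebra_simps)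
  qed
  \<comment> \<open>\<open>Q\<close> is built to agree with \<open>K\<close> in weight
    \<open>w\<close>, one power of delta at a time, while commuting with \<open>H\<close>
    exactly.\<close>
  have "\<exists>Q. gen Q \<and> rot th Q = Q \<and> wt d w Q \<and> pb H Q = 0 \<and> (\<forall>E m. m < M \<longrightarrow> E + d * m = w \<longrightarrow> hp E m (K - Q) = 0)" for M
  proof (induction M)
    case 0
    show ?case by (rule exI[of _ 0]) (simp add: rot_simps)
  next
    case (Suc M)
    then obtain Q where Q: "gen Q" "rot th Q = Q" "wt d w Q" "pb H Q = 0" "\<And>E m. m < M \<Longrightarrow> E + d * m = w \<Longrightarrow> hp E m (K - Q) = 0" by blast
    show ?case
    proof (cases "d * M \<le> w")
      case False
      then show ?thesis using Q
        by (intro exI[of _ Q]) (metis le_add2 less_SucE)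
    next
      case True
      define E D where "E = w - d * M" and "D = E + n - 2"
      have ED: "E + d * M = w" using True by (simp add: E_def)
      define kp where "kp = hp E M (K - Q)"
      have gKQ: "gen (K - Q)" by (rule gen_diff[OF K'(1) Q(1)])
      have wKQ: "wt d w (K - Q)" by (rule wt_diff[OF K'(3) Q(3)])
      have kp: "homog E kp" "rot th kp = kp"
        using K'(2) Q(2) by (simp_all add: kp_def homog_hp hp_rot[symmetric] rot_simps del: hp_simps)
      have Dw: "D + d * M < w + n - 1" using ED n unfolding D_def by linarith
      have e1: "hp D M (H' - H) = hp D M (pb (\<delta>I + h) K)"
        using d1 Dw unfolding wt_hp by (metis eq_iff_diff_eq_0 hp_simps(2))
      have "wt d (w + n - 1) (pb (H - \<delta>I - h) Q)" by (rule wt_pb'[OF nH(5) Q(3)]) (use w in simp)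
      then have "hp D M (pb (H - \<delta>I - h) Q) = 0" using Dw unfolding wt_hp by blast
      then have "hp D M (pb (\<delta>I + h) Q) = 0" using Q(4) by (auto simp: pb_add pb_diff neg_eq_iff_add_eq_0)
      then have e2: "hp D M (H' - H) = hp D M (pb \<delta>I (K - Q)) + hp D M (pb h (K - Q))"
        unfolding e1 by (simp add: pb_add pb_diff algebra_simps neg_eq_iff_add_eq_0)
      \<comment> \<open>The bracket with delta I sees the previous power of delta, where
        \<open>Q\<close> already matches \<open>K\<close>.\<close>
      have e3: "hp D M (pb \<delta>I (K - Q)) = 0"
      proof (cases M)
        case (Suc M')
        have "hp D M' (pb AI (K - Q)) = 0"
        proof (cases "D = 0")
          case True then show ?thesis by (simp add: hp_pb_small[OF homog_action])
        next
          case False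
          have "D + d * M' = w" using ED Suc d by (simp add: D_def)
          then have "hp D M' (K - Q) = 0" using Q(5)[of M'] Suc by simp
          then show ?thesis using hp_pb[OF homog_action, of D M' "K - Q"] False by simp
        qed
        then show ?thesis by (simp add: \<delta>I_def pb_mult hp_delta_mult Suc del: hp_simps)
      qed (simp add: \<delta>I_def pb_mult hp_delta_mult)
      have e4: "hp D M (pb h (K - Q)) = pb h kp" if "1 \<le> E"
        using hp_pb[OF hom_h, of D M "K - Q"] n that by (auto simp: kp_def D_def)
      have "kp = 0 \<or> (\<exists>c j. kp = const3 c * h ^ j \<and> n * j = E)"
      proof (cases "1 \<le> E")
        case False
        then have "hp E M (K - Q) = 0" using gKQ unfolding gen_def wt_hp by auto
        then show ?thesis by (simp add: kp_def)
      next
        case True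
        show ?thesis unfolding h_def
        proof (rule homological_unique[OF n _ gpos kp[unfolded th_def] D_def])
          show "n = 3 \<Longrightarrow> lead_al n A = 0" by (simp add: lead_al_def)
          let ?x = "cA A' D M - cA A D M" and ?y = "(cB n B' D M - cB n B D M) / g"
          have yg: "const3 (y * g) * (P * Zr n) = const3 y * (P * CC n g 0)" for y P
            by (simp add: CC_def const3_simps mult_ac)
          have "pb h kp = hp D M ((H' - \<delta>I) - (H - \<delta>I))" using e2 e3 e4[OF True] by simp
          also have "\<dots> = hp D M (H' - \<delta>I) - hp D M (H - \<delta>I)" by (rule hp_simps(2))
          also have "\<dots> = const3 ?x * AI ^ (D div 2) + const3 (cB n B' D M - cB n B D M) * (AI ^ ((D - n) div 2) * Zr n)"
            unfolding H_def H'_def \<delta>I_def hp_normal by (simp add: const3_simps algebra_simps)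
          also have "cB n B' D M - cB n B D M = ?y * g" using gpos by simp
          also have "const3 (?y * g) * (AI ^ ((D - n) div 2) * Zr n) = const3 ?y * (AI ^ ((D - n) div 2) * CC n g 0)"
            by (rule yg)
          finally show "pb (hh n (lead_al n A) g 0) kp = const3 ?x * AI ^ (D div 2) + const3 ?y * (AI ^ ((D - n) div 2) * CC n g 0)"
            by (simp add: h_def)
          show "\<not> okA n D \<Longrightarrow> ?x = 0" "\<not> okB n D \<Longrightarrow> ?y = 0"
            using reduced_ok[OF n red(1), of D M] reduced_ok[OF n red(2), of D M] by auto
        qed
      qed
      \<comment> \<open>A nonzero constant is excluded by \<open>gen\<close>. The condition j >= 1
        recorded here makes H^j a multiple of \<open>H\<close>, hence admissible.\<close>
      then obtain c j where cj: "kp = const3 c * h ^ j" "c \<noteq> 0 \<longrightarrow> n * j = E \<and> 1 \<le> j"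
      proof
        assume "kp = 0" then show ?thesis using that[of 0 0] by (simp add: const3_simps)
      next
        assume "\<exists>c j. kp = const3 c * h ^ j \<and> n * j = E"
        then obtain c j where *: "kp = const3 c * h ^ j" "n * j = E" by auto
        show ?thesis
        proof (cases "j = 0")
          case True
          then have "E + 0 * M < 2" using * by simp
          then have "kp = 0" using gKQ unfolding gen_def wt_hp kp_def by blast
          then show ?thesis using that[of 0 0] by (simp add: const3_simps)
        qed (use that * in auto)
      qed
      \<comment> \<open>h^j is replaced by H^j, which has the same lowest part and commutes with
        \<open>H\<close> exactly.\<close>
      define q where "q = var_delta ^ M * (const3 c * H ^ j)"
      have q: "gen q" "rot th q = q" "wt d w q" "pb H q = 0" "\<And>E' m. E' + d * m = w \<Longrightarrow> m \<le> M \<Longrightarrow> hp E' m q = (if m = M then kp else 0)"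
      proof -
        show "rot th q = q" by (simp add: q_def rot_simps nH(3))
        have "pb H (var_delta ^ M) = 0" by (simp add: pb_power2)
        then show "pb H q = 0" by (simp add: q_def pb_mult pb_power2)
        show "gen q"
        proof (cases "c = 0")
          case False
          then obtain i where "j = Suc i" using cj(2) by (cases j) auto
          then have "q = (var_delta ^ M * (const3 c * H ^ i)) * H" by (simp add: q_def mult_ac)
          then show ?thesis using nH(2) by (auto simp: gen_def intro!: wt_mult_left)
        qed (simp add: q_def const3_simps)
        show "wt d w q"
        proof (cases "c = 0")
          case False
          have "wt d (d * M) (var_delta ^ M)" for d
            by (induction M) (use wt_mult[OF wt_var(3)] in auto)
          moreover have "wt d (n * j) (H ^ j)"
            by (induction j) (use wt_mult[OF nH(4)] in auto)
          ultimately have "wt d (d * M + n * j) q" unfolding q_def by (intro wt_mult wt_mult_left)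
          then show ?thesis using False cj(2) ED by (simp add: add.commute)
        qed (simp add: q_def const3_simps)
        fix E' m assume E': "E' + d * m = w" "m \<le> M"
        show "hp E' m q = (if m = M then kp else 0)"
        proof (cases "m = M \<and> c \<noteq> 0")
          case False
          then show ?thesis using E' cj(1) by (auto simp: q_def hp_delta_power const3_simps)
        next
          case True
          then have E'E: "E' = n * j" using E' ED cj(2) by auto
          define r where "r = H - \<delta>I - h"
          have pw: "wt d (n * j + 1) (H ^ j - (\<delta>I + h) ^ j)" if "1 \<le> j" for j
            using that
          proof (induction j)
            case (Suc i)
            have wh: "wt d n (\<delta>I + h)" using gen_delta_action(2)[of d] d homog_wt[OF hom_h] by (intro wt_add) (auto simp: \<delta>I_def)
            show ?case
            proof (cases "i = 0")
              case True then show ?thesis using nH(5) by (simp add: algebra_simps)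
            next
              case False
              have e: "H ^ Suc i - (\<delta>I + h) ^ Suc i = H * (H ^ i - (\<delta>I + h) ^ i) + (H - \<delta>I - h) * (\<delta>I + h) ^ i"
                by (simp add: algebra_simps)
              have p: "wt d (n * i) ((\<delta>I + h) ^ i)" by (induction i) (use wt_mult[OF wh] in auto)
              have 1: "wt d (n + (n * i + 1)) (H * (H ^ i - (\<delta>I + h) ^ i))" using Suc.IH False by (intro wt_mult nH(4)) auto
              have 2: "wt d ((n + 1) + n * i) ((H - \<delta>I - h) * (\<delta>I + h) ^ i)" by (intro wt_mult nH(5) p)
              show ?thesis unfolding e using wt_add[OF 1 wt_mono[OF 2]] by simp
            qed
          qed simp
          have "E' + d * 0 < n * j + 1" using E'E by simp
          then have "hp E' 0 (H ^ j - (\<delta>I + h) ^ j) = 0" using pw[of j] cj(2) True unfolding wt_hp by blast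
          moreover have "\<exists>X. (\<delta>I + h) ^ j = h ^ j + \<delta>I * X" for j
          proof (induction j)
            case (Suc j)
            then obtain X where "(\<delta>I + h) ^ j = h ^ j + \<delta>I * X" by blast
            then have "(\<delta>I + h) ^ Suc j = h ^ Suc j + \<delta>I * (h ^ j + \<delta>I * X + h * X)" by (simp add: algebra_simps)
            then show ?case by blast
          qed (auto intro: exI[of _ 0])
          then obtain X where "(\<delta>I + h) ^ j = h ^ j + \<delta>I * X" by blast
          then have "hp E' 0 ((\<delta>I + h) ^ j) = hp E' 0 (h ^ j)" by (simp add: \<delta>I_def hp_delta_mult mult.assoc)
          ultimately have "hp E' 0 (H ^ j) = hp E' 0 (h ^ j)" by simp
          also have "\<dots> = h ^ j" using hp_homog[OF homog_power[OF hom_h, of j]] E'E by simp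
          finally show ?thesis using True cj(1) by (simp add: q_def hp_delta_power)
        qed
      qed
      show ?thesis
      proof (intro exI[of _ "Q + q"] conjI allI impI)
        show "gen (Q + q)" "rot th (Q + q) = Q + q" "wt d w (Q + q)" "pb H (Q + q) = 0"
          using Q q by (simp_all add: gen_add rot_simps wt_add pb_add)
        fix E' m assume m: "m < Suc M" "E' + d * m = w"
        have "hp E' m (K - (Q + q)) = hp E' m (K - Q) - hp E' m q" by simp
        also have "\<dots> = 0"
        proof (cases "m = M")
          case True
          then have "E' = E" using m ED by simp
          then show ?thesis using q(5)[of E' m] True m by (simp add: kp_def)
        next
          case False
          then show ?thesis using q(5)[of E' m] Q(5)[of m E'] m by simp
        qed
        finally show "hp E' m (K - (Q + q)) = 0" .
      qed
    qed
  qed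
  from this[of "Suc w"] obtain Q where Q: "gen Q" "rot th Q = Q" "wt d w Q" "pb H Q = 0"
    "\<And>E m. m \<le> w \<Longrightarrow> E + d * m = w \<Longrightarrow> hp E m (K - Q) = 0" by (auto simp: less_Suc_eq_le)
  have KQ: "wt d (w + 1) (K - Q)"
    unfolding wt_hp
  proof (intro allI impI)
    fix E m assume lt: "E + d * m < w + 1"
    show "hp E m (K - Q) = 0"
    proof (cases "E + d * m = w")
      case True
      have "1 * m \<le> d * m" using d by (intro mult_le_mono1)
      then have "m \<le> w" using True by linarith
      then show ?thesis using Q(5) True by blast
    next
      case False
      have "wt d w (K - Q)" by (rule wt_diff[OF K'(3) Q(3)])
      then show ?thesis using lt False unfolding wt_hp by auto
    qed
  qed
  \<comment> \<open>Undoing the flow of \<open>Q\<close> first does not change the image of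
    \<open>H\<close>. The composite is again a flow, with a generator one weight higher.\<close>
  define S where "S f = ex 1 K (ex (-1) Q f)" for f
  have S: "symp S" unfolding S_def[abs_def] by (rule symp_comp[OF symp_ex[OF K'(1)] symp_ex[OF Q(1)]])
  have Su: "S u - u = ex 1 K (ex (-1) Q u) - ex 1 Q (ex (-1) Q u)" for u
    by (simp add: S_def ex_inverse(1)[OF Q(1)])
  have near: "wt e w' (S u - u)" if "wt e 1 u" "1 \<le> e" "wt e (w' + 1) (K - Q)" "1 \<le> w'" for e w' u
    unfolding Su using ex_cont[OF Q(1) K'(1) that(2,3) _ alg_wt[OF alg_ex[OF Q(1)] that(1), of "-1"], of 1] that(4) by simp
  have g3: "wt 1 (2 + 1) (K - Q)" using gen_diff[OF K'(1) Q(1)] by (simp add: gen_def)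
  obtain L where L: "gen L" "S = ex 1 L"
    using ex_surj[OF S near near] g3 by (metis le_refl one_le_numeral wt_var(1,2))
  have "wt d (w + 1) (L - 0)"
    by (rule ex_lead_wt[OF gen_0 L(1) d(1), of 1 w w]) (use near[OF wt_var(1) d(1) KQ] near[OF wt_var(2) d(1) KQ] w in \<open>auto simp: L(2)[symmetric]\<close>)
  \<comment> \<open>\<open>S\<close> commutes with the rotation, so the generators
    \<open>rot th L\<close> and \<open>L\<close> have the same time-one map.\<close>
  moreover have "rot th L = L"
  proof (rule ex_inj[OF L(1) gen_alg[OF alg_rot L(1)], of 1])
    show "ex 1 (rot th L) = ex 1 L"
    proof
      fix f
      have f: "f = rot th (rot (- th) f)" by (simp add: rot_inv)
      have "ex 1 (rot th L) f = rot th (ex 1 L (rot (- th) f))"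
        by (subst f) (simp add: symp_ex_conj[OF symp_rot L(1)])
      also have "\<dots> = rot th (ex 1 K (ex (-1) Q (rot (- th) f)))" using L(2) by (metis S_def)
      also have "\<dots> = ex 1 K (ex (-1) Q f)"
        by (simp add: symp_ex_conj[OF symp_rot K'(1)] symp_ex_conj[OF symp_rot Q(1)] K'(2) Q(2) rot_inv)
      also have "\<dots> = ex 1 L f" using L(2) by (metis S_def)
      finally show "ex 1 (rot th L) f = ex 1 L f" .
    qed
  qed simp
  moreover have "ex 1 L H = H'"
    using L(2) ex_fix[OF Q(4), of "-1"] eq by (metis S_def H_def H'_def)
  ultimately show ?thesis using L(1) by (intro exI[of _ L]) (simp add: H_def H'_def d_def th_def)
qed

text \<open>The linear part of \<open>S\<close> at delta = 0 must be a rotation, because delta I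
  occurs in both forms, and positivity of the leading coefficients makes it a symmetry of the normal
  form. Once it is divided out, the remaining map is the flow of an invariant generator whose weight
  can be raised without bound.\<close>

lemma normal_form_unique:
  assumes n: "n = 3 \<or> n = 4" and red: "reduced_coeffs n A B" "reduced_coeffs n A' B'" and B0: "0 < B 0 0" "0 < B' 0 0"
    and S: "symp S" "\<And>f. S (rot (2 * pi / real n) f) = rot (2 * pi / real n) (S f)"
    and eq: "S (normal_hamiltonian n A B) = normal_hamiltonian n A' B'"
  shows "A = A' \<and> B = B'"
proof -
  define H H' where "H = normal_hamiltonian n A B" and "H' = normal_hamiltonian n A' B'"
  define d th \<delta>I where "d = n - 2" and "th = 2 * pi / real n" and "\<delta>I = DI"
  define h h' where "h = hh n (lead_al n A) (sn n * B 0 0) 0" and "h' = hh n (lead_al n A') (sn n * B' 0 0) 0"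
  have d: "1 \<le> d" "d + 2 = n" and n0: "0 < n" using n by (auto simp: d_def)
  note nH = normal_props[OF n, where A = A and B = B, folded H_def th_def \<delta>I_def d_def, folded h_def]
  note nH' = normal_props[OF n, where A = A' and B = B', folded H'_def th_def \<delta>I_def d_def, folded h'_def]
  have SH: "S H = H'" using eq by (simp add: H_def H'_def)
  note aS = symp_alg[OF S(1)]
  have hom: "homog n (hh n (lead_al n A) g 0)" for A g
  proof -
    have "homog n (const3 (lead_al n A) * AI ^ 2)"
      using n homog_power[OF homog_action, of 2] by (auto simp: lead_al_def const3_simps intro: homog_const3)
    then show ?thesis unfolding hh_def by (intro homog_add hom_CS)
  qed
  define p q r s where "p = coeff3 (S var_x) 1 0 0" and "q = coeff3 (S var_x) 0 1 0" and "r = coeff3 (S var_y) 1 0 0" and "s = coeff3 (S var_y) 0 1 0"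
  define X Y where "X = const3 p * var_x + const3 q * var_y" and "Y = const3 r * var_x + const3 s * var_y"
  have Sv: "wt 0 1 (S var_x)" "wt 0 1 (S var_y)" using alg_wt0[OF aS] wt_var by auto
  have near: "wt e 2 (S var_x - X)" "wt e 2 (S var_y - Y)" if "1 \<le> e" for e
  proof -
    have "coeff3 (S var_x - X) i j k = 0 \<and> coeff3 (S var_y - Y) i j k = 0" if lt: "i + j + e * k < 2" for i j k
    proof (cases "i + j = 0")
      case True
      then show ?thesis using wtD[OF Sv(1), of i j k] wtD[OF Sv(2), of i j k] by (simp add: X_def Y_def)
    next
      case False
      moreover have "k \<le> e * k" using \<open>1 \<le> e\<close> by simp
      ultimately have "i + j = 1" "k = 0" using lt by linarith+
      then have "i = 1 \<and> j = 0 \<or> i = 0 \<and> j = 1" by linarith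
      then show ?thesis using \<open>k = 0\<close> by (auto simp: X_def Y_def p_def q_def r_def s_def)
    qed
    then show "wt e 2 (S var_x - X)" "wt e 2 (S var_y - Y)" by (simp_all add: wt_def)
  qed
  have c2: "coeff3 (const3 a * var_x * (const3 b * var_x)) i j k = (if i = 2 \<and> j = 0 \<and> k = 0 then a * b else 0)"
    "coeff3 (const3 a * var_x * (const3 b * var_y)) i j k = (if i = 1 \<and> j = 1 \<and> k = 0 then a * b else 0)"
    "coeff3 (const3 a * var_y * (const3 b * var_y)) i j k = (if i = 0 \<and> j = 2 \<and> k = 0 then a * b else 0)" for a b :: real and i j k
    by (auto simp: mult.assoc mult.left_commute[of _ "const3 b"] coeff3_var_mult)
  \<comment> \<open>The quadratic terms linear in delta are delta I on both sides, so the linear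
    part of \<open>S\<close> preserves x^2 + y^2.\<close>
  have quad: "X * X + Y * Y = 2 * AI"
  proof -
    have "hp 2 1 (H' - \<delta>I) = 0" using nH'(1) unfolding wt_hp by auto
    then have "hp 2 1 H' = AI" by (simp add: \<delta>I_def hp_delta_action)
    moreover have "hp 2 1 (S (H - \<delta>I)) = 0" using alg_wt0[OF aS nH(1)] unfolding wt_hp by auto
    then have "hp 2 1 H' = hp 2 1 (S \<delta>I)" using SH by (simp add: alg_simps[OF aS])
    moreover have "hp 2 1 (S \<delta>I) = hp 2 0 (S AI)" by (simp add: \<delta>I_def alg_mult[OF aS] alg_simps[OF aS] hp_delta_mult)
    ultimately have 1: "hp 2 0 (S AI) = AI" by simp
    have "2 * S AI = S (var_x ^ 2 + var_y ^ 2)"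
      unfolding var_squares alg_mult[OF aS] using alg_simps(5)[OF aS, of 2] by (simp add: const3_numeral)
    then have 2: "2 * S AI = S var_x * S var_x + S var_y * S var_y" by (simp add: alg_add[OF aS] alg_mult[OF aS] power2_eq_square)
    have hX: "homog 1 X" "homog 1 Y" unfolding X_def Y_def by (intro homog_add homog_const3 homog_simps)+
    have w3: "wt 1 3 (S v * S v - U * U)" if "wt 1 2 (S v - U)" "wt 1 1 (S v)" "wt 1 1 U" for v U
    proof -
      have e: "S v * S v - U * U = (S v - U) * S v + U * (S v - U)" by (simp add: algebra_simps)
      have 1: "wt 1 (2 + 1) ((S v - U) * S v)" "wt 1 (1 + 2) (U * (S v - U))" by (intro wt_mult that)+
      show ?thesis unfolding e by (rule wt_add) (use 1 in \<open>simp_all add: numeral_3_eq_3\<close>)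
    qed
    have "wt 1 3 (2 * S AI - (X * X + Y * Y))"
    proof -
      have "wt 1 3 ((S var_x * S var_x - X * X) + (S var_y * S var_y - Y * Y))"
        by (intro wt_add w3 near order_refl alg_wt[OF aS] wt_var homog_wt[OF hX(1)] homog_wt[OF hX(2)])
      then show ?thesis unfolding 2 by (simp add: algebra_simps)
    qed
    then have "hp 2 0 (2 * S AI - (X * X + Y * Y)) = 0" unfolding wt_hp by auto
    then have "hp 2 0 (2 * S AI) = hp 2 0 (X * X + Y * Y)" by simp
    moreover have "hp 2 0 (2 * S AI) = 2 * AI" using hp_simps(5)[of 2 0 2 "S AI"] 1 by (simp add: const3_numeral)
    moreover have "homog (1 + 1) (X * X + Y * Y)" by (intro homog_add homog_mult hX)
    then have "homog 2 (X * X + Y * Y)" by (simp add: numeral_2_eq_2)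
    ultimately show ?thesis using hp_homog[of 2 "X * X + Y * Y" 2 0] by (simp add: one_add_one)
  qed
  have cc: "coeff3 (X * X + Y * Y) i j 0 = coeff3 (var_x * var_x + var_y * var_y :: real fps3) i j 0" for i j
    unfolding quad var_squares[symmetric] by (simp add: power2_eq_square)
  have XX: "X * X + Y * Y = const3 (p * p + r * r) * (var_x * var_x) + const3 (2 * (p * q + r * s)) * (var_x * var_y) + const3 (q * q + s * s) * (var_y * var_y)"
    by (simp add: X_def Y_def const3_simps const3_numeral algebra_simps)
  have rel: "p * p + r * r = 1" "p * q + r * s = 0" "q * q + s * s = 1"
    using cc[of 2 0] cc[of 1 1] cc[of 0 2] unfolding XX by (simp_all add: coeff3_var_mult)
  have det: "p * s - q * r = 1"
  proof -
    have "pb (S var_x) (S var_y) = 1" using S(1) by (simp add: symp_def)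
    then have "coeff3 (pb (S var_x) (S var_y)) 0 0 0 = 1" by simp
    then show ?thesis by (simp add: pb_def coeff3_mult coeff3_deriv_x coeff3_deriv_y p_def q_def r_def s_def)
  qed
  have ps: "p = s" "q = - r"
  proof -
    have "s = s * (p * p + r * r)" using rel by simp
    also have "\<dots> = p * (p * s - q * r) + r * (p * q + r * s)" by (simp add: algebra_simps)
    finally show "p = s" using det rel by simp
    have "q = q * (p * p + r * r)" using rel by simp
    also have "\<dots> = p * (p * q + r * s) - r * (p * s - q * r)" by (simp add: algebra_simps)
    finally show "q = - r" using det rel by simp
  qed
  obtain t where t: "p = cos t" "r = sin t"
    using sincos_total_2pi[of p r] rel(1) by (auto simp: power2_eq_square)
  have XY: "X = rot t var_x" "Y = rot t var_y" by (simp_all add: X_def Y_def rot_var t ps[symmetric] ps(2) const3_simps)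
  have nr: "wt e 2 (S u - rot t u)" if "1 \<le> e" "u = var_x \<or> u = var_y" for e u
    using near[OF that(1)] that(2) unfolding XY by auto
  have lead: "rot t h = h'"
  proof -
    have 1: "hp n 0 (S (H - \<delta>I - h)) = 0" using alg_wt[OF aS nH(5)] unfolding wt_hp by auto
    have hh': "homog n h" unfolding h_def by (rule hom)
    have "wt d (n + 1) (S h - rot t h)"
      by (rule alg_diff_wt[OF aS alg_rot nr nr homog_wt[OF hh']]) (use d in auto)
    then have 2: "hp n 0 (S h - rot t h) = 0" unfolding wt_hp by auto
    have 3: "hp n 0 (S \<delta>I) = 0" by (simp add: \<delta>I_def alg_mult[OF aS] alg_simps[OF aS] hp_delta_mult)
    have 4: "hp n 0 (H' - \<delta>I - h') = 0" using nH'(5) unfolding wt_hp by auto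
    have 5: "hp n 0 h' = h'" "hp n 0 (rot t h) = rot t h"
      using hp_homog[OF hom[of A' "sn n * B' 0 0"], of n 0] hp_homog[OF homog_rot[OF hh'], of n 0] by (simp_all add: h'_def)
    have "hp n 0 (S H) = rot t h" using 1 2 3 5 by (simp add: alg_simps[OF aS])
    moreover have "hp n 0 H' = h'" using 4 5 by (simp add: \<delta>I_def hp_delta_mult)
    ultimately show ?thesis using SH by simp
  qed
  define G G' where "G = sn n * B 0 0" and "G' = sn n * B' 0 0"
  have G: "0 < G" "0 < G'" using B0 sn_pos by (simp_all add: G_def G'_def)
  \<comment> \<open>The leading coefficients \<open>G\<close> and \<open>G'\<close> are both
    positive and differ by the rotation through n t, which must therefore be trivial.\<close>
  have eqn: "const3 (lead_al n A') * AI ^ 2 + const3 G' * (AI ^ 0 * Zr n) =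
    const3 (lead_al n A) * AI ^ 2 + const3 G * (AI ^ 0 * (const3 (cos (real n * t)) * Zr n - const3 (sin (real n * t)) * Zi n))"
    using lead by (simp add: h_def h'_def hh_def CC_def rot_simps rot_Z const3_simps G_def G'_def)
  have c: "G' = G * cos (real n * t)"
    by (rule ray_indep(2)[OF eqn, where D = n]; use n in \<open>auto simp: lead_al_def split: if_splits\<close>)
  have c2: "G * sin (real n * t) = 0"
    by (rule ray_indep(3)[OF eqn, where D = n]; use n in \<open>auto simp: lead_al_def split: if_splits\<close>)
  then have "sin (real n * t) = 0" using G by simp
  then have "cos (real n * t) = 1 \<or> cos (real n * t) = -1"
    using sin_cos_squared_add[of "real n * t"] by (simp add: power2_eq_1_iff)
  then have cos1: "cos (real n * t) = 1" using c G by auto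
  \<comment> \<open>The rotation by t fixes the normal form, so dividing it out keeps the image of
    \<open>H\<close> and leaves a map tangent to the identity.\<close>
  define S2 where "S2 f = S (rot (- t) f)" for f
  have S2: "symp S2" unfolding S2_def[abs_def] by (rule symp_comp[OF S(1) symp_rot])
  have n2: "wt 1 2 (S2 u - u)" if u: "u = var_x \<or> u = var_y" for u
  proof -
    have w: "wt 1 1 (rot (- t) u)" using u by (intro alg_wt[OF alg_rot]) auto
    have "wt 1 (1 + 1) (S (rot (- t) u) - rot t (rot (- t) u))"
      by (rule alg_diff_wt[OF aS alg_rot nr nr w]) auto
    then show ?thesis by (simp add: S2_def rot_inv numeral_2_eq_2)
  qed
  obtain K where K: "gen K" "S2 = ex 1 K" using ex_surj[OF S2 n2 n2] by auto
  have "cos (real n * (- t)) = 1" using cos1 by simp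
  then have K_H: "ex 1 K H = H'" using nH(6)[of "- t"] SH K(2) by (metis S2_def)
  have rK: "rot th K = K"
  proof (rule ex_inj[OF K(1) gen_alg[OF alg_rot K(1)], of 1])
    show "ex 1 (rot th K) = ex 1 K"
    proof
      fix f
      have f: "f = rot th (rot (- th) f)" by (simp add: rot_inv)
      have "ex 1 (rot th K) f = rot th (ex 1 K (rot (- th) f))"
        by (subst f) (simp add: symp_ex_conj[OF symp_rot K(1)])
      also have "\<dots> = rot th (S (rot (- t) (rot (- th) f)))" using K(2) by (metis S2_def)
      also have "\<dots> = S (rot th (rot (- t) (rot (- th) f)))" by (simp add: S(2) th_def)
      also have "\<dots> = S (rot (- t) f)" by (simp add: rot_rot)
      also have "\<dots> = ex 1 K f" using K(2) by (metis S2_def)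
      finally show "ex 1 (rot th K) f = ex 1 K f" .
    qed
  qed simp
  \<comment> \<open>Generators of arbitrarily high weight carry \<open>H\<close> to
    \<open>H'\<close>, so the difference of the two has infinite weight.\<close>
  have "\<exists>K. gen K \<and> rot th K = K \<and> wt d (w + 3) K \<and> ex 1 K H = H'" for w
  proof (induction w)
    case 0
    show ?case using K(1) rK K_H gen_wt[OF K(1) d(1)] by auto
  next
    case (Suc w)
    then obtain K where "gen K" "rot th K = K" "wt d (w + 3) K" "ex 1 K H = H'" by blast
    from uniqueness_step[OF n red B0(1) _ this[unfolded th_def d_def H_def H'_def]]
    show ?case by (simp add: th_def d_def H_def H'_def add.commute)
  qed
  then have "wt d w (H' - H)" for w
  proof -
    obtain K where K: "gen K" "wt d (w + 3) K" "ex 1 K H = H'" using \<open>\<And>w. \<exists>K. gen K \<and> rot th K = K \<and> wt d (w + 3) K \<and> ex 1 K H = H'\<close>[of w] by blast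
    have "wt d (n + (w + 3) - 2) (ex 1 K H - H)" by (rule ex_tail1[OF K(1,2) _ nH(4)]) simp
    then show ?thesis unfolding K(3) by (rule wt_mono) simp
  qed
  then have "H' - H = 0" by (rule wt_eq_0)
  then have "normal_hamiltonian n A B = normal_hamiltonian n A' B'" by (simp add: H_def H'_def)
  from normal_inj[OF n this] show ?thesis by simp
qed

subsection \<open>Convergent expansions\<close>

text \<open>\<open>has_fps3_expansion\<close> with its radius made explicit, so that several
  expansions can be combined on one cube.\<close>

definition hx :: "real \<Rightarrow> (real \<Rightarrow> real \<Rightarrow> real \<Rightarrow> real) \<Rightarrow> real fps3 \<Rightarrow> bool" where
  "hx r g P \<longleftrightarrow> (\<forall>x y d. \<bar>x\<bar> < r \<and> \<bar>y\<bar> < r \<and> \<bar>d\<bar> < r \<longrightarrow>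
     ((\<lambda>(i, j, k). coeff3 P i j k * x ^ i * y ^ j * d ^ k) has_sum g x y d) UNIV)"

lemma hxD: "hx r g P \<Longrightarrow> \<bar>x\<bar> < r \<Longrightarrow> \<bar>y\<bar> < r \<Longrightarrow> \<bar>d\<bar> < r \<Longrightarrow>
    ((\<lambda>(i, j, k). coeff3 P i j k * x ^ i * y ^ j * d ^ k) has_sum g x y d) UNIV"
  by (simp add: hx_def)

lemma hx_mono: "hx r g P \<Longrightarrow> s \<le> r \<Longrightarrow> hx s g P"
  by (auto simp: hx_def)

lemma hx_cong: "hx r g P \<Longrightarrow> (\<And>x y d. \<bar>x\<bar> < r \<Longrightarrow> \<bar>y\<bar> < r \<Longrightarrow> \<bar>d\<bar> < r \<Longrightarrow> g x y d = g' x y d) \<Longrightarrow> hx r g' P"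
  by (auto simp: hx_def)

lemma expansion_hx: "has_fps3_expansion g P \<longleftrightarrow> (\<exists>r>0. hx r g P)"
  by (simp add: has_fps3_expansion_def hx_def)

lemma hx_diff: "hx r g P \<Longrightarrow> hx r h Q \<Longrightarrow> hx r (\<lambda>x y d. g x y d - h x y d) (P - Q)"
  unfolding hx_def
proof (intro allI impI, elim conjE)
  fix x y d assume P: "\<forall>x y d. \<bar>x\<bar> < r \<and> \<bar>y\<bar> < r \<and> \<bar>d\<bar> < r \<longrightarrow>
     ((\<lambda>(i, j, k). coeff3 P i j k * x ^ i * y ^ j * d ^ k) has_sum g x y d) UNIV"
    and Q: "\<forall>x y d. \<bar>x\<bar> < r \<and> \<bar>y\<bar> < r \<and> \<bar>d\<bar> < r \<longrightarrow>
     ((\<lambda>(i, j, k). coeff3 Q i j k * x ^ i * y ^ j * d ^ k) has_sum h x y d) UNIV"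
    and *: "\<bar>x\<bar> < r" "\<bar>y\<bar> < r" "\<bar>d\<bar> < r"
  have "((\<lambda>u. (case u of (i, j, k) \<Rightarrow> coeff3 P i j k * x ^ i * y ^ j * d ^ k)
      + - (case u of (i, j, k) \<Rightarrow> coeff3 Q i j k * x ^ i * y ^ j * d ^ k)) has_sum g x y d + - h x y d) UNIV"
    using P Q * by (intro has_sum_add) (auto simp: has_sum_uminus)
  then show "((\<lambda>(i, j, k). coeff3 (P - Q) i j k * x ^ i * y ^ j * d ^ k) has_sum g x y d - h x y d) UNIV"
    by (simp add: split_def algebra_simps)
qed

lemma has_sum_product_real:
  fixes f :: "'a \<Rightarrow> real" and g :: "'b \<Rightarrow> real"
  assumes f: "(f has_sum a) A" and g: "(g has_sum b) B"
  shows "((\<lambda>(x, y). f x * g y) has_sum a * b) (A \<times> B)"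
proof (rule has_sum_SigmaI)
  show "((\<lambda>y. case (x, y) of (x, y) \<Rightarrow> f x * g y) has_sum f x * b) B" for x
    using has_sum_cmult_right[OF g, of "f x"] by simp
  show "((\<lambda>x. f x * b) has_sum a * b) A" by (rule has_sum_cmult_left[OF f])
  have fa: "(\<lambda>x. norm (f x)) summable_on A" and ga: "(\<lambda>x. norm (g x)) summable_on B"
    using has_sum_imp_summable[OF f] has_sum_imp_summable[OF g] summable_on_iff_abs_summable_on_real by blast+
  have "(\<lambda>u. norm ((\<lambda>(x, y). f x * g y) u)) summable_on A \<times> B"
    unfolding Infinite_Sum.abs_summable_on_Sigma_iff
  proof (intro conjI ballI)
    show "(\<lambda>y. norm (case (x, y) of (x, y) \<Rightarrow> f x * g y)) summable_on B" for x
      using summable_on_cmult_right[OF ga, of "norm (f x)"] by (simp add: abs_mult)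
    show "(\<lambda>x. norm (\<Sum>\<^sub>\<infinity>y\<in>B. norm (case (x, y) of (x, y) \<Rightarrow> f x * g y))) summable_on A"
      using summable_on_cmult_left[OF fa, of "infsum (\<lambda>y. norm (g y)) B"] infsum_nonneg[of B "\<lambda>y. norm (g y)"]
      by (simp add: abs_mult infsum_cmult_right')
  qed
  then show "(\<lambda>(x, y). f x * g y) summable_on A \<times> B"
    using summable_on_iff_abs_summable_on_real by blast
qed

lemma hx_mult:
  assumes P: "hx r g P" and Q: "hx r h Q"
  shows "hx r (\<lambda>x y d. g x y d * h x y d) (P * Q)"
  unfolding hx_def
proof (intro allI impI)
  fix x y d :: real assume xyd: "\<bar>x\<bar> < r \<and> \<bar>y\<bar> < r \<and> \<bar>d\<bar> < r"
  define m where "m P = (\<lambda>(i, j, k). coeff3 P i j k * x ^ i * y ^ j * d ^ k)" for P :: "real fps3"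
  define B where "B = (\<lambda>(i, j, k). {..i} \<times> {..j} \<times> {..k :: nat} :: (nat \<times> nat \<times> nat) set)"
  \<comment> \<open>The Cauchy product: a multi-index together with a smaller one corresponds to a
    pair of multi-indices, the part and the rest.\<close>
  define t :: "(nat \<times> nat \<times> nat) \<times> (nat \<times> nat \<times> nat) \<Rightarrow> (nat \<times> nat \<times> nat) \<times> (nat \<times> nat \<times> nat)"
    where "t = (\<lambda>((i, j, k), (p, q, s)). ((p, q, s), (i - p, j - q, k - s)))"
  have "(m P has_sum g x y d) UNIV" "(m Q has_sum h x y d) UNIV"
    using hxD[OF P, of x y d] hxD[OF Q, of x y d] xyd by (simp_all add: m_def)
  from has_sum_product_real[OF this] have 1: "((\<lambda>(u, v). m P u * m Q v) has_sum g x y d * h x y d) UNIV"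
    by (simp only: UNIV_Times_UNIV)
  have bij: "bij_betw t (Sigma UNIV B) UNIV"
    by (rule bij_betw_byWitness[where f' = "\<lambda>((p, q, s), (i, j, k)). ((p + i, q + j, s + k), (p, q, s))"])
      (auto simp: t_def B_def)
  have 2: "((\<lambda>w. case t w of (u, v) \<Rightarrow> m P u * m Q v) has_sum g x y d * h x y d) (Sigma UNIV B)"
    using 1 unfolding has_sum_reindex_bij_betw[OF bij] .
  have "(m (P * Q) has_sum g x y d * h x y d) UNIV"
  proof (rule has_sum_SigmaD[OF 2])
    fix u :: "nat \<times> nat \<times> nat"
    obtain i j k where u: "u = (i, j, k)" by (cases u)
    have pw: "z ^ p * z ^ (i - p) = z ^ i" if "p \<le> i" for p i and z :: real
      using that by (simp flip: power_add)
    have "m (P * Q) u = (\<Sum>v\<in>B u. case v of (p, q, s) \<Rightarrow>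
        coeff3 P p q s * coeff3 Q (i - p) (j - q) (k - s) * x ^ i * y ^ j * d ^ k)"
      by (simp add: u m_def B_def coeff3_mult sum_distrib_right sum.cartesian_product split_def)
    also have "\<dots> = (\<Sum>v\<in>B u. case t (u, v) of (u, v) \<Rightarrow> m P u * m Q v)"
    proof (rule sum.cong[OF refl])
      fix v assume "v \<in> B u"
      then obtain p q s where v: "v = (p, q, s)" and le: "p \<le> i" "q \<le> j" "s \<le> k" by (cases v) (auto simp: B_def u)
      show "(case v of (p, q, s) \<Rightarrow> coeff3 P p q s * coeff3 Q (i - p) (j - q) (k - s) * x ^ i * y ^ j * d ^ k)
          = (case t (u, v) of (u, v) \<Rightarrow> m P u * m Q v)"
        unfolding u v t_def m_def prod.case pw[OF le(1), symmetric] pw[OF le(2), symmetric] pw[OF le(3), symmetric]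
        by (simp only: mult_ac)
    qed
    finally have "m (P * Q) u = (\<Sum>v\<in>B u. case t (u, v) of (u, v) \<Rightarrow> m P u * m Q v)" .
    then show "((\<lambda>v. case t (u, v) of (u, v) \<Rightarrow> m P u * m Q v) has_sum m (P * Q) u) (B u)"
      by (intro has_sum_finiteI) (auto simp: B_def u)
  qed
  then show "((\<lambda>(i, j, k). coeff3 (P * Q) i j k * x ^ i * y ^ j * d ^ k) has_sum g x y d * h x y d) UNIV"
    by (simp add: m_def)
qed

lemma hx_const3: "hx r (\<lambda>x y d. c) (const3 c)"
  unfolding hx_def
proof (intro allI impI)
  fix x y d :: real
  have [simp]: "coeff3 (const3 c) i j k = (if i = 0 \<and> j = 0 \<and> k = 0 then c else 0)" for i j k
    by (simp add: const3_def coeff3_def)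
  have "((\<lambda>(i, j, k). coeff3 (const3 c) i j k * x ^ i * y ^ j * d ^ k) has_sum c) {(0, 0, 0)}"
    by (rule has_sum_finiteI) auto
  then show "((\<lambda>(i, j, k). coeff3 (const3 c) i j k * x ^ i * y ^ j * d ^ k) has_sum c) UNIV"
    by (rule has_sum_cong_neutral[THEN iffD1, rotated -1]) (auto split: if_splits)
qed

text \<open>After division by x^N, where \<open>N\<close> is the first index with a nonzero
  coefficient, the sum tends to that coefficient; for N < M the bound makes it tend to zero
  instead.\<close>

lemma powser_flat:
  fixes w :: "nat \<Rightarrow> real"
  assumes r: "0 < r" and w: "\<And>x. \<bar>x\<bar> < r \<Longrightarrow> (\<lambda>n. w n * x ^ n) sums W x"
    and W: "\<And>x. \<bar>x\<bar> < r \<Longrightarrow> \<bar>W x\<bar> \<le> C * \<bar>x\<bar> ^ M" and n: "n < M"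
  shows "w n = 0"
proof (rule ccontr)
  assume "w n \<noteq> 0"
  define N where "N = (LEAST n. w n \<noteq> 0)"
  have N: "w N \<noteq> 0" unfolding N_def by (rule LeastI[of "\<lambda>n. w n \<noteq> 0", OF \<open>w n \<noteq> 0\<close>])
  have N2: "w n = 0" if "n < N" for n using not_less_Least[OF that[unfolded N_def]] by blast
  have NM: "N < M" using N2[of n] \<open>w n \<noteq> 0\<close> n by (meson le_less_trans not_le)
  define c where "c n = w (n + N)" for n
  have s: "(\<lambda>n. c n * x ^ n) sums (if x = 0 then c 0 else W x / x ^ N)" if "norm x < r" for x
  proof (cases "x = 0")
    case False
    have "(\<lambda>n. w (n + N) * x ^ (n + N)) sums W x"
      using sums_iff_shift[of "\<lambda>n. w n * x ^ n" N "W x"] N2 w[of x] that by simp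
    then have "(\<lambda>n. w (n + N) * x ^ (n + N) / x ^ N) sums (W x / x ^ N)"
      by (rule sums_divide)
    moreover have "w (n + N) * x ^ (n + N) / x ^ N = c n * x ^ n" for n
      using False by (simp add: c_def power_add)
    ultimately show ?thesis using False by simp
  qed (use powser_sums_zero[of c] in simp)
  have "((\<lambda>x. if x = 0 then c 0 else W x / x ^ N) \<longlongrightarrow> c 0) (at (0 :: real))"
    by (rule powser_limit_0[OF r s])
  moreover have "((\<lambda>x. if x = 0 then c 0 else W x / x ^ N) \<longlongrightarrow> 0) (at (0 :: real))"
  proof (rule Lim_null_comparison)
    have "norm (if x = 0 then c 0 else W x / x ^ N) \<le> \<bar>C\<bar> * \<bar>x\<bar>" if x: "x \<noteq> 0" "dist x 0 < min r 1" for x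
    proof -
      have x1: "0 < \<bar>x\<bar>" "\<bar>x\<bar> < r" "\<bar>x\<bar> \<le> 1" using x by auto
      have "\<bar>W x\<bar> \<le> \<bar>C\<bar> * \<bar>x\<bar> ^ M" by (rule order_trans[OF W[OF x1(2)]]) (auto intro: mult_right_mono)
      also have "\<bar>x\<bar> ^ M \<le> \<bar>x\<bar> ^ Suc N" using x1 NM by (intro power_decreasing) auto
      finally have "\<bar>W x\<bar> \<le> \<bar>C\<bar> * \<bar>x\<bar> ^ Suc N" by (simp add: mult_left_mono)
      then show ?thesis using x1 by (simp add: abs_divide power_abs divide_le_eq mult_ac)
    qed
    then show "\<forall>\<^sub>F x in at 0. norm (if x = 0 then c 0 else W x / x ^ N) \<le> \<bar>C\<bar> * \<bar>x\<bar>"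
      unfolding eventually_at using r by (intro exI[of _ "min r 1"]) auto
    show "((\<lambda>x. \<bar>C\<bar> * \<bar>x\<bar>) \<longlongrightarrow> 0) (at (0 :: real))" by (auto intro!: tendsto_eq_intros)
  qed
  ultimately have "c 0 = 0" using tendsto_unique trivial_limit_at by blast
  then show False using N by (simp add: c_def)
qed

section \<open>Uniqueness of convergent expansions\<close>

lemma powser_unique:
  fixes a b :: "nat \<Rightarrow> real"
  assumes r: "0 < r" and a: "\<And>x. \<bar>x\<bar> < r \<Longrightarrow> (\<lambda>n. a n * x ^ n) sums f x"
    and b: "\<And>x. \<bar>x\<bar> < r \<Longrightarrow> (\<lambda>n. b n * x ^ n) sums f x"
  shows "a = b"
proof
  fix n
  have "(\<lambda>n. (a n - b n) * x ^ n) sums 0" if "\<bar>x\<bar> < r" for x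
    using sums_diff[OF a b, of x x] that by (simp add: algebra_simps)
  from powser_flat[OF r this, of 0 "Suc n" n] show "a n = b n" by simp
qed

text \<open>Summing over the inner index first gives a vanishing power series in x whose
  coefficients are the inner sums. Applied once per variable this reduces uniqueness to one
  variable.\<close>

lemma has_sum_nested_zero:
  fixes c :: "nat \<Rightarrow> 'b \<Rightarrow> real"
  assumes r: "0 < r" and z: "\<And>x. \<bar>x\<bar> < r \<Longrightarrow> ((\<lambda>(i, q). c i q * x ^ i) has_sum 0) UNIV"
  shows "(c i has_sum 0) UNIV"
proof -
  define s where "s i = infsum (c i) UNIV" for i
  have cs: "(c i has_sum s i) UNIV" for i
  proof -
    have "(\<lambda>(i, q). c i q * (r / 2) ^ i) summable_on UNIV \<times> UNIV"
      using has_sum_imp_summable[OF z[of "r / 2"]] r by simp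
    then have "(\<lambda>q. c i q * (r / 2) ^ i) summable_on UNIV" by (rule summable_on_SigmaD1) simp
    then have "(\<lambda>q. c i q * (r / 2) ^ i * inverse ((r / 2) ^ i)) summable_on UNIV" by (rule summable_on_cmult_left)
    moreover have "(\<lambda>q. c i q * (r / 2) ^ i * inverse ((r / 2) ^ i)) = c i" using r by (simp add: fun_eq_iff)
    ultimately show ?thesis by (simp add: s_def)
  qed
  have "s = (\<lambda>_. 0)"
  proof (rule powser_unique[OF r])
    fix x :: real assume x: "\<bar>x\<bar> < r"
    have "((\<lambda>i. s i * x ^ i) has_sum 0) UNIV"
      by (rule has_sum_SigmaD[where B = "\<lambda>_. UNIV" and f = "\<lambda>(i, q). c i q * x ^ i"])
        (use z[OF x] has_sum_cmult_left[OF cs] in auto)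
    then show "(\<lambda>n. s n * x ^ n) sums 0" by (rule has_sum_imp_sums)
  qed simp
  then show ?thesis using cs[of i] by simp
qed

lemma hx_zero: assumes r: "0 < r" and P: "hx r (\<lambda>x y d. 0) P" shows "P = 0"
proof (rule coeff3_ext)
  fix i j k
  have 1: "((\<lambda>(j, k). coeff3 P i j k * y ^ j * d ^ k) has_sum 0) UNIV" if "\<bar>y\<bar> < r" "\<bar>d\<bar> < r" for y d
  proof -
    show ?thesis
    proof (rule has_sum_nested_zero[OF r, where c = "\<lambda>i (j, k). coeff3 P i j k * y ^ j * d ^ k" and i = i])
      fix x :: real assume "\<bar>x\<bar> < r"
      from hxD[OF P this that] show "((\<lambda>(i, q). (case q of (j, k) \<Rightarrow> coeff3 P i j k * y ^ j * d ^ k) * x ^ i) has_sum 0) UNIV"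
        by (simp add: split_def mult_ac)
    qed
  qed
  have 2: "((\<lambda>k. coeff3 P i j k * d ^ k) has_sum 0) UNIV" if "\<bar>d\<bar> < r" for d
  proof (rule has_sum_nested_zero[OF r])
    fix y :: real assume "\<bar>y\<bar> < r"
    from 1[OF this that] show "((\<lambda>(j, k). coeff3 P i j k * d ^ k * y ^ j) has_sum 0) UNIV"
      by (simp add: split_def mult_ac)
  qed
  have "(\<lambda>k. coeff3 P i j k) = (\<lambda>_. 0)"
    by (rule powser_unique[OF r, of _ "\<lambda>_. 0"]) (use has_sum_imp_sums[OF 2] in auto)
  then show "coeff3 P i j k = coeff3 0 i j k" by (simp add: fun_eq_iff)
qed

lemma hx_unique: "0 < r \<Longrightarrow> hx r g P \<Longrightarrow> hx r g Q \<Longrightarrow> P = Q"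
  using hx_zero[of r "P - Q"] hx_diff[of r g P g Q] by simp

text \<open>The definition of conjugacy only asserts that some Taylor series exists; two conjugacies
  of one map have to speak of the same series to be compared.\<close>

lemma taylor_unique:
  assumes "has_taylor_series f G" "has_taylor_series f G'" shows "G = G'"
proof -
  have "P = Q" if PQ: "has_fps3_expansion g P" "has_fps3_expansion g Q" for g P Q
  proof -
    obtain r s where "0 < r" "hx r g P" "0 < s" "hx s g Q"
      using PQ unfolding expansion_hx by blast
    then show ?thesis
      by (intro hx_unique[of "min r s" g]) (auto intro: hx_mono[of r] hx_mono[of s])
  qed
  then show ?thesis using assms unfolding has_taylor_series_def by (auto simp: prod_eq_iff)
qed

text \<open>The factor i of a derivative is absorbed by passing from the radius r/4 to r/2.\<close>

lemma nat_mult_half_power: "real i * (r / 4) ^ (i - 1) \<le> 4 / r * (r / 2) ^ i" if "0 < r"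
proof (cases i)
  case (Suc m)
  have "real (Suc m) \<le> 2 ^ Suc m" using less_exp[of "Suc m"] by (metis less_imp_le of_nat_le_iff of_nat_numeral of_nat_power)
  then have "real (Suc m) * (r / 4) ^ m \<le> 2 ^ Suc m * (r / 4) ^ m" using that by (intro mult_right_mono) auto
  also have "\<dots> = 2 * (2 ^ m * (r / 4) ^ m)" by simp
  also have "2 ^ m * (r / 4) ^ m = (r / 2) ^ m" by (simp add: power_mult_distrib[symmetric])
  finally show ?thesis using that Suc by (simp add: field_simps)
qed (use that in simp)

lemma hx_summable:
  assumes P: "hx r g P" and s: "0 \<le> s" "s < r"
  shows "(\<lambda>(i, j, k). \<bar>coeff3 P i j k\<bar> * s ^ (i + j + k)) summable_on UNIV"
proof -
  have "(\<lambda>(i, j, k). coeff3 P i j k * s ^ i * s ^ j * s ^ k) summable_on UNIV"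
    using has_sum_imp_summable[OF hxD[OF P, of s s s]] s by simp
  then have "(\<lambda>u. norm ((\<lambda>(i, j, k). coeff3 P i j k * s ^ i * s ^ j * s ^ k) u)) summable_on UNIV"
    using summable_on_iff_abs_summable_on_real by blast
  then show ?thesis by (simp add: split_def abs_mult power_add mult_ac s power_abs)
qed

text \<open>On the cube of size r/4 the differentiated terms are dominated by the absolutely
  convergent terms at r/2. This gives the uniform convergence of the derivatives that termwise
  differentiation needs.\<close>

lemma hx_deriv:
  assumes r: "0 < r" and P: "hx r g P"
  obtains gx gy where "hx (r / 4) gx (deriv_x P)" "hx (r / 4) gy (deriv_y P)"
    "\<And>x y d. \<bar>x\<bar> < r / 4 \<Longrightarrow> \<bar>y\<bar> < r / 4 \<Longrightarrow> \<bar>d\<bar> < r / 4 \<Longrightarrow>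
      ((\<lambda>p :: real^2. g (p $ 1) (p $ 2) d) has_derivative (\<lambda>h. gx x y d * h $ 1 + gy x y d * h $ 2)) (at (vector [x, y]))"
proof -
  define A where "A = (\<lambda>(i, j, k). \<bar>coeff3 P i j k\<bar> * (r / 2) ^ (i + j + k))"
  have A: "A summable_on UNIV" "\<And>u. 0 \<le> A u" using hx_summable[OF P, of "r / 2"] r by (auto simp: A_def)
  define a1 where "a1 x y d = (\<lambda>(i, j, k). coeff3 P i j k * real i * x ^ (i - 1) * y ^ j * d ^ k)" for x y d
  define a2 where "a2 x y d = (\<lambda>(i, j, k). coeff3 P i j k * real j * x ^ i * y ^ (j - 1) * d ^ k)" for x y d
  have pw: "\<bar>x\<bar> ^ i \<le> (r / 2) ^ i" "\<bar>x\<bar> ^ i \<le> (r / 4) ^ i" if "\<bar>x\<bar> < r / 4" for x i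
    using that by (intro power_mono; simp)+
  have b1: "\<bar>a1 x y d u\<bar> \<le> 4 / r * A u" and b2: "\<bar>a2 x y d u\<bar> \<le> 4 / r * A u" 
    if "\<bar>x\<bar> < r / 4" "\<bar>y\<bar> < r / 4" "\<bar>d\<bar> < r / 4" for x y d u
  proof -
    obtain i j k where u: "u = (i, j, k)" by (cases u)
    have key: "real i * \<bar>x\<bar> ^ (i - 1) \<le> 4 / r * (r / 2) ^ i" if "\<bar>x\<bar> < r / 4" for x i
      by (rule order_trans[OF mult_left_mono[OF pw(2)[OF that]] nat_mult_half_power[OF r]]) simp
    have "\<bar>a1 x y d u\<bar> = \<bar>coeff3 P i j k\<bar> * ((real i * \<bar>x\<bar> ^ (i - 1)) * (\<bar>y\<bar> ^ j * \<bar>d\<bar> ^ k))"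
      by (simp add: a1_def u abs_mult power_abs mult_ac)
    also have "\<dots> \<le> \<bar>coeff3 P i j k\<bar> * ((4 / r * (r / 2) ^ i) * ((r / 2) ^ j * (r / 2) ^ k))"
      using r by (intro mult_left_mono mult_mono key pw that) auto
    finally show "\<bar>a1 x y d u\<bar> \<le> 4 / r * A u" by (simp add: A_def u power_add mult_ac)
    have "\<bar>a2 x y d u\<bar> = \<bar>coeff3 P i j k\<bar> * ((real j * \<bar>y\<bar> ^ (j - 1)) * (\<bar>x\<bar> ^ i * \<bar>d\<bar> ^ k))"
      by (simp add: a2_def u abs_mult power_abs mult_ac)
    also have "\<dots> \<le> \<bar>coeff3 P i j k\<bar> * ((4 / r * (r / 2) ^ j) * ((r / 2) ^ i * (r / 2) ^ k))"
      using r by (intro mult_left_mono mult_mono key pw that) auto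
    finally show "\<bar>a2 x y d u\<bar> \<le> 4 / r * A u" by (simp add: A_def u power_add mult_ac)
  qed
  have summ: "f summable_on UNIV" if "\<And>u. \<bar>f u\<bar> \<le> 4 / r * A u" for f :: "nat \<times> nat \<times> nat \<Rightarrow> real"
  proof -
    have "(\<lambda>u. norm (f u)) summable_on UNIV"
      by (rule Infinite_Sum.abs_summable_on_comparison_test'[OF summable_on_cmult_right[OF A(1), of "4 / r"]]) (use that in simp)
    then show ?thesis using summable_on_iff_abs_summable_on_real by blast
  qed
  define gx gy where "gx x y d = infsum (a1 x y d) UNIV" and "gy x y d = infsum (a2 x y d) UNIV" for x y d
  have h1: "(a1 x y d has_sum gx x y d) UNIV" and h2: "(a2 x y d has_sum gy x y d) UNIV" 
    if "\<bar>x\<bar> < r / 4" "\<bar>y\<bar> < r / 4" "\<bar>d\<bar> < r / 4" for x y d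
    using summ[OF b1[OF that]] summ[OF b2[OF that]] by (simp_all add: gx_def gy_def)
  have "hx (r / 4) gx (deriv_x P)" unfolding hx_def
  proof (intro allI impI, elim conjE)
    fix x y d assume *: "\<bar>x\<bar> < r / 4" "\<bar>y\<bar> < r / 4" "\<bar>d\<bar> < r / 4"
    define s :: "nat \<times> nat \<times> nat \<Rightarrow> nat \<times> nat \<times> nat" where "s = (\<lambda>(i, j, k). (Suc i, j, k))"
    have "(a1 x y d has_sum gx x y d) (range s)"
    proof (rule has_sum_cong_neutral[THEN iffD1, OF _ _ _ h1[OF *]])
      fix u assume "u \<in> UNIV - range s"
      moreover have "u = s (fst u - 1, snd u)" if "fst u \<noteq> 0" using that by (simp add: s_def split_def prod_eq_iff)
      ultimately have "fst u = 0" by (metis DiffD2 rangeI)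
      then show "a1 x y d u = 0" by (simp add: a1_def split_def)
    qed auto
    then have "(a1 x y d \<circ> s has_sum gx x y d) UNIV"
      by (subst (asm) has_sum_reindex) (auto simp: s_def inj_def)
    then show "((\<lambda>(i, j, k). coeff3 (deriv_x P) i j k * x ^ i * y ^ j * d ^ k) has_sum gx x y d) UNIV"
      by (simp add: a1_def s_def o_def split_def coeff3_deriv_x mult_ac)
  qed
  moreover have "hx (r / 4) gy (deriv_y P)" unfolding hx_def
  proof (intro allI impI, elim conjE)
    fix x y d assume *: "\<bar>x\<bar> < r / 4" "\<bar>y\<bar> < r / 4" "\<bar>d\<bar> < r / 4"
    define s :: "nat \<times> nat \<times> nat \<Rightarrow> nat \<times> nat \<times> nat" where "s = (\<lambda>(i, j, k). (i, Suc j, k))"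
    have "(a2 x y d has_sum gy x y d) (range s)"
    proof (rule has_sum_cong_neutral[THEN iffD1, OF _ _ _ h2[OF *]])
      fix u assume "u \<in> UNIV - range s"
      moreover have "u = s (fst u, fst (snd u) - 1, snd (snd u))" if "fst (snd u) \<noteq> 0"
        using that by (simp add: s_def split_def prod_eq_iff)
      ultimately have "fst (snd u) = 0" by (metis DiffD2 rangeI)
      then show "a2 x y d u = 0" by (simp add: a2_def split_def)
    qed auto
    then have "(a2 x y d \<circ> s has_sum gy x y d) UNIV"
      by (subst (asm) has_sum_reindex) (auto simp: s_def inj_def)
    then show "((\<lambda>(i, j, k). coeff3 (deriv_y P) i j k * x ^ i * y ^ j * d ^ k) has_sum gy x y d) UNIV"
      by (simp add: a2_def s_def o_def split_def coeff3_deriv_y mult_ac)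
  qed
  moreover have "((\<lambda>p :: real^2. g (p $ 1) (p $ 2) d) has_derivative (\<lambda>h. gx x y d * h $ 1 + gy x y d * h $ 2)) (at (vector [x, y]))"
    if *: "\<bar>x\<bar> < r / 4" "\<bar>y\<bar> < r / 4" "\<bar>d\<bar> < r / 4" for x y d
  proof -
    define S :: "(real^2) set" where "S = {p. \<bar>p $ 1\<bar> < r / 4 \<and> \<bar>p $ 2\<bar> < r / 4}"
    have S_box: "S = box (vector [- (r / 4), - (r / 4)]) (vector [r / 4, r / 4])"
      by (auto simp: S_def mem_box_cart forall_2 vector_2)
    then have S: "open S" "convex S" by (simp_all add: open_box convex_box)
    \<comment> \<open>Differentiation of series is available for sequences, so the triples of
      exponents are enumerated.\<close>
    define e :: "nat \<Rightarrow> nat \<times> nat \<times> nat" where "e n = (fst (prod_decode n), prod_decode (snd (prod_decode n)))" for n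
    have e: "bij_betw e UNIV UNIV"
      by (rule bij_betw_byWitness[where f' = "\<lambda>(i, u). prod_encode (i, prod_encode u)"]) (auto simp: e_def)
    define f where "f n p = (case e n of (i, j, k) \<Rightarrow> coeff3 P i j k * (p $ 1) ^ i * (p $ 2) ^ j * d ^ k)" for n and p :: "real^2"
    define f' where "f' n p h = a1 (p $ 1) (p $ 2) d (e n) * h $ 1 + a2 (p $ 1) (p $ 2) d (e n) * h $ 2" for n and p h :: "real^2"
    have es: "(\<lambda>n. F (e n)) sums s" if "(F has_sum s) UNIV" for F :: "nat \<times> nat \<times> nat \<Rightarrow> real" and s
      using that has_sum_reindex_bij_betw[OF e, of F s] has_sum_imp_sums by blast
    have fs: "(\<lambda>n. f n p) sums g (p $ 1) (p $ 2) d" if "p \<in> S" for p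
      using es[OF hxD[OF P, of "p $ 1" "p $ 2" d]] that * r by (simp add: S_def f_def)
    define g' where "g' p h = gx (p $ 1) (p $ 2) d * h $ 1 + gy (p $ 1) (p $ 2) d * h $ 2" for p h :: "real^2"
    have f's: "(\<lambda>n. f' n p h) sums g' p h" if "p \<in> S" for p h
      unfolding f'_def g'_def using that * by (intro sums_add sums_mult2 es h1 h2) (auto simp: S_def)
    \<comment> \<open>Twice the bound 4 / r, once for each partial derivative.\<close>
    define M where "M n = 8 / r * A (e n)" for n
    have M: "summable M"
      unfolding M_def using es[OF has_sum_infsum[OF A(1)]] by (intro summable_mult) (auto simp: sums_iff)
    have f'M: "\<bar>f' n p h\<bar> \<le> M n * norm h" if "p \<in> S" for n p h
    proof -
      have "\<bar>f' n p h\<bar> \<le> \<bar>a1 (p $ 1) (p $ 2) d (e n)\<bar> * \<bar>h $ 1\<bar> + \<bar>a2 (p $ 1) (p $ 2) d (e n)\<bar> * \<bar>h $ 2\<bar>"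
        unfolding f'_def by (metis abs_mult abs_triangle_ineq)
      also have "\<dots> \<le> (4 / r * A (e n)) * norm h + (4 / r * A (e n)) * norm h"
        using that * by (intro add_mono mult_mono b1 b2 component_le_norm_cart) (auto simp: S_def r A(2) less_imp_le)
      also have "\<dots> = M n * norm h" by (simp add: M_def)
      finally show ?thesis .
    qed
    have "\<exists>g0. \<forall>p\<in>S. (\<lambda>n. f n p) sums g0 p \<and> (g0 has_derivative g' p) (at p within S)"
    proof (rule has_derivative_series[OF S(2)])
      show "(f n has_derivative f' n p) (at p within S)" for n p
        unfolding f_def f'_def a1_def a2_def
        by (cases "e n") (auto intro!: derivative_eq_intros bounded_linear.has_derivative[OF bounded_linear_vec_nth] simp: algebra_simps)
      show "(\<lambda>n. f n (vector [x, y])) sums g x y d" using fs[of "vector [x, y]"] * by (simp add: S_def)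
      show "vector [x, y] \<in> S" using * by (simp add: S_def)
      fix \<epsilon> :: real assume "\<epsilon> > 0"
      then obtain N where N: "\<And>n. N \<le> n \<Longrightarrow> norm (\<Sum>i. M (i + n)) < \<epsilon>" using suminf_exist_split[OF _ M] by blast
      show "\<forall>\<^sub>F n in sequentially. \<forall>p\<in>S. \<forall>h. norm ((\<Sum>i<n. f' i p h) - g' p h) \<le> \<epsilon> * norm h"
        unfolding eventually_sequentially
      proof (intro exI[of _ N] allI impI ballI)
        fix n p h assume n: "N \<le> n" and p: "p \<in> S"
        have Mn: "summable (\<lambda>i. M (i + n))" using M by (simp add: summable_iff_shift)
        have "(\<lambda>i. f' (i + n) p h) sums (g' p h - (\<Sum>i<n. f' i p h))"
          by (rule sums_split_initial_segment[OF f's[OF p]])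
        then have "norm (g' p h - (\<Sum>i<n. f' i p h)) \<le> (\<Sum>i. M (i + n) * norm h)"
          using f'M[OF p] summable_mult2[OF Mn] by (intro norm_sums_le[OF _ summable_sums]) auto
        also have "\<dots> = (\<Sum>i. M (i + n)) * norm h" by (rule suminf_mult2[OF Mn, symmetric])
        also have "\<dots> \<le> \<epsilon> * norm h" using N[OF n] by (intro mult_right_mono) auto
        finally show "norm ((\<Sum>i<n. f' i p h) - g' p h) \<le> \<epsilon> * norm h" by (simp add: norm_minus_commute)
      qed
    qed
    then obtain g0 where g0: "\<And>p. p \<in> S \<Longrightarrow> (\<lambda>n. f n p) sums g0 p" "\<And>p. p \<in> S \<Longrightarrow> (g0 has_derivative g' p) (at p within S)" by blast
    have v: "vector [x, y] \<in> S" using * by (simp add: S_def)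
    have "((\<lambda>p. g (p $ 1) (p $ 2) d) has_derivative g' (vector [x, y])) (at (vector [x, y]) within S)"
      by (rule has_derivative_transform[OF v _ g0(2)[OF v]]) (metis fs g0(1) sums_unique2)
    then show ?thesis using at_within_open[OF v S(1)] by (simp add: g'_def[abs_def])
  qed
  ultimately show ?thesis using that by blast
qed

subsection \<open>Taylor series of an analytic family\<close>

lemma coeff3_delta_power: "coeff3 (var_delta ^ l * f) i j k = (if k < l then 0 else coeff3 f i j (k - l))" for f :: "real fps3"
proof -
  have "var_delta ^ l = pconst (fps_X ^ l :: real fps)"
    by (induction l) (simp_all add: var_delta_pconst)
  then show ?thesis by (simp add: coeff3_def fps_X_power_mult_nth)
qed

text \<open>The flow of delta I is the rotation by - delta; \<open>fact l * cos_coeff l\<close> and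
  \<open>fact l * sin_coeff l\<close> are the l-th derivatives of cosine and sine at 0.\<close>

lemma ad_delta_action:
  shows "(ad DI ^^ l) var_x =
      const3 (fact l * cos_coeff l) * (var_delta ^ l * var_x) + const3 (fact l * sin_coeff l) * (var_delta ^ l * var_y)"
    and "(ad DI ^^ l) var_y =
      const3 (fact l * cos_coeff l) * (var_delta ^ l * var_y) - const3 (fact l * sin_coeff l) * (var_delta ^ l * var_x)"
proof -
  have xy: "pb var_x AI = var_y" "pb var_y AI = - var_x"
    using pb_swap[of var_x AI] pb_swap[of var_y AI] by (simp_all add: pb_action)
  have dl: "pb (var_delta ^ l * f) DI = var_delta ^ Suc l * pb f AI" for l f
  proof -
    have "pb var_delta g = 0" "pb g var_delta = 0" for g by (simp_all add: var_delta_pconst)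
    then show ?thesis by (simp add: pb_mult pb_power)
  qed
  have cs: "fact (Suc l) * cos_coeff (Suc l) = - (fact l * sin_coeff l)" "fact (Suc l) * sin_coeff (Suc l) = fact l * cos_coeff l" for l
    by (simp_all add: cos_coeff_Suc sin_coeff_Suc field_simps del: of_nat_Suc)
  have c0: "cos_coeff 0 = 1" "sin_coeff 0 = 0" by (simp_all add: cos_coeff_def sin_coeff_def)
  show "(ad DI ^^ l) var_x =
      const3 (fact l * cos_coeff l) * (var_delta ^ l * var_x) + const3 (fact l * sin_coeff l) * (var_delta ^ l * var_y)"
  proof (induction l)
    case (Suc l)
    show ?case
      unfolding funpow.simps o_apply Suc unfolding ad_def pb_add pb_const3_mult dl xy cs by (simp add: const3_simps)
  qed (simp add: c0 const3_simps)
  show "(ad DI ^^ l) var_y =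
      const3 (fact l * cos_coeff l) * (var_delta ^ l * var_y) - const3 (fact l * sin_coeff l) * (var_delta ^ l * var_x)"
  proof (induction l)
    case (Suc l)
    have m: "f - g = f + const3 (-1) * g" for f g :: "real fps3" by (simp add: const3_simps)
    show ?case
      unfolding funpow.simps o_apply Suc unfolding ad_def m pb_add pb_const3_mult dl xy cs by (simp add: const3_simps)
  qed (simp add: c0 const3_simps)
qed

lemma ex_delta_action:
  fixes i j k :: nat
  defines "c f u v \<equiv> (if i = 1 \<and> j = 0 then u else if i = 0 \<and> j = 1 then v else 0 :: real)"
  shows "coeff3 (ex 1 DI var_x) i j k = c 0 (cos_coeff k) (sin_coeff k)"
    and "coeff3 (ex 1 DI var_y) i j k = c 0 (- sin_coeff k) (cos_coeff k)"
proof -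
  have s: "(\<Sum>l\<le>i + j + k. 1 ^ l / fact l * (if k < l then 0 else fact l * f l * (if k - l = 0 then g else 0))) = f k * g" for f :: "nat \<Rightarrow> real" and g
  proof -
    have "(\<Sum>l\<le>i + j + k. 1 ^ l / fact l * (if k < l then 0 else fact l * f l * (if k - l = 0 then g else 0)))
      = (\<Sum>l\<le>i + j + k. if l = k then f k * g else 0)" by (rule sum.cong) auto
    then show ?thesis by simp
  qed
  have x: "coeff3 var_x i j m = (if m = 0 then c 0 1 0 else 0)" "coeff3 var_y i j m = (if m = 0 then c 0 0 1 else 0)" for m
    by (auto simp: c_def)
  have e: "coeff3 (ex 1 DI f) i j k = (\<Sum>l\<le>i + j + k. 1 ^ l / fact l * (if k < l then 0 else fact l * u l * (if k - l = 0 then p else 0)))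
      + (\<Sum>l\<le>i + j + k. 1 ^ l / fact l * (if k < l then 0 else fact l * v l * (if k - l = 0 then q else 0)))"
    if "\<And>l. coeff3 ((ad DI ^^ l) f) i j k =
      (if k < l then 0 else fact l * u l * (if k - l = 0 then p else 0)) + (if k < l then 0 else fact l * v l * (if k - l = 0 then q else 0))"
    for f u v p q
    by (simp add: ex_def that sum.distrib distrib_left add_divide_distrib)
  have "coeff3 (ex 1 DI var_x) i j k = cos_coeff k * c 0 1 0 + sin_coeff k * c 0 0 1"
    unfolding s[symmetric] by (rule e) (simp add: ad_delta_action coeff3_delta_power x mult.assoc del: coeff3_var)
  then show "coeff3 (ex 1 DI var_x) i j k = c 0 (cos_coeff k) (sin_coeff k)" by (auto simp: c_def)
  have "coeff3 (ex 1 DI var_y) i j k = cos_coeff k * c 0 0 1 + (- sin_coeff k) * c 0 1 0"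
    unfolding s[of cos_coeff, symmetric] s[of "\<lambda>k. - sin_coeff k", symmetric] by (rule e) (simp add: ad_delta_action coeff3_delta_power x mult.assoc del: coeff3_var)
  then show "coeff3 (ex 1 DI var_y) i j k = c 0 (- sin_coeff k) (cos_coeff k)" by (auto simp: c_def)
qed

text \<open>\<open>C t\<close> and \<open>S t\<close> are the coefficients of delta^k in cos (t -
  delta) and sin (t - delta), so this is the linear part prescribed for the family.\<close>

lemma ex_delta_action_rot:
  fixes i j k :: nat
  defines "C t \<equiv> cos t * cos_coeff k + sin t * sin_coeff k" and "S t \<equiv> sin t * cos_coeff k - cos t * sin_coeff k"
  shows "coeff3 (ex 1 DI (rot t var_x)) i j k = (if i = 1 \<and> j = 0 then C t else if i = 0 \<and> j = 1 then - S t else 0)"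
    and "coeff3 (ex 1 DI (rot t var_y)) i j k = (if i = 1 \<and> j = 0 then S t else if i = 0 \<and> j = 1 then C t else 0)"
proof -
  note a = alg_ex[OF gen_delta_action(1), of 1]
  note as = alg_add[OF a] alg_mult[OF a] alg_simps[OF a]
  show "coeff3 (ex 1 DI (rot t var_x)) i j k = (if i = 1 \<and> j = 0 then C t else if i = 0 \<and> j = 1 then - S t else 0)"
    "coeff3 (ex 1 DI (rot t var_y)) i j k = (if i = 1 \<and> j = 0 then S t else if i = 0 \<and> j = 1 then C t else 0)"
    unfolding rot_var as coeff3_simps coeff3_const3_mult ex_delta_action by (simp_all add: C_def S_def algebra_simps)
qed

lemma basis_4:
  defines "e1 \<equiv> (axis 1 1, 0) :: (real^2) \<times> real \<times> real" and "e2 \<equiv> (axis 2 1, 0) :: (real^2) \<times> real \<times> real"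
    and "e3 \<equiv> (0, 1, 0) :: (real^2) \<times> real \<times> real" and "e4 \<equiv> (0, 0, 1) :: (real^2) \<times> real \<times> real"
  shows "Basis = {e1, e2, e3, e4}" "distinct [e1, e2, e3, e4]"
    by (auto simp: Basis_prod_def Basis_vec_def UNIV_2 e1_def e2_def e3_def e4_def axis_eq_axis prod_eq_iff zero_prod_def)

lemma analytic_expansion:
  fixes F :: "real \<Rightarrow> real \<Rightarrow> real^2 \<Rightarrow> real^2"
  assumes "real_analytic_at (\<lambda>(p, \<delta>, nu). F \<delta> nu p) (0, 0, 0)"
  obtains rho D where "0 < rho" "\<And>x y d v. \<bar>x\<bar> < rho \<Longrightarrow> \<bar>y\<bar> < rho \<Longrightarrow> \<bar>d\<bar> < rho \<Longrightarrow> \<bar>v\<bar> < rho \<Longrightarrow>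
    ((\<lambda>((i, j, k), l). (x ^ i * y ^ j * d ^ k * v ^ l) *\<^sub>R D ((i, j, k), l)) has_sum F d v (vector [x, y])) UNIV"
proof -
  obtain r c where r: "0 < r" and c: "\<And>X. X \<in> ball (0, 0, 0) r \<Longrightarrow>
    ((\<lambda>m. (\<Prod>e\<in>Basis. ((X - (0, 0, 0)) \<bullet> e) ^ m e) *\<^sub>R c m) has_sum (\<lambda>(p, \<delta>, nu). F \<delta> nu p) X) (Basis \<rightarrow>\<^sub>E UNIV)"
    using assms unfolding real_analytic_at_def by blast
  define e1 e2 e3 e4 where e: "e1 = ((axis 1 1, 0) :: (real^2) \<times> real \<times> real)" "e2 = ((axis 2 1, 0) :: (real^2) \<times> real \<times> real)"
    "e3 = ((0, 1, 0) :: (real^2) \<times> real \<times> real)" "e4 = ((0, 0, 1) :: (real^2) \<times> real \<times> real)"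
  have B: "Basis = {e1, e2, e3, e4}" "distinct [e1, e2, e3, e4]" using basis_4 by (simp_all add: e)
  \<comment> \<open>Exponents of x, y, delta and nu are identified with multi-indices over the basis
    of the product space, nu being kept apart for the later summation.\<close>
  define ph :: "(nat \<times> nat \<times> nat) \<times> nat \<Rightarrow> (real^2) \<times> real \<times> real \<Rightarrow> nat"
    where "ph = (\<lambda>((i, j, k), l). \<lambda>e\<in>Basis. if e = e1 then i else if e = e2 then j else if e = e3 then k else l)"
  have bij: "bij_betw ph UNIV (Basis \<rightarrow>\<^sub>E UNIV)"
  proof (rule bij_betw_byWitness[where f' = "\<lambda>m. ((m e1, m e2, m e3), m e4)"])
    show "\<forall>u\<in>UNIV. ((ph u e1, ph u e2, ph u e3), ph u e4) = u" using B by (auto simp: ph_def)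
    show "\<forall>m\<in>Basis \<rightarrow>\<^sub>E UNIV. ph ((m e1, m e2, m e3), m e4) = m"
    proof
      fix m :: "(real^2) \<times> real \<times> real \<Rightarrow> nat" assume m: "m \<in> Basis \<rightarrow>\<^sub>E UNIV"
      show "ph ((m e1, m e2, m e3), m e4) = m"
      proof
        fix b show "ph ((m e1, m e2, m e3), m e4) b = m b"
          by (cases "b \<in> Basis") (use B PiE_arb[OF m] in \<open>auto simp: ph_def\<close>)
      qed
    qed
    show "ph ` UNIV \<subseteq> Basis \<rightarrow>\<^sub>E UNIV" by (auto simp: ph_def PiE_def)
  qed auto
  show thesis
  proof (rule that[of "r / 4" "c \<circ> ph"])
    fix x y d v :: real assume *: "\<bar>x\<bar> < r / 4" "\<bar>y\<bar> < r / 4" "\<bar>d\<bar> < r / 4" "\<bar>v\<bar> < r / 4"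
    define X :: "(real^2) \<times> real \<times> real" where "X = (vector [x, y], d, v)"
    have "norm X \<le> norm (vector [x, y] :: real^2) + norm (d, v)" unfolding X_def by (rule norm_Pair_le)
    moreover have "norm (d, v) \<le> \<bar>d\<bar> + \<bar>v\<bar>" using norm_Pair_le[of d v] by simp
    moreover have "norm (vector [x, y] :: real^2) \<le> \<bar>x\<bar> + \<bar>y\<bar>" using norm_le_l1_cart[of "vector [x, y] :: real^2"] by (simp add: sum_2)
    ultimately have "norm X < r" using * by linarith
    moreover have z: "(0, 0, 0) = (0 :: (real^2) \<times> real \<times> real)" by (simp add: zero_prod_def)
    ultimately have X: "X \<in> ball (0, 0, 0) r" by (simp add: dist_norm)
    have hs: "((\<lambda>u. (\<Prod>e\<in>Basis. (X \<bullet> e) ^ ph u e) *\<^sub>R c (ph u)) has_sum F d v (vector [x, y])) UNIV"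
      using c[OF X] has_sum_reindex_bij_betw[OF bij, of "\<lambda>m. (\<Prod>e\<in>Basis. (X \<bullet> e) ^ m e) *\<^sub>R c m" "F d v (vector [x, y])"]
      by (simp add: z X_def)
    have pr: "(\<Prod>e\<in>Basis. (X \<bullet> e) ^ ph ((i, j, k), l) e) = x ^ i * y ^ j * d ^ k * v ^ l" for i j k l
    proof -
      have "X \<bullet> e1 = x" "X \<bullet> e2 = y" "X \<bullet> e3 = d" "X \<bullet> e4 = v"
        by (simp_all add: X_def e inner_axis)
      moreover have "e2 \<noteq> e1" "e3 \<noteq> e1" "e3 \<noteq> e2" "e4 \<noteq> e1" "e4 \<noteq> e2" "e4 \<noteq> e3" using B(2) by auto
      ultimately show ?thesis using B(2) by (simp add: B(1) ph_def mult.assoc)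
    qed
    have "(\<lambda>u. (\<Prod>e\<in>Basis. (X \<bullet> e) ^ ph u e) *\<^sub>R c (ph u)) =
        (\<lambda>((i, j, k), l). (x ^ i * y ^ j * d ^ k * v ^ l) *\<^sub>R (c \<circ> ph) ((i, j, k), l))"
      by (auto simp: fun_eq_iff pr)
    then show "((\<lambda>((i, j, k), l). (x ^ i * y ^ j * d ^ k * v ^ l) *\<^sub>R (c \<circ> ph) ((i, j, k), l)) has_sum F d v (vector [x, y])) UNIV"
      using hs by simp
  qed (use r in simp)
qed

text \<open>Convergence is unconditional, so the sum over the exponents of nu may be taken first; it
  gives each coefficient as a power series in nu.\<close>

lemma hx_family:
  fixes D :: "(nat \<times> nat \<times> nat) \<times> nat \<Rightarrow> real"
  assumes rho: "0 < rho" and D: "\<And>x y d v. \<bar>x\<bar> < rho \<Longrightarrow> \<bar>y\<bar> < rho \<Longrightarrow> \<bar>d\<bar> < rho \<Longrightarrow> \<bar>v\<bar> < rho \<Longrightarrow>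
    ((\<lambda>((i, j, k), l). x ^ i * y ^ j * d ^ k * v ^ l * D ((i, j, k), l)) has_sum g v x y d) UNIV"
  obtains P where "fam {-rho<..<rho} P" "\<And>v. \<bar>v\<bar> < rho \<Longrightarrow> hx rho (g v) (P v)"
proof -
  define P where "P v = Abs_fps3 (\<lambda>i j k. infsum (\<lambda>l. D ((i, j, k), l) * v ^ l) UNIV)" for v
  have s: "((\<lambda>l. D ((i, j, k), l) * v ^ l) has_sum coeff3 (P v) i j k) UNIV" if "\<bar>v\<bar> < rho" for v i j k
  proof -
    let ?m = "(rho / 2) ^ i * (rho / 2) ^ j * (rho / 2) ^ k"
    have "(\<lambda>(u, l). (\<lambda>((i, j, k), l). (rho / 2) ^ i * (rho / 2) ^ j * (rho / 2) ^ k * v ^ l * D ((i, j, k), l)) (u, l)) summable_on UNIV \<times> UNIV"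
      using has_sum_imp_summable[OF D[of "rho / 2" "rho / 2" "rho / 2" v]] rho that by (simp add: split_def)
    from summable_on_SigmaD1[OF this, of "(i, j, k)"]
    have "(\<lambda>l. ?m * v ^ l * D ((i, j, k), l)) summable_on UNIV" by simp
    then have "(\<lambda>l. inverse ?m * (?m * v ^ l * D ((i, j, k), l))) summable_on UNIV" by (rule summable_on_cmult_right)
    moreover have "(\<lambda>l. inverse ?m * (?m * v ^ l * D ((i, j, k), l))) = (\<lambda>l. D ((i, j, k), l) * v ^ l)"
      using less_imp_neq[OF rho] by (simp add: fun_eq_iff field_simps)
    ultimately show ?thesis by (simp add: P_def)
  qed
  show thesis
  proof (rule that[of P])
    show "fam {-rho<..<rho} P" unfolding fam_def
    proof (intro ballI allI)
      fix v i j k assume "v \<in> {-rho<..<rho}"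
      then have "\<bar>v\<bar> < rho" by auto
      from ra_powser[OF has_sum_imp_sums[OF s] this] show "ra (\<lambda>v. coeff3 (P v) i j k) v" .
    qed
    fix v assume v: "\<bar>v\<bar> < rho"
    show "hx rho (g v) (P v)" unfolding hx_def
    proof (intro allI impI, elim conjE)
      fix x y d assume *: "\<bar>x\<bar> < rho" "\<bar>y\<bar> < rho" "\<bar>d\<bar> < rho"
      show "((\<lambda>(i, j, k). coeff3 (P v) i j k * x ^ i * y ^ j * d ^ k) has_sum g v x y d) UNIV"
      proof -
        define f where "f = (\<lambda>((i, j, k), l). x ^ i * y ^ j * d ^ k * v ^ l * D ((i, j, k), l))"
        have 1: "(f has_sum g v x y d) (UNIV \<times> UNIV)" using D[OF * v] by (simp add: f_def)
        show ?thesis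
        proof (rule has_sum_SigmaD[OF 1])
          fix u :: "nat \<times> nat \<times> nat"
          obtain i j k where u: "u = (i, j, k)" by (cases u)
          show "((\<lambda>l. f (u, l)) has_sum (case u of (i, j, k) \<Rightarrow> coeff3 (P v) i j k * x ^ i * y ^ j * d ^ k)) UNIV"
            using has_sum_cmult_right[OF s[OF v, of i j k], of "x ^ i * y ^ j * d ^ k"] by (simp add: u f_def mult_ac)
        qed
      qed
    qed
  qed
qed

lemma hx_deriv_vector:
  fixes h :: "real \<Rightarrow> real^2 \<Rightarrow> real"
  assumes r: "0 < r" and P: "hx r (\<lambda>x y d. h d (vector [x, y])) P"
  shows "\<exists>gx gy. hx (r / 4) gx (deriv_x P) \<and> hx (r / 4) gy (deriv_y P) \<and>
    (\<forall>x y d. \<bar>x\<bar> < r / 4 \<and> \<bar>y\<bar> < r / 4 \<and> \<bar>d\<bar> < r / 4 \<longrightarrow>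
      (h d has_derivative (\<lambda>k. gx x y d * k $ 1 + gy x y d * k $ 2)) (at (vector [x, y])))"
proof (rule hx_deriv[OF r P])
  fix gx gy assume g: "hx (r / 4) gx (deriv_x P)" "hx (r / 4) gy (deriv_y P)"
    and d: "\<And>x y d. \<bar>x\<bar> < r / 4 \<Longrightarrow> \<bar>y\<bar> < r / 4 \<Longrightarrow> \<bar>d\<bar> < r / 4 \<Longrightarrow>
      ((\<lambda>p :: real^2. h d (vector [p $ 1, p $ 2])) has_derivative (\<lambda>h. gx x y d * h $ 1 + gy x y d * h $ 2)) (at (vector [x, y]))"
  have "vector [p $ 1, p $ 2] = p" for p :: "real^2" by (simp add: vec_eq_iff forall_2)
  then show ?thesis using g d by (intro exI[of _ gx] exI[of _ gy]) simp
qed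

text \<open>The pointwise determinant is the value of the series \<open>pb P Q\<close>, which must
  then be the constant one by uniqueness of expansions.\<close>

lemma jacobian_pb:
  fixes f :: "real \<Rightarrow> real^2 \<Rightarrow> real^2"
  assumes r: "0 < r" and P: "hx r (\<lambda>x y d. f d (vector [x, y]) $ 1) P" and Q: "hx r (\<lambda>x y d. f d (vector [x, y]) $ 2) Q"
    and det: "\<And>x y d. \<bar>x\<bar> < r \<Longrightarrow> \<bar>y\<bar> < r \<Longrightarrow> \<bar>d\<bar> < r \<Longrightarrow> det (jacobian (f d) (at (vector [x, y]))) = 1"
  shows "pb P Q = 1"
proof -
  obtain px py where p: "hx (r / 4) px (deriv_x P)" "hx (r / 4) py (deriv_y P)"
    "\<And>x y d. \<bar>x\<bar> < r / 4 \<Longrightarrow> \<bar>y\<bar> < r / 4 \<Longrightarrow> \<bar>d\<bar> < r / 4 \<Longrightarrow>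
      ((\<lambda>p. f d p $ 1) has_derivative (\<lambda>h. px x y d * h $ 1 + py x y d * h $ 2)) (at (vector [x, y]))"
    using hx_deriv_vector[OF r P] by blast
  obtain qx qy where q: "hx (r / 4) qx (deriv_x Q)" "hx (r / 4) qy (deriv_y Q)"
    "\<And>x y d. \<bar>x\<bar> < r / 4 \<Longrightarrow> \<bar>y\<bar> < r / 4 \<Longrightarrow> \<bar>d\<bar> < r / 4 \<Longrightarrow>
      ((\<lambda>p. f d p $ 2) has_derivative (\<lambda>h. qx x y d * h $ 1 + qy x y d * h $ 2)) (at (vector [x, y]))"
    using hx_deriv_vector[OF r Q] by blast
  have one: "px x y d * qy x y d - py x y d * qx x y d = 1"
    if *: "\<bar>x\<bar> < r / 4" "\<bar>y\<bar> < r / 4" "\<bar>d\<bar> < r / 4" for x y d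
  proof -
    let ?J = "jacobian (f d) (at (vector [x, y]))"
    let ?D = "\<lambda>h :: real^2. vector [px x y d * h $ 1 + py x y d * h $ 2, qx x y d * h $ 1 + qy x y d * h $ 2] :: real^2"
    have "(f d has_derivative ?D) (at (vector [x, y]))"
      unfolding has_derivative_componentwise_within[of "f d"]
    proof
      fix b :: "real^2" assume "b \<in> Basis"
      then obtain i where b: "b = axis i 1" by (auto simp: Basis_vec_def)
      show "((\<lambda>p. f d p \<bullet> b) has_derivative (\<lambda>h. ?D h \<bullet> b)) (at (vector [x, y]))"
        using p(3)[OF *] q(3)[OF *] exhaust_2[of i] by (auto simp: b inner_axis)
    qed
    moreover from this have "(f d has_derivative (\<lambda>h. ?J *v h)) (at (vector [x, y]))"
      using jacobian_works differentiableI by blast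
    ultimately have J: "?D = (\<lambda>h. ?J *v h)" by (rule has_derivative_unique)
    have "?J $ 1 $ 1 = px x y d" "?J $ 1 $ 2 = py x y d" "?J $ 2 $ 1 = qx x y d" "?J $ 2 $ 2 = qy x y d"
      using fun_cong[OF J, of "axis 1 1"] fun_cong[OF J, of "axis 2 1"]
      by (auto simp: vec_eq_iff forall_2 matrix_vector_mult_def sum_2 axis_def)
    then show ?thesis using det[of x y d] * by (simp add: det_2)
  qed
  have r4: "0 < r / 4" using r by simp
  have "hx (r / 4) (\<lambda>x y d. px x y d * qy x y d - py x y d * qx x y d) (pb P Q)"
    unfolding pb_def by (intro hx_diff hx_mult p q)
  then have "hx (r / 4) (\<lambda>x y d. 1) (pb P Q)" by (rule hx_cong) (rule one)
  from hx_unique[OF r4 this hx_const3[of _ 1]] show ?thesis by (simp add: const3_simps)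
qed

lemma hx_section:
  assumes r: "0 < r" and P: "hx r g P" and d: "\<bar>d\<bar> < r"
  shows "((\<lambda>k. coeff3 P i j k * d ^ k) has_sum infsum (\<lambda>k. coeff3 P i j k * d ^ k) UNIV) UNIV"
proof -
  have "(\<lambda>(i, u). (\<lambda>(i, j, k). coeff3 P i j k * (r / 2) ^ i * (r / 2) ^ j * d ^ k) (i, u)) summable_on UNIV \<times> UNIV"
    using has_sum_imp_summable[OF hxD[OF P, of "r / 2" "r / 2" d]] r d by (simp add: split_def)
  from summable_on_SigmaD1[OF this, of i]
  have "(\<lambda>(j, k). coeff3 P i j k * (r / 2) ^ i * (r / 2) ^ j * d ^ k) summable_on UNIV \<times> UNIV" by simp
  from summable_on_SigmaD1[OF this, of j]
  have "(\<lambda>k. coeff3 P i j k * (r / 2) ^ i * (r / 2) ^ j * d ^ k) summable_on UNIV" by simp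
  then have "(\<lambda>k. inverse ((r / 2) ^ i * (r / 2) ^ j) * (coeff3 P i j k * (r / 2) ^ i * (r / 2) ^ j * d ^ k)) summable_on UNIV"
    by (rule summable_on_cmult_right)
  moreover have "(\<lambda>k. inverse ((r / 2) ^ i * (r / 2) ^ j) * (coeff3 P i j k * (r / 2) ^ i * (r / 2) ^ j * d ^ k)) = (\<lambda>k. coeff3 P i j k * d ^ k)"
    using less_imp_neq[OF r] by (simp add: fun_eq_iff field_simps)
  ultimately show ?thesis by simp
qed

text \<open>Grouping the terms by their degree in x, y turns the expansion, for fixed delta, into a
  power series in t along a ray. Fixed delta is all that can be used, as the error estimate for the
  map is assumed separately for each parameter.\<close>

lemma hx_ray:
  fixes a b :: real
  assumes r: "0 < r" and P: "hx r g P" and d: "\<bar>d\<bar> < r" and t: "\<bar>t * a\<bar> < r" "\<bar>t * b\<bar> < r"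
  shows "(\<lambda>N. (\<Sum>i\<le>N. infsum (\<lambda>k. coeff3 P i (N - i) k * d ^ k) UNIV * a ^ i * b ^ (N - i)) * t ^ N) sums g (t * a) (t * b) d"
proof -
  define c where "c i j = infsum (\<lambda>k. coeff3 P i j k * d ^ k) UNIV" for i j
  define f where "f = (\<lambda>(i, j, k). coeff3 P i j k * (t * a) ^ i * (t * b) ^ j * d ^ k)"
  define u :: "(nat \<times> nat) \<times> nat \<Rightarrow> nat \<times> nat \<times> nat" where "u = (\<lambda>((N, i), k). (i, N - i, k))"
  let ?S = "Sigma UNIV (\<lambda>N. {..N :: nat})"
  have bij: "bij_betw u (?S \<times> UNIV) UNIV"
    by (rule bij_betw_byWitness[where f' = "\<lambda>(i, j, k). ((i + j, i), k)"]) (auto simp: u_def)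
  have "(f has_sum g (t * a) (t * b) d) UNIV" unfolding f_def by (rule hxD[OF P t d])
  then have 1: "((\<lambda>w. f (u w)) has_sum g (t * a) (t * b) d) (?S \<times> UNIV)"
    unfolding has_sum_reindex_bij_betw[OF bij] .
  have 2: "((\<lambda>(N, i). c i (N - i) * a ^ i * b ^ (N - i) * t ^ N) has_sum g (t * a) (t * b) d) ?S"
  proof (rule has_sum_SigmaD[OF 1])
    fix w assume "w \<in> ?S"
    then obtain N i where w: "w = (N, i)" "i \<le> N" by auto
    have "(t * a) ^ i * (t * b) ^ (N - i) = a ^ i * b ^ (N - i) * t ^ N"
      using w(2) by (simp add: power_mult_distrib mult_ac flip: power_add)
    then have "f (u (w, k)) = coeff3 P i (N - i) k * d ^ k * (a ^ i * b ^ (N - i) * t ^ N)" for k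
      by (simp only: w f_def u_def prod.case mult_ac)
    then show "((\<lambda>k. f (u (w, k))) has_sum (case w of (N, i) \<Rightarrow> c i (N - i) * a ^ i * b ^ (N - i) * t ^ N)) UNIV"
      using has_sum_cmult_left[OF hx_section[OF r P d, of i "N - i"], of "a ^ i * b ^ (N - i) * t ^ N"] by (simp add: w c_def mult.assoc)
  qed
  have "((\<lambda>N. (\<Sum>i\<le>N. c i (N - i) * a ^ i * b ^ (N - i)) * t ^ N) has_sum g (t * a) (t * b) d) UNIV"
    by (rule has_sum_SigmaD[OF 2]) (auto intro!: has_sum_finiteI simp: sum_distrib_right)
  then show ?thesis unfolding c_def by (rule has_sum_imp_sums)
qed

text \<open>Along a ray the remainder is O(t^4), so by \<open>powser_flat\<close> the blocks of
  degree below four are those of the explicit terms.\<close>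

lemma map_blocks:
  fixes f :: "real \<Rightarrow> real^2 \<Rightarrow> real^2" and h :: "complex \<Rightarrow> real"
  assumes r: "0 < r" and P: "hx r (\<lambda>x y d. h (to_complex (f d (vector [x, y])))) P" and d: "\<bar>d\<bar> < r"
    and h: "h = Re \<or> h = Im" and n: "n = 3 \<or> n = 4" and f0: "f d 0 = 0"
    and form: "(\<lambda>p. norm (to_complex (f d p)
          - (l * to_complex p + a * to_complex p ^ 2 * cnj (to_complex p) + b * cnj (to_complex p) ^ (n - 1))))
        \<in> O[at 0](\<lambda>p. norm (to_complex p) ^ 4)"
    and N: "N < 4"
  shows "(\<Sum>i\<le>N. infsum (\<lambda>k. coeff3 P i (N - i) k * d ^ k) UNIV * x ^ i * y ^ (N - i)) =
    h ((if N = 1 then l * Complex x y else 0) + (if N = 3 then a * Complex x y ^ 2 * cnj (Complex x y) else 0)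
      + (if N = n - 1 then b * cnj (Complex x y) ^ (n - 1) else 0))"
proof -
  define z where "z = Complex x y"
  define c where "c N = (if N = 1 then l * z else 0) + (if N = 3 then a * z ^ 2 * cnj z else 0) + (if N = n - 1 then b * cnj z ^ (n - 1) else 0)" for N
  define Q where "Q N = (\<Sum>i\<le>N. infsum (\<lambda>k. coeff3 P i (N - i) k * d ^ k) UNIV * x ^ i * y ^ (N - i))" for N
  have hl: "h (u - w) = h u - h w" "h (u + w) = h u + h w" "h (of_real t * u) = t * h u" "\<bar>h u\<bar> \<le> norm u" for u w t
    using h abs_Re_le_cmod abs_Im_le_cmod by auto
  define E where "E p = to_complex (f d p)
          - (l * to_complex p + a * to_complex p ^ 2 * cnj (to_complex p) + b * cnj (to_complex p) ^ (n - 1))" for p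
  obtain C e where C: "C > 0" and e: "0 < e" and bound: "\<And>p. p \<noteq> 0 \<Longrightarrow> norm p < e \<Longrightarrow> norm (E p) \<le> C * norm (to_complex p) ^ 4"
  proof -
    from landau_o.bigE[OF form[folded E_def]] obtain C where C: "C > 0"
      and ev: "\<forall>\<^sub>F p in at 0. norm (norm (E p)) \<le> C * norm (norm (to_complex p) ^ 4)" by auto
    from ev obtain e where "e > 0" "\<And>p. p \<noteq> 0 \<Longrightarrow> norm p < e \<Longrightarrow> norm (E p) \<le> C * norm (to_complex p) ^ 4"
      unfolding eventually_at by (auto simp: norm_power)
    with C show thesis using that by blast
  qed
  have tc0: "to_complex 0 = 0" by (simp add: to_complex_def complex_eq_iff)
  have E0: "E 0 = 0" using n by (auto simp: E_def f0 tc0)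
  have bound': "norm (E p) \<le> C * norm (to_complex p) ^ 4" if "norm p < e" for p
    by (cases "p = 0") (use bound that in \<open>simp_all add: E0 tc0\<close>)
  \<comment> \<open>Small enough for t (x, y) to stay in the domain of the expansion and in the ball
    where the remainder is estimated.\<close>
  define s where "s = min r e / (1 + \<bar>x\<bar> + \<bar>y\<bar>)"
  have s: "0 < s" using r e by (simp add: s_def)
  have "Q N - (if N < 4 then h (c N) else 0) = 0"
  proof (rule powser_flat[OF s, where M = 4 and C = "C * norm z ^ 4" and
        W = "\<lambda>t. h (E (vector [t * x, t * y]))"])
    fix t :: real assume "\<bar>t\<bar> < s"
    then have t: "\<bar>t\<bar> * (1 + \<bar>x\<bar> + \<bar>y\<bar>) < min r e" by (simp add: s_def pos_less_divide_eq)
    have xy: "\<bar>t * x\<bar> + \<bar>t * y\<bar> < min r e"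
      by (rule le_less_trans[OF _ t]) (simp add: abs_mult algebra_simps)
    then have txy: "\<bar>t * x\<bar> < r" "\<bar>t * y\<bar> < r" by auto
    have tz: "to_complex (vector [t * x, t * y]) = of_real t * z"
      by (simp add: to_complex_def z_def complex_eq_iff)
    have "norm (vector [t * x, t * y] :: real^2) \<le> \<bar>t * x\<bar> + \<bar>t * y\<bar>"
      using norm_le_l1_cart[of "vector [t * x, t * y] :: real^2"] by (simp add: sum_2)
    then have ne: "norm (vector [t * x, t * y] :: real^2) < e" using xy by linarith
    have 1: "(\<lambda>N. Q N * t ^ N) sums h (to_complex (f d (vector [t * x, t * y])))"
      unfolding Q_def by (rule hx_ray[OF r P d txy])
    have 2: "(\<lambda>N. (if N < 4 then h (c N) else 0) * t ^ N) sums (\<Sum>N<4. (if N < 4 then h (c N) else 0) * t ^ N)"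
      by (rule sums_finite) auto
    have 3: "(\<Sum>N<4. (if N < 4 then h (c N) else 0) * t ^ N)
      = h (l * (of_real t * z) + a * (of_real t * z) ^ 2 * cnj (of_real t * z) + b * cnj (of_real t * z) ^ (n - 1))"
    proof -
      have "(\<Sum>N<4. (if N < 4 then h (c N) else 0) * t ^ N) = h (c 0) + t * h (c 1) + t ^ 2 * h (c 2) + t ^ 3 * h (c 3)"
        by (simp add: eval_nat_numeral)
      also have "\<dots> = h (c 0 + of_real t * c 1 + of_real (t ^ 2) * c 2 + of_real (t ^ 3) * c 3)"
        unfolding hl ..
      also have "c 0 + of_real t * c 1 + of_real (t ^ 2) * c 2 + of_real (t ^ 3) * c 3 =
          l * (of_real t * z) + a * (of_real t * z) ^ 2 * cnj (of_real t * z) + b * cnj (of_real t * z) ^ (n - 1)"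
        using n by (elim disjE) (simp_all add: c_def power_mult_distrib algebra_simps power2_eq_square power3_eq_cube)
      finally show ?thesis .
    qed
    have "(\<lambda>N. Q N * t ^ N - (if N < 4 then h (c N) else 0) * t ^ N) sums h (E (vector [t * x, t * y]))"
      using sums_diff[OF 1 2] unfolding 3 by (simp only: E_def tz hl)
    then show "(\<lambda>N. (Q N - (if N < 4 then h (c N) else 0)) * t ^ N) sums h (E (vector [t * x, t * y]))"
      by (simp only: left_diff_distrib)
    have "\<bar>h (E (vector [t * x, t * y]))\<bar> \<le> C * norm (of_real t * z) ^ 4"
      using order_trans[OF hl(4) bound'[OF ne]] by (simp only: tz)
    then show "\<bar>h (E (vector [t * x, t * y]))\<bar> \<le> C * norm z ^ 4 * \<bar>t\<bar> ^ 4"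
      by (simp add: norm_mult power_mult_distrib mult_ac)
  qed (rule N)
  then show ?thesis using N by (simp add: Q_def c_def z_def)
qed

text \<open>\<open>map_blocks\<close> gives values for each fixed delta; comparing power series in
  delta turns them into coefficients. The coordinate \<open>u\<close> goes with \<open>h\<close>: x
  with the real part, y with the imaginary part.\<close>

lemma map_coeffs:
  fixes f :: "real \<Rightarrow> real^2 \<Rightarrow> real^2" and h :: "complex \<Rightarrow> real" and a b :: "real \<Rightarrow> complex" and th :: real and u P :: "real fps3"
  defines "X \<equiv> P - ex 1 DI (rot th u)"
  assumes r: "0 < r" and P: "hx r (\<lambda>x y d. h (to_complex (f d (vector [x, y])))) P"
    and h: "h = Re \<and> u = var_x \<or> h = Im \<and> u = var_y" and n: "n = 3 \<or> n = 4" and f0: "\<And>d. \<bar>d\<bar> < r \<Longrightarrow> f d 0 = 0"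
    and form: "\<And>d. \<bar>d\<bar> < r \<Longrightarrow> (\<lambda>p. norm (to_complex (f d p)
          - (cis (th - d) * to_complex p + a d * to_complex p ^ 2 * cnj (to_complex p) + b d * cnj (to_complex p) ^ (n - 1))))
        \<in> O[at 0](\<lambda>p. norm (to_complex p) ^ 4)"
  shows "wt 0 2 X" "wt (n - 2) (n - 1) X"
    "(\<Sum>i\<le>n - 1. coeff3 P i (n - 1 - i) 0 * x ^ i * y ^ (n - 1 - i)) =
      h ((if n = 4 then a 0 * Complex x y ^ 2 * cnj (Complex x y) else 0) + b 0 * cnj (Complex x y) ^ (n - 1))"
proof -
  have h': "h = Re \<or> h = Im" and h0: "h 0 = 0" using h by auto
  define c where "c d i j = infsum (\<lambda>k. coeff3 P i j k * d ^ k) UNIV" for d i j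
  have cs: "(\<lambda>k. coeff3 P i j k * d ^ k) sums c d i j" if "\<bar>d\<bar> < r" for d i j
    unfolding c_def by (rule has_sum_imp_sums[OF hx_section[OF r P that]])
  have c0: "c 0 i j = coeff3 P i j 0" for i j
    using cs[of 0 i j] r by simp
  have bl: "(\<Sum>i\<le>N. c d i (N - i) * x ^ i * y ^ (N - i)) =
    h ((if N = 1 then cis (th - d) * Complex x y else 0) + (if N = 3 then a d * Complex x y ^ 2 * cnj (Complex x y) else 0)
      + (if N = n - 1 then b d * cnj (Complex x y) ^ (n - 1) else 0))" if "\<bar>d\<bar> < r" "N < 4" for N d x y
    unfolding c_def by (rule map_blocks[OF r P that(1) h' n f0[OF that(1)] form[OF that(1)] that(2)])
  have zero: "coeff3 P i j k = 0" if "\<And>d. \<bar>d\<bar> < r \<Longrightarrow> c d i j = 0" for i j k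
  proof -
    have "(\<lambda>k. coeff3 P i j k) = (\<lambda>_. 0)"
      by (rule powser_unique[OF r, where f = "\<lambda>_. 0"]) (use cs that in \<open>auto, metis\<close>)
    then show ?thesis by (simp add: fun_eq_iff)
  qed
  have P00: "coeff3 P 0 0 k = 0" for k
    by (rule zero) (use bl[of _ 0 1 1] n h0 in auto)
  have P2: "coeff3 P i (2 - i) k = 0" if "n = 4" "i \<le> 2" for i k
  proof (rule zero)
    fix d assume d: "\<bar>d\<bar> < r"
    \<comment> \<open>A binary quadratic form is determined by its values in the directions (0, 1),
      (1, 0) and (1, 1).\<close>
    have "c d 0 2 = 0" "c d 2 0 = 0" "c d 0 2 + c d 1 1 + c d 2 0 = 0"
      using bl[OF d, of 2 0 1] bl[OF d, of 2 1 0] bl[OF d, of 2 1 1] that(1) h0 by (simp_all add: eval_nat_numeral)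
    then have "c d 0 2 = 0" "c d 1 1 = 0" "c d 2 0 = 0" by auto
    moreover have "i = 0 \<or> i = 1 \<or> i = 2" using that(2) by auto
    ultimately show "c d i (2 - i) = 0" by auto
  qed
  define Ck Sk where "Ck k = cos th * cos_coeff k + sin th * sin_coeff k"
    and "Sk k = sin th * cos_coeff k - cos th * sin_coeff k" for k
  have CS: "(\<lambda>k. Ck k * d ^ k) sums cos (th - d)" "(\<lambda>k. Sk k * d ^ k) sums sin (th - d)" "(\<lambda>k. (- Sk k) * d ^ k) sums (- sin (th - d))" for d
  proof -
    have c: "(\<lambda>k. cos_coeff k * d ^ k) sums cos d" "(\<lambda>k. sin_coeff k * d ^ k) sums sin d"
      using cos_converges[of d] sin_converges[of d] by simp_all
    show "(\<lambda>k. Ck k * d ^ k) sums cos (th - d)"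
      using sums_add[OF sums_mult[OF c(1), of "cos th"] sums_mult[OF c(2), of "sin th"]]
      by (simp add: Ck_def cos_diff algebra_simps)
    show S: "(\<lambda>k. Sk k * d ^ k) sums sin (th - d)"
      using sums_diff[OF sums_mult[OF c(1), of "sin th"] sums_mult[OF c(2), of "cos th"]]
      by (simp add: Sk_def sin_diff algebra_simps)
    from sums_minus[OF S] show "(\<lambda>k. (- Sk k) * d ^ k) sums (- sin (th - d))" by simp
  qed
  have b10: "c d 1 0 = h (cis (th - d))" and b01: "c d 0 1 = h (cis (th - d) * \<i>)" if "\<bar>d\<bar> < r" for d
  proof -
    have "Complex 1 0 = 1" "Complex 0 1 = \<i>" by (simp_all add: complex_eq_iff)
    then show "c d 1 0 = h (cis (th - d))" "c d 0 1 = h (cis (th - d) * \<i>)"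
      using bl[OF that, of 1 1 0] bl[OF that, of 1 0 1] n by auto
  qed
  have lin: "coeff3 P i j k = w k" if "\<And>d. \<bar>d\<bar> < r \<Longrightarrow> (\<lambda>k. w k * d ^ k) sums c d i j" for w i j k
    using powser_unique[OF r, of "\<lambda>k. coeff3 P i j k" "\<lambda>d. c d i j" w] cs that by (simp add: fun_eq_iff)
  have P1: "coeff3 P 1 0 k = (if h = Re then Ck k else Sk k)" "coeff3 P 0 1 k = (if h = Re then - Sk k else Ck k)" for k
  proof -
    have RI: "Re \<noteq> Im" by (metis complex.sel(1) complex.sel(2) zero_neq_one)
    show "coeff3 P 1 0 k = (if h = Re then Ck k else Sk k)"
      using h b10 CS RI by (intro lin[of "\<lambda>k. if h = Re then Ck k else Sk k"]) auto
    show "coeff3 P 0 1 k = (if h = Re then - Sk k else Ck k)"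
      using h b01 CS(1) CS(3) RI by (intro lin[of "\<lambda>k. if h = Re then - Sk k else Ck k"]) auto
  qed
  have ex: "coeff3 (ex 1 DI (rot th u)) i j k =
      (if i = 1 \<and> j = 0 then if h = Re then Ck k else Sk k else if i = 0 \<and> j = 1 then if h = Re then - Sk k else Ck k else 0)" for i j k
  proof -
    have RI: "Re \<noteq> Im" by (metis complex.sel(1) complex.sel(2) zero_neq_one)
    show ?thesis using h RI by (auto simp: ex_delta_action_rot Ck_def Sk_def)
  qed
  have X1: "coeff3 X i j k = 0" if "i + j < 2" for i j k
  proof -
    have "i = 0 \<and> j = 0 \<or> i = 1 \<and> j = 0 \<or> i = 0 \<and> j = 1" using that by auto
    then show ?thesis by (elim disjE conjE) (simp_all add: X_def ex P00 P1[simplified])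
  qed
  then show "wt 0 2 X" by (simp add: wt_def)
  show "wt (n - 2) (n - 1) X" unfolding wt_def
  proof (intro allI impI)
    fix i j k assume ijk: "i + j + (n - 2) * k < n - 1"
    show "coeff3 X i j k = 0"
    proof (cases "i + j < 2")
      case False
      then have "n = 4" "j = 2 - i" "i \<le> 2" using ijk n by auto
      then show ?thesis using P2[of i k] False by (auto simp: X_def ex)
    qed (rule X1)
  qed
  have "(\<Sum>i\<le>n - 1. c 0 i (n - 1 - i) * x ^ i * y ^ (n - 1 - i)) =
      h ((if n = 4 then a 0 * Complex x y ^ 2 * cnj (Complex x y) else 0) + b 0 * cnj (Complex x y) ^ (n - 1))"
    using bl[of 0 "n - 1" x y] r n by auto
  then show "(\<Sum>i\<le>n - 1. coeff3 P i (n - 1 - i) 0 * x ^ i * y ^ (n - 1 - i)) =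
      h ((if n = 4 then a 0 * Complex x y ^ 2 * cnj (Complex x y) else 0) + b 0 * cnj (Complex x y) ^ (n - 1))"
    by (simp only: c0)
qed

lemma taylor_map:
  fixes F :: "real \<Rightarrow> real \<Rightarrow> real^2 \<Rightarrow> real^2" and a b :: "real \<Rightarrow> real \<Rightarrow> complex"
    and U :: "(real^2) set" and P :: "(real \<times> real) set" and n :: nat
  defines "th \<equiv> 2 * pi / real n"
  assumes n: "n = 3 \<or> n = 4" and U: "open U" "0 \<in> U" and P: "open P" "(0, 0) \<in> P"
    and F_analytic: "real_analytic_on (\<lambda>(p, \<delta>, nu). F \<delta> nu p) (U \<times> P)"
    and F_area: "\<And>\<delta> nu. (\<delta>, nu) \<in> P \<Longrightarrow> area_preserving_on (F \<delta> nu) U"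
    and F_orientation: "\<And>\<delta> nu. (\<delta>, nu) \<in> P \<Longrightarrow> orientation_preserving_on (F \<delta> nu) U"
    and F_origin: "\<And>\<delta> nu. (\<delta>, nu) \<in> P \<Longrightarrow> F \<delta> nu 0 = 0"
    and F_form: "\<And>\<delta> nu. (\<delta>, nu) \<in> P \<Longrightarrow>
      (\<lambda>p. norm (to_complex (F \<delta> nu p)
          - (cis (2 * pi / real n - \<delta>) * to_complex p
             + a nu \<delta> * to_complex p ^ 2 * cnj (to_complex p)
             + b nu \<delta> * cnj (to_complex p) ^ (n - 1))))
        \<in> O[at 0](\<lambda>p. norm (to_complex p) ^ 4)"
  obtains rho and G :: "real \<Rightarrow> formal_map" where "0 < rho" "fam {-rho<..<rho} (\<lambda>nu. fst (G nu))" "fam {-rho<..<rho} (\<lambda>nu. snd (G nu))"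
    "\<And>nu. nu \<in> {-rho<..<rho} \<Longrightarrow> has_taylor_series (\<lambda>\<delta>. F \<delta> nu) (G nu)"
    "\<And>nu. nu \<in> {-rho<..<rho} \<Longrightarrow> vanishes_at_origin (G nu)"
    "\<And>nu. nu \<in> {-rho<..<rho} \<Longrightarrow> pb (fst (G nu)) (snd (G nu)) = 1"
    "\<And>nu u. nu \<in> {-rho<..<rho} \<Longrightarrow> u = var_x \<or> u = var_y \<Longrightarrow> wt 0 2 (subst_xy u (G nu) - ex 1 DI (rot th u))"
    "\<And>nu u. nu \<in> {-rho<..<rho} \<Longrightarrow> u = var_x \<or> u = var_y \<Longrightarrow> wt (n - 2) (n - 1) (subst_xy u (G nu) - ex 1 DI (rot th u))"
    "\<And>x y. (\<Sum>i\<le>n - 1. coeff3 (fst (G 0)) i (n - 1 - i) 0 * x ^ i * y ^ (n - 1 - i)) =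
      Re ((if n = 4 then a 0 0 * Complex x y ^ 2 * cnj (Complex x y) else 0) + b 0 0 * cnj (Complex x y) ^ (n - 1))"
    "\<And>x y. (\<Sum>i\<le>n - 1. coeff3 (snd (G 0)) i (n - 1 - i) 0 * x ^ i * y ^ (n - 1 - i)) =
      Im ((if n = 4 then a 0 0 * Complex x y ^ 2 * cnj (Complex x y) else 0) + b 0 0 * cnj (Complex x y) ^ (n - 1))"
proof -
  have "real_analytic_at (\<lambda>(p, \<delta>, nu). F \<delta> nu p) (0, 0, 0)"
    using F_analytic U(2) P(2) by (auto simp: real_analytic_on_def)
  then obtain rho1 D where rho1: "0 < rho1" and D: "\<And>x y d v. \<bar>x\<bar> < rho1 \<Longrightarrow> \<bar>y\<bar> < rho1 \<Longrightarrow> \<bar>d\<bar> < rho1 \<Longrightarrow> \<bar>v\<bar> < rho1 \<Longrightarrow>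
    ((\<lambda>((i, j, k), l). (x ^ i * y ^ j * d ^ k * v ^ l) *\<^sub>R D ((i, j, k), l)) has_sum F d v (vector [x, y])) UNIV"
    by (rule analytic_expansion) blast
  obtain eU where eU: "0 < eU" "ball 0 eU \<subseteq> U" using U openE by blast
  obtain eP where eP: "0 < eP" "ball (0, 0) eP \<subseteq> P" using P openE by blast
  define rho where "rho = Min {rho1, eU / 2, eP / 2}"
  have rho: "0 < rho" "rho \<le> rho1" "rho \<le> eU / 2" "rho \<le> eP / 2" using rho1 eU(1) eP(1) by (simp_all add: rho_def)
  have inU: "vector [x, y] \<in> U" if "\<bar>x\<bar> < rho" "\<bar>y\<bar> < rho" for x y
  proof -
    have "norm (vector [x, y] :: real^2) \<le> \<bar>x\<bar> + \<bar>y\<bar>"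
      using norm_le_l1_cart[of "vector [x, y] :: real^2"] by (simp add: sum_2)
    then have "vector [x, y] \<in> ball (0 :: real^2) eU" using that rho(3) by (simp add: dist_norm)
    then show ?thesis using eU(2) by blast
  qed
  have inP: "(d, v) \<in> P" if "\<bar>d\<bar> < rho" "\<bar>v\<bar> < rho" for d v
  proof -
    have "norm (d, v) \<le> \<bar>d\<bar> + \<bar>v\<bar>" using norm_Pair_le[of d v] by simp
    then have "norm ((0, 0) - (d, v)) < eP" using that rho(4) by (simp add: norm_Pair)
    then have "(d, v) \<in> ball (0, 0) eP" by (simp add: dist_norm)
    then show ?thesis using eP(2) by blast
  qed
  have Dk: "((\<lambda>((i, j, k), l). x ^ i * y ^ j * d ^ k * v ^ l * vec_nth (D ((i, j, k), l)) m) has_sum vec_nth (F d v (vector [x, y])) m) UNIV"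
    if "\<bar>x\<bar> < rho" "\<bar>y\<bar> < rho" "\<bar>d\<bar> < rho" "\<bar>v\<bar> < rho" for x y d v m
    using has_sum_bounded_linear[OF bounded_linear_vec_nth[of m] D[of x y d v]] that rho(2) by (simp add: split_def)
  obtain P1 where P1: "fam {-rho<..<rho} P1" "\<And>v. \<bar>v\<bar> < rho \<Longrightarrow> hx rho (\<lambda>x y d. vec_nth (F d v (vector [x, y])) 1) (P1 v)"
    using hx_family[OF rho(1), where D = "\<lambda>u. vec_nth (D u) 1" and g = "\<lambda>v x y d. vec_nth (F d v (vector [x, y])) 1"] Dk[of _ _ _ _ 1] by blast
  obtain P2 where P2: "fam {-rho<..<rho} P2" "\<And>v. \<bar>v\<bar> < rho \<Longrightarrow> hx rho (\<lambda>x y d. vec_nth (F d v (vector [x, y])) 2) (P2 v)"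
    using hx_family[OF rho(1), where D = "\<lambda>u. vec_nth (D u) 2" and g = "\<lambda>v x y d. vec_nth (F d v (vector [x, y])) 2"] Dk[of _ _ _ _ 2] by blast
  define G where "G v = (P1 v, P2 v)" for v
  have hR: "hx rho (\<lambda>x y d. Re (to_complex (F d v (vector [x, y])))) (P1 v)" and hI: "hx rho (\<lambda>x y d. Im (to_complex (F d v (vector [x, y])))) (P2 v)"
    if "\<bar>v\<bar> < rho" for v
    using P1(2)[OF that] P2(2)[OF that] by (simp_all add: to_complex_def)
  note R = map_coeffs[OF rho(1) hR _ n F_origin[OF inP] F_form[OF inP], of _ var_x, folded th_def]
  note I = map_coeffs[OF rho(1) hI _ n F_origin[OF inP] F_form[OF inP], of _ var_y, folded th_def]
  have van: "vanishes_at_origin (G v)" if "\<bar>v\<bar> < rho" for v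
  proof -
    have "wt 0 1 (rot th u)" if "u = var_x \<or> u = var_y" for u using that by (intro alg_wt[OF alg_rot]) auto
    then have e: "wt 0 1 (ex 1 DI (rot th u))" if "u = var_x \<or> u = var_y" for u
      using that by (intro alg_wt[OF alg_ex[OF gen_delta_action(1)]]) auto
    have "wt 0 1 (P1 v - ex 1 DI (rot th var_x))" "wt 0 1 (P2 v - ex 1 DI (rot th var_y))"
      using wt_mono[OF R(1)[of v], of 1] wt_mono[OF I(1)[of v], of 1] that by simp_all
    then have "wt 0 1 (P1 v)" "wt 0 1 (P2 v)"
      using wt_add[OF _ e[of var_x], of "P1 v - ex 1 DI (rot th var_x)"]
        wt_add[OF _ e[of var_y], of "P2 v - ex 1 DI (rot th var_y)"] by simp_all
    then show ?thesis unfolding G_def by (rule wt_vanishes)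
  qed
  show thesis
  proof (rule that[of rho G])
    fix v assume "v \<in> {-rho<..<rho}"
    then have v: "\<bar>v\<bar> < rho" by auto
    show "has_taylor_series (\<lambda>\<delta>. F \<delta> v) (G v)"
      unfolding has_taylor_series_def expansion_hx G_def using P1(2)[OF v] P2(2)[OF v] rho(1) by auto
    show "vanishes_at_origin (G v)" by (rule van[OF v])
    have "pb (P1 v) (P2 v) = 1"
    proof (rule jacobian_pb[OF rho(1) P1(2)[OF v] P2(2)[OF v]])
      fix x y d :: real assume *: "\<bar>x\<bar> < rho" "\<bar>y\<bar> < rho" "\<bar>d\<bar> < rho"
      show "det (jacobian (F d v) (at (vector [x, y]))) = 1"
        using F_area[OF inP[OF *(3) v]] F_orientation[OF inP[OF *(3) v]] inU[OF *(1,2)]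
        unfolding area_preserving_on_def orientation_preserving_on_def by force
    qed
    then show "pb (fst (G v)) (snd (G v)) = 1" by (simp add: G_def)
    fix u :: "real fps3" assume u: "u = var_x \<or> u = var_y"
    have s: "subst_xy var_x (G v) = P1 v" "subst_xy var_y (G v) = P2 v"
      using subst_var[OF van[OF v]] by (simp_all add: G_def)
    show "wt 0 2 (subst_xy u (G v) - ex 1 DI (rot th u))"
      "wt (n - 2) (n - 1) (subst_xy u (G v) - ex 1 DI (rot th u))"
      using u R(1,2)[OF v] I(1,2)[OF v] v by (auto simp: s)
  next
    have 0: "\<bar>0\<bar> < rho" using rho(1) by simp
    fix x y :: real
    show "(\<Sum>i\<le>n - 1. coeff3 (fst (G 0)) i (n - 1 - i) 0 * x ^ i * y ^ (n - 1 - i)) =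
      Re ((if n = 4 then a 0 0 * Complex x y ^ 2 * cnj (Complex x y) else 0) + b 0 0 * cnj (Complex x y) ^ (n - 1))"
      using R(3)[OF 0, of x y] 0 by (simp add: G_def)
    show "(\<Sum>i\<le>n - 1. coeff3 (snd (G 0)) i (n - 1 - i) 0 * x ^ i * y ^ (n - 1 - i)) =
      Im ((if n = 4 then a 0 0 * Complex x y ^ 2 * cnj (Complex x y) else 0) + b 0 0 * cnj (Complex x y) ^ (n - 1))"
      using I(3)[OF 0, of x y] 0 by (simp add: G_def)
  qed (use rho(1) P1(1) P2(1) in \<open>simp_all add: G_def\<close>)
qed

subsection \<open>The leading resonant term\<close>

lemma zspan_sum:
  assumes "finite A" "\<And>a. a \<in> A \<Longrightarrow> zspan D (g a)" shows "zspan D (sum g A)"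
  using assms
proof (induction A)
  case empty
  have "zspan D (const3 0 * (AI ^ 0 * Zr D))" by (intro zspan.smul zspan.mon0) simp
  then show ?case by (simp add: const3_simps)
qed (auto intro: zspan.add)

lemma homog_zspan: assumes "homog D f" shows "zspan D f"
proof -
  have "zspan D (\<Sum>i\<le>D. const3 (coeff3 f i (D - i) 0) * (var_x ^ i * var_y ^ (D - i)))"
  proof (intro zspan_sum zspan.smul)
    fix i assume "i \<in> {..D}"
    then show "zspan D (var_x ^ i * var_y ^ (D - i))" using zspan_monomial[of i "D - i"] by simp
  qed simp
  then show ?thesis by (simp add: homog_expand[OF assms, symmetric])
qed

lemma hh_add: "hh n al g1 g2 + hh n al' g1' g2' = hh n (al + al') (g1 + g1') (g2 + g2')"
  and hh_smul: "const3 c * hh n al g1 g2 = hh n (c * al) (c * g1) (c * g2)"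
  by (simp_all add: hh_def CC_def const3_simps algebra_simps)

lemma rot_hh: "0 < n \<Longrightarrow> rot (2 * pi / real n) (hh n al g1 g2) = hh n al g1 g2"
  by (simp add: hh_def rot_simps rot_CS)

lemma homog_hh: "n = 4 \<or> al = 0 \<Longrightarrow> homog n (hh n al g1 g2)"
proof -
  assume a: "n = 4 \<or> al = 0"
  have "homog 4 (AI ^ 2)" using homog_power[OF homog_action, of 2] by simp
  then have "homog n (const3 al * AI ^ 2)" using a unfolding homog_iff by auto
  then show ?thesis unfolding hh_def by (intro homog_add hom_CS)
qed

text \<open>Averaging kills every basis element of degree n except z^n and, for n = 4, the square of
  I.\<close>

lemma invariant_leading:
  assumes n: "n = 3 \<or> n = 4" and f: "homog n f" "rot (2 * pi / real n) f = f"
  shows "\<exists>al g1 g2. f = hh n al g1 g2 \<and> (n = 3 \<longrightarrow> al = 0)"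
proof -
  have n0: "0 < n" using n by auto
  have h0: "hh n 0 0 0 = 0" by (simp add: hh_def CC_def const3_simps)
  have Z: "av n (Zr n) = hh n 0 1 0" "av n (Zi n) = hh n 0 0 (-1)"
  proof -
    have e: "Zr n = hh n 0 1 0" "Zi n = hh n 0 0 (-1)" by (simp_all add: hh_def CC_def const3_simps)
    show "av n (Zr n) = hh n 0 1 0" unfolding e by (rule av_fix[OF n0 rot_hh[OF n0]])
    show "av n (Zi n) = hh n 0 0 (-1)" unfolding e by (rule av_fix[OF n0 rot_hh[OF n0]])
  qed
  have I: "av 4 (AI ^ 2) = hh 4 1 0 0"
  proof -
    have e: "AI ^ 2 = hh 4 1 0 0" by (simp add: hh_def CC_def const3_simps)
    show ?thesis unfolding e using av_fix[of 4 "hh 4 1 0 0"] rot_hh[of 4 1 0 0] by simp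
  qed
  define good where "good f \<longleftrightarrow> (\<exists>al g1 g2. av n f = hh n al g1 g2 \<and> (n = 3 \<longrightarrow> al = 0))" for f
  have mon: "good (AI ^ a * Zr p) \<and> good (AI ^ a * Zi p)" if "2 * a + p = n" for a p
  proof -
    have "a = 0 \<and> p = n \<or> n = 4 \<and> a = 2 \<and> p = 0 \<or> \<not> n dvd p"
    proof (cases "n dvd p")
      case True
      then obtain m where "p = n * m" by auto
      moreover have "2 * a \<noteq> 3" by presburger
      ultimately show ?thesis using that n by (cases m) auto
    qed simp
    then consider "a = 0" "p = n" | "n = 4" "a = 2" "p = 0" | "\<not> n dvd p" by blast
    then show ?thesis
    proof cases
      case 1
      have "good (Zr n)" unfolding good_def Z by (intro exI[of _ 0] exI[of _ 1]) auto
      moreover have "good (Zi n)" unfolding good_def Z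
        by (rule exI[of _ 0], rule exI[of _ 0], rule exI[of _ "-1"]) auto
      ultimately show ?thesis using 1 by simp
    next
      case 2
      have "good (AI ^ 2)" unfolding good_def using 2 I by auto
      moreover have "good 0" unfolding good_def av_linear using h0 by metis
      ultimately show ?thesis using 2 by simp
    next
      case 3
      then show ?thesis unfolding good_def by (simp add: av_linear av_Z[OF n0]) (metis h0)
    qed
  qed
  have "zspan D f \<Longrightarrow> D = n \<Longrightarrow> good f" for D f
  proof (induction rule: zspan.induct)
    case (add D f f') then show ?case unfolding good_def by (auto simp: av_linear hh_add) (metis add_0)+
  next
    case (smul D f a) then show ?case unfolding good_def by (auto simp: av_linear hh_smul) (metis mult_zero_right)+
  qed (use mon in auto)
  from this[OF homog_zspan[OF f(1)] refl] show ?thesis unfolding good_def av_fix[OF n0 f(2)] .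
qed

lemma coeff3_Z:
  "coeff3 (Zr 0) i j k = (if i = 0 \<and> j = 0 \<and> k = 0 then 1 else 0)" "coeff3 (Zi 0) i j k = 0"
  "coeff3 (Zr (Suc p)) i j k = (if i = 0 then 0 else coeff3 (Zr p) (i - 1) j k) - (if j = 0 then 0 else coeff3 (Zi p) i (j - 1) k)"
  "coeff3 (Zi (Suc p)) i j k = (if i = 0 then 0 else coeff3 (Zi p) (i - 1) j k) + (if j = 0 then 0 else coeff3 (Zr p) i (j - 1) k)"
  by (auto simp: Z_Suc coeff3_var_mult)

text \<open>\<open>lead1\<close>, \<open>lead2\<close> and \<open>lead0\<close> recover g1, g2 and
  al from coefficients of \<open>hh\<close>, so that these depend analytically on nu. For n = 4 the
  difference in \<open>lead1\<close> cancels the contribution of I^2.\<close>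

definition lead1 :: "nat \<Rightarrow> real fps3 \<Rightarrow> real" where
  "lead1 n f = (if n = 3 then coeff3 f 3 0 0 else (coeff3 f 4 0 0 - coeff3 f 2 2 0 / 2) / 4)"

definition lead2 :: "nat \<Rightarrow> real fps3 \<Rightarrow> real" where
  "lead2 n f = (if n = 3 then coeff3 f 0 3 0 else - coeff3 f 3 1 0 / 4)"

definition lead0 :: "nat \<Rightarrow> real fps3 \<Rightarrow> real" where
  "lead0 n f = (if n = 3 then 0 else 4 * (coeff3 f 4 0 0 - lead1 n f))"

lemma lead_hh:
  assumes n: "n = 3 \<or> n = 4" and al: "n = 3 \<longrightarrow> al = 0"
  shows "lead0 n (hh n al g1 g2) = al" "lead1 n (hh n al g1 g2) = g1" "lead2 n (hh n al g1 g2) = g2"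
proof -
  have q: "const3 (1/4 :: real) = const3 (1/2) * const3 (1/2)" by (simp flip: const3_simps(2))
  have AI2: "AI ^ 2 = const3 (1/4) * (var_x * (var_x * (var_x * var_x)) + const3 2 * (var_x * (var_x * (var_y * var_y))) + var_y * (var_y * (var_y * var_y)))"
    unfolding q action_I_def by (simp add: power2_eq_square const3_numeral algebra_simps)
  have 3: "lead1 3 (hh 3 0 g1 g2) = g1" "lead2 3 (hh 3 0 g1 g2) = g2" "lead0 3 (hh 3 0 g1 g2) = 0"
    unfolding lead1_def lead2_def lead0_def hh_def CC_def by (simp_all add: eval_nat_numeral coeff3_Z const3_simps)
  have 4: "lead1 4 (hh 4 al g1 g2) = g1" "lead2 4 (hh 4 al g1 g2) = g2"
    unfolding lead1_def lead2_def hh_def CC_def AI2 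
    by (simp add: eval_nat_numeral coeff3_Z coeff3_var_mult, simp add: field_simps) (simp add: eval_nat_numeral coeff3_Z coeff3_var_mult)
  have 5: "lead0 4 (hh 4 al g1 g2) = al"
    unfolding lead0_def 4 unfolding hh_def CC_def AI2 by (simp add: eval_nat_numeral coeff3_Z coeff3_var_mult)
  show "lead0 n (hh n al g1 g2) = al" "lead1 n (hh n al g1 g2) = g1" "lead2 n (hh n al g1 g2) = g2"
    using n al 3 4 5 by blast+
qed

lemma values_eq:
  assumes P: "homog N P" and Q: "homog N Q"
    and eq: "\<And>x. (\<Sum>i\<le>N. coeff3 P i (N - i) 0 * x ^ i) = (\<Sum>i\<le>N. coeff3 Q i (N - i) 0 * x ^ i)"
  shows "P = Q"
proof (rule coeff3_ext)
  fix i j k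
  have c: "coeff3 P i (N - i) 0 = coeff3 Q i (N - i) 0" if "i \<le> N" for i
    using polyfun_eq_coeffs[of "\<lambda>i. coeff3 P i (N - i) 0" N "\<lambda>i. coeff3 Q i (N - i) 0"] eq that by blast
  show "coeff3 P i j k = coeff3 Q i j k"
  proof (cases "i + j = N \<and> k = 0")
    case True then show ?thesis using c[of i] by auto
  next
    case False
    then have "i + j \<noteq> N \<or> k \<noteq> 0" by blast
    then show ?thesis using homogD[OF P] homogD[OF Q] by metis
  qed
qed

text \<open>The formal version of the resonant terms \<open>a z\<^sup>2 z\<^bsup>*\<^esup> + b z\<^bsup>*(n-1)\<^esup>\<close> (\<open>a\<close> being absent for \<open>n = 3\<close>).\<close>
definition res_re :: "nat \<Rightarrow> complex \<Rightarrow> complex \<Rightarrow> real fps3" where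
  "res_re n a b = const3 (Re b) * Zr (n - 1) + const3 (Im b) * Zi (n - 1)
     + (if n = 4 then 2 * (AI * (const3 (Re a) * var_x - const3 (Im a) * var_y)) else 0)"

definition res_im :: "nat \<Rightarrow> complex \<Rightarrow> complex \<Rightarrow> real fps3" where
  "res_im n a b = const3 (Im b) * Zr (n - 1) - const3 (Re b) * Zi (n - 1)
     + (if n = 4 then 2 * (AI * (const3 (Re a) * var_y + const3 (Im a) * var_x)) else 0)"

lemma res_values:
  assumes n: "n = 3 \<or> n = 4"
  shows "homog (n - 1) f \<Longrightarrow> (\<And>x y. (\<Sum>i\<le>n - 1. coeff3 f i (n - 1 - i) 0 * x ^ i * y ^ (n - 1 - i)) =
      Re ((if n = 4 then a * Complex x y ^ 2 * cnj (Complex x y) else 0) + b * cnj (Complex x y) ^ (n - 1))) \<Longrightarrow> f = res_re n a b"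
    and "homog (n - 1) f \<Longrightarrow> (\<And>x y. (\<Sum>i\<le>n - 1. coeff3 f i (n - 1 - i) 0 * x ^ i * y ^ (n - 1 - i)) =
      Im ((if n = 4 then a * Complex x y ^ 2 * cnj (Complex x y) else 0) + b * cnj (Complex x y) ^ (n - 1))) \<Longrightarrow> f = res_im n a b"
proof -
  have v: "homog 1 (const3 s * var_x + const3 t * var_y)" for s t
    using homog_mult[of 0 "const3 s" 1 var_x] by (simp add: homog_iff)
  have v': "homog 1 (const3 s * var_x - const3 t * var_y)" "homog 1 (const3 s * var_y + const3 t * var_x)" for s t
    using v[of s "-t"] v[of t s] by (simp_all add: const3_simps add.commute)
  have c: "homog D (const3 s * f)" if "homog D f" for D s f
    using that by (simp add: homog_iff)
  have two: "2 = const3 (2 :: real)" by (simp add: const3_numeral)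
  have AIv: "n = 4 \<Longrightarrow> homog (n - 1) (2 * (AI * f))" if "homog 1 f" for f
    using c[OF homog_mult[OF homog_action that], of 2] unfolding two by simp
  have m: "f - g = f + const3 (-1) * g" for f g :: "real fps3" by (simp add: const3_simps)
  have hr: "homog (n - 1) (res_re n a b)" unfolding res_re_def
    by (intro homog_add c homog_Z) (use AIv[OF v'(1)] in auto)
  have hi: "homog (n - 1) (res_im n a b)" unfolding res_im_def
    unfolding m[of "const3 (Im b) * Zr (n - 1)"]
    by (intro homog_add c homog_Z) (use AIv[OF v'(2)] in auto)
  have AIx: "2 * (AI * f) = var_x * (var_x * f) + var_y * (var_y * f)" for f
  proof -
    have "2 * (AI * f) = (var_x ^ 2 + var_y ^ 2) * f" by (simp only: var_squares mult_ac)
    then show ?thesis by (simp add: power2_eq_square algebra_simps)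
  qed
  have "(\<Sum>i\<le>n - 1. coeff3 (res_re n a b) i (n - 1 - i) 0 * x ^ i) =
     Re ((if n = 4 then a * Complex x 1 ^ 2 * cnj (Complex x 1) else 0) + b * cnj (Complex x 1) ^ (n - 1))" for x
  proof -
    have 3: "(\<Sum>i\<le>2. coeff3 (res_re 3 a b) i (2 - i) 0 * x ^ i) = Re (b * cnj (Complex x 1) ^ 2)"
      unfolding res_re_def AIx by (simp add: eval_nat_numeral coeff3_Z coeff3_var_mult) (simp add: algebra_simps)?
    have 4: "(\<Sum>i\<le>3. coeff3 (res_re 4 a b) i (3 - i) 0 * x ^ i) = Re (a * Complex x 1 ^ 2 * cnj (Complex x 1) + b * cnj (Complex x 1) ^ 3)"
      unfolding res_re_def AIx by (simp add: eval_nat_numeral coeff3_Z coeff3_var_mult) (simp add: algebra_simps)?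
    show ?thesis using n
    proof
      assume "n = 3" then show ?thesis using 3 by simp
    next
      assume "n = 4" then show ?thesis using 4 by simp
    qed
  qed
  then show "f = res_re n a b" if "homog (n - 1) f" "\<And>x y. (\<Sum>i\<le>n - 1. coeff3 f i (n - 1 - i) 0 * x ^ i * y ^ (n - 1 - i)) =
      Re ((if n = 4 then a * Complex x y ^ 2 * cnj (Complex x y) else 0) + b * cnj (Complex x y) ^ (n - 1))"
    using values_eq[OF that(1) hr] that(2)[of _ 1] by simp
  have "(\<Sum>i\<le>n - 1. coeff3 (res_im n a b) i (n - 1 - i) 0 * x ^ i) =
     Im ((if n = 4 then a * Complex x 1 ^ 2 * cnj (Complex x 1) else 0) + b * cnj (Complex x 1) ^ (n - 1))" for x
  proof -
    have 3: "(\<Sum>i\<le>2. coeff3 (res_im 3 a b) i (2 - i) 0 * x ^ i) = Im (b * cnj (Complex x 1) ^ 2)"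
      unfolding res_im_def AIx by (simp add: eval_nat_numeral coeff3_Z coeff3_var_mult) (simp add: algebra_simps)?
    have 4: "(\<Sum>i\<le>3. coeff3 (res_im 4 a b) i (3 - i) 0 * x ^ i) = Im (a * Complex x 1 ^ 2 * cnj (Complex x 1) + b * cnj (Complex x 1) ^ 3)"
      unfolding res_im_def AIx by (simp add: eval_nat_numeral coeff3_Z coeff3_var_mult) (simp add: algebra_simps)?
    show ?thesis using n
    proof
      assume "n = 3" then show ?thesis using 3 by simp
    next
      assume "n = 4" then show ?thesis using 4 by simp
    qed
  qed
  then show "f = res_im n a b" if "homog (n - 1) f" "\<And>x y. (\<Sum>i\<le>n - 1. coeff3 f i (n - 1 - i) 0 * x ^ i * y ^ (n - 1 - i)) =
      Im ((if n = 4 then a * Complex x y ^ 2 * cnj (Complex x y) else 0) + b * cnj (Complex x y) ^ (n - 1))"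
    using values_eq[OF that(1) hi] that(2)[of _ 1] by simp
qed

lemma euler: "homog n f \<Longrightarrow> var_x * deriv_x f + var_y * deriv_y f = of_nat n * f"
proof (rule coeff3_ext)
  fix i j k assume f: "homog n f"
  have e: "of_nat n * f = const3 (real n) * f" by (simp add: const3_of_nat)
  have "coeff3 f i j k = 0" if "i + j \<noteq> n" using homogD[OF f] that by blast
  then show "coeff3 (var_x * deriv_x f + var_y * deriv_y f) i j k = coeff3 (of_nat n * f) i j k"
    unfolding e coeff3_const3_mult coeff3_simps coeff3_var_mult coeff3_deriv_x coeff3_deriv_y
    by (cases i; cases j; cases "i + j = n") (auto simp: algebra_simps)
qed

text \<open>In degree n - 1 the conjugacy says that the nonlinear terms of \<open>T\<close>, turned
  back by the rotation, form the Hamiltonian vector field of H + K - rot K. Euler's identity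
  recovers this function from a and b, and averaging removes the contribution of
  \<open>K\<close>.\<close>

lemma leading_nonzero:
  fixes n :: nat and T K H and a b :: complex
  defines "d \<equiv> n - 2" and "th \<equiv> 2 * pi / real n"
  assumes n: "n = 3 \<or> n = 4" and T: "alg T"
    and near: "wt d 2 (T var_x - rot th var_x)" "wt d 2 (T var_y - rot th var_y)"
    and K: "gen K" "wt d n K" and H: "gen H" "wt d n H" "rot th H = H"
    and conj: "\<And>f. T (ex 1 K f) = ex 1 K (ex 1 H (rot th f))"
    and t: "hp (n - 1) 0 (T var_x) = res_re n a b" "hp (n - 1) 0 (T var_y) = res_im n a b" and b: "b \<noteq> 0"
  shows "\<exists>al g1 g2. hp n 0 H = hh n al g1 g2 \<and> (n = 3 \<longrightarrow> al = 0) \<and> (g1, g2) \<noteq> (0, 0)"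
proof -
  have n0: "0 < n" and n3: "3 \<le> n" "2 \<le> n" "d + 2 = n" using n by (auto simp: d_def)
  define f where "f = hp n 0 (H + K - rot th K)"
  \<comment> \<open>All exponentials are expanded to first order; the neglected terms have weight n
    because n <= 1 + 2 (n - 2).\<close>
  have main: "wt d n (T u - rot th u - pb (rot th u) (H + K - rot th K))" if u: "wt d 1 u" for u
  proof -
    define v where "v = rot th u"
    define w where "w = ex 1 H v"
    have v: "wt d 1 v" unfolding v_def by (rule alg_wt[OF alg_rot u])
    have w: "wt d 1 w" unfolding w_def by (rule alg_wt[OF alg_ex[OF H(1)] v])
    have le: "n \<le> 1 + 2 * (n - 2)" using n by auto
    have A1: "wt d n (ex 1 K u - u - pb u K)"
      using wt_mono[OF ex_tail2[OF K n3(2) u, of 1] le] by (simp add: const3_simps)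
    have A2: "wt d n (T (ex 1 K u) - T u - T (pb u K))"
      using alg_wt[OF T A1] by (simp add: alg_simps[OF T])
    have pu: "wt d (n - 1) (pb u K)" by (rule wt_pb'[OF u K(2)]) (use n in auto)
    have A3: "wt d n (T (pb u K) - pb v (rot th K))"
      using alg_diff_wt[OF T alg_rot near pu] n0 by (simp add: v_def symp_pb[OF symp_rot])
    have B1: "wt d n (ex 1 H v - v - pb v H)"
      using wt_mono[OF ex_tail2[OF H(1,2) n3(2) v, of 1] le] by (simp add: const3_simps)
    have B2: "wt d n (ex 1 K w - w - pb w K)"
      using wt_mono[OF ex_tail2[OF K n3(2) w, of 1] le] by (simp add: const3_simps)
    have wv: "wt d (1 + n - 2) (w - v)" unfolding w_def by (rule ex_tail1[OF H(1,2) n3(2) v])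
    have B3: "wt d n (pb (w - v) K)" by (rule wt_pb'[OF wv K(2)]) (use n in auto)
    have eq: "T u - v - pb v (H + K - rot th K) =
      (ex 1 K w - w - pb w K) + (ex 1 H v - v - pb v H) + pb (w - v) K - (T (pb u K) - pb v (rot th K))
       - (T (ex 1 K u) - T u - T (pb u K))"
      unfolding conj by (simp add: pb_add pb_diff flip: v_def w_def)
    show ?thesis unfolding v_def[symmetric] eq
      by (rule wt_diff[OF wt_diff[OF wt_add[OF wt_add[OF B2 B1] B3] A3] A2])
  qed
  have hu: "hp (n - 1) 0 (T u) = pb (rot th u) f" if u: "homog 1 u" for u
  proof -
    have hv: "homog 1 (rot th u)" by (rule homog_rot[OF u])
    have "hp (n - 1) 0 (T u - rot th u - pb (rot th u) (H + K - rot th K)) = 0"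
      using main[OF homog_wt[OF u]] n0 unfolding wt_hp by auto
    moreover have "hp (n - 1) 0 (rot th u) = 0" using n by (auto simp: hp_homog[OF hv])
    moreover have "hp (n - 1) 0 (pb (rot th u) (H + K - rot th K)) = pb (rot th u) f"
      using hp_pb[OF hv, of "n - 1" 0 "H + K - rot th K"] n by (auto simp: f_def)
    ultimately show ?thesis by simp
  qed
  define c s where "c = const3 (cos th)" and "s = const3 (sin th)"
  have cs: "c * c + s * s = 1"
    using sin_cos_squared_add[of th] unfolding c_def s_def
    by (simp only: power2_eq_square add.commute flip: const3_simps)
  define X Y where "X = res_re n a b" and "Y = res_im n a b"
  have XY: "X = c * deriv_y f + s * deriv_x f" "Y = s * deriv_y f - c * deriv_x f"
    using hu[of var_x] hu[of var_y] unfolding t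
    by (simp_all add: X_def Y_def rot_var c_def s_def pb_add pb_diff pb_const3_mult pb_var)
  have fx: "deriv_x f = s * X - c * Y" and fy: "deriv_y f = c * X + s * Y"
  proof -
    have "s * X - c * Y = (c * c + s * s) * deriv_x f" unfolding XY by (simp add: algebra_simps)
    then show "deriv_x f = s * X - c * Y" using cs by simp
    have "c * X + s * Y = (c * c + s * s) * deriv_y f" unfolding XY by (simp add: algebra_simps)
    then show "deriv_y f = c * X + s * Y" using cs by simp
  qed
  \<comment> \<open>In complex notation p - i q = - i e^(i th) conj b, and the leading coefficient g
    turns out to be this number divided by n.\<close>
  define p q where "p = sin th * Re b - cos th * Im b" and "q = cos th * Re b + sin th * Im b"
  define al where "al = (if n = 4 then 4 * (sin th * Re a - cos th * Im a) else 0)"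
  have "of_nat n * f = var_x * (s * X - c * Y) + var_y * (c * X + s * Y)"
    using euler[of n f, symmetric] unfolding fx fy by (simp only: f_def homog_hp)
  also have "\<dots> = const3 p * Zr (Suc (n - 1)) + const3 q * Zi (Suc (n - 1)) + const3 al * AI ^ 2"
  proof -
    have two: "var_x * var_x + var_y * var_y = 2 * AI" using var_squares by (simp add: power2_eq_square)
    define R J where "R = Zr (n - 1)" and "J = Zi (n - 1)"
    define br bi ar ai where "br = const3 (Re b)" and "bi = const3 (Im b)" and "ar = const3 (Re a)" and "ai = const3 (Im a)"
    have p: "const3 p = s * br - c * bi" "const3 q = c * br + s * bi"
      by (simp_all add: p_def q_def s_def c_def br_def bi_def const3_simps)
    have 1: "var_x * (s * (br * R + bi * J) - c * (bi * R - br * J)) + var_y * (c * (br * R + bi * J) + s * (bi * R - br * J))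
      = const3 p * Zr (Suc (n - 1)) + const3 q * Zi (Suc (n - 1))"
      unfolding p Z_Suc R_def[symmetric] J_def[symmetric] by (simp add: algebra_simps)
    have 2: "var_x * (s * (2 * (AI * (ar * var_x - ai * var_y))) - c * (2 * (AI * (ar * var_y + ai * var_x))))
       + var_y * (c * (2 * (AI * (ar * var_x - ai * var_y))) + s * (2 * (AI * (ar * var_y + ai * var_x))))
      = 4 * (s * ar - c * ai) * AI ^ 2"
    proof -
      have "var_x * (s * (2 * (AI * (ar * var_x - ai * var_y))) - c * (2 * (AI * (ar * var_y + ai * var_x))))
       + var_y * (c * (2 * (AI * (ar * var_x - ai * var_y))) + s * (2 * (AI * (ar * var_y + ai * var_x))))
        = 2 * AI * (s * ar - c * ai) * (var_x * var_x + var_y * var_y)" by (simp add: algebra_simps)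
      then show ?thesis unfolding two by (simp add: power2_eq_square)
    qed
    show ?thesis
    proof (cases "n = 4")
      case True
      have al: "const3 al = 4 * (s * ar - c * ai)"
        using True by (simp add: al_def s_def c_def ar_def ai_def const3_simps const3_numeral)
      have "X = (br * R + bi * J) + 2 * (AI * (ar * var_x - ai * var_y))"
        "Y = (bi * R - br * J) + 2 * (AI * (ar * var_y + ai * var_x))"
        using True by (simp_all add: X_def Y_def res_re_def res_im_def R_def J_def br_def bi_def ar_def ai_def)
      then have "var_x * (s * X - c * Y) + var_y * (c * X + s * Y) =
        (var_x * (s * (br * R + bi * J) - c * (bi * R - br * J)) + var_y * (c * (br * R + bi * J) + s * (bi * R - br * J)))
        + (var_x * (s * (2 * (AI * (ar * var_x - ai * var_y))) - c * (2 * (AI * (ar * var_y + ai * var_x))))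
       + var_y * (c * (2 * (AI * (ar * var_x - ai * var_y))) + s * (2 * (AI * (ar * var_y + ai * var_x)))))"
        by (simp only: distrib_left add_diff_add) (simp only: ac_simps)
      then show ?thesis unfolding 1 2 al by simp
    next
      case False
      have "X = br * R + bi * J" "Y = bi * R - br * J"
        using False by (simp_all add: X_def Y_def res_re_def res_im_def R_def J_def br_def bi_def)
      then show ?thesis unfolding 1[symmetric] using False by (simp add: al_def const3_simps)
    qed
  qed
  also have "Suc (n - 1) = n" using n0 by simp
  also have "const3 p * Zr n + const3 q * Zi n + const3 al * AI ^ 2 = hh n al p (- q)"
    by (simp add: hh_def CC_def const3_simps)
  finally have "const3 (inverse (real n)) * (of_nat n * f) = const3 (inverse (real n)) * hh n al p (- q)" by simp
  moreover have "const3 (inverse (real n)) * (of_nat n * f) = f"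
  proof -
    have "const3 (inverse (real n)) * (of_nat n * f) = const3 (inverse (real n) * real n) * f"
      by (simp only: const3_simps const3_of_nat mult.assoc)
    then show ?thesis using n0 by (simp add: const3_simps)
  qed
  ultimately have f: "f = hh n (inverse (real n) * al) (inverse (real n) * p) (inverse (real n) * (- q))"
    by (simp add: hh_smul)
  define k where "k = hp n 0 K"
  have avr: "av n (rot th k) = rot th (av n k)"
    by (simp add: av_def rot_simps rot_rot add.commute)
  have f2: "f = hp n 0 H + k + const3 (-1) * rot th k"
    by (simp add: f_def k_def hp_rot const3_simps)
  \<comment> \<open>The explicit formula shows that f is invariant, while k minus its rotation has
    mean zero.\<close>
  have "f = av n f" using av_fix[OF n0, of f] rot_hh[OF n0] f by (metis)
  also have "\<dots> = av n (hp n 0 H) + av n k + const3 (-1) * av n k"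
    unfolding f2 av_linear avr using rot_av[OF n0, of k] by (simp add: th_def)
  also have "\<dots> = av n (hp n 0 H)" by (simp add: const3_simps)
  also have "\<dots> = hp n 0 H"
  proof (rule av_fix[OF n0])
    show "rot (2 * pi / real n) (hp n 0 H) = hp n 0 H" using H(3) hp_rot[of n 0 th H] by (simp add: th_def)
  qed
  finally have "hp n 0 H = hh n (inverse (real n) * al) (inverse (real n) * p) (inverse (real n) * (- q))"
    using f by simp
  moreover have "(inverse (real n) * p, inverse (real n) * (- q)) \<noteq> (0, 0)"
  proof
    assume "(inverse (real n) * p, inverse (real n) * (- q)) = (0, 0)"
    then have pq: "p = 0" "q = 0" using n0 by auto
    have "Re b = sin th * p + cos th * q" "Im b = sin th * q - cos th * p"
      using sin_cos_squared_add[of th] unfolding p_def q_def by (algebra)+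
    then show False using b pq by (simp add: complex_eq_iff)
  qed
  moreover have "n = 3 \<longrightarrow> inverse (real n) * al = 0" by (simp add: al_def)
  ultimately show ?thesis by blast
qed

subsection \<open>Conjugacy with the normal form\<close>

text \<open>The rotation that makes g positive is chosen separately for each nu and need not depend
  continuously on it. Only the modulus of g enters the coefficients, and it is analytic since g does
  not vanish.\<close>

lemma normal_family:
  fixes n :: nat and V :: "real set" and al g1 g2 :: "real \<Rightarrow> real" and H :: "real \<Rightarrow> real fps3"
  defines "th \<equiv> 2 * pi / real n"
  assumes n: "n = 3 \<or> n = 4" and V: "open V"
    and al3: "\<And>nu. nu \<in> V \<Longrightarrow> n = 3 \<Longrightarrow> al nu = 0"
    and ra: "\<And>nu. nu \<in> V \<Longrightarrow> ra al nu" "\<And>nu. nu \<in> V \<Longrightarrow> ra g1 nu" "\<And>nu. nu \<in> V \<Longrightarrow> ra g2 nu"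
    and nz: "\<And>nu. nu \<in> V \<Longrightarrow> (g1 nu, g2 nu) \<noteq> (0, 0)"
    and H: "fam V H" "\<And>nu. nu \<in> V \<Longrightarrow> rot th (H nu) = H nu" "\<And>nu. nu \<in> V \<Longrightarrow> wt 0 3 (H nu - DI)"
      "\<And>nu. nu \<in> V \<Longrightarrow> wt (n - 2) (n + 1) (H nu - DI - hh n (al nu) (g1 nu) (g2 nu))"
  shows "\<exists>L A B. (\<forall>k m. \<forall>nu\<in>V. ra (A k m) nu \<and> ra (B k m) nu) \<and>
    (\<forall>nu\<in>V. gen (L nu) \<and> rot th (L nu) = L nu \<and> reduced_coeffs n (\<lambda>k m. A k m nu) (\<lambda>k m. B k m nu) \<and> 0 < B 0 0 nu \<and>
      (\<exists>t. rot t (ex 1 (L nu) (H nu)) = normal_hamiltonian n (\<lambda>k m. A k m nu) (\<lambda>k m. B k m nu)))"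
proof -
  have R: "res n V al g1 g2" by unfold_locales (use n al3 ra nz in auto)
  have n0: "0 < n" using n by auto
  obtain L where L: "\<And>nu. nu \<in> V \<Longrightarrow> gen (L nu)" "\<And>nu. nu \<in> V \<Longrightarrow> rot th (L nu) = L nu"
    "\<And>nu. nu \<in> V \<Longrightarrow> wt (n - 2) (n + 1) (ex 1 (L nu) (H nu) - DI - hh n (al nu) (g1 nu) (g2 nu))"
    and nf: "\<And>D m. \<exists>x y. res.nfw n V g1 g2 D x y (\<lambda>nu. hp D m (ex 1 (L nu) (H nu) - DI))"
  proof -
    have "\<exists>L. (\<forall>nu\<in>V. gen (L nu) \<and> rot th (L nu) = L nu \<and> wt (n - 2) (n + 1) (ex 1 (L nu) (H nu) - DI - hh n (al nu) (g1 nu) (g2 nu))) \<and>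
      (\<forall>D m. \<exists>x y. res.nfw n V g1 g2 D x y (\<lambda>nu. hp D m (ex 1 (L nu) (H nu) - DI)))"
      using res.reduced_normal_form[OF R V H(1)] H(2-4)
      unfolding res.h_def[OF R] res.dd_def[OF R] res.nf_def[OF R] th_def by blast
    then show thesis using that by blast
  qed
  obtain X Y where XY: "\<And>D m. res.nfw n V g1 g2 D (X D m) (Y D m) (\<lambda>nu. hp D m (ex 1 (L nu) (H nu) - DI))"
    using nf by metis
  have raXY: "ra (X D m) nu" "ra (Y D m) nu" if "nu \<in> V" for D m nu
    using XY[of D m] that unfolding res.nfw_def[OF R] by auto
  have hpL: "hp D m (ex 1 (L nu) (H nu) - DI) =
      const3 (X D m nu) * AI ^ (D div 2) + const3 (Y D m nu) * (AI ^ ((D - n) div 2) * CC n (g1 nu) (g2 nu))" if "nu \<in> V" for D m nu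
    using XY[of D m] that unfolding res.nfw_def[OF R] res.C_def[OF R] by blast
  have ok: "\<not> okA n D \<Longrightarrow> X D m nu = 0" "\<not> okB n D \<Longrightarrow> Y D m nu = 0" for D m nu
    using XY[of D m] unfolding res.nfw_def[OF R] by blast+
  define \<gamma> where "\<gamma> nu = sqrt (g1 nu ^ 2 + g2 nu ^ 2)" for nu
  have pos: "0 < g1 nu ^ 2 + g2 nu ^ 2" if "nu \<in> V" for nu
    using nz[OF that] by (auto simp: sum_power2_gt_zero_iff)
  have \<gamma>: "0 < \<gamma> nu" "\<gamma> nu ^ 2 = g1 nu ^ 2 + g2 nu ^ 2" if "nu \<in> V" for nu
    using pos[OF that] by (simp_all add: \<gamma>_def)
  define A where "A k m nu = X (2 * k + 4) m nu" for k m nu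
  define B where "B k m nu = Y (2 * k + n) m nu * \<gamma> nu / sn n" for k m nu
  show ?thesis
  proof (rule exI[of _ L], rule exI[of _ A], rule exI[of _ B], intro conjI allI ballI)
    fix k m nu assume nu: "nu \<in> V"
    show "ra (A k m) nu" using raXY[OF nu] by (simp add: A_def[abs_def])
    have "ra \<gamma> nu" unfolding \<gamma>_def[abs_def]
      by (intro ra_sqrt ra_add ra_power ra nu pos)
    then show "ra (B k m) nu" unfolding B_def[abs_def] by (intro ra_divide_const ra_mult raXY nu)
  next
    fix nu assume nu: "nu \<in> V"
    let ?A = "\<lambda>k m. A k m nu" and ?B = "\<lambda>k m. B k m nu"
    show "gen (L nu)" "rot th (L nu) = L nu" using L nu by auto
    show "reduced_coeffs n ?A ?B"
      unfolding reduced_coeffs_def A_def B_def using ok by (auto simp: okA_def okB_def keepA_def keepB_def)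
    define u v where "u = g1 nu / \<gamma> nu" and "v = - (g2 nu / \<gamma> nu)"
    have uv: "u * \<gamma> nu = g1 nu" "v * \<gamma> nu = - g2 nu" using \<gamma>[OF nu] by (simp_all add: u_def v_def)
    have "u ^ 2 + v ^ 2 = (g1 nu ^ 2 + g2 nu ^ 2) / \<gamma> nu ^ 2"
      by (simp only: u_def v_def power_divide power2_minus add_divide_distrib)
    also have "\<dots> = 1" unfolding \<gamma>(2)[OF nu, symmetric] using \<gamma>(1)[OF nu] by simp
    finally have "u ^ 2 + v ^ 2 = 1" .
    then obtain \<tau> where \<tau>: "u = cos \<tau>" "v = sin \<tau>" using sincos_total_2pi by blast
    define t where "t = \<tau> / real n"
    have nt: "real n * t = \<tau>" using n0 by (simp add: t_def)
    have rC: "rot t (CC n (g1 nu) (g2 nu)) = const3 (\<gamma> nu) * Zr n"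
    proof -
      have 1: "g1 nu * cos \<tau> - g2 nu * sin \<tau> = \<gamma> nu"
      proof -
        have "\<gamma> nu * (g1 nu * cos \<tau> - g2 nu * sin \<tau>) = g1 nu * (u * \<gamma> nu) - g2 nu * (v * \<gamma> nu)" by (simp add: \<tau> algebra_simps)
        also have "\<dots> = \<gamma> nu * \<gamma> nu" unfolding uv using \<gamma>(2)[OF nu] by (simp add: power2_eq_square)
        finally show ?thesis using \<gamma>(1)[OF nu] by simp
      qed
      have 2: "g1 nu * sin \<tau> + g2 nu * cos \<tau> = 0"
      proof -
        have "\<gamma> nu * (g1 nu * sin \<tau> + g2 nu * cos \<tau>) = g1 nu * (v * \<gamma> nu) + g2 nu * (u * \<gamma> nu)" by (simp add: \<tau> algebra_simps)
        also have "\<dots> = 0" unfolding uv by simp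
        finally show ?thesis using \<gamma>(1)[OF nu] by simp
      qed
      have "rot t (CC n (g1 nu) (g2 nu)) = const3 (g1 nu * cos \<tau> - g2 nu * sin \<tau>) * Zr n - const3 (g1 nu * sin \<tau> + g2 nu * cos \<tau>) * Zi n"
        unfolding CC_def rot_simps rot_Z nt by (simp add: const3_simps algebra_simps)
      then show ?thesis unfolding 1 2 by (simp add: const3_simps)
    qed
    have rL: "hp D m (rot t (ex 1 (L nu) (H nu)) - DI) =
        const3 (X D m nu) * AI ^ (D div 2) + const3 (Y D m nu * \<gamma> nu) * (AI ^ ((D - n) div 2) * Zr n)" for D m
    proof -
      have "hp D m (rot t (ex 1 (L nu) (H nu)) - DI) = rot t (hp D m (ex 1 (L nu) (H nu) - DI))"
        unfolding hp_rot[symmetric] by (simp add: rot_simps del: hp_simps)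
      also have "\<dots> = const3 (X D m nu) * AI ^ (D div 2) + const3 (Y D m nu) * (AI ^ ((D - n) div 2) * (const3 (\<gamma> nu) * Zr n))"
        unfolding hpL[OF nu] by (simp add: rot_simps rC)
      finally show ?thesis by (simp add: const3_simps mult_ac)
    qed
    have cA: "cA ?A D m = X D m nu" for D m
    proof (cases "4 \<le> D \<and> even D")
      case True
      then have "2 * ((D - 4) div 2) + 4 = D" by auto
      then show ?thesis using True by (simp add: cA_def A_def)
    next
      case False
      then show ?thesis using ok(1)[of D m nu] by (auto simp: cA_def okA_def)
    qed
    have cB: "cB n ?B D m = Y D m nu * \<gamma> nu" for D m
    proof (cases "n \<le> D \<and> even (D - n)")
      case True
      then have "2 * ((D - n) div 2) + n = D" by auto
      then show ?thesis using True sn_pos[of n] by (simp add: cB_def B_def)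
    next
      case False
      then show ?thesis using ok(2)[of D m nu] by (auto simp: cB_def okB_def)
    qed
    have "rot t (ex 1 (L nu) (H nu)) - DI = normal_hamiltonian n ?A ?B - DI"
      by (rule hp_ext) (unfold rL hp_normal cA cB, rule refl)
    then show "\<exists>t. rot t (ex 1 (L nu) (H nu)) = normal_hamiltonian n ?A ?B" by (intro exI[of _ t]) simp
    have "hp n 0 (ex 1 (L nu) (H nu) - DI - hh n (al nu) (g1 nu) (g2 nu)) = 0"
      using L(3)[OF nu] unfolding wt_hp by auto
    moreover have "homog n (hh n (al nu) (g1 nu) (g2 nu))" using n al3[OF nu] by (intro homog_hh) auto
    ultimately have "hp n 0 (ex 1 (L nu) (H nu) - DI) = hh n (al nu) (g1 nu) (g2 nu)"
      by (simp add: hp_simps(2)[of n 0 _ "hh n (al nu) (g1 nu) (g2 nu)"] hp_homog)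
    then have "rot t (hh n (al nu) (g1 nu) (g2 nu)) = hp n 0 (rot t (ex 1 (L nu) (H nu)) - DI)"
      using hp_rot[of n 0 t "ex 1 (L nu) (H nu) - DI"] by (simp add: rot_simps del: hp_simps)
    then have e: "const3 (X n 0 nu) * AI ^ (n div 2) + const3 (Y n 0 nu * \<gamma> nu) * (AI ^ 0 * Zr n) =
      const3 (al nu) * AI ^ 2 + const3 (\<gamma> nu) * (AI ^ 0 * (const3 1 * Zr n - const3 0 * Zi n))"
      unfolding rL hh_def by (simp add: rot_simps rC const3_simps)
    have "Y n 0 nu * \<gamma> nu = \<gamma> nu * 1"
    proof (rule ray_indep(2)[OF e, where D = n])
      show "2 * (n div 2) = n" if "X n 0 nu \<noteq> 0"
      proof -
        have "even n" using that ok(1)[of n 0 nu] unfolding okA_def by blast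
        then show ?thesis by simp
      qed
      show "al nu \<noteq> 0 \<Longrightarrow> 2 * 2 = n" using al3[OF nu] n by auto
    qed (use n0 in auto)
    then show "0 < B 0 0 nu" using \<gamma>(1)[OF nu] sn_pos[of n] by (simp add: B_def)
  qed
qed

section \<open>Canonical changes of variables as symplectic automorphisms\<close>

lemma canonical_symp:
  assumes T: "symp T" and T': "alg T'" and inv: "\<And>f. T (T' f) = f" "\<And>f. T' (T f) = f"
  shows "formal_canonical_change (T var_x, T var_y)"
proof -
  note v = alg_vanishes[OF symp_alg[OF T]] alg_vanishes[OF T']
  have s: "subst_xy f (T var_x, T var_y) = T f" "subst_xy f (T' var_x, T' var_y) = T' f" for f
    using alg_eq_subst[OF symp_alg[OF T]] alg_eq_subst[OF T'] by metis+
  have "(T var_x, T var_y) \<circ>\<^sub>f (T' var_x, T' var_y) = formal_id" "(T' var_x, T' var_y) \<circ>\<^sub>f (T var_x, T var_y) = formal_id"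
    by (simp_all add: formal_comp_def formal_id_def s inv)
  moreover have "deriv_x (T var_x) * deriv_y (T var_y) - deriv_y (T var_x) * deriv_x (T var_y) = 1"
    using T by (simp add: symp_def pb_def)
  ultimately show ?thesis unfolding formal_canonical_change_def using v by auto
qed

lemma canonical_inverse:
  assumes "formal_canonical_change \<Psi>"
  obtains T' where "symp (\<lambda>f. subst_xy f \<Psi>)" "symp T'" "\<And>f. subst_xy (T' f) \<Psi> = f" "\<And>f. T' (subst_xy f \<Psi>) = f"
proof -
  obtain \<Psi>' where v: "vanishes_at_origin \<Psi>" "vanishes_at_origin \<Psi>'" and i: "\<Psi> \<circ>\<^sub>f \<Psi>' = formal_id" "\<Psi>' \<circ>\<^sub>f \<Psi> = formal_id"
    and d: "pb (fst \<Psi>) (snd \<Psi>) = 1"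
    using assms unfolding formal_canonical_change_def pb_def by blast
  have id: "subst_xy f formal_id = f" for f
    using alg_eq_subst[OF alg_id] unfolding formal_id_def by metis
  have s: "symp (\<lambda>f. subst_xy f \<Psi>)"
    using alg_subst[OF v(1)] subst_var[OF v(1)] d by (simp add: symp_def)
  have 1: "subst_xy (subst_xy f \<Psi>) \<Psi>' = f" "subst_xy (subst_xy f \<Psi>') \<Psi> = f" for f
    using subst_comp[OF v, of f] subst_comp[OF v(2,1), of f] by (simp_all add: i id)
  show thesis
    by (rule that[OF s symp_inv[OF s alg_subst[OF v(2)]]]) (use 1 in auto)
qed

text \<open>Substitution is contravariant: the rotation, applied last as a map, acts first on
  \<open>f\<close>.\<close>

lemma conjugacy_subst:
  assumes v: "vanishes_at_origin G" "vanishes_at_origin \<Psi>" and H: "gen H" and \<Phi>: "formal_hamiltonian_flow H \<Phi>"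
  shows "\<Psi> \<circ>\<^sub>f G = (formal_rotation \<alpha> \<circ>\<^sub>f \<Phi> 1) \<circ>\<^sub>f \<Psi> \<longleftrightarrow>
    (\<forall>f. subst_xy (subst_xy f \<Psi>) G = subst_xy (ex 1 H (rot \<alpha> f)) \<Psi>)"
proof -
  have \<Phi>1: "\<Phi> 1 = (ex 1 H var_x, ex 1 H var_y)" by (rule flow_unique[OF H \<Phi>])
  have e: "subst_xy f (\<Phi> 1) = ex 1 H f" for f
    unfolding \<Phi>1 using alg_eq_subst[OF alg_ex[OF H]] by metis
  have a1: "alg (\<lambda>f. subst_xy (subst_xy f \<Psi>) G)" by (rule alg_comp[OF alg_subst[OF v(1)] alg_subst[OF v(2)]])
  have a2: "alg (\<lambda>f. subst_xy (ex 1 H (rot \<alpha> f)) \<Psi>)"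
    by (rule alg_comp[OF alg_subst[OF v(2)] alg_comp[OF alg_ex[OF H] alg_rot]])
  have l: "\<Psi> \<circ>\<^sub>f G = (subst_xy (subst_xy var_x \<Psi>) G, subst_xy (subst_xy var_y \<Psi>) G)"
    by (simp add: formal_comp_def subst_var[OF v(2)])
  have r: "(formal_rotation \<alpha> \<circ>\<^sub>f \<Phi> 1) \<circ>\<^sub>f \<Psi> = (subst_xy (ex 1 H (rot \<alpha> var_x)) \<Psi>, subst_xy (ex 1 H (rot \<alpha> var_y)) \<Psi>)"
    by (simp add: formal_comp_def e formal_rotation_def rot_var)
  show ?thesis unfolding l r
  proof
    assume "(subst_xy (subst_xy var_x \<Psi>) G, subst_xy (subst_xy var_y \<Psi>) G) =
      (subst_xy (ex 1 H (rot \<alpha> var_x)) \<Psi>, subst_xy (ex 1 H (rot \<alpha> var_y)) \<Psi>)"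
    then have "(\<lambda>f. subst_xy (subst_xy f \<Psi>) G) = (\<lambda>f. subst_xy (ex 1 H (rot \<alpha> f)) \<Psi>)"
      by (intro alg_ext[OF a1 a2]) auto
    then show "\<forall>f. subst_xy (subst_xy f \<Psi>) G = subst_xy (ex 1 H (rot \<alpha> f)) \<Psi>" by metis
  qed simp
qed

text \<open>
  Two normal forms of one map differ by a canonical \<open>S\<close> conjugating \<open>R \<circ> \<Phi>\<close> with \<open>R \<circ> \<Phi>'\<close>. Since \<open>R\<close> has order \<open>n\<close>
  and commutes with the flows, the \<open>n\<close>-th powers are \<open>\<Phi>\<^bsup>n\<^esup>\<close> and \<open>\<Phi>'\<^bsup>n\<^esup>\<close>; a formal flow determines its Hamiltonian.
\<close>
lemma conjugate_normal_forms:
  fixes n :: nat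
  defines "th \<equiv> 2 * pi / real n"
  assumes n0: "0 < n" and S: "symp S" "\<And>f. S (S' f) = f" and N: "gen N" "rot th N = N" and N': "gen N'" "rot th N' = N'"
    and conj: "\<And>f. S (ex 1 N (rot th f)) = ex 1 N' (rot th (S f))"
  shows "S N = N'" "\<And>f. S (rot th f) = rot th (S f)"
proof -
  have com: "rot th (ex t N f) = ex t N (rot th f)" if "gen N" "rot th N = N" for t N f
    using symp_ex_conj[OF symp_rot that(1), of th t f] that(2) by simp
  have pw: "((\<lambda>f. ex 1 N (rot th f)) ^^ m) f = ex (real m) N (rot (real m * th) f)" if "gen N" "rot th N = N" for N m f
  proof (induction m)
    case (Suc m)
    have a: "1 + real m = real (Suc m)" "th + real m * th = real (Suc m) * th" by (simp_all add: algebra_simps)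
    show ?case using Suc by (simp only: funpow.simps o_apply com[OF that] rot_rot ex_ex[OF that(1)] a)
  qed (simp add: rot_trivial)
  have it: "S (((\<lambda>f. ex 1 N (rot th f)) ^^ m) f) = ((\<lambda>f. ex 1 N' (rot th f)) ^^ m) (S f)" for m f
    by (induction m) (simp_all add: conj)
  have full: "rot (real n * th) f = f" for f unfolding th_def by (rule rot_full[OF n0])
  have "ex (real n) N' g = ex (real n) (S N) g" for g
  proof -
    have "S (ex (real n) N (S' g)) = ex (real n) N' (S (S' g))"
      using it[of n "S' g"] unfolding pw[OF N] pw[OF N'] full .
    then show ?thesis unfolding symp_ex_conj[OF S(1) N(1)] S(2) by simp
  qed
  then have "ex (real n) N' = ex (real n) (S N)" by (rule ext)
  then have "N' = S N" using n0 by (intro ex_inj[OF gen_alg[OF symp_alg[OF S(1)] N(1)] N'(1), of "real n"]) auto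
  then show SN: "S N = N'" by simp
  fix f
  have "ex 1 N' (S (rot th f)) = ex 1 N' (rot th (S f))"
    using conj[of f] unfolding symp_ex_conj[OF S(1) N(1)] SN .
  \<comment> \<open>Since \<open>S\<close> carries the flow of \<open>N\<close> to that of
    \<open>N'\<close>, this flow can be cancelled from the conjugacy, which leaves the commutation
    with the rotation.\<close>
  then have "ex (- 1) N' (ex 1 N' (S (rot th f))) = ex (- 1) N' (ex 1 N' (rot th (S f)))" by simp
  then show "S (rot th f) = rot th (S f)" by (simp add: ex_inverse(2)[OF N'(1)])
qed

theorem theorem4:
  fixes n :: nat
    and F :: "real \<Rightarrow> real \<Rightarrow> real^2 \<Rightarrow> real^2"
    and a b :: "real \<Rightarrow> real \<Rightarrow> complex"
    and U :: "(real^2) set" and P :: "(real \<times> real) set"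
  assumes n: "n = 3 \<or> n = 4"
    and U: "open U" "0 \<in> U"
    and P: "open P" "(0, 0) \<in> P"
    and F_analytic: "real_analytic_on (\<lambda>(p, \<delta>, \<nu>). F \<delta> \<nu> p) (U \<times> P)"
    and F_area: "\<And>\<delta> \<nu>. (\<delta>, \<nu>) \<in> P \<Longrightarrow> area_preserving_on (F \<delta> \<nu>) U"
    and F_orientation: "\<And>\<delta> \<nu>. (\<delta>, \<nu>) \<in> P \<Longrightarrow> orientation_preserving_on (F \<delta> \<nu>) U"
    and F_origin: "\<And>\<delta> \<nu>. (\<delta>, \<nu>) \<in> P \<Longrightarrow> F \<delta> \<nu> 0 = 0"
    and a_analytic: "real_analytic_on (\<lambda>(\<delta>, \<nu>). a \<nu> \<delta>) P"
    and b_analytic: "real_analytic_on (\<lambda>(\<delta>, \<nu>). b \<nu> \<delta>) P"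
    and F_form: "\<And>\<delta> \<nu>. (\<delta>, \<nu>) \<in> P \<Longrightarrow>
      (\<lambda>p. norm (to_complex (F \<delta> \<nu> p)
          - (cis (2 * pi / real n - \<delta>) * to_complex p
             + a \<nu> \<delta> * to_complex p ^ 2 * cnj (to_complex p)
             + b \<nu> \<delta> * cnj (to_complex p) ^ (n - 1))))
        \<in> O[at 0](\<lambda>p. norm (to_complex p) ^ 4)"
    and b_nonzero: "b 0 0 \<noteq> 0"
  shows "\<exists>\<nu>\<^sub>0>0. \<exists>A B :: nat \<Rightarrow> nat \<Rightarrow> real \<Rightarrow> real.
    (\<forall>k m. real_analytic_on (A k m) {-\<nu>\<^sub>0<..<\<nu>\<^sub>0} \<and> real_analytic_on (B k m) {-\<nu>\<^sub>0<..<\<nu>\<^sub>0}) \<and>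
    (\<forall>\<nu>\<in>{-\<nu>\<^sub>0<..<\<nu>\<^sub>0}.
       reduced_coeffs n (\<lambda>k m. A k m \<nu>) (\<lambda>k m. B k m \<nu>) \<and> B 0 0 \<nu> > 0 \<and>
       formally_conjugate_to_flow (\<lambda>\<delta>. F \<delta> \<nu>) (2 * pi / real n)
         (normal_hamiltonian n (\<lambda>k m. A k m \<nu>) (\<lambda>k m. B k m \<nu>)) \<and>
       (\<forall>A' B' :: nat \<Rightarrow> nat \<Rightarrow> real.
          reduced_coeffs n A' B' \<and> B' 0 0 > 0 \<and>
          formally_conjugate_to_flow (\<lambda>\<delta>. F \<delta> \<nu>) (2 * pi / real n)
            (normal_hamiltonian n A' B') \<longrightarrow>
          A' = (\<lambda>k m. A k m \<nu>) \<and> B' = (\<lambda>k m. B k m \<nu>)))"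
proof -
  define th where "th = 2 * pi / real n"
  define d where "d = n - 2"
  have n0: "0 < n" "3 \<le> n" and d: "1 \<le> d" "d + 2 = n" using n by (auto simp: d_def)
  obtain rho and G :: "real \<Rightarrow> formal_map" where rho: "0 < rho"
    and famG: "fam {-rho<..<rho} (\<lambda>nu. fst (G nu))" "fam {-rho<..<rho} (\<lambda>nu. snd (G nu))"
    and tay: "\<And>nu. nu \<in> {-rho<..<rho} \<Longrightarrow> has_taylor_series (\<lambda>\<delta>. F \<delta> nu) (G nu)"
    and van: "\<And>nu. nu \<in> {-rho<..<rho} \<Longrightarrow> vanishes_at_origin (G nu)"
    and det: "\<And>nu. nu \<in> {-rho<..<rho} \<Longrightarrow> pb (fst (G nu)) (snd (G nu)) = 1"
    and lin: "\<And>nu u. nu \<in> {-rho<..<rho} \<Longrightarrow> u = var_x \<or> u = var_y \<Longrightarrow> wt 0 2 (subst_xy u (G nu) - ex 1 DI (rot th u))"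
    and low: "\<And>nu u. nu \<in> {-rho<..<rho} \<Longrightarrow> u = var_x \<or> u = var_y \<Longrightarrow> wt d (n - 1) (subst_xy u (G nu) - ex 1 DI (rot th u))"
    and val: "\<And>x y. (\<Sum>i\<le>n - 1. coeff3 (fst (G 0)) i (n - 1 - i) 0 * x ^ i * y ^ (n - 1 - i)) =
      Re ((if n = 4 then a 0 0 * Complex x y ^ 2 * cnj (Complex x y) else 0) + b 0 0 * cnj (Complex x y) ^ (n - 1))"
    "\<And>x y. (\<Sum>i\<le>n - 1. coeff3 (snd (G 0)) i (n - 1 - i) 0 * x ^ i * y ^ (n - 1 - i)) =
      Im ((if n = 4 then a 0 0 * Complex x y ^ 2 * cnj (Complex x y) else 0) + b 0 0 * cnj (Complex x y) ^ (n - 1))"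
    unfolding th_def d_def
    by (rule taylor_map[OF n U P F_analytic F_area F_orientation F_origin F_form]) blast+
  have 0: "0 \<in> {-rho<..<rho}" using rho by simp
  obtain K H where famK: "fam {-rho<..<rho} K" and famH: "fam {-rho<..<rho} H"
    and KH: "\<And>nu. nu \<in> {-rho<..<rho} \<Longrightarrow> wt 0 3 (K nu) \<and> wt d n (K nu) \<and> wt 0 3 (H nu - DI) \<and> wt d n (H nu) \<and> rot th (H nu) = H nu"
    and conj: "\<And>nu f. nu \<in> {-rho<..<rho} \<Longrightarrow> subst_xy (ex 1 (K nu) f) (G nu) = ex 1 (K nu) (ex 1 (H nu) (rot th f))"
    using resonant_normal_form[OF n0(2) d_def th_def van det famG lin low] by blast
  have genK: "gen (K nu)" and genH: "gen (H nu)" if "nu \<in> {-rho<..<rho}" for nu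
  proof -
    have 3: "gen M" if "wt 0 3 M" for M using wt_d_mono[OF that] wt_mono[OF that, of 2] by (auto simp: gen_def)
    show "gen (K nu)" using 3 KH[OF that] by blast
    show "gen (H nu)" using gen_add[OF 3 gen_delta_action(1), of "H nu - DI"] KH[OF that] by simp
  qed
  have symG: "symp (\<lambda>f. subst_xy f (G nu))" if "nu \<in> {-rho<..<rho}" for nu
    using alg_subst[OF van[OF that]] subst_var[OF van[OF that]] det[OF that] by (simp add: symp_def)
  define h where "h nu = hp n 0 (H nu)" for nu
  \<comment> \<open>Read off by fixed linear formulas instead of being chosen for each nu, so that
    analyticity is visible.\<close>
  define al g1 g2 where "al nu = lead0 n (h nu)" and "g1 nu = lead1 n (h nu)" and "g2 nu = lead2 n (h nu)" for nu
  have lead: "h nu = hh n (al nu) (g1 nu) (g2 nu)" if "nu \<in> {-rho<..<rho}" for nu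
  proof -
    have "rot th (h nu) = h nu" using KH[OF that] hp_rot[of n 0 th "H nu"] by (simp add: h_def)
    then obtain al' g1' g2' where "h nu = hh n al' g1' g2'" "n = 3 \<longrightarrow> al' = 0"
      using invariant_leading[OF n, of "h nu"] homog_hp unfolding h_def th_def by blast
    then show ?thesis using lead_hh[OF n, of al' g1' g2'] by (simp add: al_def g1_def g2_def)
  qed
  have al3: "n = 3 \<Longrightarrow> al nu = 0" for nu by (simp add: al_def lead0_def)
  have ra: "ra al nu" "ra g1 nu" "ra g2 nu" if "nu \<in> {-rho<..<rho}" for nu
  proof -
    have c: "ra (\<lambda>nu. coeff3 (h nu) i j 0) nu" for i j
      using fam_hp[OF famH, of n 0] that unfolding fam_def h_def by blast
    show g1: "ra g1 nu" unfolding g1_def[abs_def] lead1_def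
      by (cases "n = 3") (simp_all, auto intro!: ra_divide_const ra_diff c)
    show "ra g2 nu" unfolding g2_def[abs_def] lead2_def
      by (cases "n = 3") (simp_all only: if_True if_False, auto intro!: ra_divide_const ra_minus c)
    show "ra al nu" unfolding al_def[abs_def] lead0_def g1_def[symmetric]
      by (cases "n = 3") (simp_all only: if_True if_False, auto intro!: ra_mult ra_const ra_diff c g1)
  qed
  have g0: "(g1 0, g2 0) \<noteq> (0, 0)"
  proof -
    have sx: "subst_xy var_x (G 0) = fst (G 0)" "subst_xy var_y (G 0) = snd (G 0)"
      using subst_var[OF van[OF 0]] by simp_all
    have near: "wt d 2 (subst_xy u (G 0) - rot th u)" if u: "u = var_x \<or> u = var_y" for u
    proof -
      have "wt d 1 u" using u by auto
      then have "wt d 1 (rot th u)" by (rule alg_wt[OF alg_rot])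
      from ex_tail1[OF gen_delta_action(1) gen_delta_action(2) _ this, of 1]
      have 1: "wt d 2 (ex 1 DI (rot th u) - rot th u)" by (rule wt_mono) (use d in auto)
      have 2: "wt d 2 (subst_xy u (G 0) - ex 1 DI (rot th u))"
        by (rule wt_mono[OF low[OF 0 u]]) (use n0 in auto)
      have "subst_xy u (G 0) - rot th u = (subst_xy u (G 0) - ex 1 DI (rot th u)) + (ex 1 DI (rot th u) - rot th u)"
        by simp
      then show ?thesis using wt_add[OF 2 1] by metis
    qed
    have cv: "coeff3 (hp (n - 1) 0 f) i (n - 1 - i) 0 = coeff3 f i (n - 1 - i) 0" if "i \<le> n - 1" for f i
      using that by simp
    have t: "hp (n - 1) 0 (subst_xy var_x (G 0)) = res_re n (a 0 0) (b 0 0)" "hp (n - 1) 0 (subst_xy var_y (G 0)) = res_im n (a 0 0) (b 0 0)"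
      unfolding sx using res_values[OF n, OF homog_hp] val cv by simp_all
    have "\<exists>al g1 g2. hp n 0 (H 0) = hh n al g1 g2 \<and> (n = 3 \<longrightarrow> al = 0) \<and> (g1, g2) \<noteq> (0, 0)"
      by (rule leading_nonzero[OF n symp_alg[OF symG[OF 0]] _ _ genK[OF 0] _ genH[OF 0] _ _ _ t b_nonzero])
        (use near KH[OF 0] conj[OF 0] in \<open>auto simp: d_def th_def\<close>)
    then obtain al' g1' g2' where h0: "h 0 = hh n al' g1' g2'" "n = 3 \<longrightarrow> al' = 0" "(g1', g2') \<noteq> (0, 0)"
      unfolding h_def by blast
    then show ?thesis using lead_hh[OF n h0(2), of g1' g2'] by (simp add: g1_def g2_def)
  qed
  \<comment> \<open>The leading coefficient is continuous and nonzero at nu = 0; keeping it nonzero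
    decides how small nu has to be.\<close>
  obtain nu0 where nu0: "0 < nu0" "nu0 \<le> rho" and nz: "\<And>nu. nu \<in> {-nu0<..<nu0} \<Longrightarrow> (g1 nu, g2 nu) \<noteq> (0, 0)"
  proof -
    have "isCont (\<lambda>nu. (g1 nu, g2 nu)) 0" by (intro continuous_Pair ra_isCont ra 0)
    then have "\<forall>\<^sub>F nu in at 0. (g1 nu, g2 nu) \<noteq> (0, 0)"
      using g0 tendsto_imp_eventually_ne unfolding isCont_def by blast
    then obtain e where e: "0 < e" "\<And>nu. nu \<noteq> 0 \<Longrightarrow> dist nu 0 < e \<Longrightarrow> (g1 nu, g2 nu) \<noteq> (0, 0)"
      unfolding eventually_at by auto
    show thesis
    proof (rule that[of "min e rho"])
      fix nu assume "nu \<in> {- min e rho<..<min e rho}"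
      then have "dist nu 0 < e" by auto
      then show "(g1 nu, g2 nu) \<noteq> (0, 0)" using e(2) g0 by (cases "nu = 0") auto
    qed (use e(1) rho in auto)
  qed
  define V where "V = {-nu0<..<nu0}"
  have VS: "nu \<in> {-rho<..<rho}" if "nu \<in> V" for nu using that nu0 by (auto simp: V_def)
  \<comment> \<open>Below weight n + 1 a positive power of delta leaves degree at most two, where
    \<open>H\<close> equals delta I exactly. Without delta only degree n can contribute, and there
    the leading form is read off.\<close>
  have wlead: "wt (n - 2) (n + 1) (H nu - DI - hh n (al nu) (g1 nu) (g2 nu))" if "nu \<in> V" for nu
    unfolding wt_hp
  proof (intro allI impI)
    fix D m assume Dm: "D + (n - 2) * m < n + 1"
    note nu = VS[OF that]
    have w: "hp D m (H nu - DI) = 0" if "D + d * m < n \<or> D < 3"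
    proof (cases "D < 3")
      case True
      then show ?thesis using KH[OF nu] unfolding wt_hp by auto
    next
      case False
      have "wt d n DI" using gen_delta_action(2)[of d] d by simp
      then have "wt d n (H nu - DI)" using KH[OF nu] wt_diff by blast
      then show ?thesis using that False unfolding wt_hp by blast
    qed
    have hl: "homog n (hh n (al nu) (g1 nu) (g2 nu))" using n al3[of nu] by (intro homog_hh) auto
    show "hp D m (H nu - DI - hh n (al nu) (g1 nu) (g2 nu)) = 0"
    proof (cases "D = n \<and> m = 0")
      case True
      then show ?thesis using lead[OF nu] n by (auto simp: h_def hp_homog[OF hl] hp_delta_action)
    next
      case False
      have "D + d * m < n \<or> D < 3"
      proof (cases m)
        case 0 then show ?thesis using False Dm by auto
      next
        case (Suc m') then have "D + d \<le> n" using Dm by (simp add: d_def)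
        then show ?thesis using d by auto
      qed
      moreover have "hp D m (hh n (al nu) (g1 nu) (g2 nu)) = 0" by (simp only: hp_homog[OF hl] False if_False)
      ultimately show ?thesis by (subst hp_simps(2)) (simp only: w diff_0_right)
    qed
  qed
  have "open V" by (simp add: V_def)
  have famV: "fam V H" using famH VS unfolding fam_def by blast
  obtain L A B where raAB: "\<And>k m nu. nu \<in> V \<Longrightarrow> ra (A k m) nu \<and> ra (B k m) nu"
    and L: "\<And>nu. nu \<in> V \<Longrightarrow> gen (L nu) \<and> rot th (L nu) = L nu"
    and red: "\<And>nu. nu \<in> V \<Longrightarrow> reduced_coeffs n (\<lambda>k m. A k m nu) (\<lambda>k m. B k m nu) \<and> 0 < B 0 0 nu"
    and tN: "\<And>nu. nu \<in> V \<Longrightarrow> \<exists>t. rot t (ex 1 (L nu) (H nu)) = normal_hamiltonian n (\<lambda>k m. A k m nu) (\<lambda>k m. B k m nu)"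
  proof -
    have "\<exists>L A B. (\<forall>k m. \<forall>nu\<in>V. ra (A k m) nu \<and> ra (B k m) nu) \<and>
      (\<forall>nu\<in>V. gen (L nu) \<and> rot th (L nu) = L nu \<and> reduced_coeffs n (\<lambda>k m. A k m nu) (\<lambda>k m. B k m nu) \<and> 0 < B 0 0 nu \<and>
      (\<exists>t. rot t (ex 1 (L nu) (H nu)) = normal_hamiltonian n (\<lambda>k m. A k m nu) (\<lambda>k m. B k m nu)))"
      unfolding th_def
      by (rule normal_family[OF n \<open>open V\<close> al3 ra(1)[OF VS] ra(2)[OF VS] ra(3)[OF VS] nz[folded V_def] famV _ _ wlead])
        (use KH VS in \<open>auto simp: th_def\<close>)
    then show thesis using that by blast
  qed
  have main: "formally_conjugate_to_flow (\<lambda>\<delta>. F \<delta> nu) th (normal_hamiltonian n (\<lambda>k m. A k m nu) (\<lambda>k m. B k m nu))"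
    if nu: "nu \<in> V" for nu
  proof -
    define N where "N = normal_hamiltonian n (\<lambda>k m. A k m nu) (\<lambda>k m. B k m nu)"
    have gN: "gen N" unfolding N_def by (rule normal_props(2)[OF n])
    obtain t where t: "rot t (ex 1 (L nu) (H nu)) = N" using tN[OF nu] unfolding N_def by blast
    note S = VS[OF nu]
    have gL: "gen (L nu)" "rot th (L nu) = L nu" using L[OF nu] by auto
    \<comment> \<open>The change of variables \<open>T\<close> combines the flow of \<open>K\<close>
      from the averaging with the inverses of the reduction by \<open>L\<close> and of the
      normalising rotation.\<close>
    define W where "W f = ex (- 1) (L nu) (rot (- t) f)" for f
    define T where "T f = ex 1 (K nu) (W f)" for f
    define T' where "T' f = rot t (ex 1 (L nu) (ex (- 1) (K nu) f))" for f
    have W: "symp W" unfolding W_def[abs_def] by (rule symp_comp[OF symp_ex[OF gL(1)] symp_rot])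
    have T: "symp T" unfolding T_def[abs_def] by (rule symp_comp[OF symp_ex[OF genK[OF S]] W])
    have T': "alg T'" unfolding T'_def[abs_def]
      by (rule alg_comp[OF alg_rot alg_comp[OF alg_ex[OF gL(1)] alg_ex[OF genK[OF S]]]])
    have inv: "T (T' f) = f" "T' (T f) = f" for f
      by (simp_all add: T_def T'_def W_def rot_inv ex_inverse[OF gL(1)] ex_inverse[OF genK[OF S]])
    have WN: "W N = H nu" unfolding W_def t[symmetric] by (simp add: rot_inv ex_inverse[OF gL(1)])
    have Wr: "rot th (W f) = W (rot th f)" for f
      unfolding W_def symp_ex_conj[OF symp_rot gL(1)] gL(2) rot_rot by (simp add: add.commute)
    have Tc: "subst_xy (T f) (G nu) = T (ex 1 N (rot th f))" for f
      unfolding T_def conj[OF S] Wr symp_ex_conj[OF W gN] WN ..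
    define \<Psi> where "\<Psi> = (T var_x, T var_y)"
    have \<Psi>: "formal_canonical_change \<Psi>" unfolding \<Psi>_def by (rule canonical_symp[OF T T' inv])
    have v\<Psi>: "vanishes_at_origin \<Psi>" unfolding \<Psi>_def by (rule alg_vanishes[OF symp_alg[OF T]])
    have s: "subst_xy f \<Psi> = T f" for f unfolding \<Psi>_def using alg_eq_subst[OF symp_alg[OF T]] by metis
    note fl = flow_ex[OF gN]
    have "\<Psi> \<circ>\<^sub>f G nu = (formal_rotation th \<circ>\<^sub>f (\<lambda>t. (ex t N var_x, ex t N var_y)) 1) \<circ>\<^sub>f \<Psi>"
      unfolding conjugacy_subst[OF van[OF S] v\<Psi> gN fl] s using Tc by blast
    then show ?thesis unfolding formally_conjugate_to_flow_def N_def[symmetric]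
      using tay[OF S] \<Psi> fl by blast
  qed
  have unique: "A' = A'' \<and> B' = B''"
    if nu: "nu \<in> V" and r: "reduced_coeffs n A' B'" "0 < B' 0 0" "reduced_coeffs n A'' B''" "0 < B'' 0 0"
      and c: "formally_conjugate_to_flow (\<lambda>\<delta>. F \<delta> nu) th (normal_hamiltonian n A' B')"
        "formally_conjugate_to_flow (\<lambda>\<delta>. F \<delta> nu) th (normal_hamiltonian n A'' B'')"
    for nu A' B' A'' B''
  proof -
    define N N' where "N = normal_hamiltonian n A' B'" and "N' = normal_hamiltonian n A'' B''"
    have gN: "gen N" "rot th N = N" "gen N'" "rot th N' = N'"
      using normal_props(2,3)[OF n] by (simp_all add: N_def N'_def th_def)
    note S = VS[OF nu]
    have ex: "\<exists>T T'. symp T \<and> symp T' \<and> (\<forall>f. T (T' f) = f \<and> T' (T f) = f) \<and> (\<forall>f. subst_xy (T f) (G nu) = T (ex 1 M (rot th f)))"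
      if M: "gen M" "formally_conjugate_to_flow (\<lambda>\<delta>. F \<delta> nu) th M" for M
    proof -
      obtain G1 \<Psi> \<Phi> where *: "has_taylor_series (\<lambda>\<delta>. F \<delta> nu) G1" "formal_canonical_change \<Psi>" "formal_hamiltonian_flow M \<Phi>"
        "\<Psi> \<circ>\<^sub>f G1 = (formal_rotation th \<circ>\<^sub>f \<Phi> 1) \<circ>\<^sub>f \<Psi>"
        using M(2) unfolding formally_conjugate_to_flow_def by blast
      have G1: "G1 = G nu" by (rule taylor_unique[OF *(1) tay[OF S]])
      have v: "vanishes_at_origin \<Psi>" using *(2) unfolding formal_canonical_change_def by blast
      have "\<forall>f. subst_xy (subst_xy f \<Psi>) (G nu) = subst_xy (ex 1 M (rot th f)) \<Psi>"
        using *(4) conjugacy_subst[OF van[OF S] v M(1) *(3)] unfolding G1 by blast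
      moreover obtain M' where "symp (\<lambda>f. subst_xy f \<Psi>)" "symp M'" "\<And>f. subst_xy (M' f) \<Psi> = f" "\<And>f. M' (subst_xy f \<Psi>) = f"
        by (rule canonical_inverse[OF *(2)]) blast
      ultimately show ?thesis by (intro exI[of _ "\<lambda>f. subst_xy f \<Psi>"] exI[of _ M'] conjI allI) blast+
    qed
    obtain T T' where T: "symp T" "symp T'" "\<And>f. T (T' f) = f" "\<And>f. T' (T f) = f"
      "\<And>f. subst_xy (T f) (G nu) = T (ex 1 N (rot th f))" using ex[OF gN(1)] c(1) unfolding N_def by blast
    obtain R R' where R: "symp R" "symp R'" "\<And>f. R (R' f) = f" "\<And>f. R' (R f) = f"
      "\<And>f. subst_xy (R f) (G nu) = R (ex 1 N' (rot th f))" using ex[OF gN(3)] c(2) unfolding N'_def by blast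
    \<comment> \<open>Both normal forms are conjugate to the same map, so \<open>Q\<close>
      conjugates one with the other.\<close>
    define Q where "Q f = R' (T f)" for f
    have Q: "symp Q" unfolding Q_def[abs_def] by (rule symp_comp[OF R(2) T(1)])
    have Qi: "Q (T' (R f)) = f" for f by (simp add: Q_def T R)
    have Qc: "Q (ex 1 N (rot th f)) = ex 1 N' (rot th (Q f))" for f
    proof -
      have "Q (ex 1 N (rot th f)) = R' (subst_xy (R (R' (T f))) (G nu))" by (simp add: Q_def T(5) R(3))
      then show ?thesis by (simp only: R(5) R(4) Q_def)
    qed
    note cj = conjugate_normal_forms[OF n0(1) Q Qi gN[unfolded th_def] Qc[unfolded th_def]]
    show ?thesis
      by (rule normal_form_unique[OF n r(1) r(3) r(2) r(4) Q cj(2) cj(1)[unfolded N_def N'_def]])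
  qed
  show ?thesis
  proof (rule exI[of _ nu0], rule conjI[OF nu0(1)], rule exI[of _ A], rule exI[of _ B], fold V_def th_def, intro conjI allI ballI impI)
    show "real_analytic_on (A k m) V" "real_analytic_on (B k m) V" for k m
      unfolding real_analytic_on_def using raAB ra_real_analytic_at by blast+
    fix nu assume nu: "nu \<in> V"
    show "reduced_coeffs n (\<lambda>k m. A k m nu) (\<lambda>k m. B k m nu)" "0 < B 0 0 nu" using red[OF nu] by auto
    show "formally_conjugate_to_flow (\<lambda>\<delta>. F \<delta> nu) th (normal_hamiltonian n (\<lambda>k m. A k m nu) (\<lambda>k m. B k m nu))"
      by (rule main[OF nu])
    fix A' B' assume *: "reduced_coeffs n A' B' \<and> 0 < B' 0 0 \<and> formally_conjugate_to_flow (\<lambda>\<delta>. F \<delta> nu) th (normal_hamiltonian n A' B')"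
    show "A' = (\<lambda>k m. A k m nu)" "B' = (\<lambda>k m. B k m nu)"
      using unique[OF nu, of A' B' "\<lambda>k m. A k m nu" "\<lambda>k m. B k m nu"] * red[OF nu] main[OF nu] by auto
  qed
qed

end
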